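(* Let $\mathcal{L}_0$, $\mathcal{L}_1$ and $\mathcal{M}$ be arbitrary Lagrangian planes in $\mathbb{C}^n\oplus\mathbb{C}^n$. Then $$\iota(\mathcal{L}_0,\mathcal{L}_1,\mathcal{M}) = \min\left\{ \operatorname{Mas}_{[0,1]}(\mathcal{L}(t),\mathcal{M}) \;:\; \mathcal{L}(0)=\mathcal{L}_0,\ \mathcal{L}(1)=\mathcal{L}_1,\ t\mapsto\mathcal{L}(t) \text{ is non-decreasing}\right\},$$ where the minimum is over paths $\mathcal{L}:[0,1]\to\Lambda(n)$ and is attained by some (not necessarily unique) path. Furthermore, any non-decreasing path $\mathcal{L}(t)$ from $\mathcal{L}_0$ to $\mathcal{L}_1$ that attains the minimum for one Lagrangian plane $\mathcal{M}$ attains the minimum for all Lagrangian planes $\mathcal{M}$.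
   Context: $\mathbb{C}^n\oplus\mathbb{C}^n$ is equipped with the canonical (sesquilinear) Hermitian symplectic form $\omega((x_1,x_2),(y_1,y_2)) := \langle x_1,y_2\rangle_{\mathbb{C}^n} - \langle x_2,y_1\rangle_{\mathbb{C}^n}$. A subspace $\mathcal{L}$ is Lagrangian if it equals $\{v : \omega(u,v)=0 \text{ for all } u\in\mathcal{L}\}$; $\Lambda(n)$ is the set of Lagrangian planes. For an $n\times n$ Hermitian matrix $M$, $\mathcal{G}_M := \{(x,Mx): x\in\mathbb{C}^n\}$, and $\mathcal{G}_\infty := 0\oplus\mathbb{C}^n$. $n_\pm$ is the number of positive/negative eigenvalues (of a Hermitian matrix or form), counted with multiplicity. Duistermaat index. $\iota:\Lambda(n)^3\to\{0,\dots,n\}$ is the unique function such that (1) $\iota(\mathcal{G}_0,\mathcal{G}_A,\mathcal{G}_\infty)=n_-(A)$ for every Hermitian $A$; (2) $\iota$ is invariant under applying a linear symplectic transformation to all three arguments; (3) $\iota(\mathcal{L}_1,\mathcal{L}_2,\mathcal{L}_3)-\iota(\mathcal{L}_1,\mathcal{L}_2,\mathcal{L}_4)+\iota(\mathcal{L}_1,\mathcal{L}_3,\mathcal{L}_4)-\iota(\mathcal{L}_2,\mathcal{L}_3,\mathcal{L}_4)=0$ for all Lagrangian planes. Explicitly, $\iota(\mathcal{L}_1,\mathcal{L}_2,\mathcal{L}_3)=n_-(\Omega)-n+\dim(\mathcal{L}_1\cap\mathcal{L}_3)$, where $\Omega$ is the Hermitian form on $\mathcal{L}_1\oplus\mathcal{L}_2\oplus\mathcal{L}_3$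 given by $\Omega(u_1,u_2,u_3;v_1,v_2,v_3)=\omega(u_1,v_2)+\omega(u_2,v_3)+\omega(u_3,v_1)-\omega(u_2,v_1)-\omega(u_3,v_2)-\omega(u_1,v_3)$. Crossing form and non-decreasing paths. Let $\mathcal{L}:[0,1]\to\Lambda(n)$ be a differentiable path given by a differentiable frame $(X(t),Y(t))$, i.e. $X(t),Y(t)$ are $n\times n$ matrices such that $x\mapsto (X(t)x,Y(t)x)$ is injective with range $\mathcal{L}(t)$. The crossing form at $t_0$ is the quadratic form on $\mathcal{L}(t_0)$ given by $\mathfrak{q}(v,v)=\langle x,(X^*(t_0)Y'(t_0)-Y^*(t_0)X'(t_0))x\rangle$ for $v=(X(t_0)x,Y(t_0)x)$ (independent of the frame). The path is non-decreasing if $\mathfrak{q}$ is positive semidefinite at all $t$. Maslov index. A path is regular with respect to $\mathcal{M}\in\Lambda(n)$ if it is continuously differentiable and $\mathfrak{q}|_{\mathcal{L}(t_0)\cap\mathcal{M}}$ is non-degenerate at every $t_0\in[0,1]$ with $\mathcal{L}(t_0)\cap\mathcal{M}\neq\{0\}$ (such $t_0$ are then isolated). For a regular path, $$\operatorname{Mas}_{[0,1]}(\mathcal{L}(t),\mathcal{M}) := \sum_{t\in[0,1)} n_+(\mathfrak{q}|_{\mathcal{L}(t)\cap\mathcal{M}}) - \sum_{t\in(0,1]} n_-(\mathfrak{q}|_{\mathcal{L}(t)\cap\mathcal{M}}).$$ For a general continuous path, $\operatorname{Mas}_{[0,1]}(\mathcal{L}(t),\mathcal{M})$ is defined as the Maslov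 index of any regular path homotopic to it with fixed endpoints (such a regular path exists and the value does not depend on its choice). *)

theory Defs
  imports "HOL-Analysis.Analysis"
begin

subsection \<open>The Hermitian symplectic space\<close>

text \<open>Inner products are antilinear in the first argument.\<close>

definition cdot :: "complex ^ 'n \<Rightarrow> complex ^ 'n \<Rightarrow> complex" where
  "cdot x y = (\<Sum>i\<in>UNIV. cnj (x $ i) * y $ i)"

definition adj :: "complex ^ 'n ^ 'm \<Rightarrow> complex ^ 'm ^ 'n" where
  "adj A = (\<chi> i j. cnj (A $ j $ i))"

definition hermitian :: "complex ^ 'n ^ 'n \<Rightarrow> bool" where
  "hermitian A \<longleftrightarrow> adj A = A"

type_synonym 'n phase = "(complex ^ 'n) \<times> (complex ^ 'n)"

definition pscale :: "complex \<Rightarrow> 'n phase \<Rightarrow> 'n::finite phase" where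
  "pscale c v = (c *s fst v, c *s snd v)"

global_interpretation phase: vector_space "pscale :: complex \<Rightarrow> 'n::finite phase \<Rightarrow> 'n phase"
  by unfold_locales
    (auto simp: pscale_def vector_add_ldistrib vector_sadd_rdistrib vector_smult_assoc)

definition pdot :: "'n phase \<Rightarrow> 'n::finite phase \<Rightarrow> complex" where
  "pdot u v = cdot (fst u) (fst v) + cdot (snd u) (snd v)"

definition sympl :: "'n phase \<Rightarrow> 'n::finite phase \<Rightarrow> complex" where
  "sympl u v = cdot (fst u) (snd v) - cdot (snd u) (fst v)"

definition symplectic_map :: "('n phase \<Rightarrow> 'n::finite phase) \<Rightarrow> bool" where
  "symplectic_map T \<longleftrightarrow>
     Vector_Spaces.linear pscale pscale T \<and> (\<forall>u v. sympl (T u) (T v) = sympl u v)"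

definition Lagr :: "'n::finite phase set set" where
  "Lagr = {L. phase.subspace L \<and> L = {v. \<forall>u\<in>L. sympl u v = 0}}"

definition graph :: "complex ^ 'n ^ 'n \<Rightarrow> 'n::finite phase set" where
  "graph A = range (\<lambda>x. (x, A *v x))"

definition graph_inf :: "'n::finite phase set" where
  "graph_inf = {0} \<times> UNIV"


subsection \<open>Counting eigenvalues\<close>

definition mat_eigenspace :: "complex ^ 'n ^ 'n \<Rightarrow> real \<Rightarrow> (complex ^ 'n) set" where
  "mat_eigenspace A \<mu> = {x. A *v x = of_real \<mu> *s x}"

text \<open>Only used for Hermitian matrices, where all eigenvalues are real and the multiplicity is
  the dimension of the eigenspace.\<close>

definition mat_n_neg :: "complex ^ 'n ^ 'n \<Rightarrow> nat" where
  "mat_n_neg A =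
     (\<Sum>\<mu> | \<mu> < 0 \<and> mat_eigenspace A \<mu> \<noteq> {0}. vec.dim (mat_eigenspace A \<mu>))"

text \<open>The eigenvalues of a Hermitian form \<open>q\<close> on a subspace \<open>V\<close> are those of the self-adjoint
  operator on \<open>V\<close> representing \<open>q\<close> through the inner product; by Sylvester's law the number of
  positive (negative) ones is independent of the inner product.\<close>

definition form_eigenspace ::
    "('n phase \<Rightarrow> 'n phase \<Rightarrow> complex) \<Rightarrow> 'n::finite phase set \<Rightarrow> real \<Rightarrow> 'n phase set" where
  "form_eigenspace q V \<mu> = {v\<in>V. \<forall>u\<in>V. q u v = of_real \<mu> * pdot u v}"

definition form_n_pos ::
    "('n phase \<Rightarrow> 'n phase \<Rightarrow> complex) \<Rightarrow> 'n::finite phase set \<Rightarrow> nat" where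
  "form_n_pos q V =
     (\<Sum>\<mu> | \<mu> > 0 \<and> form_eigenspace q V \<mu> \<noteq> {0}. phase.dim (form_eigenspace q V \<mu>))"

definition form_n_neg ::
    "('n phase \<Rightarrow> 'n phase \<Rightarrow> complex) \<Rightarrow> 'n::finite phase set \<Rightarrow> nat" where
  "form_n_neg q V =
     (\<Sum>\<mu> | \<mu> < 0 \<and> form_eigenspace q V \<mu> \<noteq> {0}. phase.dim (form_eigenspace q V \<mu>))"

definition form_nondegenerate ::
    "('n phase \<Rightarrow> 'n phase \<Rightarrow> complex) \<Rightarrow> 'n::finite phase set \<Rightarrow> bool" where
  "form_nondegenerate q V \<longleftrightarrow> (\<forall>v\<in>V. (\<forall>u\<in>V. q u v = 0) \<longrightarrow> v = 0)"


subsection \<open>The Duistermaat index\<close>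

text \<open>The extensional function space makes the characterisation unique as a HOL function.\<close>

definition is_duistermaat_index ::
    "('n phase set \<times> 'n phase set \<times> 'n::finite phase set \<Rightarrow> nat) \<Rightarrow> bool" where
  "is_duistermaat_index j \<longleftrightarrow>
     j \<in> (Lagr \<times> Lagr \<times> Lagr) \<rightarrow>\<^sub>E {0..CARD('n)} \<and>
     (\<forall>A. hermitian A \<longrightarrow> j (graph 0, graph A, graph_inf) = mat_n_neg A) \<and>
     (\<forall>T. symplectic_map T \<longrightarrow>
        (\<forall>L1\<in>Lagr. \<forall>L2\<in>Lagr. \<forall>L3\<in>Lagr. j (T ` L1, T ` L2, T ` L3) = j (L1, L2, L3))) \<and>
     (\<forall>L1\<in>Lagr. \<forall>L2\<in>Lagr. \<forall>L3\<in>Lagr. \<forall>L4\<in>Lagr.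
        int (j (L1, L2, L3)) - int (j (L1, L2, L4)) + int (j (L1, L3, L4))
          - int (j (L2, L3, L4)) = 0)"

definition duistermaat_index ::
    "'n phase set \<times> 'n phase set \<times> 'n::finite phase set \<Rightarrow> nat" where
  "duistermaat_index = (THE j. is_duistermaat_index j)"


subsection \<open>Frames and the topology of the Lagrangian Grassmannian\<close>

definition frame_map ::
    "complex ^ 'n ^ 'n \<Rightarrow> complex ^ 'n ^ 'n \<Rightarrow> complex ^ 'n \<Rightarrow> 'n::finite phase" where
  "frame_map X Y x = (X *v x, Y *v x)"

definition is_frame ::
    "complex ^ 'n ^ 'n \<Rightarrow> complex ^ 'n ^ 'n \<Rightarrow> 'n::finite phase set \<Rightarrow> bool" where
  "is_frame X Y L \<longleftrightarrow> inj (frame_map X Y) \<and> range (frame_map X Y) = L"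

definition Lagr_frames :: "((complex ^ 'n ^ 'n) \<times> (complex ^ 'n ^ 'n)) set" where
  "Lagr_frames = {(X, Y). \<exists>L\<in>Lagr. is_frame X Y L}"

text \<open>The usual (Grassmannian) topology: the quotient topology with respect to the map taking a
  frame to its range.\<close>

definition Lagr_topology :: "'n::finite phase set topology" where
  "Lagr_topology = topology (\<lambda>U. U \<subseteq> Lagr \<and>
     openin (top_of_set Lagr_frames) {(X, Y) \<in> Lagr_frames. range (frame_map X Y) \<in> U})"

lemma openin_Lagr_topology:
  fixes U :: "'n::finite phase set set"
  shows "openin Lagr_topology U \<longleftrightarrow> U \<subseteq> Lagr \<and>
     openin (top_of_set Lagr_frames) {(X, Y) \<in> Lagr_frames. range (frame_map X Y) \<in> U}"
proof -
  let ?P = "\<lambda>U :: 'n phase set set. {(X, Y) \<in> Lagr_frames. range (frame_map X Y) \<in> U}"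
  have Int: "?P (S \<inter> T) = ?P S \<inter> ?P T" for S T by auto
  have Un: "?P (\<Union>K) = (\<Union>S\<in>K. ?P S)" for K by auto
  have "istopology (\<lambda>U. U \<subseteq> Lagr \<and> openin (top_of_set Lagr_frames) (?P U))"
    unfolding istopology_def Int Un by (auto intro!: openin_Int openin_Union)
  then show ?thesis
    unfolding Lagr_topology_def by (simp add: topology_inverse')
qed


subsection \<open>Differentiable paths and the crossing form\<close>

definition mderiv :: "(real \<Rightarrow> complex ^ 'n ^ 'n) \<Rightarrow> real \<Rightarrow> complex ^ 'n ^ 'n" where
  "mderiv X t = vector_derivative X (at t within {0..1})"

definition diff_frame ::
    "(real \<Rightarrow> complex ^ 'n ^ 'n) \<Rightarrow> (real \<Rightarrow> complex ^ 'n ^ 'n) \<Rightarrow>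
     (real \<Rightarrow> 'n::finite phase set) \<Rightarrow> bool" where
  "diff_frame X Y L \<longleftrightarrow> X differentiable_on {0..1} \<and> Y differentiable_on {0..1} \<and>
     (\<forall>t\<in>{0..1}. L t \<in> Lagr \<and> is_frame (X t) (Y t) (L t))"

definition diff_path :: "(real \<Rightarrow> 'n::finite phase set) \<Rightarrow> bool" where
  "diff_path L \<longleftrightarrow> (\<exists>X Y. diff_frame X Y L)"

definition C1_path :: "(real \<Rightarrow> 'n::finite phase set) \<Rightarrow> bool" where
  "C1_path L \<longleftrightarrow> (\<exists>X Y. diff_frame X Y L \<and>
     continuous_on {0..1} (mderiv X) \<and> continuous_on {0..1} (mderiv Y))"

text \<open>The sesquilinear form whose quadratic form is the crossing form of \<open>L\<close> at \<open>t\<close>; its value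
  does not depend on the differentiable frame.\<close>

definition crossing_form ::
    "(real \<Rightarrow> 'n phase set) \<Rightarrow> real \<Rightarrow> 'n phase \<Rightarrow> 'n::finite phase \<Rightarrow> complex" where
  "crossing_form L t u v = (THE c. \<exists>X Y x y. diff_frame X Y L \<and>
     u = frame_map (X t) (Y t) x \<and> v = frame_map (X t) (Y t) y \<and>
     c = cdot x ((adj (X t) ** mderiv Y t - adj (Y t) ** mderiv X t) *v y))"

definition nondecreasing :: "(real \<Rightarrow> 'n::finite phase set) \<Rightarrow> bool" where
  "nondecreasing L \<longleftrightarrow> diff_path L \<and>
     (\<forall>t\<in>{0..1}. \<forall>v\<in>L t. Re (crossing_form L t v v) \<ge> 0)"


subsection \<open>The Maslov index\<close>

definition regular_path :: "(real \<Rightarrow> 'n phase set) \<Rightarrow> 'n::finite phase set \<Rightarrow> bool" where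
  "regular_path L M \<longleftrightarrow> C1_path L \<and>
     (\<forall>t\<in>{0..1}. L t \<inter> M \<noteq> {0} \<longrightarrow> form_nondegenerate (crossing_form L t) (L t \<inter> M))"

definition maslov_regular :: "(real \<Rightarrow> 'n phase set) \<Rightarrow> 'n::finite phase set \<Rightarrow> int" where
  "maslov_regular L M =
     (\<Sum>t | t \<in> {0..<1} \<and> L t \<inter> M \<noteq> {0}. int (form_n_pos (crossing_form L t) (L t \<inter> M))) -
     (\<Sum>t | t \<in> {0<..1} \<and> L t \<inter> M \<noteq> {0}. int (form_n_neg (crossing_form L t) (L t \<inter> M)))"

definition path_homotopic ::
    "(real \<Rightarrow> 'n phase set) \<Rightarrow> (real \<Rightarrow> 'n::finite phase set) \<Rightarrow> bool" where
  "path_homotopic L R \<longleftrightarrow>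
     homotopic_with (\<lambda>h. h 0 = L 0 \<and> h 1 = L 1) (top_of_set {0..1}) Lagr_topology L R"

definition maslov :: "(real \<Rightarrow> 'n phase set) \<Rightarrow> 'n::finite phase set \<Rightarrow> int" where
  "maslov L M = (THE k. \<exists>R. regular_path R M \<and> path_homotopic L R \<and> k = maslov_regular R M)"

definition nondecreasing_from_to ::
    "'n phase set \<Rightarrow> 'n phase set \<Rightarrow> (real \<Rightarrow> 'n::finite phase set) \<Rightarrow> bool" where
  "nondecreasing_from_to L0 L1 L \<longleftrightarrow> nondecreasing L \<and> L 0 = L0 \<and> L 1 = L1"

end

theory Submission
  imports Defs
begin

text \<open>
  In a symplectic chart sending a Lagrangian plane \<open>N\<close> to infinity, the planes transversal to \<open>N\<close> are
  the graphs of Hermitian matrices. The Duistermaat index is built from the numbers \<open>n\<^sub>-(B - A)\<close> of such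
  graphs; its independence of the chart is the identity
  \<open>n\<^sub>-(B - A) + n\<^sub>-(A) = n\<^sub>-(B) + n\<^sub>-(A\<inverse> - B\<inverse>)\<close>, which compares two Schur complements of one block
  matrix. As long as a path stays transversal to \<open>N\<close>, its Maslov index with respect to \<open>M\<close> is
  \<open>\<iota>(L(a), L(b), M) - \<iota>(L(a), L(b), N)\<close>. By the cocycle identity these increments add up to a homotopy
  invariant of continuous paths, which on regular paths is the count of signed crossings, and
  \<open>Mas(L, M) - \<iota>(L\<^sub>0, L\<^sub>1, M)\<close> does not depend on \<open>M\<close>. For \<open>M = L\<^sub>1\<close> the index \<open>\<iota>\<close> vanishes while the
  Maslov index of a non-decreasing path is non-negative: this is the lower bound. It is attained by a
  segment in a chart in which the matrix of \<open>L\<^sub>1\<close> dominates that of \<open>L\<^sub>0\<close>; such a chart is found by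
  pushing \<open>L\<^sub>1\<close> slightly in the positive direction and sending the result to infinity.
\<close>

section \<open>Linear algebra in phase space\<close>

text \<open>\<open>maslov\<close> is a definite description over the regular paths homotopic to a
  given one, so it has a usable value only once every differentiable path, whose velocity may be
  discontinuous, has been deformed into a regular one. To this end the path is replaced, chart by
  chart, by segments with velocity zero at the joints, and then rotated fast enough to make all
  crossings definite. Eigenvalue counts are awkward under sums and perturbations; they are traded
  for the largest dimension of a positive definite subspace, bounded below by exhibiting such a
  subspace and above by exhibiting a non-positive one of complementary dimension. Finitely many
  Lagrangian planes have a common transversal. Any index identity can thus be read in one chart,
  where \<open>n\<^sub>-(B - A) + n\<^sub>-(C - B) - n\<^sub>-(C - A)\<close> is a coboundary and
  the cocycle identity is formal. The push of \<open>L1\<close> has its origin in the requirement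
  that \<iota>(\<open>L0\<close>, \<open>L1\<close>, \<open>N\<close>) be zero: with
  \<open>N\<close> at infinity this says exactly that the matrix of \<open>L1\<close> dominates that
  of \<open>L0\<close>.\<close>

lemma cdot_add_left: "cdot (x + y) z = cdot x z + cdot y z"
  and cdot_add_right: "cdot x (y + z) = cdot x y + cdot x z"
  and cdot_diff_left: "cdot (x - y) z = cdot x z - cdot y z"
  and cdot_diff_right: "cdot x (y - z) = cdot x y - cdot x z"
  and cdot_minus_left: "cdot (- x) z = - cdot x z"
  and cdot_minus_right: "cdot x (- z) = - cdot x z"
  and cdot_scale_left: "cdot (c *s x) z = cnj c * cdot x z"
  and cdot_scale_right: "cdot x (c *s z) = c * cdot x z"
  and cdot_zero_left [simp]: "cdot 0 x = 0"
  and cdot_zero_right [simp]: "cdot x 0 = 0"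
  and cnj_cdot: "cnj (cdot x y) = cdot y x"
  by (simp_all add: cdot_def algebra_simps sum.distrib sum_distrib_left sum_subtractf sum_negf)

lemma cdot_self: "cdot x x = of_real ((norm x)\<^sup>2)"
proof -
  have "cnj (x $ i) * x $ i = of_real ((norm (x $ i))\<^sup>2)" for i
    using complex_norm_square[of "x $ i"] by (simp add: mult.commute)
  then show ?thesis
    by (simp add: cdot_def norm_vec_def L2_set_def sum_nonneg)
qed

lemma cdot_self_eq_0_iff [simp]: "cdot x x = 0 \<longleftrightarrow> x = 0"
  by (simp add: cdot_self)

lemma cdot_left_0_imp: "(\<And>x. cdot x y = 0) \<Longrightarrow> y = 0"
  using cdot_self_eq_0_iff by blast

lemma cdot_adj: "cdot (A *v x) y = cdot x (adj A *v y)"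
proof -
  have "cdot (A *v x) y = (\<Sum>i\<in>UNIV. \<Sum>j\<in>UNIV. cnj (A $ i $ j) * cnj (x $ j) * y $ i)"
    by (simp add: cdot_def matrix_vector_mult_def sum_distrib_right)
  also have "\<dots> = (\<Sum>j\<in>UNIV. \<Sum>i\<in>UNIV. cnj (A $ i $ j) * cnj (x $ j) * y $ i)"
    by (rule sum.swap)
  also have "\<dots> = cdot x (adj A *v y)"
    by (simp add: cdot_def matrix_vector_mult_def adj_def sum_distrib_left algebra_simps)
  finally show ?thesis .
qed

lemma bounded_bilinear_cdot:
  "bounded_bilinear (cdot :: complex ^ 'n \<Rightarrow> complex ^ 'n::finite \<Rightarrow> complex)"
proof
  show "\<exists>K. \<forall>a b :: complex ^ 'n. norm (cdot a b) \<le> norm a * norm b * K"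
  proof (intro exI[of _ "real CARD('n)"] allI)
    fix a b :: "complex ^ 'n"
    have "norm (cdot a b) \<le> (\<Sum>i\<in>(UNIV::'n set). norm a * norm b)"
      unfolding cdot_def
      by (rule order_trans[OF norm_sum sum_mono])
        (simp add: norm_mult mult_mono Finite_Cartesian_Product.norm_nth_le)
    then show "norm (cdot a b) \<le> norm a * norm b * real CARD('n)"
      by (simp add: mult.commute)
  qed
qed (simp_all add: cdot_def algebra_simps sum.distrib scaleR_sum_right)

lemma hermitian_cdot_iff: "hermitian A \<longleftrightarrow> (\<forall>x y. cdot (A *v x) y = cdot x (A *v y))"
proof
  assume R: "\<forall>x y. cdot (A *v x) y = cdot x (A *v y)"
  have "cdot x (adj A *v y - A *v y) = 0" for x y
    using R by (simp add: cdot_diff_right cdot_adj)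
  then have "adj A *v y - A *v y = 0" for y
    using cdot_left_0_imp by blast
  then show "hermitian A"
    unfolding hermitian_def by (auto simp: matrix_eq)
qed (simp add: hermitian_def cdot_adj)

lemma pscale_simps [simp]: "fst (pscale c v) = c *s fst v" "snd (pscale c v) = c *s snd v"
  by (simp_all add: pscale_def)

lemma pdot_add_left: "pdot (x + y) z = pdot x z + pdot y z"
  and pdot_add_right: "pdot x (y + z) = pdot x y + pdot x z"
  and pdot_scale_right: "pdot x (pscale c z) = c * pdot x z"
  and pdot_zero_left [simp]: "pdot 0 x = 0"
  and pdot_zero_right [simp]: "pdot x 0 = 0"
  and cnj_pdot: "cnj (pdot x y) = pdot y x"
  by (simp_all add: pdot_def cdot_add_left cdot_add_right cdot_diff_left cdot_diff_right
      cdot_scale_left cdot_scale_right cnj_cdot algebra_simps)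

lemma pdot_self: "pdot x x = of_real ((norm x)\<^sup>2)"
  by (simp add: pdot_def cdot_self norm_prod_def)

lemma sympl_add_left: "sympl (x + y) z = sympl x z + sympl y z"
  and sympl_add_right: "sympl x (y + z) = sympl x y + sympl x z"
  and sympl_diff_right: "sympl x (y - z) = sympl x y - sympl x z"
  and sympl_scale_left: "sympl (pscale c x) z = cnj c * sympl x z"
  and sympl_scale_right: "sympl x (pscale c z) = c * sympl x z"
  and sympl_zero_left [simp]: "sympl 0 x = 0"
  and sympl_zero_right [simp]: "sympl x 0 = 0"
  and cnj_sympl: "cnj (sympl x y) = - sympl y x"
  by (simp_all add: sympl_def cdot_add_left cdot_add_right cdot_diff_left cdot_diff_right
      cdot_scale_left cdot_scale_right cnj_cdot algebra_simps)

lemma bounded_bilinear_sympl: "bounded_bilinear (sympl :: 'n phase \<Rightarrow> 'n::finite phase \<Rightarrow> complex)"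
proof -
  interpret cd: bounded_bilinear "cdot :: complex ^ 'n \<Rightarrow> complex ^ 'n \<Rightarrow> complex"
    by (rule bounded_bilinear_cdot)
  have 1: "bounded_bilinear (\<lambda>(u::'n phase) v::'n phase. cdot (fst u) (snd v))"
    by (rule bounded_bilinear.comp[OF bounded_bilinear_cdot bounded_linear_fst bounded_linear_snd])
  have 2: "bounded_bilinear (\<lambda>(u::'n phase) v::'n phase. cdot (snd u) (fst v))"
    by (rule bounded_bilinear.comp[OF bounded_bilinear_cdot bounded_linear_snd bounded_linear_fst])
  obtain K1 where K1: "\<And>(u :: 'n phase) (v :: 'n phase). norm (cdot (fst u) (snd v)) \<le> norm u * norm v * K1"
    using bounded_bilinear.bounded[OF 1] by metis
  obtain K2 where K2: "\<And>(u :: 'n phase) (v :: 'n phase). norm (cdot (snd u) (fst v)) \<le> norm u * norm v * K2"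
    using bounded_bilinear.bounded[OF 2] by metis
  show ?thesis
  proof
    show "\<exists>K. \<forall>(a :: 'n phase) (b :: 'n phase). norm (sympl a b) \<le> norm a * norm b * K"
    proof (intro exI allI)
      fix a b :: "'n phase"
      show "norm (sympl a b) \<le> norm a * norm b * (K1 + K2)"
        unfolding sympl_def using norm_triangle_ineq4 K1[of a b] K2[of a b]
        by (smt (verit, best) distrib_left)
    qed
  qed (simp_all add: sympl_def cd.add_left cd.add_right cd.scaleR_left cd.scaleR_right algebra_simps)
qed

lemma sympl_right_0_imp:
  assumes "\<And>u. sympl u v = 0" shows "v = 0"
proof -
  have "cdot x (snd v) = 0" for x using assms[of "(x, 0)"] by (simp add: sympl_def)
  moreover have "cdot x (fst v) = 0" for x using assms[of "(0, x)"] by (simp add: sympl_def)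
  ultimately show ?thesis by (metis cdot_left_0_imp prod_eqI fst_zero snd_zero)
qed

interpretation vecprod: finite_dimensional_vector_space_prod
  "(*s) :: complex \<Rightarrow> complex ^ 'n::finite \<Rightarrow> complex ^ 'n" "(*s) :: complex \<Rightarrow> complex ^ 'n \<Rightarrow> complex ^ 'n"
  cart_basis cart_basis ..

lemma vecprod_scale_eq: "vecprod.scale = pscale"
  by (auto simp: fun_eq_iff vecprod.scale_def pscale_def)

text \<open>The complex structure of phase space is carried by \<open>pscale\<close>; the basis of
  pairs transports the dimension theory of the product to it.\<close>

interpretation phasefd: finite_dimensional_vector_space
  "pscale :: complex \<Rightarrow> 'n::finite phase \<Rightarrow> 'n phase" vecprod.Basis_pair
  using vecprod.p.finite_dimensional_vector_space_axioms unfolding vecprod_scale_eq .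

interpretation phasepair: finite_dimensional_vector_space_pair
  "pscale :: complex \<Rightarrow> 'n::finite phase \<Rightarrow> 'n phase" vecprod.Basis_pair
  "pscale :: complex \<Rightarrow> 'n::finite phase \<Rightarrow> 'n phase" vecprod.Basis_pair ..

interpretation vecphase: finite_dimensional_vector_space_pair
  "(*s) :: complex \<Rightarrow> complex ^ 'n::finite \<Rightarrow> complex ^ 'n" cart_basis
  "pscale :: complex \<Rightarrow> 'n::finite phase \<Rightarrow> 'n phase" vecprod.Basis_pair ..

lemma phase_dim_Times:
  "vec.subspace S \<Longrightarrow> vec.subspace T \<Longrightarrow> phase.dim (S \<times> T) = vec.dim S + vec.dim T"
  using vecprod.dim_Times unfolding vecprod_scale_eq .

lemma dim_UNIV_cvec: "vec.dim (UNIV :: (complex ^ 'n::finite) set) = CARD('n)"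
  using vec.dim_UNIV[where 'a=complex and 'b='n] card_cart_basis by metis

lemma phase_dim_UNIV: "phase.dim (UNIV :: 'n::finite phase set) = 2 * CARD('n)"
proof -
  have "phase.dim ((UNIV :: (complex ^ 'n) set) \<times> (UNIV :: (complex ^ 'n) set)) = CARD('n) + CARD('n)"
    by (subst phase_dim_Times) (auto simp only: vec.subspace_UNIV dim_UNIV_cvec)
  then show ?thesis by simp
qed

section \<open>Inertia of Hermitian forms\<close>

text \<open>Relative to a subspace, because the crossing form is meaningful only on the plane of the
  path at the given time.\<close>

definition herm_form :: "'n phase set \<Rightarrow> ('n phase \<Rightarrow> 'n::finite phase \<Rightarrow> complex) \<Rightarrow> bool" where
  "herm_form V q \<longleftrightarrow>
     (\<forall>u\<in>V. \<forall>v\<in>V. \<forall>w\<in>V. q u (v + w) = q u v + q u w) \<and>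
     (\<forall>u\<in>V. \<forall>v\<in>V. \<forall>c. q u (pscale c v) = c * q u v) \<and>
     (\<forall>u\<in>V. \<forall>v\<in>V. q v u = cnj (q u v))"

definition pos_on :: "('n phase \<Rightarrow> 'n phase \<Rightarrow> complex) \<Rightarrow> 'n::finite phase set \<Rightarrow> bool" where
  "pos_on q W \<longleftrightarrow> (\<forall>u\<in>W. u \<noteq> 0 \<longrightarrow> Re (q u u) > 0)"

text \<open>The variational form of Sylvester's index. It refers to no inner product, so it is
  directly compatible with linear substitutions and can be estimated by test subspaces.\<close>

definition npos :: "('n phase \<Rightarrow> 'n phase \<Rightarrow> complex) \<Rightarrow> 'n::finite phase set \<Rightarrow> nat" where
  "npos q V = Max {phase.dim W | W. phase.subspace W \<and> W \<subseteq> V \<and> pos_on q W}"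

abbreviation nneg :: "('n phase \<Rightarrow> 'n phase \<Rightarrow> complex) \<Rightarrow> 'n::finite phase set \<Rightarrow> nat" where
  "nneg q V \<equiv> npos (\<lambda>u v. - q u v) V"

lemma herm_form_subset: "herm_form V q \<Longrightarrow> W \<subseteq> V \<Longrightarrow> herm_form W q"
  unfolding herm_form_def by blast

lemma herm_form_uminus: "herm_form V q \<Longrightarrow> herm_form V (\<lambda>u v. - q u v)"
  unfolding herm_form_def by (metis add.commute complex_cnj_minus minus_add_distrib mult_minus_right)

context
  fixes V :: "'n::finite phase set" and q
  assumes V: "phase.subspace V" and q: "herm_form V q"
begin

lemma herm_add_right: "u \<in> V \<Longrightarrow> v \<in> V \<Longrightarrow> w \<in> V \<Longrightarrow> q u (v + w) = q u v + q u w"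
  and herm_scale_right: "u \<in> V \<Longrightarrow> v \<in> V \<Longrightarrow> q u (pscale c v) = c * q u v"
  and herm_cnj: "u \<in> V \<Longrightarrow> v \<in> V \<Longrightarrow> q v u = cnj (q u v)"
  using q unfolding herm_form_def by blast+

lemma herm_add_left: "u \<in> V \<Longrightarrow> v \<in> V \<Longrightarrow> w \<in> V \<Longrightarrow> q (v + w) u = q v u + q w u"
  using herm_cnj[of u "v + w"] herm_cnj[of u v] herm_cnj[of u w] herm_add_right[of u v w]
    phase.subspace_add[OF V] by simp

lemma herm_scale_left: "u \<in> V \<Longrightarrow> v \<in> V \<Longrightarrow> q (pscale c v) u = cnj c * q v u"
  using herm_cnj[of u "pscale c v"] herm_cnj[of u v] herm_scale_right[of u v c]
    phase.subspace_scale[OF V] by simp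

lemma herm_zero: "u \<in> V \<Longrightarrow> q u 0 = 0" "u \<in> V \<Longrightarrow> q 0 u = 0"
  using herm_scale_right[of u 0 0] herm_scale_left[of u 0 0] phase.subspace_0[OF V] by simp_all

lemma herm_diff_right: "u \<in> V \<Longrightarrow> v \<in> V \<Longrightarrow> w \<in> V \<Longrightarrow> q u (v - w) = q u v - q u w"
  using herm_add_right[of u "v - w" w] phase.subspace_diff[OF V] by simp

lemma herm_quad_add:
  assumes "u \<in> V" "v \<in> V"
  shows "Re (q (u + v) (u + v)) = Re (q u u) + 2 * Re (q u v) + Re (q v v)"
proof -
  have "q (u + v) (u + v) = q u u + q u v + (q v u + q v v)"
    using assms V by (simp add: herm_add_left herm_add_right phase.subspace_add)
  moreover have "Re (q v u) = Re (q u v)"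
    using herm_cnj[OF assms] by simp
  ultimately show ?thesis by simp
qed

lemma herm_quad_scale: "u \<in> V \<Longrightarrow> Re (q (pscale c u) (pscale c u)) = (cmod c)\<^sup>2 * Re (q u u)"
proof -
  assume u: "u \<in> V"
  have "q (pscale c u) (pscale c u) = (cnj c * c) * q u u"
    using u V by (simp add: herm_scale_left herm_scale_right phase.subspace_scale)
  also have "cnj c * c = of_real ((cmod c)\<^sup>2)"
    by (metis complex_norm_square mult.commute)
  finally show ?thesis by simp
qed

text \<open>Polarization: the values on \<open>u + v\<close> kill the real part of
  \<open>q u v\<close>, and replacing \<open>v\<close> by \<open>\<i>\<close> times \<open>v\<close>
  kills the imaginary part.\<close>

lemma herm_isotropic_zero:
  assumes W: "phase.subspace W" "W \<subseteq> V" "\<And>u. u \<in> W \<Longrightarrow> Re (q u u) = 0"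
    and uv: "u \<in> W" "v \<in> W"
  shows "q u v = 0"
proof -
  have Re0: "Re (q u v) = 0" if "u \<in> W" "v \<in> W" for u v
  proof -
    have "u \<in> V" "v \<in> V" using that W(2) by auto
    then show ?thesis
      using herm_quad_add[of u v] W(3)[OF that(1)] W(3)[OF that(2)]
        W(3)[OF phase.subspace_add[OF W(1) that]] by simp
  qed
  have "Re (q u (pscale \<i> v)) = 0"
    using Re0[OF uv(1) phase.subspace_scale[OF W(1) uv(2)]] .
  then have "Im (q u v) = 0"
    using herm_scale_right[OF subsetD[OF W(2) uv(1)] subsetD[OF W(2) uv(2)], of \<i>] by simp
  with Re0[OF uv] show ?thesis by (simp add: complex_eq_iff)
qed

lemma herm_semidefinite_null:
  assumes W: "phase.subspace W" "W \<subseteq> V" "\<And>u. u \<in> W \<Longrightarrow> Re (q u u) \<ge> 0"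
    and uv: "u \<in> W" "v \<in> W" and v0: "Re (q v v) = 0"
  shows "q u v = 0"
proof (rule ccontr)
  assume n: "q u v \<noteq> 0"
  \<comment> \<open>Along \<open>u + pscale c v\<close> there is no quadratic term, since
    \<open>v\<close> is null. With this \<open>k\<close> the value becomes minus
    \<open>Re (q u u)\<close> minus twice the squared modulus of \<open>q u v\<close>, which is
    negative.\<close>
  define k where "k = Re (q u u) / (cmod (q u v))\<^sup>2 + 1"
  define c where "c = - of_real k * cnj (q u v)"
  have uvV: "u \<in> V" "v \<in> V" using uv W by auto
  have w: "u + pscale c v \<in> W"
    using W uv by (simp add: phase.subspace_add phase.subspace_scale)
  have cv: "pscale c v \<in> V" using V uvV by (simp add: phase.subspace_scale)
  have "Re (q (u + pscale c v) (u + pscale c v)) = Re (q u u) + 2 * Re (c * q u v)"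
    using herm_quad_add[OF uvV(1) cv] herm_quad_scale[OF uvV(2), of c] v0 herm_scale_right[OF uvV, of c]
    by simp
  also have "c * q u v = - of_real (k * (cmod (q u v))\<^sup>2)"
    unfolding c_def using complex_norm_square[of "q u v"] by (simp add: mult.commute)
  also have "Re (q u u) + 2 * Re (- complex_of_real (k * (cmod (q u v))\<^sup>2)) < 0"
  proof -
    have "k * (cmod (q u v))\<^sup>2 = Re (q u u) + (cmod (q u v))\<^sup>2"
      using n by (simp add: k_def field_simps)
    moreover have "(cmod (q u v))\<^sup>2 > 0" "Re (q u u) \<ge> 0" using n W(3)[OF uv(1)] by simp_all
    ultimately show ?thesis unfolding minus_complex.sel uminus_complex.sel Re_complex_of_real by linarith
  qed
  finally show False using W(3)[OF w] by simp
qed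

text \<open>Gram-Schmidt orthogonalization with respect to \<open>q\<close>. Positivity is required
  on the span only; it makes the denominators nonzero there, while \<open>v\<close> ranges over all
  of \<open>V\<close>.\<close>

lemma pos_projection:
  assumes "finite B" "phase.span B \<subseteq> V" "pos_on q (phase.span B)" "v \<in> V"
  shows "\<exists>p\<in>phase.span B. \<forall>u\<in>phase.span B. q u (v - p) = 0"
  using assms
proof (induction B arbitrary: v rule: finite_induct)
  case empty
  then show ?case by (auto simp: herm_zero)
next
  case (insert b B)
  let ?S = "phase.span B" and ?S' = "phase.span (insert b B)"
  have sub: "?S \<subseteq> ?S'" by (simp add: phase.span_mono subset_insertI)
  have SV: "?S \<subseteq> V" and pS: "pos_on q ?S"
    using sub insert.prems by (auto simp: pos_on_def)
  have bS': "b \<in> ?S'" by (simp add: phase.span_base)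
  then have bV: "b \<in> V" using insert.prems by auto
  obtain pb where pb: "pb \<in> ?S" "\<forall>u\<in>?S. q u (b - pb) = 0"
    using insert.IH[OF SV pS bV] by blast
  obtain pv where pv: "pv \<in> ?S" "\<forall>u\<in>?S. q u (v - pv) = 0"
    using insert.IH[OF SV pS insert.prems(3)] by blast
  \<comment> \<open>The part of the new vector \<open>b\<close> orthogonal to the earlier span. If
    it vanishes the span does not grow; otherwise it supplies one further coefficient.\<close>
  define b' where "b' = b - pb"
  show ?case
  proof (cases "b' = 0")
    case True
    then have "b \<in> ?S" using pb by (simp add: b'_def)
    then have "?S' = ?S" by (rule phase.span_redundant)
    then show ?thesis using pv by auto
  next
    case False
    have b'S: "b' \<in> ?S'"
      unfolding b'_def using bS' pb sub phase.span_diff by blast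
    have b'V: "b' \<in> V" using b'S insert.prems by auto
    have nz: "q b' b' \<noteq> 0"
      using insert.prems(2) b'S False by (auto simp: pos_on_def)
    define c where "c = q b' (v - pv) / q b' b'"
    define p where "p = pv + pscale c b'"
    have pvV: "v - pv \<in> V" using pv SV insert.prems(3) V by (meson phase.subspace_diff subsetD)
    have cb: "pscale c b' \<in> V" using b'V V by (simp add: phase.subspace_scale)
    have eq: "v - p = (v - pv) - pscale c b'" by (simp add: p_def algebra_simps)
    have pS': "p \<in> ?S'"
      unfolding p_def using pv sub b'S by (meson phase.span_add phase.span_scale subsetD)
    have "q u (v - p) = 0" if u: "u \<in> ?S'" for u
    proof -
      obtain k where k: "u - pscale k b \<in> ?S" using u phase.span_breakdown_eq by blast
      define w where "w = (u - pscale k b) + pscale k pb"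
      have wS: "w \<in> ?S" unfolding w_def using k pb by (meson phase.span_add phase.span_scale)
      then have wV: "w \<in> V" using SV by auto
      have uw: "u = w + pscale k b'"
        by (simp add: w_def b'_def phase.scale_right_diff_distrib)
      have kb: "pscale k b' \<in> V" using b'V V by (simp add: phase.subspace_scale)
      have "q w (v - p) = 0"
        unfolding eq using wV pvV cb wS pv pb herm_scale_right[OF wV b'V, of c]
        by (simp add: herm_diff_right b'_def)
      moreover have "q b' (v - p) = 0"
        unfolding eq using b'V pvV cb herm_scale_right[OF b'V b'V, of c] nz
        by (simp add: herm_diff_right c_def)
      moreover have "v - p \<in> V" unfolding eq using pvV cb V by (simp add: phase.subspace_diff)
      ultimately show ?thesis
        unfolding uw using wV kb b'V by (simp add: herm_add_left herm_scale_left)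
    qed
    then show ?thesis using pS' by blast
  qed
qed

lemma subspace_orth: "P \<subseteq> V \<Longrightarrow> phase.subspace {v\<in>V. \<forall>u\<in>P. q u v = 0}"
proof (rule phase.subspaceI)
  assume "P \<subseteq> V"
  then have PV: "u \<in> V" if "u \<in> P" for u using that by blast
  show "0 \<in> {v\<in>V. \<forall>u\<in>P. q u v = 0}" using phase.subspace_0[OF V] PV by (simp add: herm_zero)
  show "x + y \<in> {v\<in>V. \<forall>u\<in>P. q u v = 0}"
    if "x \<in> {v\<in>V. \<forall>u\<in>P. q u v = 0}" "y \<in> {v\<in>V. \<forall>u\<in>P. q u v = 0}" for x y
    using that phase.subspace_add[OF V] PV by (simp add: herm_add_right)
  show "pscale c x \<in> {v\<in>V. \<forall>u\<in>P. q u v = 0}" if "x \<in> {v\<in>V. \<forall>u\<in>P. q u v = 0}" for c x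
    using that phase.subspace_scale[OF V] PV by (simp add: herm_scale_right)
qed

lemma pos_orth_decomposition:
  assumes P: "phase.subspace P" "P \<subseteq> V" "pos_on q P"
  defines "Q \<equiv> {v\<in>V. \<forall>u\<in>P. q u v = 0}"
  shows "{x + y |x y. x \<in> P \<and> y \<in> Q} = V" "P \<inter> Q = {0}" "phase.dim P + phase.dim Q = phase.dim V"
proof -
  have sQ: "phase.subspace Q" unfolding Q_def by (rule subspace_orth[OF P(2)])
  obtain B where B: "finite B" "phase.span B = P"
    using phasefd.basis_subspace_exists[OF P(1)] by metis
  show 1: "{x + y |x y. x \<in> P \<and> y \<in> Q} = V"
  proof (intro equalityI subsetI)
    fix v assume v: "v \<in> V"
    obtain p where p: "p \<in> P" "\<forall>u\<in>P. q u (v - p) = 0"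
      using pos_projection[OF B(1), of v] B(2) P v by auto
    have "v - p \<in> V" using v p(1) P(2) V by (meson phase.subspace_diff subsetD)
    with p have "v - p \<in> Q" unfolding Q_def by blast
    then show "v \<in> {x + y |x y. x \<in> P \<and> y \<in> Q}"
      using p(1) by (intro CollectI exI[of _ p] exI[of _ "v - p"]) simp
  next
    fix v assume "v \<in> {x + y |x y. x \<in> P \<and> y \<in> Q}"
    then show "v \<in> V" using P(2) phase.subspace_add[OF V] unfolding Q_def by blast
  qed
  show 2: "P \<inter> Q = {0}"
  proof -
    have "u = 0" if "u \<in> P" "u \<in> Q" for u
    proof -
      have "q u u = 0" using that unfolding Q_def by blast
      then show ?thesis using P(3) that(1) unfolding pos_on_def by (metis less_irrefl zero_complex.sel(1))
    qed
    then show ?thesis using phase.subspace_0[OF P(1)] phase.subspace_0[OF sQ] by blast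
  qed
  show "phase.dim P + phase.dim Q = phase.dim V"
    using phasefd.dim_sums_Int[OF P(1) sQ] unfolding 1 2 by simp
qed

end

section \<open>The positive index: test subspaces, inertia decomposition, additivity\<close>

lemma npos_set:
  fixes V :: "'n::finite phase set" and q
  defines "S \<equiv> {phase.dim W | W. phase.subspace W \<and> W \<subseteq> V \<and> pos_on q W}"
  assumes "phase.subspace V"
  shows "finite S" "S \<noteq> {}"
proof -
  have "S \<subseteq> {..phase.dim V}" unfolding S_def using phasefd.dim_subset by auto
  then show "finite S" using finite_subset by blast
  have "phase.subspace {0::'n phase}" "{0} \<subseteq> V" "pos_on q {0}"
    using assms phase.subspace_0 by (auto simp: pos_on_def)
  then show "S \<noteq> {}" unfolding S_def by blast
qed

lemma npos_ge:
  assumes "phase.subspace V" "phase.subspace W" "W \<subseteq> V" "pos_on q W"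
  shows "phase.dim W \<le> npos q V"
  unfolding npos_def using npos_set(1)[OF assms(1)] assms by (intro Max_ge) auto

lemma npos_attained:
  assumes "phase.subspace V"
  obtains W where "phase.subspace W" "W \<subseteq> V" "pos_on q W" "phase.dim W = npos q V"
proof -
  have "npos q V \<in> {phase.dim W | W. phase.subspace W \<and> W \<subseteq> V \<and> pos_on q W}"
    unfolding npos_def by (rule Max_in[OF npos_set[OF assms]])
  then show ?thesis using that by auto
qed

lemma dim_add_le_of_Int_trivial:
  assumes "phase.subspace W" "phase.subspace Q" "W \<subseteq> V" "Q \<subseteq> V" "phase.subspace V" "W \<inter> Q \<subseteq> {0}"
  shows "phase.dim W + phase.dim Q \<le> phase.dim V"
proof -
  have "W \<inter> Q = {0}" using assms phase.subspace_0 by blast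
  moreover have "{x + y |x y. x \<in> W \<and> y \<in> Q} \<subseteq> V"
    using assms phase.subspace_add by blast
  ultimately show ?thesis
    using phasefd.dim_sums_Int[OF assms(1,2)] phasefd.dim_subset[of "{x + y |x y. x \<in> W \<and> y \<in> Q}" V]
    by simp
qed

text \<open>A positive definite subspace meets \<open>Q\<close> only in zero, so the two dimensions
  add up to at most that of \<open>V\<close>.\<close>

lemma npos_le:
  assumes "phase.subspace V" "phase.subspace Q" "Q \<subseteq> V" "\<And>u. u \<in> Q \<Longrightarrow> Re (q u u) \<le> 0"
  shows "npos q V + phase.dim Q \<le> phase.dim V"
proof -
  obtain W where W: "phase.subspace W" "W \<subseteq> V" "pos_on q W" "phase.dim W = npos q V"
    using npos_attained[OF assms(1)] .
  have "u = 0" if "u \<in> W" "u \<in> Q" for u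
    using W(3) assms(4)[OF that(2)] that(1) unfolding pos_on_def by force
  then have "W \<inter> Q \<subseteq> {0}" by blast
  then show ?thesis using dim_add_le_of_Int_trivial[OF W(1) assms(2) W(2) assms(3,1)] W(4) by simp
qed

lemma npos_le_dim:
  assumes "phase.subspace V" shows "npos q V \<le> phase.dim V"
proof -
  obtain W where "W \<subseteq> V" "phase.dim W = npos q V" by (rule npos_attained[OF assms, of q])
  then show ?thesis using phasefd.dim_subset[of W V] by simp
qed

lemma npos_eqI:
  assumes "phase.subspace V" "phase.subspace P" "P \<subseteq> V" "pos_on q P"
    "phase.subspace Q" "Q \<subseteq> V" "\<And>u. u \<in> Q \<Longrightarrow> Re (q u u) \<le> 0" "phase.dim P + phase.dim Q = phase.dim V"
  shows "npos q V = phase.dim P"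
  using npos_ge[OF assms(1-4)] npos_le[OF assms(1,5,6), of q] assms(7,8) by simp

text \<open>Take \<open>P\<close> of maximal dimension and \<open>Q\<close> as its orthogonal
  complement. A vector of \<open>Q\<close> with positive value could be adjoined to
  \<open>P\<close>, against maximality; hence \<open>Q\<close> is non-positive.\<close>

lemma inertia_decomposition:
  assumes V: "phase.subspace V" and q: "herm_form V q"
  obtains P Q where "phase.subspace P" "P \<subseteq> V" "pos_on q P" "phase.dim P = npos q V"
    "phase.subspace Q" "Q \<subseteq> V" "\<forall>u\<in>Q. Re (q u u) \<le> 0" "\<forall>u\<in>P. \<forall>v\<in>Q. q u v = 0"
    "{x + y |x y. x \<in> P \<and> y \<in> Q} = V" "phase.dim P + phase.dim Q = phase.dim V"
proof -
  obtain P where P: "phase.subspace P" "P \<subseteq> V" "pos_on q P" "phase.dim P = npos q V"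
    using npos_attained[OF V] .
  define Q where "Q = {v\<in>V. \<forall>u\<in>P. q u v = 0}"
  note D = pos_orth_decomposition[OF V q P(1-3), folded Q_def]
  have sQ: "phase.subspace Q" unfolding Q_def by (rule subspace_orth[OF V q P(2)])
  have "Re (q v v) \<le> 0" if v: "v \<in> Q" for v
  proof (rule ccontr)
    assume n: "\<not> Re (q v v) \<le> 0"
    define R where "R = {x + y |x y. x \<in> P \<and> y \<in> phase.span {v}}"
    have spv: "phase.span {v} \<subseteq> Q" using sQ v by (simp add: phase.span_minimal)
    have v0: "v \<noteq> 0" using n herm_zero[OF V q, of 0] phase.subspace_0[OF V] by auto
    have RV: "R \<subseteq> V" unfolding R_def using D(1) spv by blast
    have sR: "phase.subspace R" unfolding R_def by (rule phase.subspace_sums[OF P(1) phase.subspace_span])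
    have "pos_on q R"
      unfolding pos_on_def
    proof (intro ballI impI)
      fix r assume r: "r \<in> R" "r \<noteq> 0"
      then obtain x c where x: "x \<in> P" "r = x + pscale c v"
        unfolding R_def phase.span_singleton by blast
      have xV: "x \<in> V" and vV: "v \<in> V" "pscale c v \<in> V" using x P v V by (auto simp: Q_def phase.subspace_scale)
      have "q x (pscale c v) = 0" using herm_scale_right[OF V q xV vV(1)] v x by (simp add: Q_def)
      then have eq: "Re (q r r) = Re (q x x) + (cmod c)\<^sup>2 * Re (q v v)"
        unfolding x(2) using herm_quad_add[OF V q xV vV(2)] herm_quad_scale[OF V q vV(1)] by simp
      show "Re (q r r) > 0"
      proof (cases "x = 0")
        case True
        then have "c \<noteq> 0" using r x by auto
        then show ?thesis using n eq True herm_zero[OF V q, of 0] phase.subspace_0[OF V] by simp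
      next
        case False
        then have "Re (q x x) > 0" using P(3) x by (auto simp: pos_on_def)
        moreover have "(cmod c)\<^sup>2 * Re (q v v) \<ge> 0" using n by simp
        ultimately show ?thesis using eq by linarith
      qed
    qed
    then have "phase.dim R \<le> npos q V" by (rule npos_ge[OF V sR RV])
    moreover have "phase.dim R = phase.dim P + 1"
    proof -
      have "P \<inter> phase.span {v} = {0}" using D(2) spv phase.span_zero phase.subspace_0[OF P(1)] by blast
      then show ?thesis
        using phasefd.dim_sums_Int[OF P(1) phase.subspace_span, of "{v}"] v0 unfolding R_def by simp
    qed
    ultimately show False using P(4) by simp
  qed
  then show ?thesis
    using that[of P Q] P sQ D Q_def by blast
qed

text \<open>The inertia decompositions of the two summands are added: by orthogonality the quadratic
  form splits, so the sum of the positive parts is positive and the sum of the non-positive parts is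
  non-positive.\<close>

lemma npos_orth_sum:
  assumes V: "phase.subspace V" and q: "herm_form V q"
    and V1: "phase.subspace V1" and V2: "phase.subspace V2" and Vsum: "{x + y |x y. x \<in> V1 \<and> y \<in> V2} = V"
    and orth: "\<And>u v. u \<in> V1 \<Longrightarrow> v \<in> V2 \<Longrightarrow> q u v = 0" and triv: "V1 \<inter> V2 \<subseteq> {0}"
  shows "npos q V = npos q V1 + npos q V2"
proof -
  have sub: "V1 \<subseteq> V" "V2 \<subseteq> V"
  proof -
    have "v \<in> V" if "v \<in> V1" for v
      unfolding Vsum[symmetric] using that phase.subspace_0[OF V2] by (intro CollectI exI[of _ v] exI[of _ 0]) simp
    moreover have "v \<in> V" if "v \<in> V2" for v
      unfolding Vsum[symmetric] using that phase.subspace_0[OF V1] by (intro CollectI exI[of _ 0] exI[of _ v]) simp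
    ultimately show "V1 \<subseteq> V" "V2 \<subseteq> V" by blast+
  qed
  obtain P1 Q1 where 1: "phase.subspace P1" "P1 \<subseteq> V1" "pos_on q P1" "phase.dim P1 = npos q V1"
    "phase.subspace Q1" "Q1 \<subseteq> V1" "\<forall>u\<in>Q1. Re (q u u) \<le> 0" "\<forall>u\<in>P1. \<forall>v\<in>Q1. q u v = 0"
    "{x + y |x y. x \<in> P1 \<and> y \<in> Q1} = V1" "phase.dim P1 + phase.dim Q1 = phase.dim V1"
    by (rule inertia_decomposition[OF V1 herm_form_subset[OF q sub(1)]])
  obtain P2 Q2 where 2: "phase.subspace P2" "P2 \<subseteq> V2" "pos_on q P2" "phase.dim P2 = npos q V2"
    "phase.subspace Q2" "Q2 \<subseteq> V2" "\<forall>u\<in>Q2. Re (q u u) \<le> 0" "\<forall>u\<in>P2. \<forall>v\<in>Q2. q u v = 0"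
    "{x + y |x y. x \<in> P2 \<and> y \<in> Q2} = V2" "phase.dim P2 + phase.dim Q2 = phase.dim V2"
    by (rule inertia_decomposition[OF V2 herm_form_subset[OF q sub(2)]])
  define P where "P = {x + y |x y. x \<in> P1 \<and> y \<in> P2}"
  define Q where "Q = {x + y |x y. x \<in> Q1 \<and> y \<in> Q2}"
  have dimsum: "phase.dim {x + y |x y. x \<in> A \<and> y \<in> B} = phase.dim A + phase.dim B"
    if "phase.subspace A" "phase.subspace B" "A \<subseteq> V1" "B \<subseteq> V2" for A B
  proof -
    have "A \<inter> B = {0}" using that triv phase.subspace_0 by blast
    then show ?thesis using phasefd.dim_sums_Int[OF that(1,2)] by simp
  qed
  have quad: "Re (q (x + y) (x + y)) = Re (q x x) + Re (q y y)" if "x \<in> V1" "y \<in> V2" for x y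
    using herm_quad_add[OF V q, of x y] that sub orth by auto
  have "npos q V = phase.dim P"
  proof (rule npos_eqI[OF V])
    show "phase.subspace P" "phase.subspace Q"
      unfolding P_def Q_def by (rule phase.subspace_sums[OF 1(1) 2(1)] phase.subspace_sums[OF 1(5) 2(5)])+
    show "P \<subseteq> V" unfolding P_def Vsum[symmetric] using 1(2) 2(2) by blast
    show "Q \<subseteq> V" unfolding Q_def Vsum[symmetric] using 1(6) 2(6) by blast
    show "pos_on q P"
      unfolding pos_on_def
    proof (intro ballI impI)
      fix z assume z: "z \<in> P" "z \<noteq> 0"
      then obtain x y where xy: "x \<in> P1" "y \<in> P2" "x + y \<noteq> 0" and zxy: "z = x + y"
        unfolding P_def by blast
      have nn: "Re (q u u) \<ge> 0" if "u \<in> P1 \<or> u \<in> P2" for u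
      proof (cases "u = 0")
        case True then show ?thesis using herm_zero[OF V q phase.subspace_0[OF V]] by simp
      next
        case False then show ?thesis
          using bspec[OF 1(3)[unfolded pos_on_def], of u] bspec[OF 2(3)[unfolded pos_on_def], of u] that by auto
      qed
      have "Re (q x x) > 0 \<or> Re (q y y) > 0"
        using xy bspec[OF 1(3)[unfolded pos_on_def], of x] bspec[OF 2(3)[unfolded pos_on_def], of y]
        by (cases "x = 0") auto
      moreover have "x \<in> V1" "y \<in> V2" using xy 1(2) 2(2) by auto
      ultimately show "Re (q z z) > 0"
        using quad[of x y] nn[of x] nn[of y] xy(1,2) unfolding zxy by linarith
    qed
    show "Re (q u u) \<le> 0" if u: "u \<in> Q" for u
    proof -
      obtain x y where "u = x + y" "x \<in> Q1" "y \<in> Q2" using u unfolding Q_def by blast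
      moreover from this have "x \<in> V1" "y \<in> V2" using 1(6) 2(6) by auto
      ultimately show ?thesis using quad[of x y] bspec[OF 1(7), of x] bspec[OF 2(7), of y] by simp
    qed
    show "phase.dim P + phase.dim Q = phase.dim V"
      unfolding P_def Q_def Vsum[symmetric]
      using dimsum[OF 1(1) 2(1) 1(2) 2(2)] dimsum[OF 1(5) 2(5) 1(6) 2(6)]
        dimsum[OF V1 V2] 1(10) 2(10) by simp
  qed
  also have "\<dots> = npos q V1 + npos q V2" unfolding P_def using dimsum[OF 1(1) 2(1) 1(2) 2(2)] 1(4) 2(4) by simp
  finally show ?thesis .
qed

text \<open>Splitting off a positive part and then, from the non-positive rest, a negative part
  leaves a subspace on which the form is both non-positive and non-negative. By polarization it
  vanishes there, so this rest lies in the radical.\<close>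

lemma dim_le_inertia_plus_radical:
  assumes V: "phase.subspace V" and q: "herm_form V q"
  shows "phase.dim V \<le> npos q V + nneg q V + phase.dim {v\<in>V. \<forall>u\<in>V. q u v = 0}"
proof -
  obtain P Q where PQ: "phase.subspace P" "P \<subseteq> V" "pos_on q P" "phase.dim P = npos q V"
    "phase.subspace Q" "Q \<subseteq> V" "\<forall>u\<in>Q. Re (q u u) \<le> 0" "\<forall>u\<in>P. \<forall>v\<in>Q. q u v = 0"
    "{x + y |x y. x \<in> P \<and> y \<in> Q} = V" "phase.dim P + phase.dim Q = phase.dim V"
    by (rule inertia_decomposition[OF V q])
  have q': "herm_form Q (\<lambda>u v. - q u v)"
    using herm_form_uminus[OF herm_form_subset[OF q PQ(6)]] .
  obtain P' Q' where PQ': "phase.subspace P'" "P' \<subseteq> Q" "pos_on (\<lambda>u v. - q u v) P'" "phase.dim P' = npos (\<lambda>u v. - q u v) Q"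
    "phase.subspace Q'" "Q' \<subseteq> Q" "\<forall>u\<in>Q'. Re (- q u u) \<le> 0" "\<forall>u\<in>P'. \<forall>v\<in>Q'. - q u v = 0"
    "{x + y |x y. x \<in> P' \<and> y \<in> Q'} = Q" "phase.dim P' + phase.dim Q' = phase.dim Q"
    by (rule inertia_decomposition[OF PQ(5) q'])
  have "Q' \<subseteq> V" using PQ'(6) PQ(6) by blast
  have z: "q u v = 0" if "u \<in> Q'" "v \<in> Q'" for u v
  proof (rule herm_isotropic_zero[OF V q PQ'(5) \<open>Q' \<subseteq> V\<close> _ that])
    fix u assume "u \<in> Q'"
    then show "Re (q u u) = 0" using bspec[OF PQ(7), of u] subsetD[OF PQ'(6), of u] bspec[OF PQ'(7), of u] by simp
  qed
  have "Q' \<subseteq> {v\<in>V. \<forall>u\<in>V. q u v = 0}"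
  proof (intro subsetI CollectI)
    fix v assume v: "v \<in> Q'"
    then have vV: "v \<in> V" "v \<in> Q" using PQ'(6) PQ(6) by auto
    have "q u v = 0" if u: "u \<in> V" for u
    proof -
      obtain x y where xy: "x \<in> P" "y \<in> Q" "u = x + y" using u PQ(9) by blast
      obtain a b where ab: "a \<in> P'" "b \<in> Q'" "y = a + b" using xy PQ'(9) by blast
      have mem: "x \<in> V" "a \<in> V" "b \<in> V" "y \<in> V" using xy ab PQ(2,6) PQ'(2,6) by auto
      have "q u v = q x v + (q a v + q b v)"
        unfolding xy(3) ab(3) using mem vV phase.subspace_add[OF V] by (simp add: herm_add_left[OF V q])
      then show ?thesis using PQ(8) xy(1) vV(2) PQ'(8) ab(1) v z[OF ab(2) v] by simp
    qed
    then show "v \<in> V \<and> (\<forall>u\<in>V. q u v = 0)" using vV by blast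
  qed
  then have "phase.dim Q' \<le> phase.dim {v\<in>V. \<forall>u\<in>V. q u v = 0}" by (rule phasefd.dim_subset)
  moreover have "phase.dim P' \<le> nneg q V"
    using npos_ge[OF V PQ'(1) _ PQ'(3)] PQ'(2) PQ(6) by blast
  ultimately show ?thesis using PQ(4,10) PQ'(10) by linarith
qed

lemma npos_cong:
  assumes "\<And>u. u \<in> V \<Longrightarrow> q u u = r u u"
  shows "npos q V = npos r V"
proof -
  have "pos_on q W = pos_on r W" if "W \<subseteq> V" for W
    using that assms unfolding pos_on_def by (metis subsetD)
  then have "{phase.dim W | W. phase.subspace W \<and> W \<subseteq> V \<and> pos_on q W} =
    {phase.dim W | W. phase.subspace W \<and> W \<subseteq> V \<and> pos_on r W}" by blast
  then show ?thesis unfolding npos_def by simp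
qed

lemma npos_image:
  fixes T :: "'n phase \<Rightarrow> 'n::finite phase"
  assumes V: "phase.subspace V" and T: "Vector_Spaces.linear pscale pscale T" and inj: "inj_on T V"
  shows "npos q (T ` V) = npos (\<lambda>u v. q (T u) (T v)) V"
proof (rule antisym)
  interpret T: Vector_Spaces.linear pscale pscale T by (rule T)
  have sTV: "phase.subspace (T ` V)" by (rule T.subspace_image[OF V])
  have dimT: "phase.dim (T ` W) = phase.dim W" if "phase.subspace W" "W \<subseteq> V" for W
    by (rule phasepair.dim_image_eq[OF T])
      (metis that inj inj_on_subset phase.span_eq_iff)
  have T0: "T u = 0 \<longleftrightarrow> u = 0" if "u \<in> V" for u
    using inj that phase.subspace_0[OF V] T.zero by (metis inj_onD)
  {
    obtain W where W: "phase.subspace W" "W \<subseteq> T ` V" "pos_on q W" "phase.dim W = npos q (T ` V)"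
      using npos_attained[OF sTV] .
    define W' where "W' = V \<inter> T -` W"
    have sW': "phase.subspace W'" unfolding W'_def
      by (intro phase.subspace_inter V T.subspace_vimage W)
    have "T ` W' = W" using W(2) by (auto simp: W'_def)
    then have "phase.dim W' = npos q (T ` V)" using dimT[OF sW'] W by (simp add: W'_def)
    moreover have "pos_on (\<lambda>u v. q (T u) (T v)) W'"
      using W(3) T0 by (auto simp: pos_on_def W'_def)
    ultimately show "npos q (T ` V) \<le> npos (\<lambda>u v. q (T u) (T v)) V"
      using npos_ge[OF V sW' _, of "\<lambda>u v. q (T u) (T v)"] by (simp add: W'_def)
  }
  {
    obtain W where W: "phase.subspace W" "W \<subseteq> V" "pos_on (\<lambda>u v. q (T u) (T v)) W"
        "phase.dim W = npos (\<lambda>u v. q (T u) (T v)) V"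
      using npos_attained[OF V] .
    have "pos_on q (T ` W)" using W(3) T.zero by (auto simp: pos_on_def)
    then show "npos (\<lambda>u v. q (T u) (T v)) V \<le> npos q (T ` V)"
      using npos_ge[OF sTV T.subspace_image[OF W(1)] image_mono[OF W(2)]] W(4) dimT[OF W(1,2)] by simp
  }
qed

text \<open>Points of phase space are pairs; with the default rules the simplifier would split every
  quantifier over them.\<close>

declare split_paired_All [simp del] split_paired_Ex [simp del]

subsection \<open>The spectral theorem\<close>

lemma scaleR_eq_pscale: "r *\<^sub>R v = pscale (of_real r) (v :: 'n::finite phase)"
  by (simp add: prod_eq_iff vec_eq_iff) (simp add: scaleR_conv_of_real)

lemma real_subspace_phase: "phase.subspace V \<Longrightarrow> subspace V"
  unfolding subspace_def by (simp add: phase.subspace_0 phase.subspace_add phase.subspace_scale scaleR_eq_pscale)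

lemma closed_phase_subspace: "phase.subspace V \<Longrightarrow> closed (V :: 'n::finite phase set)"
  by (rule closed_subspace[OF real_subspace_phase])

lemma phase_linear_iff:
  "Vector_Spaces.linear pscale pscale (T :: 'n::finite phase \<Rightarrow> 'm::finite phase) \<longleftrightarrow>
     (\<forall>x y. T (x + y) = T x + T y) \<and> (\<forall>c x. T (pscale c x) = pscale c (T x))"
  by (simp add: Vector_Spaces.linear_iff phase.vector_space_axioms)

lemma phase_linear_imp_linear:
  assumes "Vector_Spaces.linear pscale pscale (T :: 'n::finite phase \<Rightarrow> 'm::finite phase)"
  shows "linear T" "bounded_linear T"
proof -
  show "linear T"
    using assms unfolding phase_linear_iff by (intro linearI) (simp_all add: scaleR_eq_pscale)
  then show "bounded_linear T" by (simp add: linear_conv_bounded_linear)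
qed

lemma phase_projection:
  assumes "phase.subspace V"
  obtains \<pi> where "Vector_Spaces.linear pscale pscale \<pi>" "\<forall>v\<in>V. \<pi> v = v" "range \<pi> = V"
proof -
  obtain B where B: "phase.independent B" "phase.span B = V"
    using phasefd.basis_subspace_exists[OF assms] by metis
  obtain \<pi> where p: "Vector_Spaces.linear pscale pscale \<pi>" "\<forall>x\<in>B. \<pi> x = id x" "range \<pi> = phase.span (id ` B)"
    using phasepair.linear_independent_extend_subspace[OF B(1), of id] by blast
  have "\<forall>v\<in>V. \<pi> v = v"
  proof
    fix v assume "v \<in> V"
    then show "\<pi> v = v"
    using phasepair.linear_eq_on[OF p(1) phase.linear_ident, of v B] p(2) B(2) by simp
  qed
  then show ?thesis using that[OF p(1)] p(3) B(2) by simp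
qed

text \<open>Nothing is known about \<open>q\<close> off \<open>V\<close>. Composition with a linear
  projection onto \<open>V\<close> gives a real bilinear map on the whole space, which is bounded
  because the dimension is finite.\<close>

lemma herm_form_continuous:
  assumes V: "phase.subspace V" and q: "herm_form V q"
  shows "continuous_on V (\<lambda>u. q u u)"
proof -
  obtain \<pi> where p: "Vector_Spaces.linear pscale pscale \<pi>" "\<forall>v\<in>V. \<pi> v = v" "range \<pi> = V"
    by (rule phase_projection[OF V])
  interpret p: Vector_Spaces.linear pscale pscale \<pi> by (rule p(1))
  define r where "r = (\<lambda>u v. q (\<pi> u) (\<pi> v))"
  have pV: "\<pi> v \<in> V" for v using p(3) by blast
  have "bilinear r"
    unfolding bilinear_def
  proof (intro conjI allI linearI)
    fix x y z c
    show "r x (y + z) = r x y + r x z"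
      by (simp add: r_def p.add herm_add_right[OF V q] pV)
    show "r (y + z) x = r y x + r z x"
      by (simp add: r_def p.add herm_add_left[OF V q] pV)
    show "r x (c *\<^sub>R y) = c *\<^sub>R r x y"
      by (simp add: r_def scaleR_eq_pscale p.scale herm_scale_right[OF V q] pV scaleR_conv_of_real)
    show "r (c *\<^sub>R y) x = c *\<^sub>R r y x"
      by (simp add: r_def scaleR_eq_pscale p.scale herm_scale_left[OF V q] pV scaleR_conv_of_real)
  qed
  then have "bounded_bilinear r" by (simp add: bilinear_conv_bounded_bilinear)
  then have "continuous_on V (\<lambda>u. r u u)"
    by (rule bounded_bilinear.continuous_on[OF _ continuous_on_id continuous_on_id])
  then show ?thesis by (rule continuous_on_eq) (simp add: r_def p(2))
qed

lemma herm_form_pdot: "herm_form V pdot"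
  unfolding herm_form_def by (simp add: pdot_add_right pdot_scale_right cnj_pdot)

lemma pos_on_pdot: "pos_on pdot V"
  unfolding pos_on_def by (simp add: pdot_self)

text \<open>With \<nu> the maximum of the quadratic form on the unit sphere, the form
  \<open>r\<close> is positive semidefinite and vanishes at the maximizer \<open>v\<close>. A null
  vector of a semidefinite form is in its radical, and this is the eigenvector equation.\<close>

lemma Rayleigh_maximizer:
  assumes V: "phase.subspace V" "V \<noteq> {0}" and q: "herm_form V q"
  obtains \<nu> v where "v \<in> V" "v \<noteq> 0" "\<And>u. u \<in> V \<Longrightarrow> q u v = of_real \<nu> * pdot u v"
proof -
  define S where "S = V \<inter> sphere 0 1"
  have cS: "compact S" unfolding S_def by (simp add: closed_Int_compact closed_phase_subspace V(1))
  obtain w where w: "w \<in> V" "w \<noteq> 0" using V phase.subspace_0[OF V(1)] by blast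
  have "(1 / norm w) *\<^sub>R w \<in> V"
    unfolding scaleR_eq_pscale by (rule phase.subspace_scale[OF V(1) w(1)])
  then have "(1 / norm w) *\<^sub>R w \<in> S" using w(2) by (simp add: S_def)
  then have "S \<noteq> {}" by blast
  have cont: "continuous_on S (\<lambda>u. Re (q u u))"
    by (intro continuous_on_Re continuous_on_subset[OF herm_form_continuous[OF V(1) q]]) (simp add: S_def)
  obtain v where v: "v \<in> S" "\<And>u. u \<in> S \<Longrightarrow> Re (q u u) \<le> Re (q v v)"
    using continuous_attains_sup[OF cS \<open>S \<noteq> {}\<close> cont] by blast
  define \<nu> where "\<nu> = Re (q v v)"
  have vV: "v \<in> V" "norm v = 1" using v(1) by (simp_all add: S_def)
  define r where "r = (\<lambda>u w. of_real \<nu> * pdot u w - q u w)"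
  have r: "herm_form V r"
    unfolding herm_form_def
  proof (intro conjI ballI allI)
    fix u v w c assume m: "u \<in> V" "v \<in> V"
    show "r u (pscale c v) = c * r u v"
      by (simp add: r_def herm_scale_right[OF V(1) q m] pdot_scale_right algebra_simps)
    show "r v u = cnj (r u v)"
      by (simp add: r_def herm_cnj[OF V(1) q m] cnj_pdot)
    assume "w \<in> V"
    then show "r u (v + w) = r u v + r u w"
      by (simp add: r_def herm_add_right[OF V(1) q m] pdot_add_right algebra_simps)
  qed
  have "Re (r u u) \<ge> 0" if u: "u \<in> V" for u
  proof (cases "u = 0")
    case True then show ?thesis using herm_zero[OF V(1) r u] by simp
  next
    case False
    define u' where "u' = pscale (of_real (1 / norm u)) u"
    have "u' \<in> V" unfolding u'_def by (rule phase.subspace_scale[OF V(1) u])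
    moreover have "norm u' = 1" unfolding u'_def scaleR_eq_pscale[symmetric] using False by simp
    ultimately have "Re (q u' u') \<le> \<nu>" using v(2)[of u'] by (simp add: S_def \<nu>_def)
    moreover have "Re (q u' u') = (1 / norm u)\<^sup>2 * Re (q u u)"
      unfolding u'_def using herm_quad_scale[OF V(1) q u, of "of_real (1 / norm u)"] by (simp add: norm_divide)
    ultimately have "Re (q u u) \<le> \<nu> * (norm u)\<^sup>2"
      using False by (simp add: field_simps)
    then show ?thesis by (simp add: r_def pdot_self)
  qed
  moreover have "Re (r v v) = 0" using vV by (simp add: r_def pdot_self \<nu>_def)
  ultimately have "r u v = 0" if "u \<in> V" for u
    using herm_semidefinite_null[OF V(1) r V(1) subset_refl _ that vV(1)] by blast
  then have "q u v = of_real \<nu> * pdot u v" if "u \<in> V" for u using that by (simp add: r_def)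
  moreover have "v \<noteq> 0" using vV by auto
  ultimately show ?thesis using that vV(1) by blast
qed

lemma subspace_form_eigenspace:
  assumes V: "phase.subspace V" and q: "herm_form V q"
  shows "phase.subspace (form_eigenspace q V \<mu>)"
proof (rule phase.subspaceI)
  show "0 \<in> form_eigenspace q V \<mu>"
    using phase.subspace_0[OF V] by (simp add: form_eigenspace_def herm_zero[OF V q])
  show "x + y \<in> form_eigenspace q V \<mu>" if "x \<in> form_eigenspace q V \<mu>" "y \<in> form_eigenspace q V \<mu>" for x y
    using that phase.subspace_add[OF V]
    by (simp add: form_eigenspace_def herm_add_right[OF V q] pdot_add_right algebra_simps)
  show "pscale c x \<in> form_eigenspace q V \<mu>" if "x \<in> form_eigenspace q V \<mu>" for c x
    using that phase.subspace_scale[OF V]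
    by (simp add: form_eigenspace_def herm_scale_right[OF V q] pdot_scale_right algebra_simps)
qed

text \<open>Spectral theorem by induction on the dimension, splitting off one eigenspace at a time.
  Finiteness of the spectrum is carried along because the eigenvalue count is a sum that would
  collapse to zero over an infinite index set.\<close>

lemma form_n_pos_eq_npos_aux:
  assumes "phase.subspace V" "herm_form V q"
  shows "finite {\<mu>. form_eigenspace q V \<mu> \<noteq> {0}} \<and> form_n_pos q V = npos q V"
  using assms
proof (induction "phase.dim V" arbitrary: V rule: less_induct)
  case less
  note V = less.prems(1) and q = less.prems(2)
  show ?case
  proof (cases "V = {0}")
    case True
    have "form_eigenspace q V \<mu> = {0}" for \<mu>
      using phase.subspace_0[OF subspace_form_eigenspace[OF V q, of \<mu>]] True
      unfolding form_eigenspace_def by blast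
    moreover have "npos q V = 0" using npos_le_dim[OF V, of q] True by simp
    ultimately show ?thesis by (simp add: form_n_pos_def)
  next
    case False
    obtain \<nu> v where v: "v \<in> V" "v \<noteq> 0" "\<And>u. u \<in> V \<Longrightarrow> q u v = of_real \<nu> * pdot u v"
      using Rayleigh_maximizer[OF V False q] by blast
    \<comment> \<open>The entire eigenspace is removed, not only the line through \<open>v\<close>:
      then \<nu> disappears from the spectrum of the complement and all other eigenspaces stay the
      same.\<close>
    define E where "E = form_eigenspace q V \<nu>"
    define V' where "V' = {v\<in>V. \<forall>u\<in>E. pdot u v = 0}"
    have sE: "phase.subspace E" unfolding E_def by (rule subspace_form_eigenspace[OF V q])
    have EV: "E \<subseteq> V" unfolding E_def form_eigenspace_def by blast
    have sV': "phase.subspace V'" unfolding V'_def by (rule subspace_orth[OF V herm_form_pdot EV])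
    have V'V: "V' \<subseteq> V" unfolding V'_def by blast
    have q': "herm_form V' q" by (rule herm_form_subset[OF q V'V])
    note D = pos_orth_decomposition[OF V herm_form_pdot sE EV pos_on_pdot, folded V'_def]
    have vE: "v \<in> E" using v by (simp add: E_def form_eigenspace_def)
    then have En: "E \<noteq> {0}" using v(2) by blast
    have "\<not> E \<subseteq> {0}" using vE v(2) by blast
    then have dE: "phase.dim E > 0" using phasefd.dim_eq_0[of E] by linarith
    have orth: "q u w = 0" if "u \<in> E" "w \<in> V'" for u w
    proof -
      have "q w u = of_real \<nu> * pdot w u" using that V'V unfolding E_def form_eigenspace_def by blast
      moreover have "pdot w u = 0" using that cnj_pdot[of u w] by (simp add: V'_def)
      moreover have "w \<in> V" "u \<in> V" using that EV V'V by blast+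
      ultimately show ?thesis using herm_cnj[OF V q, of w u] by simp
    qed
    have sup: "form_eigenspace q V' \<mu> \<subseteq> form_eigenspace q V \<mu>" for \<mu>
    proof
      fix x assume x: "x \<in> form_eigenspace q V' \<mu>"
      then have xV': "x \<in> V'" by (simp add: form_eigenspace_def)
      have "q w x = of_real \<mu> * pdot w x" if "w \<in> V" for w
      proof -
        obtain e w' where ew: "e \<in> E" "w' \<in> V'" "w = e + w'" using D(1) \<open>w \<in> V\<close> by blast
        have "q w x = q e x + q w' x"
          unfolding ew(3) using ew xV' EV V'V by (intro herm_add_left[OF V q]) auto
        moreover have "q w' x = of_real \<mu> * pdot w' x" using x ew by (simp add: form_eigenspace_def)
        moreover have "pdot e x = 0" using xV' ew by (simp add: V'_def)
        ultimately show ?thesis using orth[OF ew(1) xV'] ew(3) by (simp add: pdot_add_left)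
      qed
      then show "x \<in> form_eigenspace q V \<mu>" using xV' V'V by (auto simp: form_eigenspace_def)
    qed
    \<comment> \<open>Eigenvectors for different eigenvalues are orthogonal, so those for
      \<open>\<mu> \<noteq> \<nu>\<close> already lie in the complement of \<open>E\<close>.\<close>
    have sub: "form_eigenspace q V \<mu> \<subseteq> form_eigenspace q V' \<mu>" if "\<mu> \<noteq> \<nu>" for \<mu>
    proof
      fix x assume x: "x \<in> form_eigenspace q V \<mu>"
      then have xV: "x \<in> V" by (simp add: form_eigenspace_def)
      have "pdot u x = 0" if u: "u \<in> E" for u
      proof -
        have uV: "u \<in> V" using u EV by auto
        have 1: "q u x = of_real \<mu> * pdot u x" using x uV by (simp add: form_eigenspace_def)
        have "q x u = of_real \<nu> * pdot x u" using u xV by (simp add: E_def form_eigenspace_def)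
        then have 2: "q u x = of_real \<nu> * pdot u x"
          using herm_cnj[OF V q xV uV] by (simp add: cnj_pdot)
        have "(of_real \<mu> - of_real \<nu>) * pdot u x = 0" by (simp only: left_diff_distrib 1[symmetric] 2[symmetric] diff_self)
        then show ?thesis using \<open>\<mu> \<noteq> \<nu>\<close> by (simp only: mult_eq_0_iff right_minus_eq of_real_eq_iff) simp
      qed
      then have "x \<in> V'" using xV by (simp add: V'_def)
      then show "x \<in> form_eigenspace q V' \<mu>" using x V'V by (auto simp: form_eigenspace_def)
    qed
    have eq: "form_eigenspace q V \<mu> = form_eigenspace q V' \<mu>" if "\<mu> \<noteq> \<nu>" for \<mu>
      using sub[OF that] sup[of \<mu>] by blast
    have "form_eigenspace q V' \<nu> \<subseteq> E \<inter> V'" using sup[of \<nu>] by (auto simp: E_def form_eigenspace_def)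
    then have l0: "form_eigenspace q V' \<nu> = {0}"
      using phase.subspace_0[OF subspace_form_eigenspace[OF sV' q', of \<nu>]] unfolding D(2) by blast
    have "phase.dim V' < phase.dim V" using D(3) dE by linarith
    then have IH: "finite {\<mu>. form_eigenspace q V' \<mu> \<noteq> {0}}" "form_n_pos q V' = npos q V'"
      using less.hyps[of V'] sV' q' by auto
    have set: "{\<mu>. form_eigenspace q V \<mu> \<noteq> {0}} = insert \<nu> {\<mu>. form_eigenspace q V' \<mu> \<noteq> {0}}"
    proof (rule set_eqI)
      fix \<mu>
      show "\<mu> \<in> {\<mu>. form_eigenspace q V \<mu> \<noteq> {0}} \<longleftrightarrow> \<mu> \<in> insert \<nu> {\<mu>. form_eigenspace q V' \<mu> \<noteq> {0}}"
        using eq[of \<mu>] En l0 unfolding E_def by (cases "\<mu> = \<nu>") simp_all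
    qed
    have fin: "finite {\<mu>. form_eigenspace q V \<mu> \<noteq> {0}}" unfolding set using IH(1) by simp
    have fin': "finite {\<mu>. \<mu> > 0 \<and> form_eigenspace q V' \<mu> \<noteq> {0}}"
      by (rule finite_subset[OF _ IH(1)]) blast
    have npos_eq: "npos q V = npos q E + npos q V'"
      by (rule npos_orth_sum[OF V q sE sV' D(1) orth]) (use D(2) in auto)
    have quadE: "Re (q u u) = \<nu> * (norm u)\<^sup>2" if "u \<in> E" for u
      using that EV by (auto simp: E_def form_eigenspace_def pdot_self)
    have "form_n_pos q V = (if \<nu> > 0 then phase.dim E else 0) + form_n_pos q V'"
    proof (cases "\<nu> > 0")
      case True
      have "{\<mu>. \<mu> > 0 \<and> form_eigenspace q V \<mu> \<noteq> {0}} = insert \<nu> {\<mu>. \<mu> > 0 \<and> form_eigenspace q V' \<mu> \<noteq> {0}}"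
        using set True by (simp add: set_eq_iff) blast
      moreover have "(\<Sum>\<mu> | \<mu> > 0 \<and> form_eigenspace q V' \<mu> \<noteq> {0}. phase.dim (form_eigenspace q V \<mu>)) = form_n_pos q V'"
        unfolding form_n_pos_def
      proof (rule sum.cong[OF refl])
        fix \<mu> assume "\<mu> \<in> {\<mu>. \<mu> > 0 \<and> form_eigenspace q V' \<mu> \<noteq> {0}}"
        then have "\<mu> \<noteq> \<nu>" using l0 by blast
        then show "phase.dim (form_eigenspace q V \<mu>) = phase.dim (form_eigenspace q V' \<mu>)" by (simp add: eq)
      qed
      ultimately show ?thesis using True l0 fin' unfolding form_n_pos_def[of q V] E_def by simp
    next
      case False
      have "{\<mu>. \<mu> > 0 \<and> form_eigenspace q V \<mu> \<noteq> {0}} = {\<mu>. \<mu> > 0 \<and> form_eigenspace q V' \<mu> \<noteq> {0}}"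
        using set False by (simp add: set_eq_iff) blast
      moreover have "\<mu> \<noteq> \<nu>" if "\<mu> > 0" for \<mu> using that False by blast
      ultimately show ?thesis using False eq unfolding form_n_pos_def by simp
    qed
    moreover have "npos q E = (if \<nu> > 0 then phase.dim E else 0)"
    proof (cases "\<nu> > 0")
      case True
      then have "pos_on q E" unfolding pos_on_def by (simp add: quadE)
      then have "phase.dim E \<le> npos q E" by (rule npos_ge[OF sE sE subset_refl])
      then show ?thesis using True npos_le_dim[OF sE, of q] by simp
    next
      case False
      then have "npos q E + phase.dim E \<le> phase.dim E"
        by (intro npos_le[OF sE sE subset_refl]) (simp add: quadE mult_nonpos_nonneg)
      then show ?thesis using False by simp
    qed
    ultimately show ?thesis using fin npos_eq IH(2) by simp
  qed
qed

lemma form_n_pos_eq_npos: "phase.subspace V \<Longrightarrow> herm_form V q \<Longrightarrow> form_n_pos q V = npos q V"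
  using form_n_pos_eq_npos_aux by blast

lemma form_n_neg_eq_nneg:
  assumes "phase.subspace V" "herm_form V q"
  shows "form_n_neg q V = nneg q V"
proof -
  have "form_eigenspace q V \<mu> = form_eigenspace (\<lambda>u v. - q u v) V (- \<mu>)" for \<mu>
    unfolding form_eigenspace_def by (simp add: minus_equation_iff eq_commute)
  then have "form_n_neg q V = form_n_pos (\<lambda>u v. - q u v) V"
    unfolding form_n_neg_def form_n_pos_def
    by (intro sum.reindex_bij_witness[of _ uminus uminus]) auto
  then show ?thesis using form_n_pos_eq_npos[OF assms(1) herm_form_uminus[OF assms(2)]] by simp
qed


subsection \<open>Inertia of Hermitian matrices\<close>

definition mat_form :: "complex ^ 'n ^ 'n \<Rightarrow> 'n phase \<Rightarrow> 'n::finite phase \<Rightarrow> complex" where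
  "mat_form A u v = cdot (fst u) (A *v fst v)"

text \<open>A copy of the vectors of length \<open>n\<close> inside phase space: matrices become
  forms on it, and the theory of forms on subspaces of phase space serves for matrices as
  well.\<close>

definition horiz :: "'n::finite phase set" where
  "horiz = UNIV \<times> {0}"

definition mpos :: "complex ^ 'n ^ 'n \<Rightarrow> nat" where
  "mpos A = npos (mat_form A) horiz"

abbreviation mneg :: "complex ^ 'n ^ 'n \<Rightarrow> nat" where
  "mneg A \<equiv> mpos (- A)"

lemma horiz_iff: "u \<in> horiz \<longleftrightarrow> snd u = 0"
  by (simp add: horiz_def mem_Times_iff)

lemma norm_horiz: "u \<in> horiz \<Longrightarrow> norm u = norm (fst u)"
  by (simp add: horiz_iff norm_prod_def)

lemma subspace_horiz: "phase.subspace horiz"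
  by (rule phase.subspaceI) (simp_all add: horiz_iff)

lemma dim_horiz: "phase.dim (horiz :: 'n::finite phase set) = CARD('n)"
  unfolding horiz_def
  by (subst phase_dim_Times) (simp_all only: vec.subspace_UNIV vec.subspace_single_0 dim_UNIV_cvec, simp)

lemma mat_vec_minus: "(- A) *v x = - (A *v (x :: complex ^ 'n))"
  by (simp add: matrix_vector_mult_def vec_eq_iff sum_negf)

lemma mat_form_uminus: "mat_form (- A) u v = - mat_form A u v"
  by (simp add: mat_form_def mat_vec_minus cdot_minus_right)

lemma herm_mat_form: "hermitian A \<Longrightarrow> herm_form V (mat_form A)"
  unfolding herm_form_def mat_form_def
  by (simp add: cdot_add_right matrix_vector_right_distrib vector_scalar_commute cdot_scale_right
      cnj_cdot hermitian_cdot_iff)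

lemma mneg_eq: "mneg A = nneg (mat_form A) horiz"
  unfolding mpos_def by (rule npos_cong) (simp add: mat_form_uminus)

lemma hermitian_uminus: "hermitian A \<Longrightarrow> hermitian (- A)"
  and hermitian_add: "hermitian A \<Longrightarrow> hermitian B \<Longrightarrow> hermitian (A + B)"
  and hermitian_diff: "hermitian A \<Longrightarrow> hermitian B \<Longrightarrow> hermitian (A - B)"
  and hermitian_scaleR: "hermitian A \<Longrightarrow> hermitian (r *\<^sub>R A)"
  and hermitian_0: "hermitian 0"
  unfolding hermitian_def adj_def by (simp_all add: vec_eq_iff)

lemma mat_n_neg_eq_mneg:
  assumes "hermitian (A :: complex ^ 'a ^ 'a)"
  shows "mat_n_neg A = mneg A"
proof -
  have E: "form_eigenspace (mat_form A) horiz \<mu> = mat_eigenspace A \<mu> \<times> {0}" for \<mu>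
  proof -
    have "(\<forall>u\<in>horiz. mat_form A u v = of_real \<mu> * pdot u v) \<longleftrightarrow> A *v fst v = of_real \<mu> *s fst v"
      if v: "v \<in> horiz" for v
    proof
      assume L: "\<forall>u\<in>horiz. mat_form A u v = of_real \<mu> * pdot u v"
      have "cdot x (A *v fst v - of_real \<mu> *s fst v) = 0" for x
        using bspec[OF L, of "(x, 0)"] v
        by (simp add: horiz_iff mat_form_def pdot_def cdot_diff_right cdot_scale_right)
      then show "A *v fst v = of_real \<mu> *s fst v" using cdot_left_0_imp by fastforce
    qed (use v in \<open>simp add: horiz_iff mat_form_def pdot_def cdot_scale_right\<close>)
    then have "form_eigenspace (mat_form A) horiz \<mu> = {v\<in>horiz. A *v fst v = of_real \<mu> *s fst v}"
      unfolding form_eigenspace_def by blast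
    then show ?thesis
      by (simp add: set_eq_iff horiz_iff mat_eigenspace_def mem_Times_iff conj_commute)
  qed
  have "vec.subspace (mat_eigenspace A \<mu>)" for \<mu>
    unfolding mat_eigenspace_def
    by (rule vec.subspaceI)
      (simp_all add: matrix_vector_right_distrib vector_scalar_commute vector_add_ldistrib
        vector_smult_assoc mult.commute)
  then have dim: "phase.dim (mat_eigenspace A \<mu> \<times> {0}) = vec.dim (mat_eigenspace A \<mu>)" for \<mu>
    by (subst phase_dim_Times) (simp_all only: vec.subspace_single_0, simp)
  have "(mat_eigenspace A \<mu> \<times> {0 :: complex ^ 'a} \<noteq> {0}) = (mat_eigenspace A \<mu> \<noteq> {0})" for \<mu>
  proof -
    have "0 \<in> mat_eigenspace A \<mu>" by (simp add: mat_eigenspace_def)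
    moreover have "mat_eigenspace A \<mu> = fst ` (mat_eigenspace A \<mu> \<times> {0 :: complex ^ 'a})" by force
    moreover have "fst ` {0 :: 'a phase} = {0}" by simp
    moreover have "{0} \<times> {0} = {0 :: 'a phase}" unfolding zero_prod_def by simp
    ultimately show ?thesis by metis
  qed
  then have "form_n_neg (mat_form A) horiz = mat_n_neg A"
    unfolding form_n_neg_def mat_n_neg_def E dim by simp
  then show ?thesis
    using form_n_neg_eq_nneg[OF subspace_horiz herm_mat_form[OF assms]] by (simp add: mneg_eq)
qed

lemma mat_vec_scaleR: "(r *\<^sub>R A) *v x = r *\<^sub>R (A *v (x :: complex ^ 'n))"
  by (simp add: matrix_vector_mult_def vec_eq_iff scaleR_sum_right)

lemma cdot_scaleR_right: "cdot x (r *\<^sub>R y) = of_real r * cdot x y"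
proof -
  have "cdot x (r *\<^sub>R y) = r *\<^sub>R cdot x y" by (simp add: cdot_def scaleR_sum_right)
  then show ?thesis by (simp add: scaleR_conv_of_real)
qed

lemma bounded_bilinear_mat_vec: "bounded_bilinear ((*v) :: complex ^ 'n ^ 'm \<Rightarrow> complex ^ 'n \<Rightarrow> complex ^ 'm)"
proof -
  have "(A :: complex ^ 'n ^ 'm) *v (c *\<^sub>R y) = c *\<^sub>R (A *v y)" for A c y
    by (simp add: matrix_vector_mult_def vec_eq_iff scaleR_sum_right)
  then have "bilinear ((*v) :: complex ^ 'n ^ 'm \<Rightarrow> complex ^ 'n \<Rightarrow> complex ^ 'm)"
    unfolding bilinear_def
    by (intro conjI allI linearI)
      (simp_all add: matrix_vector_right_distrib matrix_vector_mult_add_rdistrib mat_vec_scaleR)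
  then show ?thesis by (simp add: bilinear_conv_bounded_bilinear)
qed

lemma mat_form_add: "mat_form (A + B) u v = mat_form A u v + mat_form B u v"
  and mat_form_diff: "mat_form (A - B) u v = mat_form A u v - mat_form B u v"
  and mat_form_scaleR: "mat_form (r *\<^sub>R A) u v = of_real r * mat_form A u v"
  by (simp_all add: mat_form_def matrix_vector_mult_add_rdistrib matrix_vector_mult_diff_rdistrib
      mat_vec_scaleR cdot_add_right cdot_diff_right cdot_scaleR_right)

lemma mat_form_bound:
  obtains K where "K > 0" "\<forall>(A :: complex ^ 'n ^ 'n) u v. norm (mat_form A u v) \<le> K * norm A * norm u * norm (v :: 'n::finite phase)"
proof -
  obtain K1 where K1: "K1 > 0" "\<forall>(x :: complex ^ 'n) y. norm (cdot x y) \<le> norm x * norm y * K1"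
    using bounded_bilinear.pos_bounded[OF bounded_bilinear_cdot] by blast
  obtain K2 where K2: "K2 > 0" "\<forall>(A :: complex ^ 'n ^ 'n) x. norm (A *v x) \<le> norm A * norm x * K2"
    using bounded_bilinear.pos_bounded[OF bounded_bilinear_mat_vec] by blast
  have "norm (mat_form A u v) \<le> (K1 * K2) * norm A * norm u * norm v" for A and u v :: "'n phase"
  proof -
    have fu: "norm (fst u) \<le> norm u" "norm (fst v) \<le> norm v"
      using norm_fst_le[of "fst u" "snd u"] norm_fst_le[of "fst v" "snd v"] by simp_all
    have "norm (mat_form A u v) \<le> norm (fst u) * norm (A *v fst v) * K1"
      unfolding mat_form_def using K1(2) by blast
    also have "\<dots> \<le> norm u * (norm A * norm v * K2) * K1"
    proof (intro mult_right_mono mult_mono)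
      have "norm (A *v fst v) \<le> norm A * norm (fst v) * K2" using K2(2) by blast
      also have "\<dots> \<le> norm A * norm v * K2" using K2(1) fu by (intro mult_right_mono mult_left_mono) auto
      finally show "norm (A *v fst v) \<le> norm A * norm v * K2" .
    qed (use fu K1 K2 in auto)
    finally show ?thesis by (simp add: algebra_simps)
  qed
  then show ?thesis using that[of "K1 * K2"] K1(1) K2(1) by simp
qed

text \<open>The kernel is placed in \<open>horiz\<close>, where it equals the intersection of
  \<open>graph A\<close> with \<open>graph 0\<close>; a symplectic chart carries it onto the
  intersection of the path with the reference plane.\<close>

definition mker :: "complex ^ 'n ^ 'n \<Rightarrow> 'n::finite phase set" where
  "mker A = {u\<in>horiz. A *v fst u = 0}"

lemma subspace_mker: "phase.subspace (mker A)"
  by (rule phase.subspaceI)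
    (simp_all add: mker_def horiz_iff matrix_vector_right_distrib vector_scalar_commute)

lemma mker_eq_0_iff: "mker A = {0} \<longleftrightarrow> (\<forall>x. A *v x = 0 \<longrightarrow> x = 0)"
proof
  assume L: "mker A = {0}"
  show "\<forall>x. A *v x = 0 \<longrightarrow> x = 0"
  proof (intro allI impI)
    fix x assume "A *v x = 0"
    then have "(x, 0) \<in> mker A" by (simp add: mker_def horiz_iff)
    then show "x = 0" unfolding L by (simp add: zero_prod_def)
  qed
next
  assume R: "\<forall>x. A *v x = 0 \<longrightarrow> x = 0"
  have "u = 0" if "u \<in> mker A" for u
    using that R by (simp add: mker_def horiz_iff prod_eq_iff)
  then show "mker A = {0}" using phase.subspace_0[OF subspace_mker] by blast
qed

lemma radical_mat_form: "{v\<in>horiz. \<forall>u\<in>horiz. mat_form A u v = 0} = mker A"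
proof -
  have "(\<forall>u\<in>horiz. mat_form A u v = 0) \<longleftrightarrow> A *v fst v = 0" for v
  proof
    assume L: "\<forall>u\<in>horiz. mat_form A u v = 0"
    have "cdot x (A *v fst v) = 0" for x
      using bspec[OF L, of "(x, 0)"] by (simp add: horiz_iff mat_form_def)
    then show "A *v fst v = 0" using cdot_left_0_imp by blast
  qed (simp add: mat_form_def)
  then show ?thesis by (simp add: mker_def)
qed

section \<open>Monotonicity, subadditivity and nullity for matrices\<close>

lemma mpos_attained:
  obtains W where "phase.subspace W" "W \<subseteq> horiz" "pos_on (mat_form A) W" "phase.dim W = mpos A"
  unfolding mpos_def by (rule npos_attained[OF subspace_horiz])

lemma mpos_ge:
  "phase.subspace W \<Longrightarrow> W \<subseteq> horiz \<Longrightarrow> pos_on (mat_form A) W \<Longrightarrow> phase.dim W \<le> mpos A"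
  unfolding mpos_def by (rule npos_ge[OF subspace_horiz])

lemma mpos_le:
  fixes A :: "complex ^ 'n ^ 'n"
  assumes "phase.subspace Q" "Q \<subseteq> horiz" "\<And>u. u \<in> Q \<Longrightarrow> Re (mat_form A u u) \<le> 0"
  shows "mpos A + phase.dim Q \<le> CARD('n)"
  unfolding mpos_def dim_horiz[symmetric] by (rule npos_le[OF subspace_horiz assms])

lemma mpos_mono:
  assumes "\<And>x. Re (cdot x (A *v x)) \<le> Re (cdot x (B *v x))"
  shows "mpos A \<le> mpos B"
proof -
  obtain W where W: "phase.subspace W" "W \<subseteq> horiz" "pos_on (mat_form A) W" "phase.dim W = mpos A"
    by (rule mpos_attained)
  have "pos_on (mat_form B) W"
    unfolding pos_on_def
  proof (intro ballI impI)
    fix u assume "u \<in> W" "u \<noteq> 0"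
    then have "Re (mat_form A u u) > 0" using W(3) unfolding pos_on_def by blast
    then show "Re (mat_form B u u) > 0" using assms[of "fst u"] by (simp add: mat_form_def)
  qed
  then show ?thesis using mpos_ge[OF W(1,2)] W(4) by simp
qed

lemma dim_Int_ge:
  assumes "phase.subspace S" "phase.subspace T" "S \<subseteq> V" "T \<subseteq> V" "phase.subspace V"
  shows "phase.dim S + phase.dim T \<le> phase.dim V + phase.dim (S \<inter> T)"
proof -
  have "{x + y |x y. x \<in> S \<and> y \<in> T} \<subseteq> V" using assms(3,4) phase.subspace_add[OF assms(5)] by blast
  then show ?thesis
    using phasefd.dim_sums_Int[OF assms(1,2)] phasefd.dim_subset[of "{x + y |x y. x \<in> S \<and> y \<in> T}" V]
    by simp
qed

lemma mpos_decomposition: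
  assumes "hermitian (A :: complex ^ 'n ^ 'n)"
  obtains Q where "phase.subspace Q" "Q \<subseteq> horiz" "\<forall>u\<in>Q. Re (mat_form A u u) \<le> 0"
    "mpos A + phase.dim Q = CARD('n)"
proof -
  obtain P Q where "phase.subspace P" "P \<subseteq> horiz" "pos_on (mat_form A) P" "phase.dim P = npos (mat_form A) horiz"
    "phase.subspace Q" "Q \<subseteq> horiz" "\<forall>u\<in>Q. Re (mat_form A u u) \<le> 0" "\<forall>u\<in>P. \<forall>v\<in>Q. mat_form A u v = 0"
    "{x + y |x y. x \<in> P \<and> y \<in> Q} = horiz" "phase.dim P + phase.dim Q = phase.dim (horiz :: 'n phase set)"
    by (rule inertia_decomposition[OF subspace_horiz herm_mat_form[OF assms]])
  then show ?thesis using that[of Q] by (simp add: mpos_def dim_horiz)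
qed

text \<open>Non-positive subspaces of complementary dimension for the two matrices intersect in one
  that is non-positive for the sum. Together with \<open>mpos_add_ge\<close> this yields the bounds
  0 and \<open>n\<close> for the triple index.\<close>

lemma mpos_add_le:
  assumes A: "hermitian (A :: complex ^ 'n ^ 'n)" and B: "hermitian B"
  shows "mpos (A + B) \<le> mpos A + mpos B"
proof -
  obtain Q where Q: "phase.subspace Q" "Q \<subseteq> horiz" "\<forall>u\<in>Q. Re (mat_form A u u) \<le> 0"
    "mpos A + phase.dim Q = CARD('n)" by (rule mpos_decomposition[OF A])
  obtain R where R: "phase.subspace R" "R \<subseteq> horiz" "\<forall>u\<in>R. Re (mat_form B u u) \<le> 0"
    "mpos B + phase.dim R = CARD('n)" by (rule mpos_decomposition[OF B])
  have "Re (mat_form (A + B) u u) \<le> 0" if "u \<in> Q \<inter> R" for u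
    using that bspec[OF Q(3), of u] bspec[OF R(3), of u] by (simp add: mat_form_add)
  moreover have "Q \<inter> R \<subseteq> horiz" using Q(2) by blast
  ultimately have "mpos (A + B) + phase.dim (Q \<inter> R) \<le> CARD('n)"
    by (intro mpos_le phase.subspace_inter Q R)
  then show ?thesis
    using dim_Int_ge[OF Q(1) R(1) Q(2) R(2) subspace_horiz] Q(4) R(4) by (simp add: dim_horiz)
qed

lemma mpos_add_ge: "mpos A + mpos B \<le> mpos (A + B) + CARD('n)" for A :: "complex ^ 'n ^ 'n"
proof -
  obtain Q where Q: "phase.subspace Q" "Q \<subseteq> horiz" "pos_on (mat_form A) Q" "phase.dim Q = mpos A"
    by (rule mpos_attained)
  obtain R where R: "phase.subspace R" "R \<subseteq> horiz" "pos_on (mat_form B) R" "phase.dim R = mpos B"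
    by (rule mpos_attained)
  have "pos_on (mat_form (A + B)) (Q \<inter> R)"
    using Q(3) R(3) unfolding pos_on_def by (simp add: mat_form_add add_pos_pos)
  moreover have "Q \<inter> R \<subseteq> horiz" using Q(2) by blast
  ultimately have "phase.dim (Q \<inter> R) \<le> mpos (A + B)"
    by (intro mpos_ge phase.subspace_inter Q R)
  then show ?thesis
    using dim_Int_ge[OF Q(1) R(1) Q(2) R(2) subspace_horiz] Q(4) R(4) by (simp add: dim_horiz)
qed

lemma mpos_mneg_ge:
  assumes "hermitian (A :: complex ^ 'n ^ 'n)"
  shows "CARD('n) \<le> mpos A + mneg A + phase.dim (mker A)"
  using dim_le_inertia_plus_radical[OF subspace_horiz herm_mat_form[OF assms]]
  unfolding radical_mat_form dim_horiz mneg_eq[symmetric] mpos_def[symmetric] .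

text \<open>A maximal negative subspace stays non-positive when the kernel is added to it.\<close>

lemma mpos_mneg_le:
  assumes "hermitian (A :: complex ^ 'n ^ 'n)"
  shows "mpos A + mneg A + phase.dim (mker A) \<le> CARD('n)"
proof -
  obtain W where W: "phase.subspace W" "W \<subseteq> horiz" "pos_on (mat_form (- A)) W" "phase.dim W = mneg A"
    by (rule mpos_attained)
  define Q where "Q = {x + y |x y. x \<in> W \<and> y \<in> mker A}"
  have sQ: "phase.subspace Q" unfolding Q_def by (rule phase.subspace_sums[OF W(1) subspace_mker])
  have kH: "mker A \<subseteq> horiz" unfolding mker_def by blast
  have QH: "Q \<subseteq> horiz" unfolding Q_def using W(2) kH phase.subspace_add[OF subspace_horiz] by blast
  have "u = 0" if "u \<in> W" "u \<in> mker A" for u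
    using bspec[OF W(3)[unfolded pos_on_def] that(1)] that(2)
    by (cases "u = 0") (simp_all add: mker_def mat_form_def mat_vec_minus)
  then have int: "W \<inter> mker A = {0}"
    using phase.subspace_0[OF W(1)] phase.subspace_0[OF subspace_mker] by blast
  have dQ: "phase.dim Q = mneg A + phase.dim (mker A)"
    using phasefd.dim_sums_Int[OF W(1) subspace_mker, of A] W(4) unfolding int Q_def by simp
  have "Re (mat_form A u u) \<le> 0" if u: "u \<in> Q" for u
  proof -
    obtain x y where xy: "x \<in> W" "y \<in> mker A" "u = x + y" using u unfolding Q_def by blast
    have "mat_form A y y = 0" "mat_form A x y = 0" using xy(2) by (simp_all add: mker_def mat_form_def)
    then have "Re (mat_form A u u) = Re (mat_form A x x)"
      using herm_quad_add[OF phase.subspace_UNIV herm_mat_form[OF assms], of x y] xy(3) by simp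
    moreover have "Re (mat_form A x x) \<le> 0"
      using bspec[OF W(3)[unfolded pos_on_def] xy(1)]
      by (cases "x = 0") (simp_all add: mat_form_def mat_vec_minus cdot_minus_right)
    ultimately show ?thesis by simp
  qed
  then have "mpos A + phase.dim Q \<le> CARD('n)" by (rule mpos_le[OF sQ QH])
  then show ?thesis using dQ by simp
qed

section \<open>Inertia under perturbation\<close>

lemma pos_on_coercive:
  assumes W: "phase.subspace W" and q: "herm_form W q" and pos: "pos_on q W"
  obtains c where "c > 0" "\<forall>u\<in>W. c * (norm u)\<^sup>2 \<le> Re (q u u)"
proof -
  define S where "S = W \<inter> sphere 0 1"
  have cS: "compact S" unfolding S_def by (simp add: closed_Int_compact closed_phase_subspace W)
  have cont: "continuous_on S (\<lambda>u. Re (q u u))"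
    by (intro continuous_on_Re continuous_on_subset[OF herm_form_continuous[OF W q]]) (simp add: S_def)
  obtain c where c: "c > 0" "\<forall>u\<in>S. c \<le> Re (q u u)"
  proof (cases "S = {}")
    case True then show ?thesis using that[of 1] by simp
  next
    case False
    obtain v where v: "v \<in> S" "\<forall>u\<in>S. Re (q v v) \<le> Re (q u u)"
      using continuous_attains_inf[OF cS False cont] by blast
    have "v \<in> W" "norm v = 1" using v(1) by (simp_all add: S_def)
    then have "Re (q v v) > 0" using pos unfolding pos_on_def by fastforce
    then show ?thesis using that v(2) by blast
  qed
  have "c * (norm u)\<^sup>2 \<le> Re (q u u)" if u: "u \<in> W" for u
  proof (cases "u = 0")
    case True then show ?thesis using herm_zero[OF W q u] by simp
  next
    case False
    define u' where "u' = pscale (of_real (1 / norm u)) u"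
    have "u' \<in> W" unfolding u'_def by (rule phase.subspace_scale[OF W u])
    moreover have "norm u' = 1" unfolding u'_def scaleR_eq_pscale[symmetric] using False by simp
    ultimately have "c \<le> Re (q u' u')" using c(2) by (simp add: S_def)
    also have "Re (q u' u') = (1 / norm u)\<^sup>2 * Re (q u u)"
      unfolding u'_def using herm_quad_scale[OF W q u, of "of_real (1 / norm u)"] by (simp add: norm_divide)
    finally show ?thesis using False by (simp add: field_simps)
  qed
  then show ?thesis using that c(1) by blast
qed

lemma pos_on_open:
  assumes W: "phase.subspace W" and A: "hermitian A" and pos: "pos_on (mat_form A) W"
  obtains e where "e > 0" "\<forall>B. norm (B - A) < e \<longrightarrow> pos_on (mat_form B) W"
proof -
  obtain c where c: "c > 0" "\<forall>u\<in>W. c * (norm u)\<^sup>2 \<le> Re (mat_form A u u)"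
    by (rule pos_on_coercive[OF W herm_mat_form[OF A] pos])
  obtain K where K: "K > 0" "\<forall>(A :: complex ^ 'a ^ 'a) u v. norm (mat_form A u v) \<le> K * norm A * norm u * norm (v :: 'a phase)"
    by (rule mat_form_bound)
  have "pos_on (mat_form B) W" if B: "norm (B - A) < c / K" for B
    unfolding pos_on_def
  proof (intro ballI impI)
    fix u assume u: "u \<in> W" "u \<noteq> 0"
    have "\<bar>Re (mat_form (B - A) u u)\<bar> \<le> K * norm (B - A) * norm u * norm u"
      using K(2) abs_Re_le_cmod order_trans by blast
    also have "\<dots> < c * (norm u)\<^sup>2"
      using B K(1) u(2) by (simp add: power2_eq_square field_simps)
    finally have "Re (mat_form (B - A) u u) > - (c * (norm u)\<^sup>2)" by linarith
    moreover have "mat_form B u u = mat_form A u u + mat_form (B - A) u u" by (simp add: mat_form_diff)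
    ultimately show "Re (mat_form B u u) > 0" using bspec[OF c(2) u(1)] by simp
  qed
  then show ?thesis using that[of "c / K"] c(1) K(1) by simp
qed

text \<open>Positive and negative subspaces both survive small perturbations, so neither index can
  drop. Without kernel they already add up to \<open>n\<close>, so neither can grow.\<close>

lemma mpos_locally_constant:
  assumes A: "hermitian (A :: complex ^ 'n ^ 'n)" and k: "mker A = {0}"
  obtains e where "e > 0" "\<forall>B. hermitian B \<longrightarrow> norm (B - A) < e \<longrightarrow> mpos B = mpos A \<and> mneg B = mneg A"
proof -
  obtain P where P: "phase.subspace P" "P \<subseteq> horiz" "pos_on (mat_form A) P" "phase.dim P = mpos A"
    by (rule mpos_attained)
  obtain M where M: "phase.subspace M" "M \<subseteq> horiz" "pos_on (mat_form (- A)) M" "phase.dim M = mneg A"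
    by (rule mpos_attained)
  obtain e1 where e1: "e1 > 0" "\<forall>B. norm (B - A) < e1 \<longrightarrow> pos_on (mat_form B) P"
    by (rule pos_on_open[OF P(1) A P(3)])
  obtain e2 where e2: "e2 > 0" "\<forall>B. norm (B - (- A)) < e2 \<longrightarrow> pos_on (mat_form B) M"
    by (rule pos_on_open[OF M(1) hermitian_uminus[OF A] M(3)])
  have "mpos B = mpos A \<and> mneg B = mneg A" if B: "hermitian B" "norm (B - A) < min e1 e2" for B
  proof -
    have 1: "mpos A \<le> mpos B" using mpos_ge[OF P(1,2)] e1(2) B(2) P(4) by simp
    have "norm (- B - (- A)) < e2" using B(2) by (simp add: norm_minus_commute)
    then have 2: "mneg A \<le> mneg B" using mpos_ge[OF M(1,2)] e2(2) M(4) by metis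
    show ?thesis using 1 2 mpos_mneg_le[OF B(1)] mpos_mneg_ge[OF A] k by simp
  qed
  then show ?thesis using that[of "min e1 e2"] e1 e2 by simp
qed

text \<open>Here \<open>a\<close> is the size of the component on which the unperturbed form is
  definite and \<open>b\<close> that of the kernel component. The unperturbed form controls
  \<open>a\<close> at order one, the perturbation controls \<open>b\<close> at order
  \<open>s\<close>, and half of \<open>c1\<close> pays for everything of order \<open>s\<close> that
  multiplies the square of \<open>a\<close>.\<close>

lemma crossing_estimate:
  fixes a b c1 c2 k s :: real
  assumes "c1 > 0" "c2 > 0" "k \<ge> 0" "s > 0" and s: "s * (k + 4 * k\<^sup>2 / c2 + c2 / 4) \<le> c1 / 2"
    and ab: "a \<noteq> 0 \<or> b \<noteq> 0"
  shows "0 < c1 * a\<^sup>2 + s * (- (k * a\<^sup>2) - 2 * k * a * b + c2 * b\<^sup>2 - c2 / 4 * (a\<^sup>2 + b\<^sup>2))"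
proof -
  \<comment> \<open>The square is weighted so that the mixed term costs only a quarter of the
    \<open>c2\<close> available for \<open>b\<close>; another quarter is given to the error term and
    one half is left.\<close>
  have "0 \<le> (2 * k * a - c2 / 2 * b)\<^sup>2 / c2" using assms by simp
  also have "(2 * k * a - c2 / 2 * b)\<^sup>2 / c2 = 4 * k\<^sup>2 / c2 * a\<^sup>2 - 2 * k * a * b + c2 / 4 * b\<^sup>2"
    using assms(2) by (simp add: power2_eq_square field_simps)
  finally have 1: "2 * k * a * b \<le> 4 * k\<^sup>2 / c2 * a\<^sup>2 + c2 / 4 * b\<^sup>2" by simp
  have "- ((k + 4 * k\<^sup>2 / c2 + c2 / 4) * a\<^sup>2) + c2 / 2 * b\<^sup>2
    \<le> - (k * a\<^sup>2) - 2 * k * a * b + c2 * b\<^sup>2 - c2 / 4 * (a\<^sup>2 + b\<^sup>2)"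
  proof -
    have "(k + 4 * k\<^sup>2 / c2 + c2 / 4) * a\<^sup>2 = k * a\<^sup>2 + 4 * k\<^sup>2 / c2 * a\<^sup>2 + c2 / 4 * a\<^sup>2"
      by (simp only: distrib_right)
    moreover have "c2 / 4 * (a\<^sup>2 + b\<^sup>2) = c2 / 4 * a\<^sup>2 + c2 / 4 * b\<^sup>2" by (simp only: distrib_left)
    moreover have "c2 * b\<^sup>2 = c2 / 2 * b\<^sup>2 + c2 / 4 * b\<^sup>2 + c2 / 4 * b\<^sup>2" by simp
    ultimately show ?thesis using 1 by linarith
  qed
  then have "s * (- ((k + 4 * k\<^sup>2 / c2 + c2 / 4) * a\<^sup>2) + c2 / 2 * b\<^sup>2)
    \<le> s * (- (k * a\<^sup>2) - 2 * k * a * b + c2 * b\<^sup>2 - c2 / 4 * (a\<^sup>2 + b\<^sup>2))"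
    using assms(4) by (simp only: mult_le_cancel_left_pos)
  moreover have "s * (k + 4 * k\<^sup>2 / c2 + c2 / 4) * a\<^sup>2 \<le> c1 / 2 * a\<^sup>2"
    using s by (rule mult_right_mono) simp
  moreover have "s * (- ((k + 4 * k\<^sup>2 / c2 + c2 / 4) * a\<^sup>2) + c2 / 2 * b\<^sup>2)
    = - (s * (k + 4 * k\<^sup>2 / c2 + c2 / 4) * a\<^sup>2) + s * (c2 / 2 * b\<^sup>2)" by (simp add: algebra_simps)
  moreover have "0 < c1 / 2 * a\<^sup>2 + s * (c2 / 2 * b\<^sup>2)"
  proof (cases "a = 0")
    case True
    then show ?thesis using ab assms by simp
  next
    case False
    then have "0 < c1 / 2 * a\<^sup>2" "0 \<le> s * (c2 / 2 * b\<^sup>2)" using assms by simp_all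
    then show ?thesis by linarith
  qed
  ultimately show ?thesis by linarith
qed

text \<open>On \<open>P\<close> the matrix \<open>A\<close> is coercive; on \<open>K\<close>, inside
  the kernel of \<open>A\<close>, the first nonzero contribution is \<open>s\<close> times
  \<open>B\<close>. For small \<open>s\<close> the mixed terms do not spoil positivity on the sum.
  The bound on \<open>E\<close> does not depend on \<open>s\<close>, as needed for a first-order
  Taylor remainder.\<close>

lemma pos_on_perturbation:
  assumes A: "hermitian (A :: complex ^ 'n ^ 'n)" and B: "hermitian B"
    and P: "phase.subspace P" "pos_on (mat_form A) P"
    and K: "phase.subspace K" "K \<subseteq> mker A" "pos_on (mat_form B) K"
  obtains d e where "d > 0" "e > 0"
    "\<forall>s E. 0 < s \<longrightarrow> s < d \<longrightarrow> norm E < e \<longrightarrow>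
       pos_on (mat_form (A + s *\<^sub>R (B + E))) {x + y |x y. x \<in> P \<and> y \<in> K}"
proof -
  obtain c1 where c1: "c1 > 0" "\<forall>u\<in>P. c1 * (norm u)\<^sup>2 \<le> Re (mat_form A u u)"
    by (rule pos_on_coercive[OF P(1) herm_mat_form[OF A] P(2)])
  obtain c2 where c2: "c2 > 0" "\<forall>u\<in>K. c2 * (norm u)\<^sup>2 \<le> Re (mat_form B u u)"
    by (rule pos_on_coercive[OF K(1) herm_mat_form[OF B] K(3)])
  obtain L where L: "L > 0" "\<forall>(A :: complex ^ 'n ^ 'n) u v. norm (mat_form A u v) \<le> L * norm A * norm u * norm (v :: 'n phase)"
    by (rule mat_form_bound)
  define k where "k = L * norm B"
  define M where "M = k + 4 * k\<^sup>2 / c2 + c2 / 4"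
  have k0: "k \<ge> 0" unfolding k_def using L(1) by simp
  have M0: "M > 0" unfolding M_def using k0 c2(1) by (intro add_nonneg_pos) auto
  \<comment> \<open>Chosen so that \<open>s * M\<close> stays below half of \<open>c1\<close>, as
    \<open>crossing_estimate\<close> asks. The eighth in \<open>e\<close> becomes a quarter after
    bounding the squared norm of a sum by twice the sum of the squares.\<close>
  define d where "d = c1 / (2 * M)"
  define e where "e = c2 / (8 * L)"
  have Rebound: "\<bar>Re (mat_form C u v)\<bar> \<le> L * norm C * norm u * norm v"
    for C :: "complex ^ 'n ^ 'n" and u v :: "'n phase"
    using L(2) abs_Re_le_cmod order_trans by blast
  have "pos_on (mat_form (A + s *\<^sub>R (B + E))) {x + y |x y. x \<in> P \<and> y \<in> K}"
    if s: "0 < s" "s < d" and E: "norm E < e" for s E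
    unfolding pos_on_def
  proof (intro ballI impI)
    fix w assume w: "w \<in> {x + y |x y. x \<in> P \<and> y \<in> K}" "w \<noteq> 0"
    then obtain x y where xy: "x \<in> P" "y \<in> K" "w = x + y" by blast
    have ab: "norm x \<noteq> 0 \<or> norm y \<noteq> 0" using w(2) xy(3) by auto
    have yA: "A *v fst y = 0" using xy(2) K(2) by (auto simp: mker_def)
    have 1: "Re (mat_form A w w) = Re (mat_form A x x)"
      using herm_quad_add[OF phase.subspace_UNIV herm_mat_form[OF A], of x y] yA xy(3)
      by (simp add: mat_form_def)
    have 2: "Re (mat_form B w w) = Re (mat_form B x x) + 2 * Re (mat_form B x y) + Re (mat_form B y y)"
      using herm_quad_add[OF phase.subspace_UNIV herm_mat_form[OF B], of x y] xy(3) by simp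
    have 3: "Re (mat_form B x x) \<ge> - (k * (norm x)\<^sup>2)"
      using Rebound[of B x x] by (simp add: k_def power2_eq_square)
    have 4: "2 * Re (mat_form B x y) \<ge> - (2 * k * norm x * norm y)"
      using Rebound[of B x y] unfolding k_def abs_le_iff by (simp only: mult.assoc) linarith
    have 5: "Re (mat_form E w w) \<ge> - (c2 / 4 * ((norm x)\<^sup>2 + (norm y)\<^sup>2))"
    proof -
      have "norm w \<le> norm x + norm y" unfolding xy(3) by (rule norm_triangle_ineq)
      then have "(norm w)\<^sup>2 \<le> (norm x + norm y)\<^sup>2" by (simp add: power_mono)
      also have "\<dots> \<le> 2 * ((norm x)\<^sup>2 + (norm y)\<^sup>2)"
        using sum_squares_bound[of "norm x" "norm y"] by (simp add: power2_sum)
      finally have n: "(norm w)\<^sup>2 \<le> 2 * ((norm x)\<^sup>2 + (norm y)\<^sup>2)" .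
      have "L * norm E \<le> c2 / 8" using E L(1) by (simp add: e_def field_simps)
      then have "L * norm E * (norm w)\<^sup>2 \<le> c2 / 8 * (2 * ((norm x)\<^sup>2 + (norm y)\<^sup>2))"
        using n c2(1) by (intro mult_mono) auto
      moreover have "\<bar>Re (mat_form E w w)\<bar> \<le> L * norm E * (norm w)\<^sup>2"
        using Rebound[of E w w] by (simp add: power2_eq_square mult.assoc)
      moreover have "c2 / 8 * (2 * ((norm x)\<^sup>2 + (norm y)\<^sup>2)) = c2 / 4 * ((norm x)\<^sup>2 + (norm y)\<^sup>2)" by simp
      ultimately show ?thesis by linarith
    qed
    have "s * M \<le> c1 / 2" using s M0 by (simp add: d_def field_simps)
    then have pos: "0 < c1 * (norm x)\<^sup>2 + s * (- (k * (norm x)\<^sup>2) - 2 * k * norm x * norm y + c2 * (norm y)\<^sup>2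
        - c2 / 4 * ((norm x)\<^sup>2 + (norm y)\<^sup>2))"
      using crossing_estimate[OF c1(1) c2(1) k0 s(1) _ ab] unfolding M_def by blast
    have "- (k * (norm x)\<^sup>2) - 2 * k * norm x * norm y + c2 * (norm y)\<^sup>2 - c2 / 4 * ((norm x)\<^sup>2 + (norm y)\<^sup>2)
      \<le> Re (mat_form B w w) + Re (mat_form E w w)"
      using 2 3 4 5 bspec[OF c2(2) xy(2)] by linarith
    then have "s * (- (k * (norm x)\<^sup>2) - 2 * k * norm x * norm y + c2 * (norm y)\<^sup>2 - c2 / 4 * ((norm x)\<^sup>2 + (norm y)\<^sup>2))
      \<le> s * (Re (mat_form B w w) + Re (mat_form E w w))"
      using s(1) by (simp only: mult_le_cancel_left_pos)
    moreover have "Re (mat_form (A + s *\<^sub>R (B + E)) w w)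
      = Re (mat_form A w w) + s * (Re (mat_form B w w) + Re (mat_form E w w))"
      by (simp add: mat_form_add mat_form_scaleR)
    ultimately show "Re (mat_form (A + s *\<^sub>R (B + E)) w w) > 0"
      using pos 1 bspec[OF c1(2) xy(1)] by linarith
  qed
  moreover have "d > 0" "e > 0" unfolding d_def e_def using c1(1) c2(1) L(1) M0 by simp_all
  ultimately show ?thesis using that by blast
qed

text \<open>The perturbation result for \<open>A\<close>, \<open>B\<close> and for their negatives
  gives lower bounds for both indices of the perturbed matrix. Since \<open>B\<close> has no radical
  on the kernel of \<open>A\<close>, these bounds already sum to \<open>n\<close>; hence both are
  equalities and the kernel has disappeared.\<close>

lemma crossing_inertia:
  assumes A: "hermitian (A :: complex ^ 'n ^ 'n)" and B: "hermitian B"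
    and nd: "form_nondegenerate (mat_form B) (mker A)"
  obtains d e where "d > 0" "e > 0"
    "\<forall>s E. 0 < s \<longrightarrow> s < d \<longrightarrow> norm E < e \<longrightarrow> hermitian (A + s *\<^sub>R (B + E)) \<longrightarrow>
       mpos (A + s *\<^sub>R (B + E)) = mpos A + npos (mat_form B) (mker A) \<and> mker (A + s *\<^sub>R (B + E)) = {0}"
proof -
  have kH: "mker A \<subseteq> horiz" unfolding mker_def by blast
  have kH': "mker (- A) = mker A" unfolding mker_def by (simp add: mat_vec_minus)
  obtain P where P: "phase.subspace P" "P \<subseteq> horiz" "pos_on (mat_form A) P" "phase.dim P = mpos A"
    by (rule mpos_attained)
  obtain M where M: "phase.subspace M" "M \<subseteq> horiz" "pos_on (mat_form (- A)) M" "phase.dim M = mneg A"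
    by (rule mpos_attained)
  obtain K where K: "phase.subspace K" "K \<subseteq> mker A" "pos_on (mat_form B) K"
      "phase.dim K = npos (mat_form B) (mker A)"
    by (rule npos_attained[OF subspace_mker])
  obtain N where N: "phase.subspace N" "N \<subseteq> mker A" "pos_on (\<lambda>u v. - mat_form B u v) N"
      "phase.dim N = nneg (mat_form B) (mker A)"
    by (rule npos_attained[OF subspace_mker])
  have N': "pos_on (mat_form (- B)) N" using N(3) unfolding pos_on_def by (simp add: mat_form_uminus)
  have triv: "X \<inter> Y = {0}" if "pos_on (mat_form C) X" "phase.subspace X" "phase.subspace Y" "Y \<subseteq> mker C" for X Y C
  proof -
    have "u = 0" if "u \<in> X" "u \<in> Y" for u
      using bspec[OF \<open>pos_on (mat_form C) X\<close>[unfolded pos_on_def] that(1)] subsetD[OF \<open>Y \<subseteq> mker C\<close> that(2)]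
      by (auto simp: mker_def mat_form_def)
    then show ?thesis using phase.subspace_0[OF that(2)] phase.subspace_0[OF that(3)] by blast
  qed
  define S where "S = {x + y |x y. x \<in> P \<and> y \<in> K}"
  define T where "T = {x + y |x y. x \<in> M \<and> y \<in> N}"
  have S: "phase.subspace S" "S \<subseteq> horiz" "phase.dim S = mpos A + npos (mat_form B) (mker A)"
  proof -
    show "phase.subspace S" unfolding S_def by (rule phase.subspace_sums[OF P(1) K(1)])
    show "S \<subseteq> horiz" unfolding S_def using P(2) K(2) kH phase.subspace_add[OF subspace_horiz] by blast
    show "phase.dim S = mpos A + npos (mat_form B) (mker A)"
      using phasefd.dim_sums_Int[OF P(1) K(1)] P(4) K(4) triv[OF P(3,1) K(1,2)] unfolding S_def by simp
  qed
  have T: "phase.subspace T" "T \<subseteq> horiz" "phase.dim T = mneg A + nneg (mat_form B) (mker A)"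
  proof -
    show "phase.subspace T" unfolding T_def by (rule phase.subspace_sums[OF M(1) N(1)])
    show "T \<subseteq> horiz" unfolding T_def using M(2) N(2) kH phase.subspace_add[OF subspace_horiz] by blast
    show "phase.dim T = mneg A + nneg (mat_form B) (mker A)"
      using phasefd.dim_sums_Int[OF M(1) N(1)] M(4) N(4) triv[OF M(3,1) N(1)] N(2) unfolding T_def kH' by simp
  qed
  obtain d1 e1 where 1: "d1 > 0" "e1 > 0" "\<forall>s E. 0 < s \<longrightarrow> s < d1 \<longrightarrow> norm E < e1 \<longrightarrow>
       pos_on (mat_form (A + s *\<^sub>R (B + E))) {x + y |x y. x \<in> P \<and> y \<in> K}"
    by (rule pos_on_perturbation[OF A B P(1,3) K(1-3)])
  obtain d2 e2 where 2: "d2 > 0" "e2 > 0" "\<forall>s E. 0 < s \<longrightarrow> s < d2 \<longrightarrow> norm E < e2 \<longrightarrow>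
       pos_on (mat_form (- A + s *\<^sub>R (- B + E))) {x + y |x y. x \<in> M \<and> y \<in> N}"
    by (rule pos_on_perturbation[OF hermitian_uminus[OF A] hermitian_uminus[OF B] M(1,3) N(1) _ N'])
      (simp add: kH' N(2))
  have rad: "{v \<in> mker A. \<forall>u\<in>mker A. mat_form B u v = 0} = {0}"
  proof -
    have "v = 0" if "v \<in> mker A" "\<forall>u\<in>mker A. mat_form B u v = 0" for v
      using nd that unfolding form_nondegenerate_def by blast
    moreover have "0 \<in> mker A" by (rule phase.subspace_0[OF subspace_mker])
    ultimately show ?thesis by (auto simp: mat_form_def)
  qed
  \<comment> \<open>Rank and nullity for \<open>A\<close>, and the same count for \<open>B\<close>
    on the kernel of \<open>A\<close>, where nondegeneracy makes the radical trivial.\<close>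
  have sum: "CARD('n) \<le> mpos A + mneg A + (npos (mat_form B) (mker A) + nneg (mat_form B) (mker A))"
    using mpos_mneg_ge[OF A] dim_le_inertia_plus_radical[OF subspace_mker[of A] herm_mat_form[OF B]]
    unfolding rad by simp
  have "mpos C = mpos A + npos (mat_form B) (mker A) \<and> mker C = {0}"
    if s: "0 < s" "s < min d1 d2" and E: "norm E < min e1 e2" and C: "C = A + s *\<^sub>R (B + E)" "hermitian C" for s E C
  proof -
    have "pos_on (mat_form C) S" using 1(3) s E unfolding S_def C(1) by simp
    then have p: "mpos A + npos (mat_form B) (mker A) \<le> mpos C" using mpos_ge[OF S(1,2)] S(3) by metis
    have "- C = - A + s *\<^sub>R (- B + - E)" unfolding C(1) by (simp add: algebra_simps)
    moreover have "pos_on (mat_form (- A + s *\<^sub>R (- B + - E))) T"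
      unfolding T_def using 2(3)[rule_format, of s "- E"] s E by simp
    ultimately have "pos_on (mat_form (- C)) T" by simp
    then have m: "mneg A + nneg (mat_form B) (mker A) \<le> mneg C" using mpos_ge[OF T(1,2)] T(3) by metis
    have "phase.dim (mker C) = 0" "mpos C = mpos A + npos (mat_form B) (mker A)"
      using p m sum mpos_mneg_le[OF C(2)] by linarith+
    then show ?thesis using phase.subspace_0[OF subspace_mker[of C]] phasefd.dim_eq_0[of "mker C"] by blast
  qed
  then show ?thesis using that[of "min d1 d2" "min e1 e2"] 1(1,2) 2(1,2) by simp
qed


subsection \<open>Congruence and Schur complements\<close>

definition blk :: "complex ^ 'n ^ 'n \<Rightarrow> complex ^ 'n ^ 'n \<Rightarrow> complex ^ 'n ^ 'n \<Rightarrow> complex ^ 'n ^ 'n \<Rightarrow>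
    'n::finite phase \<Rightarrow> 'n phase" where
  "blk P Q R S v = (P *v fst v + Q *v snd v, R *v fst v + S *v snd v)"

lemma linear_blk: "Vector_Spaces.linear pscale pscale (blk P Q R S)"
  unfolding phase_linear_iff
  by (simp add: blk_def prod_eq_iff matrix_vector_right_distrib vector_scalar_commute vector_add_ldistrib)

lemma mpos_image:
  fixes T :: "'n phase \<Rightarrow> 'n::finite phase"
  assumes T: "Vector_Spaces.linear pscale pscale T" and inj: "inj_on T horiz"
    and q: "\<And>u. u \<in> horiz \<Longrightarrow> q (T u) (T u) = mat_form A u u"
  shows "npos q (T ` horiz) = mpos A"
proof -
  have "npos q (T ` horiz) = npos (\<lambda>u v. q (T u) (T v)) horiz"
    by (rule npos_image[OF subspace_horiz T inj])
  also have "\<dots> = npos (mat_form A) horiz" by (rule npos_cong) (rule q)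
  finally show ?thesis by (simp add: mpos_def)
qed

lemma mat_inverse_apply:
  "A ** A' = mat 1 \<Longrightarrow> A *v (A' *v x) = x" for A A' :: "complex ^ 'n ^ 'n"
  by (simp add: matrix_vector_mul_assoc)

lemma mpos_congruence:
  fixes A B C :: "complex ^ 'n ^ 'n"
  assumes C: "C ** C' = mat 1" "C' ** C = mat 1"
    and AB: "\<And>x. cdot x (A *v x) = cdot (C *v x) (B *v (C *v x))"
  shows "mpos A = mpos B"
proof -
  have inj: "inj_on (blk C 0 0 0) horiz"
  proof (rule inj_onI)
    fix u v assume uv: "u \<in> horiz" "v \<in> horiz" "blk C 0 0 0 u = blk C 0 0 0 v"
    then have "C *v fst u = C *v fst v" by (simp add: blk_def)
    then have "C' *v (C *v fst u) = C' *v (C *v fst v)" by simp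
    then show "u = v" using uv by (simp add: mat_inverse_apply[OF C(2)] horiz_iff prod_eq_iff)
  qed
  have im: "blk C 0 0 0 ` horiz = horiz"
  proof (intro equalityI subsetI)
    fix u assume "u \<in> blk C 0 0 0 ` horiz"
    then show "u \<in> horiz" by (auto simp: blk_def horiz_iff)
  next
    fix u :: "'n phase" assume "u \<in> horiz"
    then have "u = blk C 0 0 0 (C' *v fst u, 0)"
      by (simp add: blk_def mat_inverse_apply[OF C(1)] horiz_iff prod_eq_iff)
    then show "u \<in> blk C 0 0 0 ` horiz" by (metis horiz_iff imageI snd_conv)
  qed
  have "npos (mat_form B) (blk C 0 0 0 ` horiz) = mpos A"
    by (rule mpos_image[OF linear_blk inj]) (simp add: blk_def mat_form_def AB)
  then show ?thesis unfolding im by (simp add: mpos_def)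
qed

lemma hermitian_inverse:
  fixes A A' :: "complex ^ 'n ^ 'n"
  assumes "hermitian A" "A ** A' = mat 1"
  shows "hermitian A'"
proof -
  have "cdot (A' *v x) y = cdot x (A' *v y)" for x y
  proof -
    have "cdot (A' *v x) (A *v (A' *v y)) = cdot (A *v (A' *v x)) (A' *v y)"
      using assms(1) by (simp add: hermitian_cdot_iff)
    then show ?thesis by (simp add: mat_inverse_apply[OF assms(2)])
  qed
  then show ?thesis by (simp add: hermitian_cdot_iff)
qed

text \<open>The congruence is by \<open>A\<close> itself.\<close>

lemma mpos_inverse:
  fixes A A' :: "complex ^ 'n ^ 'n"
  assumes "hermitian A" "A ** A' = mat 1" "A' ** A = mat 1"
  shows "mpos A' = mpos A"
proof -
  have "mpos A = mpos A'"
  proof (rule mpos_congruence[OF assms(2,3)])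
    fix x
    have "cdot (A *v x) (A' *v (A *v x)) = cdot (A *v x) x"
      by (simp add: mat_inverse_apply[OF assms(3)])
    then show "cdot x (A *v x) = cdot (A *v x) (A' *v (A *v x))"
      using assms(1) by (simp add: hermitian_cdot_iff)
  qed
  then show ?thesis ..
qed

text \<open>Both sides are the positive index of the Hermitian block matrix with rows \<open>(B, 1)\<close> and
  \<open>(1, A')\<close>, computed through the Schur complements of its two diagonal blocks.\<close>

lemma mpos_Schur:
  fixes A A' B B' :: "complex ^ 'n ^ 'n"
  assumes A: "hermitian A" "A ** A' = mat 1" "A' ** A = mat 1"
    and B: "hermitian B" "B ** B' = mat 1" "B' ** B = mat 1"
  shows "mpos (B - A) + mpos A = mpos B + mpos (A' - B')"
proof -
  define q where "q = (\<lambda>u v :: 'n phase. cdot (fst u) (B *v fst v) + cdot (fst u) (snd v) + cdot (snd u) (fst v)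
      + cdot (snd u) (A' *v snd v))"
  have hA': "hermitian A'" by (rule hermitian_inverse[OF A(1,2)])
  have hB': "hermitian B'" by (rule hermitian_inverse[OF B(1,2)])
  have q: "herm_form UNIV q"
    unfolding herm_form_def q_def
    using hA' B(1)
    by (simp add: cdot_add_right matrix_vector_right_distrib vector_scalar_commute cdot_scale_right
      cnj_cdot hermitian_cdot_iff algebra_simps)
  have sub: "phase.subspace (T ` horiz)" if "Vector_Spaces.linear pscale pscale T" for T :: "'n phase \<Rightarrow> 'n phase"
    using phasepair.linear_subspace_image[OF that subspace_horiz] .
  \<comment> \<open>\<open>T1\<close> and \<open>T3\<close> parametrize the two coordinate
    subspaces, \<open>T2\<close> and \<open>T4\<close> their orthogonal complements with respect to
    \<open>q\<close>. On \<open>T2\<close> the form is \<open>B ** A' ** B - B\<close>, congruent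
    through \<open>B\<close> to \<open>A' - B'\<close>; on \<open>T4\<close> it is
    \<open>B - A\<close>.\<close>
  define T1 :: "'n phase \<Rightarrow> 'n phase" where "T1 = blk (mat 1) 0 0 0"
  define T2 where "T2 = blk (mat 1) 0 (- B) 0"
  define T3 :: "'n phase \<Rightarrow> 'n phase" where "T3 = blk 0 0 (mat 1) 0"
  define T4 where "T4 = blk (mat 1) 0 (- A) 0"
  note Td = T1_def T2_def T3_def T4_def blk_def
  have lin: "Vector_Spaces.linear pscale pscale T1" "Vector_Spaces.linear pscale pscale T2"
    "Vector_Spaces.linear pscale pscale T3" "Vector_Spaces.linear pscale pscale T4"
    unfolding T1_def T2_def T3_def T4_def by (rule linear_blk)+
  have inj: "inj_on T1 horiz" "inj_on T2 horiz" "inj_on T3 horiz" "inj_on T4 horiz"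
    unfolding inj_on_def Td by (simp_all add: horiz_iff prod_eq_iff)
  have qT1: "npos q (T1 ` horiz) = mpos B"
    by (rule mpos_image[OF lin(1) inj(1)]) (simp add: Td q_def mat_form_def)
  have "npos q (T2 ` horiz) = mpos (B ** A' ** B - B)"
    by (rule mpos_image[OF lin(2) inj(2)])
      (use B(1) in \<open>simp add: Td q_def mat_form_def mat_vec_minus cdot_minus_left cdot_minus_right
        matrix_vector_mult_diff_rdistrib cdot_diff_right hermitian_cdot_iff vec.neg flip: matrix_vector_mul_assoc\<close>)
  moreover have "mpos (B ** A' ** B - B) = mpos (A' - B')"
    by (rule mpos_congruence[OF B(2,3)])
      (use B(1) in \<open>simp add: matrix_vector_mult_diff_rdistrib cdot_diff_right hermitian_cdot_iff
        mat_inverse_apply[OF B(3)] mat_inverse_apply[OF B(2)] flip: matrix_vector_mul_assoc\<close>)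
  ultimately have qT2: "npos q (T2 ` horiz) = mpos (A' - B')" by simp
  have qT3: "npos q (T3 ` horiz) = mpos A'"
    by (rule mpos_image[OF lin(3) inj(3)]) (simp add: Td q_def mat_form_def)
  have qT4: "npos q (T4 ` horiz) = mpos (B - A)"
    by (rule mpos_image[OF lin(4) inj(4)])
      (use A(1) in \<open>simp add: Td q_def mat_form_def mat_vec_minus cdot_minus_left cdot_minus_right
        matrix_vector_mult_diff_rdistrib cdot_diff_right hermitian_cdot_iff vec.neg
        mat_inverse_apply[OF A(3)]\<close>)
  have T: "T1 u = (fst u, 0)" "T2 u = (fst u, - (B *v fst u))" "T3 u = (0, fst u)" "T4 u = (fst u, - (A *v fst u))"
    for u by (simp_all add: Td mat_vec_minus)
  have "npos q UNIV = npos q (T1 ` horiz) + npos q (T2 ` horiz)"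
  proof (rule npos_orth_sum[OF phase.subspace_UNIV q sub[OF lin(1)] sub[OF lin(2)]])
    show "{x + y |x y. x \<in> T1 ` horiz \<and> y \<in> T2 ` horiz} = UNIV"
    proof (intro equalityI subsetI UNIV_I)
      fix w :: "'n phase"
      define z where "z = - (B' *v snd w)"
      have "w = T1 (fst w - z, 0) + T2 (z, 0)"
        unfolding T by (simp add: z_def vec.neg mat_inverse_apply[OF B(2)] prod_eq_iff)
      moreover have "T1 (fst w - z, 0) \<in> T1 ` horiz" "T2 (z, 0) \<in> T2 ` horiz" by (auto simp: horiz_iff)
      ultimately show "w \<in> {x + y |x y. x \<in> T1 ` horiz \<and> y \<in> T2 ` horiz}" by blast
    qed
    show "q u v = 0" if u: "u \<in> T1 ` horiz" and v: "v \<in> T2 ` horiz" for u v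
    proof -
      obtain a b where "u = T1 a" "v = T2 b" using u v by blast
      then show ?thesis unfolding T q_def by (simp add: cdot_minus_right)
    qed
    show "T1 ` horiz \<inter> T2 ` horiz \<subseteq> {0}"
    proof
      fix u assume u: "u \<in> T1 ` horiz \<inter> T2 ` horiz"
      obtain a where a: "u = T1 a" using u by blast
      obtain b where b: "u = T2 b" using u by blast
      have "B *v fst b = 0" using a b unfolding T by auto
      then have "B' *v (B *v fst b) = 0" by simp
      then have "fst b = 0" by (simp only: mat_inverse_apply[OF B(3)])
      then have "u = (0, 0)" using b unfolding T by simp
      then show "u \<in> {0}" by (simp add: zero_prod_def)
    qed
  qed
  moreover have "npos q UNIV = npos q (T3 ` horiz) + npos q (T4 ` horiz)"
  proof (rule npos_orth_sum[OF phase.subspace_UNIV q sub[OF lin(3)] sub[OF lin(4)]])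
    show "{x + y |x y. x \<in> T3 ` horiz \<and> y \<in> T4 ` horiz} = UNIV"
    proof (intro equalityI subsetI UNIV_I)
      fix w :: "'n phase"
      have "w = T3 (snd w + A *v fst w, 0) + T4 (fst w, 0)"
        unfolding T by (simp add: prod_eq_iff)
      moreover have "T3 (snd w + A *v fst w, 0) \<in> T3 ` horiz" "T4 (fst w, 0) \<in> T4 ` horiz" by (auto simp: horiz_iff)
      ultimately show "w \<in> {x + y |x y. x \<in> T3 ` horiz \<and> y \<in> T4 ` horiz}" by blast
    qed
    show "q u v = 0" if u: "u \<in> T3 ` horiz" and v: "v \<in> T4 ` horiz" for u v
    proof -
      obtain a b where "u = T3 a" "v = T4 b" using u v by blast
      then show ?thesis unfolding T q_def by (simp add: cdot_minus_right vec.neg mat_inverse_apply[OF A(3)])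
    qed
    show "T3 ` horiz \<inter> T4 ` horiz \<subseteq> {0}"
    proof
      fix u assume u: "u \<in> T3 ` horiz \<inter> T4 ` horiz"
      obtain a where a: "u = T3 a" using u by blast
      obtain b where b: "u = T4 b" using u by blast
      have "fst b = 0" using a b unfolding T by simp
      then have "u = (0, 0)" using b unfolding T by simp
      then show "u \<in> {0}" by (simp add: zero_prod_def)
    qed
  qed
  ultimately show ?thesis using qT1 qT2 qT3 qT4 mpos_inverse[OF A] by simp
qed

section \<open>Lagrangian planes\<close>

definition transv :: "'n phase set \<Rightarrow> 'n::finite phase set \<Rightarrow> bool" where
  "transv L K \<longleftrightarrow> L \<inter> K = {0}"

lemma transv_sym: "transv L K \<Longrightarrow> transv K L"
  by (simp add: transv_def Int_commute)

lemma transvD: "transv L K \<Longrightarrow> u \<in> L \<Longrightarrow> u \<in> K \<Longrightarrow> u = 0"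
  unfolding transv_def by blast

lemma Lagr_subspace: "L \<in> Lagr \<Longrightarrow> phase.subspace L"
  and Lagr_isotropic: "L \<in> Lagr \<Longrightarrow> u \<in> L \<Longrightarrow> v \<in> L \<Longrightarrow> sympl u v = 0"
  and Lagr_maximal: "L \<in> Lagr \<Longrightarrow> (\<And>u. u \<in> L \<Longrightarrow> sympl u v = 0) \<Longrightarrow> v \<in> L"
  unfolding Lagr_def by blast+

lemma LagrI:
  assumes "phase.subspace L" "\<And>u v. u \<in> L \<Longrightarrow> v \<in> L \<Longrightarrow> sympl u v = 0"
    "\<And>v. (\<And>u. u \<in> L \<Longrightarrow> sympl u v = 0) \<Longrightarrow> v \<in> L"
  shows "L \<in> Lagr"
proof -
  have "v \<in> L \<longleftrightarrow> (\<forall>u\<in>L. sympl u v = 0)" for v using assms(2,3) by blast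
  then have "L = {v. \<forall>u\<in>L. sympl u v = 0}" by blast
  then show ?thesis unfolding Lagr_def using assms(1) by blast
qed

lemma transvI: "L \<in> Lagr \<Longrightarrow> K \<in> Lagr \<Longrightarrow> (\<And>u. u \<in> L \<Longrightarrow> u \<in> K \<Longrightarrow> u = 0) \<Longrightarrow> transv L K"
  unfolding transv_def using Lagr_subspace phase.subspace_0 by blast

lemma dim_Lagr:
  assumes L: "L \<in> Lagr"
  shows "phase.dim (L :: 'n::finite phase set) = CARD('n)"
proof -
  define J :: "'n phase \<Rightarrow> 'n phase" where "J = blk 0 (mat 1) (- mat 1) 0"
  have J: "J v = (snd v, - fst v)" for v by (simp add: J_def blk_def mat_vec_minus)
  have lJ: "Vector_Spaces.linear pscale pscale J" unfolding J_def by (rule linear_blk)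
  have sL: "phase.subspace L" by (rule Lagr_subspace[OF L])
  have sJL: "phase.subspace (J ` L)" by (rule phasepair.linear_subspace_image[OF lJ sL])
  have pJ: "pdot u (J v) = sympl u v" for u v
    by (simp add: J pdot_def sympl_def cdot_minus_right)
  have Jp: "pdot (J u) v = - sympl u v" for u v
    by (simp add: J pdot_def sympl_def cdot_minus_left)
  have "inj J" unfolding inj_def by (simp add: J prod_eq_iff)
  then have dJ: "phase.dim (J ` L) = phase.dim L"
    by (intro phasepair.dim_image_eq[OF lJ]) (rule inj_on_subset[OF _ subset_UNIV])
  have "u = 0" if u: "u \<in> L" "u \<in> J ` L" for u
  proof -
    obtain v where v: "v \<in> L" "u = J v" using u(2) by blast
    have "pdot u u = 0" using pJ[of u v] Lagr_isotropic[OF L u(1) v(1)] v(2) by simp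
    then show ?thesis by (simp add: pdot_self)
  qed
  then have int: "L \<inter> J ` L = {0}" using phase.subspace_0[OF sL] phase.subspace_0[OF sJL] by blast
  define P where "P = {x + y |x y. x \<in> L \<and> y \<in> J ` L}"
  define Q where "Q = {v\<in>UNIV. \<forall>u\<in>P. pdot u v = 0}"
  have sP: "phase.subspace P" unfolding P_def by (rule phase.subspace_sums[OF sL sJL])
  have LP: "u \<in> P" if "u \<in> L" for u
    unfolding P_def using that phase.subspace_0[OF sJL] by (intro CollectI exI[of _ u] exI[of _ 0]) simp
  have JP: "J u \<in> P" if "u \<in> L" for u
    unfolding P_def using that phase.subspace_0[OF sL] by (intro CollectI exI[of _ 0] exI[of _ "J u"]) simp
  have "w = 0" if w: "w \<in> Q" for w
  proof -
    have "sympl u w = 0" if "u \<in> L" for u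
      using w JP[OF that] Jp[of u w] unfolding Q_def by auto
    then have "w \<in> L" by (rule Lagr_maximal[OF L])
    then have "pdot w w = 0" using w LP unfolding Q_def by blast
    then show ?thesis by (simp add: pdot_self)
  qed
  then have "phase.dim Q = 0" using phasefd.dim_eq_0[of Q] by blast
  then have "phase.dim P = 2 * CARD('n)"
    using pos_orth_decomposition(3)[OF phase.subspace_UNIV herm_form_pdot sP subset_UNIV pos_on_pdot]
    unfolding Q_def phase_dim_UNIV by linarith
  then show ?thesis using phasefd.dim_sums_Int[OF sL sJL] int dJ unfolding P_def by simp
qed

lemma frame_exists:
  assumes L: "L \<in> Lagr"
  obtains X Y where "is_frame X Y (L :: 'n::finite phase set)"
proof -
  obtain f where f: "Vector_Spaces.linear (*s) pscale f" "f ` (UNIV :: (complex ^ 'n) set) = L" "inj_on f UNIV"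
    using vecphase.subspace_isomorphism[OF vec.subspace_UNIV Lagr_subspace[OF L]] dim_Lagr[OF L] dim_UNIV_cvec
    by metis
  interpret f: Vector_Spaces.linear "(*s)" pscale f by (rule f(1))
  have "Vector_Spaces.linear (*s) (*s) (\<lambda>x. fst (f x))" "Vector_Spaces.linear (*s) (*s) (\<lambda>x. snd (f x))"
    by (simp_all add: Vector_Spaces.linear_iff vec.vector_space_axioms f.add f.scale)
  then have "frame_map (matrix (\<lambda>x. fst (f x))) (matrix (\<lambda>x. snd (f x))) = f"
    by (intro ext) (simp add: frame_map_def matrix_works prod_eq_iff)
  then show ?thesis using that f unfolding is_frame_def by metis
qed

lemma mat_ker_trivial_iff: "(\<forall>x. A *v x = 0 \<longrightarrow> x = 0) \<longleftrightarrow> det A \<noteq> 0" for A :: "complex ^ 'n ^ 'n"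
  by (metis invertible_det_nz invertible_left_inverse matrix_left_invertible_ker)

lemma mat_inverse_exists:
  fixes A :: "complex ^ 'n ^ 'n"
  assumes "\<And>x. A *v x = 0 \<Longrightarrow> x = 0"
  obtains A' where "A ** A' = mat 1" "A' ** A = mat 1"
  using assms matrix_left_invertible_ker[of A] matrix_left_right_inverse[of A] by metis

lemma frame_map_linear:
  "frame_map X Y (x + y) = frame_map X Y x + frame_map X Y y"
  "frame_map X Y (c *s x) = pscale c (frame_map X Y x)" "frame_map X Y 0 = 0"
  by (simp_all add: frame_map_def prod_eq_iff matrix_vector_right_distrib vector_scalar_commute)

lemma is_frame_inj_iff: "inj (frame_map X Y) \<longleftrightarrow> (\<forall>x. frame_map X Y x = 0 \<longrightarrow> x = 0)"
proof
  assume R: "\<forall>x. frame_map X Y x = 0 \<longrightarrow> x = 0"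
  show "inj (frame_map X Y)"
  proof (rule injI)
    fix x y assume "frame_map X Y x = frame_map X Y y"
    then have "frame_map X Y (x - y) = 0"
      by (simp add: frame_map_def matrix_vector_mult_diff_distrib zero_prod_def)
    then show "x = y" using R by fastforce
  qed
next
  assume L: "inj (frame_map X Y)"
  show "\<forall>x. frame_map X Y x = 0 \<longrightarrow> x = 0"
  proof (intro allI impI)
    fix x assume "frame_map X Y x = 0"
    then have "frame_map X Y x = frame_map X Y 0" by (simp add: frame_map_linear)
    then show "x = 0" by (rule injD[OF L])
  qed
qed

section \<open>Symplectic maps\<close>

lemma symplectic_linear: "symplectic_map T \<Longrightarrow> Vector_Spaces.linear pscale pscale T"
  and symplectic_sympl: "symplectic_map T \<Longrightarrow> sympl (T u) (T v) = sympl u v"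
  unfolding symplectic_map_def by blast+

lemma symplectic_zero: "symplectic_map T \<Longrightarrow> T 0 = 0"
  and symplectic_add: "symplectic_map T \<Longrightarrow> T (u + v) = T u + T v"
  and symplectic_diff: "symplectic_map T \<Longrightarrow> T (u - v) = T u - T v"
  and symplectic_scale: "symplectic_map T \<Longrightarrow> T (pscale c u) = pscale c (T u)"
  by (erule phasepair.linear_0[OF symplectic_linear] phasepair.linear_add[OF symplectic_linear]
      phasepair.linear_diff[OF symplectic_linear] phasepair.linear_scale[OF symplectic_linear])+

lemma symplectic_bij:
  assumes T: "symplectic_map (T :: 'n::finite phase \<Rightarrow> 'n phase)"
  shows "bij T"
proof -
  have "inj T"
  proof (rule injI)
    fix u v assume "T u = T v"
    then have "sympl w (u - v) = 0" for w
      using symplectic_sympl[OF T, of w "u - v"] symplectic_diff[OF T] by simp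
    then have "u - v = 0" by (rule sympl_right_0_imp)
    then show "u = v" by simp
  qed
  moreover have "surj T" by (rule phasefd.linear_inj_imp_surj[OF symplectic_linear[OF T] \<open>inj T\<close>])
  ultimately show ?thesis by (simp add: bij_def)
qed

lemma symplectic_inj: "symplectic_map T \<Longrightarrow> inj T"
  using symplectic_bij bij_is_inj by blast

lemma symplectic_inv:
  assumes T: "symplectic_map T"
  shows "symplectic_map (inv T)"
  unfolding symplectic_map_def
proof
  show "Vector_Spaces.linear pscale pscale (inv T)"
    by (rule phasefd.inj_linear_imp_inv_linear[OF symplectic_linear[OF T] symplectic_inj[OF T]])
  have "T (inv T u) = u" for u using symplectic_bij[OF T] by (simp add: bij_is_surj surj_f_inv_f)
  then show "\<forall>u v. sympl (inv T u) (inv T v) = sympl u v" using symplectic_sympl[OF T] by metis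
qed

lemma symplectic_inv_apply:
  assumes "symplectic_map T" shows "T (inv T u) = u" "inv T (T u) = u" "T ` inv T ` A = A" "inv T ` T ` A = A"
proof -
  show 1: "T (inv T u) = u" for u using symplectic_bij[OF assms] by (simp add: bij_is_surj surj_f_inv_f)
  show 2: "inv T (T u) = u" for u using symplectic_inj[OF assms] by simp
  show "T ` inv T ` A = A" "inv T ` T ` A = A" unfolding image_image 1 2 by simp_all
qed

lemma symplectic_comp: "symplectic_map S \<Longrightarrow> symplectic_map T \<Longrightarrow> symplectic_map (S \<circ> T)"
  unfolding symplectic_map_def phase_linear_iff by simp

lemma symplectic_Lagr:
  assumes T: "symplectic_map T" and L: "L \<in> Lagr"
  shows "T ` L \<in> Lagr"
proof (rule LagrI)
  show "phase.subspace (T ` L)"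
    by (rule phasepair.linear_subspace_image[OF symplectic_linear[OF T] Lagr_subspace[OF L]])
  show "sympl u v = 0" if "u \<in> T ` L" "v \<in> T ` L" for u v
    using that Lagr_isotropic[OF L] symplectic_sympl[OF T] by force
  show "v \<in> T ` L" if v: "\<And>u. u \<in> T ` L \<Longrightarrow> sympl u v = 0" for v
  proof -
    have "sympl u (inv T v) = 0" if "u \<in> L" for u
      using v[of "T u"] that symplectic_sympl[OF T, of u "inv T v"] symplectic_inv_apply(1)[OF T] by auto
    then have "inv T v \<in> L" by (rule Lagr_maximal[OF L])
    then show ?thesis using symplectic_inv_apply(1)[OF T] by (metis imageI)
  qed
qed

lemma symplectic_transv:
  assumes T: "symplectic_map T"
  shows "transv (T ` L) (T ` K) \<longleftrightarrow> transv L K"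
proof -
  have "T ` L \<inter> T ` K = T ` (L \<inter> K)" by (rule image_Int[OF symplectic_inj[OF T], symmetric])
  moreover have "T ` {0} = {0}" using symplectic_zero[OF T] by simp
  ultimately show ?thesis
    unfolding transv_def using inj_image_eq_iff[OF symplectic_inj[OF T], of "L \<inter> K" "{0}"] by simp
qed

text \<open>Block matrices make the action on frames explicit, so that continuity and
  differentiability of charts can be read off from matrix products.\<close>

lemma linear_is_blk:
  assumes T: "Vector_Spaces.linear pscale pscale (T :: 'n::finite phase \<Rightarrow> 'n phase)"
  obtains P Q R S where "T = blk P Q R S"
proof -
  note add = phasepair.linear_add[OF T] and scale = phasepair.linear_scale[OF T]
  have a1: "T (x + y, 0) = T (x, 0) + T (y, 0)" for x y using add[of "(x, 0)" "(y, 0)"] by simp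
  have a2: "T (0, x + y) = T (0, x) + T (0, y)" for x y using add[of "(0, x)" "(0, y)"] by simp
  have s1: "T (c *s x, 0) = pscale c (T (x, 0))" for c x using scale[of c "(x, 0)"] by (simp add: pscale_def)
  have s2: "T (0, c *s x) = pscale c (T (0, x))" for c x using scale[of c "(0, x)"] by (simp add: pscale_def)
  have lin: "Vector_Spaces.linear (*s) (*s) (\<lambda>x. fst (T (x, 0)))" "Vector_Spaces.linear (*s) (*s) (\<lambda>x. fst (T (0, x)))"
     "Vector_Spaces.linear (*s) (*s) (\<lambda>x. snd (T (x, 0)))" "Vector_Spaces.linear (*s) (*s) (\<lambda>x. snd (T (0, x)))"
    by (simp_all add: Vector_Spaces.linear_iff vec.vector_space_axioms a1 a2 s1 s2)
  have split: "T v = T (fst v, 0) + T (0, snd v)" for v using add[of "(fst v, 0)" "(0, snd v)"] by simp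
  have "T = blk (matrix (\<lambda>x. fst (T (x, 0)))) (matrix (\<lambda>x. fst (T (0, x))))
      (matrix (\<lambda>x. snd (T (x, 0)))) (matrix (\<lambda>x. snd (T (0, x))))"
  proof (rule ext)
    fix v
    show "T v = blk (matrix (\<lambda>x. fst (T (x, 0)))) (matrix (\<lambda>x. fst (T (0, x))))
        (matrix (\<lambda>x. snd (T (x, 0)))) (matrix (\<lambda>x. snd (T (0, x)))) v"
      unfolding blk_def matrix_works[OF lin(1)] matrix_works[OF lin(2)]
        matrix_works[OF lin(3)] matrix_works[OF lin(4)]
      by (subst split[of v]) (simp only: prod_eq_iff fst_add snd_add fst_conv snd_conv)
  qed
  then show ?thesis using that by blast
qed

section \<open>Lagrangian planes as graphs of Hermitian matrices\<close>

lemma graph_iff: "u \<in> graph A \<longleftrightarrow> snd u = A *v fst u"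
  unfolding graph_def by (auto simp: prod_eq_iff)

lemma graph_inf_iff: "u \<in> graph_inf \<longleftrightarrow> fst u = 0"
  unfolding graph_inf_def by (simp add: mem_Times_iff)

lemma graph_Lagr:
  assumes "hermitian A" shows "graph A \<in> Lagr"
proof (rule LagrI)
  show "phase.subspace (graph A)"
    by (rule phase.subspaceI) (simp_all add: graph_iff matrix_vector_right_distrib vector_scalar_commute)
  show "sympl u v = 0" if "u \<in> graph A" "v \<in> graph A" for u v
    using that assms by (simp add: graph_iff sympl_def hermitian_cdot_iff)
  show "v \<in> graph A" if v: "\<And>u. u \<in> graph A \<Longrightarrow> sympl u v = 0" for v
  proof -
    have "cdot x (snd v - A *v fst v) = 0" for x
      using v[of "(x, A *v x)"] assms by (simp add: graph_iff sympl_def hermitian_cdot_iff cdot_diff_right)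
    then have "snd v - A *v fst v = 0" by (rule cdot_left_0_imp)
    then show ?thesis by (simp add: graph_iff)
  qed
qed

lemma graph_inf_Lagr: "graph_inf \<in> Lagr"
proof (rule LagrI)
  show "phase.subspace graph_inf" by (rule phase.subspaceI) (simp_all add: graph_inf_iff)
  show "sympl u v = 0" if "u \<in> graph_inf" "v \<in> graph_inf" for u v
    using that by (simp add: graph_inf_iff sympl_def)
  show "v \<in> graph_inf" if v: "\<And>u. u \<in> graph_inf \<Longrightarrow> sympl u v = 0" for v
  proof -
    have "cdot x (fst v) = 0" for x using v[of "(0, x)"] by (simp add: graph_inf_iff sympl_def)
    then have "fst v = 0" by (rule cdot_left_0_imp)
    then show ?thesis by (simp add: graph_inf_iff)
  qed
qed

lemma graph_eq_iff: "graph A = graph B \<longleftrightarrow> A = B"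
proof
  assume E: "graph A = graph B"
  have "A *v x = B *v x" for x
  proof -
    have "(x, A *v x) \<in> graph B" unfolding E[symmetric] by (simp add: graph_iff)
    then show ?thesis by (simp add: graph_iff)
  qed
  then show "A = B" by (simp add: matrix_eq)
qed simp

lemma transv_graph_inf: "transv (graph A) graph_inf"
proof -
  have "u \<in> graph A \<inter> graph_inf \<longleftrightarrow> u = 0" for u
    by (auto simp: graph_iff graph_inf_iff prod_eq_iff)
  then show ?thesis unfolding transv_def by blast
qed

lemma transv_graphs: "transv (graph A) (graph B) \<longleftrightarrow> mker (A - B) = {0}"
proof -
  have "transv (graph A) (graph B) \<longleftrightarrow> (\<forall>x. (A - B) *v x = 0 \<longrightarrow> x = 0)"
  proof
    assume L: "transv (graph A) (graph B)"
    show "\<forall>x. (A - B) *v x = 0 \<longrightarrow> x = 0"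
    proof (intro allI impI)
      fix x assume "(A - B) *v x = 0"
      then have "(x, A *v x) \<in> graph A" "(x, A *v x) \<in> graph B"
        by (simp_all add: graph_iff matrix_vector_mult_diff_rdistrib)
      then have "(x, A *v x) = 0" by (rule transvD[OF L])
      then show "x = 0" by (simp add: zero_prod_def)
    qed
  next
    assume R: "\<forall>x. (A - B) *v x = 0 \<longrightarrow> x = 0"
    have "u \<in> graph A \<inter> graph B \<longleftrightarrow> u = 0" for u
    proof
      assume u: "u \<in> graph A \<inter> graph B"
      then have "snd u = A *v fst u" "snd u = B *v fst u" unfolding Int_iff graph_iff by blast+
      then have "(A - B) *v fst u = 0" unfolding matrix_vector_mult_diff_rdistrib by (metis right_minus_eq)
      then have "fst u = 0" using R by blast
      then show "u = 0" using u by (simp add: graph_iff prod_eq_iff)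
    qed (simp add: graph_iff)
    then show "transv (graph A) (graph B)" unfolding transv_def by blast
  qed
  then show ?thesis unfolding mker_eq_0_iff .
qed

text \<open>Transversality makes the first half \<open>X\<close> of a frame invertible, and the
  matrix is \<open>Y\<close> times the inverse of \<open>X\<close>. Isotropy of the plane is
  precisely its Hermitian symmetry.\<close>

lemma Lagr_graph_exists:
  assumes L: "L \<in> Lagr" and t: "transv L graph_inf"
  obtains A where "hermitian A" "L = graph A"
proof -
  obtain X Y where F: "is_frame X Y L" by (rule frame_exists[OF L])
  have FL: "frame_map X Y x \<in> L" for x using F unfolding is_frame_def by blast
  have "x = 0" if x: "X *v x = 0" for x
  proof -
    have "frame_map X Y x \<in> graph_inf" using x by (simp add: graph_inf_iff frame_map_def)
    then have "frame_map X Y x = 0" using FL transvD[OF t] by blast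
    then show ?thesis using F unfolding is_frame_def is_frame_inj_iff by blast
  qed
  then obtain X' where X': "X ** X' = mat 1" "X' ** X = mat 1" using mat_inverse_exists by blast
  have "L = graph (Y ** X')"
  proof (intro equalityI subsetI)
    fix u assume "u \<in> L"
    then obtain x where "u = frame_map X Y x" using F unfolding is_frame_def by blast
    then show "u \<in> graph (Y ** X')"
      by (simp add: graph_iff frame_map_def mat_inverse_apply[OF X'(2)] flip: matrix_vector_mul_assoc)
  next
    fix u assume "u \<in> graph (Y ** X')"
    then have "u = frame_map X Y (X' *v fst u)"
      by (simp add: graph_iff frame_map_def prod_eq_iff mat_inverse_apply[OF X'(1)] flip: matrix_vector_mul_assoc)
    then show "u \<in> L" using FL by metis
  qed
  moreover have "hermitian A" if "L = graph A" for A
    unfolding hermitian_cdot_iff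
  proof (intro allI)
    fix x y
    have "sympl (x, A *v x) (y, A *v y) = 0"
      by (rule Lagr_isotropic[OF L]) (simp_all add: \<open>L = graph A\<close> graph_iff)
    then show "cdot (A *v x) y = cdot x (A *v y)" by (simp add: sympl_def)
  qed
  ultimately show ?thesis using that by blast
qed

text \<open>A frame of \<open>L\<close> and a frame of \<open>K\<close>, the latter rescaled to be
  dual to the former under the symplectic form, make up a symplectic basis.\<close>

lemma normal_form:
  assumes L: "L \<in> Lagr" and K: "K \<in> Lagr" and t: "transv L K"
  obtains S where "symplectic_map S" "S ` graph 0 = L" "S ` graph_inf = (K :: 'n::finite phase set)"
proof -
  obtain X Y where F: "is_frame X Y L" by (rule frame_exists[OF L])
  obtain Z V where G: "is_frame Z V K" by (rule frame_exists[OF K])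
  \<comment> \<open>The matrix of the symplectic pairing between the two frames. A kernel vector
    would give an element of \<open>K\<close> orthogonal to \<open>L\<close>, hence in
    \<open>L\<close> by maximality, hence zero by transversality.\<close>
  define C where "C = adj X ** V - adj Y ** Z"
  have C: "sympl (frame_map X Y x) (frame_map Z V y) = cdot x (C *v y)" for x y
    by (simp add: C_def sympl_def frame_map_def matrix_vector_mult_diff_rdistrib cdot_diff_right cdot_adj
        flip: matrix_vector_mul_assoc)
  have FL: "frame_map X Y x \<in> L" "frame_map Z V x \<in> K" for x using F G unfolding is_frame_def by blast+
  have "y = 0" if y: "C *v y = 0" for y
  proof -
    have "sympl u (frame_map Z V y) = 0" if "u \<in> L" for u
    proof -
      obtain x where "u = frame_map X Y x" using F \<open>u \<in> L\<close> unfolding is_frame_def by blast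
      then show ?thesis using C y by simp
    qed
    then have "frame_map Z V y \<in> L" by (rule Lagr_maximal[OF L])
    then have "frame_map Z V y = 0" using FL(2) transvD[OF t] by blast
    then show ?thesis using G unfolding is_frame_def is_frame_inj_iff by blast
  qed
  then obtain C' where C': "C ** C' = mat 1" "C' ** C = mat 1" using mat_inverse_exists by blast
  define S where "S = (\<lambda>v. frame_map X Y (fst v) + frame_map Z V (C' *v snd v))"
  have lin: "Vector_Spaces.linear pscale pscale S"
    unfolding phase_linear_iff S_def
    by (simp add: frame_map_linear matrix_vector_right_distrib vector_scalar_commute phase.scale_right_distrib)
  have "sympl (S u) (S v) = sympl u v" for u v
  proof -
    have "sympl (frame_map Z V y) (frame_map X Y x) = - cdot (C *v y) x" for x y
      using cnj_sympl[of "frame_map X Y x" "frame_map Z V y"] C[of x y]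
      by (simp add: cnj_cdot minus_equation_iff)
    then show ?thesis
      unfolding S_def sympl_add_left sympl_add_right
      using Lagr_isotropic[OF L FL(1) FL(1)] Lagr_isotropic[OF K FL(2) FL(2)]
      by (simp add: C mat_inverse_apply[OF C'(1)] sympl_def[of u v])
  qed
  then have S: "symplectic_map S" unfolding symplectic_map_def using lin by blast
  moreover have "S ` graph 0 = L"
  proof -
    have "S ` graph 0 = range (frame_map X Y)"
      unfolding graph_def image_image S_def by (simp add: frame_map_linear)
    then show ?thesis using F unfolding is_frame_def by simp
  qed
  moreover have "S ` graph_inf = K"
  proof (intro equalityI subsetI)
    fix u assume "u \<in> S ` graph_inf"
    then show "u \<in> K" using FL(2) unfolding S_def by (auto simp: graph_inf_iff frame_map_linear)
  next
    fix u assume "u \<in> K"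
    then obtain x where x: "u = frame_map Z V x" using G unfolding is_frame_def by blast
    have "u = S (0, C *v x)" unfolding S_def x by (simp add: frame_map_linear mat_inverse_apply[OF C'(2)])
    then show "u \<in> S ` graph_inf" by (metis fst_conv graph_inf_iff imageI)
  qed
  ultimately show ?thesis using that by blast
qed

lemma chart_exists:
  assumes S: "symplectic_map S" "S ` graph_inf = K" and L: "L \<in> Lagr" and t: "transv L K"
  obtains A where "hermitian A" "S ` graph A = L"
proof -
  have "transv (inv S ` L) graph_inf"
    using t symplectic_transv[OF S(1), of "inv S ` L" graph_inf] symplectic_inv_apply(3)[OF S(1)] S(2) by simp
  then obtain A where "hermitian A" "inv S ` L = graph A"
    using Lagr_graph_exists[OF symplectic_Lagr[OF symplectic_inv[OF S(1)] L]] by blast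
  then show ?thesis using that symplectic_inv_apply(3)[OF S(1)] by metis
qed

lemma det_pencil_poly:
  fixes A B :: "complex ^ 'n ^ 'n"
  shows "\<exists>p. \<forall>c. poly p c = det (\<chi> i j. A $ i $ j + c * B $ i $ j)"
proof -
  define M where "M = (\<chi> i j. [:A $ i $ j, B $ i $ j:])"
  have "poly (det M) c = det (\<chi> i j. A $ i $ j + c * B $ i $ j)" for c
    unfolding det_def M_def by (simp add: poly_sum poly_prod)
  then show ?thesis by blast
qed

text \<open>The candidates are the graphs of real multiples \<open>c\<close> of the identity. A
  frame \<open>X\<close>, \<open>Y\<close> of a given plane fails to be transversal to such a graph
  exactly when \<open>Y - c X\<close> is singular, which is a polynomial condition on
  \<open>c\<close>; so each plane excludes finitely many values.\<close>

lemma common_transversal: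
  assumes F: "finite F" "F \<subseteq> (Lagr :: 'n::finite phase set set)"
  obtains N where "N \<in> Lagr" "\<forall>L\<in>F. transv L N"
proof -
  define bad where "bad L = {c::real. \<not> transv L (graph (mat (of_real c)))}" for L :: "'n phase set"
  have herm: "hermitian (mat (of_real c) :: complex ^ 'n ^ 'n)" for c
    by (simp add: hermitian_def adj_def mat_def vec_eq_iff)
  have "finite (bad L)" if L: "L \<in> Lagr" for L
  proof -
    obtain X Y where fr: "is_frame X Y L" by (rule frame_exists[OF L])
    have FL: "frame_map X Y x \<in> L" for x using fr unfolding is_frame_def by blast
    obtain p where p: "\<And>c. poly p c = det (\<chi> i j. Y $ i $ j + c * (- X) $ i $ j)"
      using det_pencil_poly by blast
    have ap: "(\<chi> i j. Y $ i $ j + c * (- X) $ i $ j) *v x = Y *v x - c *s (X *v x)" for c x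
      by (simp add: vec_eq_iff matrix_vector_mult_def sum_distrib_left sum_subtractf algebra_simps)
    \<comment> \<open>The polynomial is not identically zero because it does not vanish at the
      imaginary unit: \<open>Y x = \<i> X x\<close> turns the isotropy of the frame vector into
      \<open>2 \<i>\<close> times the squared norm of \<open>X x\<close> being zero.\<close>
    have "poly p \<i> \<noteq> 0"
      unfolding p mat_ker_trivial_iff[symmetric]
    proof (intro allI impI)
      fix x assume "(\<chi> i j. Y $ i $ j + \<i> * (- X) $ i $ j) *v x = 0"
      then have Y: "Y *v x = \<i> *s (X *v x)" unfolding ap by simp
      have "sympl (frame_map X Y x) (frame_map X Y x) = 0" by (rule Lagr_isotropic[OF L FL FL])
      then have "2 * \<i> * cdot (X *v x) (X *v x) = 0"
        by (simp add: sympl_def frame_map_def Y cdot_scale_left cdot_scale_right)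
      then have "X *v x = 0" by simp
      then have "frame_map X Y x = 0" by (simp add: frame_map_def Y zero_prod_def)
      then show "x = 0" using fr unfolding is_frame_def is_frame_inj_iff by blast
    qed
    then have "p \<noteq> 0" by auto
    then have "finite {c. poly p c = 0}" by (rule poly_roots_finite)
    then have "finite (of_real -` {c. poly p c = 0} :: real set)"
      by (rule finite_vimageI) (simp add: inj_on_def)
    moreover have "bad L \<subseteq> of_real -` {c. poly p c = 0}"
    proof
      fix c assume c: "c \<in> bad L"
      show "c \<in> of_real -` {c. poly p c = 0}"
      proof (rule ccontr)
        assume "c \<notin> of_real -` {c. poly p c = 0}"
        then have nz: "\<forall>x. (\<chi> i j. Y $ i $ j + of_real c * (- X) $ i $ j) *v x = 0 \<longrightarrow> x = 0"
          unfolding mat_ker_trivial_iff p[symmetric] by simp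
        have "transv L (graph (mat (of_real c)))"
        proof (rule transvI[OF L graph_Lagr[OF herm]])
          fix u assume u: "u \<in> L" "u \<in> graph (mat (of_real c))"
          obtain x where x: "u = frame_map X Y x" using fr u(1) unfolding is_frame_def by blast
          have "Y *v x = mat (of_real c) *v (X *v x)" using u(2) x by (simp add: graph_iff frame_map_def)
          also have "\<dots> = of_real c *s (X *v x)"
            by (simp add: vec_eq_iff matrix_vector_mult_def mat_def if_distrib[of "\<lambda>a. a * _"] cong: if_cong)
          finally have "x = 0" using nz unfolding ap by simp
          then show "u = 0" using x by (simp add: frame_map_linear)
        qed
        then show False using c unfolding bad_def by simp
      qed
    qed
    ultimately show ?thesis using finite_subset by blast
  qed
  then have "finite (\<Union>L\<in>F. bad L)" using F by blast
  then obtain c where c: "c \<notin> (\<Union>L\<in>F. bad L)"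
    using ex_new_if_finite[OF infinite_UNIV_char_0] by blast
  then have "\<forall>L\<in>F. transv L (graph (mat (of_real c)))" unfolding bad_def by blast
  then show ?thesis using that[OF graph_Lagr[OF herm]] by blast
qed

section \<open>The Duistermaat index\<close>

text \<open>For \<open>P\<close> and \<open>Q\<close> transversal to \<open>K\<close>, the plane \<open>Q\<close> is a graph over \<open>P\<close> along \<open>K\<close>; in a
  symplectic chart sending \<open>K\<close> to infinity the form below is minus the difference of the Hermitian
  matrices of \<open>Q\<close> and \<open>P\<close>.\<close>

definition rel_index :: "'n phase set \<Rightarrow> 'n phase set \<Rightarrow> 'n::finite phase set \<Rightarrow> nat" where
  "rel_index K P Q = npos (\<lambda>u v. - sympl u (THE w. w \<in> Q \<and> w - v \<in> K)) P"

lemma rel_index_chart: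
  assumes S: "symplectic_map S" "S ` graph_inf = K" and A: "hermitian A"
  shows "rel_index K (S ` graph A) (S ` graph B) = mneg (B - A)"
proof -
  define T where "T = S \<circ> blk (mat 1) 0 A 0"
  have T: "T u = S (fst u, A *v fst u)" for u by (simp add: T_def blk_def)
  have lin: "Vector_Spaces.linear pscale pscale T"
    using symplectic_linear[OF S(1)] linear_blk[of "mat 1" 0 A 0] unfolding T_def phase_linear_iff by simp
  have inj: "inj_on T horiz"
  proof (rule inj_onI)
    fix u v assume uv: "u \<in> horiz" "v \<in> horiz" "T u = T v"
    then have "(fst u, A *v fst u) = (fst v, A *v fst v)"
      unfolding T by (metis injD[OF symplectic_inj[OF S(1)]])
    then show "u = v" using uv by (simp add: horiz_iff prod_eq_iff)
  qed
  have im: "T ` horiz = S ` graph A"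
  proof -
    have "blk (mat 1) 0 A 0 ` horiz = graph A"
    proof (intro equalityI subsetI)
      fix u assume "u \<in> blk (mat 1) 0 A 0 ` horiz"
      then show "u \<in> graph A" by (auto simp: blk_def graph_iff)
    next
      fix u assume "u \<in> graph A"
      then have "u = blk (mat 1) 0 A 0 (fst u, 0)" by (simp add: blk_def graph_iff prod_eq_iff)
      then show "u \<in> blk (mat 1) 0 A 0 ` horiz" by (metis horiz_iff imageI snd_conv)
    qed
    then show ?thesis unfolding T_def image_comp[symmetric] by simp
  qed
  have "npos (\<lambda>u v. - sympl u (THE w. w \<in> S ` graph B \<and> w - v \<in> K)) (T ` horiz) = mpos (- (B - A))"
  proof (rule mpos_image[OF lin inj])
    fix u
    have "(THE w. w \<in> S ` graph B \<and> w - T u \<in> K) = S (fst u, B *v fst u)"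
    proof (rule the_equality)
      have "S (fst u, B *v fst u) - T u = S (0, B *v fst u - A *v fst u)"
        unfolding T symplectic_diff[OF S(1), symmetric] by simp
      then show "S (fst u, B *v fst u) \<in> S ` graph B \<and> S (fst u, B *v fst u) - T u \<in> K"
        using S(2) by (auto simp: graph_iff graph_inf_iff)
    next
      fix w assume w: "w \<in> S ` graph B \<and> w - T u \<in> K"
      then obtain z where z: "z \<in> graph B" "w = S z" by blast
      obtain y where y: "y \<in> graph_inf" "w - T u = S y" using w S(2) by blast
      have "S (z - (fst u, A *v fst u)) = S y" using y(2) z(2) unfolding T symplectic_diff[OF S(1)] by simp
      then have "z - (fst u, A *v fst u) = y" by (rule injD[OF symplectic_inj[OF S(1)]])
      then have "fst (z - (fst u, A *v fst u)) = 0" using y(1) by (simp add: graph_inf_iff)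
      then have "fst z = fst u" by simp
      then show "w = S (fst u, B *v fst u)" using z by (simp add: graph_iff) (metis prod.collapse)
    qed
    then have "- sympl (T u) (THE w. w \<in> S ` graph B \<and> w - T u \<in> K)
        = - sympl (fst u, A *v fst u) (fst u, B *v fst u)"
      using symplectic_sympl[OF S(1)] by (simp add: T)
    also have "\<dots> = mat_form (- (B - A)) u u"
      using A by (simp add: sympl_def mat_form_def mat_vec_minus matrix_vector_mult_diff_rdistrib
          cdot_diff_right hermitian_cdot_iff)
    finally show "- sympl (T u) (THE w. w \<in> S ` graph B \<and> w - T u \<in> K) = mat_form (- (B - A)) u u" .
  qed
  then show ?thesis unfolding rel_index_def im .
qed

lemma rel_index_symplectic:
  assumes T: "symplectic_map T" and L: "K \<in> Lagr" "P \<in> Lagr" "Q \<in> Lagr" and t: "transv P K" "transv Q K"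
  shows "rel_index (T ` K) (T ` P) (T ` Q) = rel_index K P Q"
proof -
  obtain S where S: "symplectic_map S" "S ` graph 0 = P" "S ` graph_inf = K"
    by (rule normal_form[OF L(2,1) t(1)])
  obtain B where B: "hermitian B" "S ` graph B = Q" by (rule chart_exists[OF S(1,3) L(3) t(2)])
  have TS: "symplectic_map (T \<circ> S)" "(T \<circ> S) ` graph_inf = T ` K"
    using symplectic_comp[OF T S(1)] S(3) by (simp_all only: image_comp[symmetric])
  have "rel_index (T ` K) ((T \<circ> S) ` graph 0) ((T \<circ> S) ` graph B) = mneg (B - 0)"
    by (rule rel_index_chart[OF TS hermitian_0])
  moreover have "rel_index K (S ` graph 0) (S ` graph B) = mneg (B - 0)"
    by (rule rel_index_chart[OF S(1,3) hermitian_0])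
  ultimately show ?thesis using S(2) B(2) by (simp only: image_comp[symmetric])
qed

text \<open>The coboundary of \<open>rel_index K\<close>: for a fixed \<open>K\<close> the cocycle
  identity is formal, and the substance lies in the independence of \<open>K\<close>.\<close>

definition triple_index :: "'n phase set \<Rightarrow> 'n phase set \<Rightarrow> 'n phase set \<Rightarrow> 'n::finite phase set \<Rightarrow> int" where
  "triple_index K P Q R = int (rel_index K P Q) + int (rel_index K Q R) - int (rel_index K P R)"

section \<open>Independence of the triple index from the chart\<close>

lemma mneg_Schur:
  fixes A A' B B' :: "complex ^ 'n ^ 'n"
  assumes A: "hermitian A" "A ** A' = mat 1" "A' ** A = mat 1"
    and B: "hermitian B" "B ** B' = mat 1" "B' ** B = mat 1"
  shows "mneg (B - A) + mneg A = mneg B + mneg (A' - B')"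
proof -
  have neg: "(- X) ** (- Y) = mat 1" if "X ** Y = mat 1" for X Y :: "complex ^ 'n ^ 'n"
    using that by (simp add: matrix_eq mat_vec_minus vec.neg flip: matrix_vector_mul_assoc)
  have "mpos (- B - - A) + mpos (- A) = mpos (- B) + mpos (- A' - - B')"
    by (rule mpos_Schur) (intro hermitian_uminus neg A B)+
  then show ?thesis by simp
qed

lemma transv_graph_0_inverse:
  fixes A :: "complex ^ 'n ^ 'n"
  assumes "transv (graph A) (graph 0)"
  obtains A' where "A ** A' = mat 1" "A' ** A = mat 1"
proof -
  have "\<forall>x. A *v x = 0 \<longrightarrow> x = 0" using assms by (simp add: transv_graphs mker_eq_0_iff)
  then show ?thesis using mat_inverse_exists[of A] that by blast
qed

lemma symplectic_rotation: "symplectic_map (blk 0 (mat 1) (- mat 1) 0)"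
  unfolding symplectic_map_def
  by (simp add: linear_blk) (simp add: blk_def sympl_def mat_vec_minus cdot_minus_left cdot_minus_right)

lemma rotation_graphs:
  fixes A A' :: "complex ^ 'n ^ 'n"
  shows "blk 0 (mat 1) (- mat 1) 0 ` graph_inf = (graph 0 :: 'n phase set)"
    and "A ** A' = mat 1 \<Longrightarrow> A' ** A = mat 1 \<Longrightarrow> blk 0 (mat 1) (- mat 1) 0 ` graph (- A') = graph A"
proof -
  define J :: "'n phase \<Rightarrow> 'n phase" where "J = blk 0 (mat 1) (- mat 1) 0"
  have J: "J v = (snd v, - fst v)" for v by (simp add: J_def blk_def mat_vec_minus)
  show "blk 0 (mat 1) (- mat 1) 0 ` graph_inf = (graph 0 :: 'n phase set)"
    unfolding J_def[symmetric]
  proof (intro equalityI subsetI)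
    fix u assume "u \<in> J ` graph_inf"
    then show "u \<in> graph 0" by (auto simp: J graph_iff graph_inf_iff)
  next
    fix u :: "'n phase" assume "u \<in> graph 0"
    then have "u = J (0, fst u)" by (simp add: J graph_iff prod_eq_iff)
    then show "u \<in> J ` graph_inf" by (metis fst_conv graph_inf_iff imageI)
  qed
  assume A: "A ** A' = mat 1" "A' ** A = (mat 1 :: complex ^ 'n ^ 'n)"
  show "blk 0 (mat 1) (- mat 1) 0 ` graph (- A') = graph A"
    unfolding J_def[symmetric]
  proof (intro equalityI subsetI)
    fix u assume "u \<in> J ` graph (- A')"
    then obtain v where v: "snd v = - (A' *v fst v)" "u = J v" by (auto simp: graph_iff mat_vec_minus)
    show "u \<in> graph A" unfolding v(2) J graph_iff by (simp add: v(1) vec.neg mat_inverse_apply[OF A(1)])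
  next
    fix u :: "'n phase" assume "u \<in> graph A"
    then have "u = J (- (A *v fst u), fst u)" by (simp add: J graph_iff prod_eq_iff)
    moreover have "(- (A *v fst u), fst u) \<in> graph (- A')"
      by (simp add: graph_iff mat_vec_minus vec.neg mat_inverse_apply[OF A(2)])
    ultimately show "u \<in> J ` graph (- A')" by blast
  qed
qed

text \<open>Exchanging \<open>K\<close> and \<open>K'\<close> replaces each matrix by minus its
  inverse. The Schur identity evaluates the resulting change as a difference of a function of
  \<open>B\<close> and the same function of \<open>A\<close>, so it cancels in a coboundary.\<close>

lemma rel_index_change:
  assumes S: "symplectic_map S" "S ` graph 0 = K'" "S ` graph_inf = K"
    and A: "hermitian A" "transv (graph A) (graph 0)" and B: "hermitian B" "transv (graph B) (graph 0)"
  shows "int (rel_index K (S ` graph A) (S ` graph B)) - int (rel_index K' (S ` graph A) (S ` graph B))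
    = int (mneg B) - int (mneg A)"
proof -
  obtain A' where A': "A ** A' = mat 1" "A' ** A = mat 1" by (rule transv_graph_0_inverse[OF A(2)])
  obtain B' where B': "B ** B' = mat 1" "B' ** B = mat 1" by (rule transv_graph_0_inverse[OF B(2)])
  define S' where "S' = S \<circ> blk 0 (mat 1) (- mat 1) 0"
  have S': "symplectic_map S'" "S' ` graph_inf = K'" "S' ` graph (- A') = S ` graph A" "S' ` graph (- B') = S ` graph B"
    unfolding S'_def using symplectic_comp[OF S(1) symplectic_rotation] S(2)
    by (simp_all only: image_comp[symmetric] rotation_graphs(1) rotation_graphs(2)[OF A'] rotation_graphs(2)[OF B'])
  have "rel_index K' (S ` graph A) (S ` graph B) = mneg (- B' - - A')"
    using rel_index_chart[OF S'(1,2), of "- A'" "- B'"] S'(3,4) hermitian_uminus[OF hermitian_inverse[OF A(1) A'(1)]]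
    by simp
  moreover have "rel_index K (S ` graph A) (S ` graph B) = mneg (B - A)"
    by (rule rel_index_chart[OF S(1,3) A(1)])
  ultimately show ?thesis using mneg_Schur[OF A(1) A' B(1) B'] by simp
qed

lemma triple_index_independent:
  assumes L: "P \<in> Lagr" "Q \<in> Lagr" "R \<in> Lagr" and K: "K \<in> Lagr" "K' \<in> (Lagr :: 'n::finite phase set set)"
    and t: "transv P K" "transv Q K" "transv R K" and t': "transv P K'" "transv Q K'" "transv R K'"
  shows "triple_index K P Q R = triple_index K' P Q R"
proof -
  have main: "triple_index K P Q R = triple_index K' P Q R"
    if K: "K \<in> Lagr" "K' \<in> Lagr" "transv K' K"
      and t: "transv P K" "transv Q K" "transv R K" and t': "transv P K'" "transv Q K'" "transv R K'"
    for K K' :: "'n phase set"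
  proof -
    obtain S where S: "symplectic_map S" "S ` graph 0 = K'" "S ` graph_inf = K"
      by (rule normal_form[OF K(2,1,3)])
    obtain A where A: "hermitian A" "S ` graph A = P" by (rule chart_exists[OF S(1,3) L(1) t(1)])
    obtain B where B: "hermitian B" "S ` graph B = Q" by (rule chart_exists[OF S(1,3) L(2) t(2)])
    obtain C where C: "hermitian C" "S ` graph C = R" by (rule chart_exists[OF S(1,3) L(3) t(3)])
    have "transv (graph A) (graph 0)" "transv (graph B) (graph 0)" "transv (graph C) (graph 0)"
      using t' unfolding A(2)[symmetric] B(2)[symmetric] C(2)[symmetric] S(2)[symmetric] symplectic_transv[OF S(1)] .
    then show ?thesis
      using rel_index_change[OF S A(1) _ B(1)] rel_index_change[OF S B(1) _ C(1)] rel_index_change[OF S A(1) _ C(1)]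
      unfolding triple_index_def A(2) B(2) C(2) by simp
  qed
  \<comment> \<open>The comparison requires the two planes at infinity to be transversal to each
    other, which \<open>K\<close> and \<open>K'\<close> need not be; a third plane transversal to
    all five mediates.\<close>
  obtain N where N: "N \<in> Lagr" "\<forall>L\<in>{P, Q, R, K, K'}. transv L N"
    by (rule common_transversal[of "{P, Q, R, K, K'}"]) (use L K in auto)
  have "triple_index N P Q R = triple_index K P Q R" by (rule main) (use N K t in auto)
  moreover have "triple_index N P Q R = triple_index K' P Q R" by (rule main) (use N K t' in auto)
  ultimately show ?thesis by simp
qed

text \<open>In a chart with \<open>P\<close> at the zero matrix the index is the excess in the
  subadditivity of the negative index for the sum of \<open>B\<close> and
  \<open>C - B\<close>.\<close>

lemma triple_index_bounds:
  assumes L: "P \<in> Lagr" "Q \<in> Lagr" "R \<in> Lagr" and K: "K \<in> (Lagr :: 'n::finite phase set set)"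
    and t: "transv P K" "transv Q K" "transv R K"
  shows "0 \<le> triple_index K P Q R" "triple_index K P Q R \<le> int (CARD('n))"
proof -
  obtain S where S: "symplectic_map S" "S ` graph 0 = P" "S ` graph_inf = K"
    by (rule normal_form[OF L(1) K t(1)])
  obtain B where B: "hermitian B" "S ` graph B = Q" by (rule chart_exists[OF S(1,3) L(2) t(2)])
  obtain C where C: "hermitian C" "S ` graph C = R" by (rule chart_exists[OF S(1,3) L(3) t(3)])
  have eq: "triple_index K P Q R = int (mneg B) + int (mneg (C - B)) - int (mneg C)"
    unfolding triple_index_def
    using rel_index_chart[OF S(1,3) hermitian_0, of B] rel_index_chart[OF S(1,3) B(1), of C]
      rel_index_chart[OF S(1,3) hermitian_0, of C] S(2) B(2) C(2) by simp
  have s: "- B + - (C - B) = - C" by simp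
  show "0 \<le> triple_index K P Q R"
    using mpos_add_le[OF hermitian_uminus[OF B(1)] hermitian_uminus[OF hermitian_diff[OF C(1) B(1)]]]
    unfolding eq s by simp
  show "triple_index K P Q R \<le> int (CARD('n))"
    using mpos_add_ge[of "- B" "- (C - B)"] unfolding eq s by simp
qed

text \<open>The choice of \<open>K\<close> is immaterial by \<open>triple_index_independent\<close>;
  \<open>restrict\<close> fixes the values outside Lagrangian triples as the extensional function
  space demands.\<close>

definition duis :: "'n phase set \<times> 'n phase set \<times> 'n::finite phase set \<Rightarrow> nat" where
  "duis = restrict (\<lambda>(P, Q, R). nat (triple_index
     (SOME K. K \<in> Lagr \<and> transv P K \<and> transv Q K \<and> transv R K) P Q R)) (Lagr \<times> Lagr \<times> Lagr)"

lemma duis_eq: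
  assumes L: "P \<in> Lagr" "Q \<in> Lagr" "R \<in> Lagr" and K: "K \<in> Lagr"
    and t: "transv P K" "transv Q K" "transv R K"
  shows "int (duis (P, Q, R)) = triple_index K P Q R"
proof -
  define N where "N = (SOME K. K \<in> Lagr \<and> transv P K \<and> transv Q K \<and> transv R K)"
  have "N \<in> Lagr \<and> transv P N \<and> transv Q N \<and> transv R N"
    unfolding N_def by (rule someI[of _ K]) (use K t in blast)
  then have "triple_index N P Q R = triple_index K P Q R"
    using triple_index_independent[OF L _ K] t by blast
  moreover have "duis (P, Q, R) = nat (triple_index N P Q R)"
    unfolding duis_def N_def using L by simp
  ultimately show ?thesis using triple_index_bounds(1)[OF L K t] by simp
qed

section \<open>Normalization and uniqueness of the Duistermaat index\<close>

lemma mneg_plus_mpos_inverse: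
  assumes "hermitian (A :: complex ^ 'n ^ 'n)" "A' ** A = mat 1"
  shows "mpos A + mneg A = CARD('n)"
proof -
  have "x = 0" if "A *v x = 0" for x
    using mat_inverse_apply[OF assms(2), of x] that by simp
  then have "mker A = {0}" unfolding mker_eq_0_iff by blast
  then show ?thesis using mpos_mneg_le[OF assms(1)] mpos_mneg_ge[OF assms(1)] by simp
qed

text \<open>The third plane is \<open>graph_inf\<close> itself, so the standard chart is not
  admissible. A common transversal is the graph of some \<open>C\<close> with \<open>C\<close> and
  \<open>D = C - A\<close> invertible; in the chart sending it to infinity the three planes have the
  matrices \<open>C'\<close>, \<open>D'\<close> and 0, and the Schur identity reduces the index to
  the negative index of \<open>C - D = A\<close>.\<close>

lemma duis_normalization:
  assumes A: "hermitian (A :: complex ^ 'n ^ 'n)"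
  shows "duis (graph 0, graph A, graph_inf) = mneg A"
proof -
  have L: "graph 0 \<in> Lagr" "graph A \<in> Lagr" "graph_inf \<in> Lagr"
    using graph_Lagr[OF hermitian_0] graph_Lagr[OF A] graph_inf_Lagr by blast+
  obtain K where K: "K \<in> Lagr" "\<forall>L\<in>{graph 0, graph A, graph_inf}. transv L K"
    by (rule common_transversal[of "{graph 0, graph A, graph_inf}"]) (use L in auto)
  have t: "transv (graph 0) K" "transv (graph A) K" "transv graph_inf K" using K(2) by blast+
  obtain C where C: "hermitian C" "K = graph C" by (rule Lagr_graph_exists[OF K(1) transv_sym[OF t(3)]])
  obtain C' where C': "C ** C' = mat 1" "C' ** C = mat 1"
    by (rule transv_graph_0_inverse[OF transv_sym[OF t(1)[unfolded C(2)]]])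
  define D where "D = C - A"
  have hD: "hermitian D" unfolding D_def by (rule hermitian_diff[OF C(1) A])
  have "transv (graph D) (graph 0)"
    using transv_sym[OF t(2)] unfolding C(2) transv_graphs D_def by simp
  then obtain D' where D': "D ** D' = mat 1" "D' ** D = mat 1" by (rule transv_graph_0_inverse)
  \<comment> \<open>It sends \<open>(0, y)\<close> to \<open>(- y, - C y)\<close>, hence infinity to
    \<open>graph C\<close>, and \<open>(x, 0)\<close> to \<open>(0, x)\<close>, hence the zero graph
    to infinity.\<close>
  define S where "S = blk 0 (- mat 1) (mat 1) (- C)"
  have S: "S v = (- snd v, fst v - C *v snd v)" for v by (simp add: S_def blk_def mat_vec_minus)
  have sS: "symplectic_map S"
    unfolding symplectic_map_def
    using C(1) by (simp add: S_def linear_blk)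
      (simp add: blk_def sympl_def mat_vec_minus cdot_minus_left cdot_minus_right cdot_diff_left
        cdot_diff_right hermitian_cdot_iff)
  have SK: "S ` graph_inf = K"
    unfolding C(2)
  proof (intro equalityI subsetI)
    fix u assume "u \<in> S ` graph_inf"
    then show "u \<in> graph C" by (auto simp: S graph_iff graph_inf_iff vec.neg)
  next
    fix u assume "u \<in> graph C"
    then have "u = S (0, - fst u)" by (simp add: S graph_iff prod_eq_iff vec.neg)
    then show "u \<in> S ` graph_inf" by (metis fst_conv graph_inf_iff imageI)
  qed
  \<comment> \<open>Inclusion is enough, since all Lagrangian planes have the same
    dimension.\<close>
  have SG: "S ` graph E = M" if "M \<in> Lagr" "\<And>x. S (x, E *v x) \<in> M" "hermitian E" for E M
  proof -
    have sub: "S ` graph E \<subseteq> M" using that(2) unfolding graph_def by blast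
    have M: "phase.subspace M" "phase.subspace (S ` graph E)"
      using Lagr_subspace[OF that(1)] Lagr_subspace[OF symplectic_Lagr[OF sS graph_Lagr[OF that(3)]]] .
    show ?thesis
      using phasefd.subspace_dim_equal[OF M(2,1) sub] dim_Lagr[OF that(1)]
        dim_Lagr[OF symplectic_Lagr[OF sS graph_Lagr[OF that(3)]]] by simp
  qed
  have hC': "hermitian C'" and hD': "hermitian D'"
    using hermitian_inverse C(1) C'(1) hD D'(1) by blast+
  have S1: "S ` graph C' = graph 0"
    by (rule SG[OF L(1) _ hC']) (simp add: S graph_iff mat_inverse_apply[OF C'(1)])
  have S2: "S ` graph D' = graph A"
  proof (rule SG[OF L(2) _ hD'])
    fix x
    have "x = C *v (D' *v x) - A *v (D' *v x)"
      using mat_inverse_apply[OF D'(1), of x] by (simp add: D_def matrix_vector_mult_diff_rdistrib)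
    then show "S (x, D' *v x) \<in> graph A" by (simp add: S graph_iff vec.neg algebra_simps)
  qed
  have S3: "S ` graph 0 = graph_inf"
    by (rule SG[OF L(3) _ hermitian_0]) (simp add: S graph_inf_iff)
  have "int (duis (graph 0, graph A, graph_inf)) = triple_index K (graph 0) (graph A) graph_inf"
    by (rule duis_eq[OF L K(1) t])
  also have "\<dots> = int (mneg (D' - C')) + int (mpos D') - int (mpos C')"
    unfolding triple_index_def
    using rel_index_chart[OF sS SK hC', of D'] rel_index_chart[OF sS SK hD', of 0] rel_index_chart[OF sS SK hC', of 0]
    unfolding S1 S2 S3 by simp
  also have "\<dots> = int (mneg A)"
  proof -
    have "mneg (C - D) + mneg D = mneg C + mneg (D' - C')" by (rule mneg_Schur[OF hD D' C(1) C'])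
    moreover have "C - D = A" by (simp add: D_def)
    ultimately show ?thesis
      using mpos_inverse[OF hD D'] mpos_inverse[OF C(1) C'] mneg_plus_mpos_inverse[OF hD D'(2)]
        mneg_plus_mpos_inverse[OF C(1) C'(2)] by simp
  qed
  finally show ?thesis by simp
qed

lemma is_duistermaat_index_duis: "is_duistermaat_index (duis :: 'n phase set \<times> 'n phase set \<times> 'n::finite phase set \<Rightarrow> nat)"
  unfolding is_duistermaat_index_def
proof (intro conjI allI impI ballI)
  show "(duis :: 'n phase set \<times> 'n phase set \<times> 'n phase set \<Rightarrow> nat) \<in> (Lagr \<times> Lagr \<times> Lagr) \<rightarrow>\<^sub>E {0..CARD('n)}"
  proof (rule PiE_I)
    fix p :: "'n phase set \<times> 'n phase set \<times> 'n phase set" assume p: "p \<in> Lagr \<times> Lagr \<times> Lagr"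
    obtain P Q R where PQR: "p = (P, Q, R)" by (cases p)
    then have L: "P \<in> Lagr" "Q \<in> Lagr" "R \<in> Lagr" using p by auto
    obtain K where K: "K \<in> Lagr" "\<forall>L\<in>{P, Q, R}. transv L K"
      by (rule common_transversal[of "{P, Q, R}"]) (use L in auto)
    then show "duis p \<in> {0..CARD('n)}"
      using duis_eq[OF L K(1)] triple_index_bounds(2)[OF L K(1)] unfolding PQR by simp
  next
    fix p :: "'n phase set \<times> 'n phase set \<times> 'n phase set" assume "p \<notin> Lagr \<times> Lagr \<times> Lagr"
    then show "duis p = undefined" unfolding duis_def restrict_def by simp
  qed
  show "duis (graph 0, graph A, graph_inf) = mat_n_neg A" if "hermitian A" for A :: "complex ^ 'n ^ 'n"
    using duis_normalization[OF that] mat_n_neg_eq_mneg[OF that] by simp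
  show "duis (T ` L1, T ` L2, T ` L3) = duis (L1, L2, L3)"
    if T: "symplectic_map T" and L: "L1 \<in> Lagr" "L2 \<in> Lagr" "L3 \<in> Lagr" for T and L1 L2 L3 :: "'n phase set"
  proof -
    obtain K where K: "K \<in> Lagr" "\<forall>L\<in>{L1, L2, L3}. transv L K"
      by (rule common_transversal[of "{L1, L2, L3}"]) (use L in auto)
    have t: "transv L1 K" "transv L2 K" "transv L3 K" using K(2) by blast+
    have "int (duis (T ` L1, T ` L2, T ` L3)) = triple_index (T ` K) (T ` L1) (T ` L2) (T ` L3)"
      by (rule duis_eq) (use L K(1) t in \<open>simp_all add: symplectic_Lagr[OF T] symplectic_transv[OF T]\<close>)
    also have "\<dots> = triple_index K L1 L2 L3"
      unfolding triple_index_def using rel_index_symplectic[OF T K(1)] L t by simp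
    also have "\<dots> = int (duis (L1, L2, L3))" using duis_eq[OF L K(1) t] by simp
    finally show ?thesis by simp
  qed
  show "int (duis (L1, L2, L3)) - int (duis (L1, L2, L4)) + int (duis (L1, L3, L4)) - int (duis (L2, L3, L4)) = 0"
    if L: "L1 \<in> Lagr" "L2 \<in> Lagr" "L3 \<in> Lagr" "L4 \<in> Lagr" for L1 L2 L3 L4 :: "'n phase set"
  proof -
    obtain K where K: "K \<in> Lagr" "\<forall>L\<in>{L1, L2, L3, L4}. transv L K"
      by (rule common_transversal[of "{L1, L2, L3, L4}"]) (use L in auto)
    have t: "transv L1 K" "transv L2 K" "transv L3 K" "transv L4 K" using K(2) by blast+
    show ?thesis
      using duis_eq[OF L(1,2,3) K(1) t(1,2,3)] duis_eq[OF L(1,2,4) K(1) t(1,2,4)]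
        duis_eq[OF L(1,3,4) K(1) t(1,3,4)] duis_eq[OF L(2,3,4) K(1) t(2,3,4)]
      unfolding triple_index_def by simp
  qed
qed

text \<open>If the third plane is transversal to the first two, a symplectic normal form brings the
  triple to the one in the normalization axiom. For general triples the cocycle identity with a
  common transversal as fourth plane leaves only terms of that kind.\<close>

lemma duistermaat_index_unique:
  fixes i j :: "'n phase set \<times> 'n phase set \<times> 'n::finite phase set \<Rightarrow> nat"
  assumes i: "is_duistermaat_index i" and j: "is_duistermaat_index j"
  shows "i = j"
proof -
  have norm: "k (P, Q, K) = mat_n_neg A"
    if k: "is_duistermaat_index k" and S: "symplectic_map S" "S ` graph 0 = P" "S ` graph_inf = K"
      and A: "hermitian A" "S ` graph A = Q" for k :: "'n phase set \<times> 'n phase set \<times> 'n phase set \<Rightarrow> nat"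
      and P Q K S A
  proof -
    have "k (S ` graph 0, S ` graph A, S ` graph_inf) = k (graph 0, graph A, graph_inf)"
      using k S(1) graph_Lagr[OF A(1)] graph_Lagr[OF hermitian_0] graph_inf_Lagr
      unfolding is_duistermaat_index_def by blast
    also have "\<dots> = mat_n_neg A" using k A(1) unfolding is_duistermaat_index_def by blast
    finally show ?thesis using S A by simp
  qed
  have chart: "i (P, Q, K) = j (P, Q, K)"
    if L: "P \<in> Lagr" "Q \<in> Lagr" "K \<in> Lagr" and t: "transv P K" "transv Q K" for P Q K
  proof -
    obtain S where S: "symplectic_map S" "S ` graph 0 = P" "S ` graph_inf = K"
      by (rule normal_form[OF L(1,3) t(1)])
    obtain A where A: "hermitian A" "S ` graph A = Q" by (rule chart_exists[OF S(1,3) L(2) t(2)])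
    show ?thesis using norm[OF i S A] norm[OF j S A] by simp
  qed
  have cocycle: "int (k (P, Q, R)) = int (k (P, Q, K)) - int (k (P, R, K)) + int (k (Q, R, K))"
    if "is_duistermaat_index k" "P \<in> Lagr" "Q \<in> Lagr" "R \<in> Lagr" "K \<in> Lagr"
    for k :: "'n phase set \<times> 'n phase set \<times> 'n phase set \<Rightarrow> nat" and P Q R K
  proof -
    have "int (k (P, Q, R)) - int (k (P, Q, K)) + int (k (P, R, K)) - int (k (Q, R, K)) = 0"
      using that unfolding is_duistermaat_index_def by blast
    then show ?thesis by simp
  qed
  have eq: "i (P, Q, R) = j (P, Q, R)" if L: "P \<in> Lagr" "Q \<in> Lagr" "R \<in> Lagr" for P Q R
  proof -
    obtain K where K: "K \<in> Lagr" "\<forall>L\<in>{P, Q, R}. transv L K"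
      by (rule common_transversal[of "{P, Q, R}"]) (use L in auto)
    have t: "transv P K" "transv Q K" "transv R K" using K(2) by blast+
    show ?thesis
      using cocycle[OF i L K(1)] cocycle[OF j L K(1)] chart[OF L(1,2) K(1) t(1,2)]
        chart[OF L(1,3) K(1) t(1,3)] chart[OF L(2,3) K(1) t(2,3)] by simp
  qed
  have ext: "i \<in> (Lagr \<times> Lagr \<times> Lagr) \<rightarrow>\<^sub>E {0..CARD('n)}" "j \<in> (Lagr \<times> Lagr \<times> Lagr) \<rightarrow>\<^sub>E {0..CARD('n)}"
    using i j unfolding is_duistermaat_index_def by blast+
  show ?thesis by (rule PiE_ext[OF ext]) (use eq in auto)
qed

section \<open>The Duistermaat index in charts\<close>

definition iota :: "'n phase set \<Rightarrow> 'n phase set \<Rightarrow> 'n::finite phase set \<Rightarrow> int" where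
  "iota P Q R = int (duistermaat_index (P, Q, R))"

lemma is_duistermaat_index: "is_duistermaat_index duistermaat_index"
  unfolding duistermaat_index_def
  by (rule theI[of _ duis]) (use is_duistermaat_index_duis duistermaat_index_unique in auto)

lemma iota_cocycle:
  "P \<in> Lagr \<Longrightarrow> Q \<in> Lagr \<Longrightarrow> R \<in> Lagr \<Longrightarrow> K \<in> Lagr \<Longrightarrow> iota P Q R - iota P Q K + iota P R K - iota Q R K = 0"
  using is_duistermaat_index unfolding is_duistermaat_index_def iota_def by blast

lemma duistermaat_index_eq_duis: "duistermaat_index = duis"
  using duistermaat_index_unique[OF is_duistermaat_index is_duistermaat_index_duis] .

lemma iota_triple_chart:
  assumes S: "symplectic_map S" "S ` graph_inf \<in> Lagr"
    and A: "hermitian A" "hermitian B" "hermitian C"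
  shows "iota (S ` graph A) (S ` graph B) (S ` graph C) = int (mneg (B - A)) + int (mneg (C - B)) - int (mneg (C - A))"
proof -
  have L: "S ` graph E \<in> Lagr" if "hermitian E" for E by (rule symplectic_Lagr[OF S(1) graph_Lagr[OF that]])
  have t: "transv (S ` graph E) (S ` graph_inf)" for E unfolding symplectic_transv[OF S(1)] by (rule transv_graph_inf)
  show ?thesis
    unfolding iota_def duistermaat_index_eq_duis duis_eq[OF L[OF A(1)] L[OF A(2)] L[OF A(3)] S(2) t t t]
      triple_index_def rel_index_chart[OF S(1) refl A(1)] rel_index_chart[OF S(1) refl A(2)] ..
qed

text \<open>In a chart the terms for the pairs \<open>P\<close>, \<open>Q\<close> cancel and the
  remaining one is the negative index of the zero matrix. This equality is what makes
  \<open>L1\<close> the right reference plane for the lower bound.\<close>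

lemma iota_degenerate:
  assumes "P \<in> Lagr" "Q \<in> Lagr" shows "iota P Q Q = 0"
proof -
  obtain K where K: "K \<in> Lagr" "\<forall>L\<in>{P, Q}. transv L K"
    by (rule common_transversal[of "{P, Q}"]) (use assms in auto)
  then have t: "transv P K" "transv Q K" by blast+
  obtain S where S: "symplectic_map S" "S ` graph 0 = P" "S ` graph_inf = K"
    by (rule normal_form[OF assms(1) K(1) t(1)])
  obtain B where B: "hermitian B" "S ` graph B = Q" by (rule chart_exists[OF S(1,3) assms(2) t(2)])
  have "mneg (0 :: complex ^ 'a ^ 'a) = 0"
    using mpos_le[OF subspace_horiz subset_refl, of "0 :: complex ^ 'a ^ 'a"] by (simp add: mat_form_def dim_horiz)
  then show ?thesis
    using iota_triple_chart[OF S(1) _ hermitian_0 B(1) B(1)] S K(1) B(2) by simp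
qed

text \<open>The third plane lies at infinity, out of reach of \<open>iota_triple_chart\<close>. A
  shear fixing infinity moves the graph of \<open>A\<close> to the zero graph, where the
  normalization axiom applies.\<close>

lemma iota_chart:
  assumes S: "symplectic_map S" "S ` graph_inf = K" "K \<in> Lagr" and A: "hermitian (A :: complex ^ 'n ^ 'n)" and B: "hermitian B"
  shows "iota (S ` graph A) (S ` graph B) K = int (mneg (B - A))"
proof -
  define S' where "S' = S \<circ> blk (mat 1) 0 A (mat 1)"
  have Tv: "blk (mat 1) 0 A (mat 1) v = (fst v, A *v fst v + snd v)" for v by (simp add: blk_def)
  have "symplectic_map (blk (mat 1) 0 A (mat 1))"
    unfolding symplectic_map_def using A
    by (simp add: linear_blk) (simp add: blk_def sympl_def cdot_add_right cdot_add_left hermitian_cdot_iff)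
  then have S': "symplectic_map S'" unfolding S'_def by (rule symplectic_comp[OF S(1)])
  have g: "blk (mat 1) 0 A (mat 1) ` graph E = graph (A + E)" for E
  proof (intro equalityI subsetI)
    fix u assume "u \<in> blk (mat 1) 0 A (mat 1) ` graph E"
    then show "u \<in> graph (A + E)" by (auto simp: Tv graph_iff matrix_vector_mult_add_rdistrib)
  next
    fix u assume "u \<in> graph (A + E)"
    then have "u = blk (mat 1) 0 A (mat 1) (fst u, E *v fst u)"
      by (simp add: Tv graph_iff prod_eq_iff matrix_vector_mult_add_rdistrib)
    then show "u \<in> blk (mat 1) 0 A (mat 1) ` graph E" by (metis fst_conv graph_iff imageI snd_conv)
  qed
  have gi: "blk (mat 1) 0 A (mat 1) ` graph_inf = (graph_inf :: 'n phase set)"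
  proof (intro equalityI subsetI)
    fix u assume "u \<in> blk (mat 1) 0 A (mat 1) ` graph_inf"
    then show "u \<in> graph_inf" by (auto simp: Tv graph_inf_iff)
  next
    fix u :: "'n phase" assume "u \<in> graph_inf"
    then have "u = blk (mat 1) 0 A (mat 1) u" by (simp add: Tv graph_inf_iff prod_eq_iff)
    then show "u \<in> blk (mat 1) 0 A (mat 1) ` graph_inf" using \<open>u \<in> graph_inf\<close> by blast
  qed
  have im: "S' ` graph 0 = S ` graph A" "S' ` graph (B - A) = S ` graph B" "S' ` graph_inf = K"
    unfolding S'_def image_comp[symmetric] g gi using S(2) by simp_all
  have h: "hermitian (B - A)" by (rule hermitian_diff[OF B A])
  have "duistermaat_index (S' ` graph 0, S' ` graph (B - A), S' ` graph_inf)
      = duistermaat_index (graph 0, graph (B - A), graph_inf)"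
    using is_duistermaat_index S' graph_Lagr[OF h] graph_Lagr[OF hermitian_0] graph_inf_Lagr
    unfolding is_duistermaat_index_def by blast
  also have "\<dots> = mneg (B - A)" unfolding duistermaat_index_eq_duis by (rule duis_normalization[OF h])
  finally show ?thesis unfolding iota_def im by simp
qed

section \<open>Charts and the topology of the Lagrangian Grassmannian\<close>

subsection \<open>Smoothness of matrix inversion\<close>

text \<open>Cramer's rule: the entries are rational functions of those of \<open>A\<close>, so
  smoothness where the determinant is nonzero follows from that of determinants.\<close>

definition cinv :: "complex ^ 'n ^ 'n \<Rightarrow> complex ^ 'n ^ 'n" where
  "cinv A = (\<chi> i j. det (\<chi> k l. if l = i then (if k = j then 1 else 0) else A $ k $ l) / det A)"

lemma mat_vec_axis: "A *v axis j 1 = (\<chi> i. A $ i $ j)" for A :: "complex ^ 'n ^ 'm"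
  by (simp add: matrix_vector_mult_def vec_eq_iff axis_def if_distrib[of "\<lambda>a. _ * a"] cong: if_cong)

lemma cinv:
  fixes A :: "complex ^ 'n ^ 'n"
  assumes "det A \<noteq> 0"
  shows "A ** cinv A = mat 1" "cinv A ** A = mat 1"
proof -
  have "A *v (cinv A *v axis j 1) = axis j 1" for j
  proof -
    have ax: "(axis j 1 :: complex ^ 'n) $ i = (if i = j then 1 else 0)" for i by (simp add: axis_def)
    have "cinv A *v axis j 1 = (\<chi> i. cinv A $ i $ j)"
      by (rule mat_vec_axis)
    also have "\<dots> = (\<chi> k. det (\<chi> i l. if l = k then axis j 1 $ i else A $ i $ l) / det A)"
      by (simp only: cinv_def vec_lambda_beta ax)
    finally show ?thesis using cramer[OF assms] by blast
  qed
  then have "(A ** cinv A) *v axis j 1 = mat 1 *v axis j 1" for j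
    by (simp flip: matrix_vector_mul_assoc)
  then show 1: "A ** cinv A = mat 1"
    by (simp add: vec_eq_iff mat_vec_axis)
  then show "cinv A ** A = mat 1" by (simp add: matrix_left_right_inverse)
qed

lemma differentiable_vec:
  fixes f :: "'a::real_normed_vector \<Rightarrow> 'b::euclidean_space ^ 'n"
  assumes "\<And>i. (\<lambda>x. f x $ i) differentiable (at a within S)"
  shows "f differentiable (at a within S)"
proof -
  have "(\<lambda>x. \<Sum>i\<in>UNIV. axis i (f x $ i)) differentiable (at a within S)"
  proof (intro differentiable_sum finite ballI)
    fix i :: 'n
    have bl: "bounded_linear (axis i :: 'b \<Rightarrow> 'b ^ 'n)"
      by (intro linear_conv_bounded_linear[THEN iffD1] linearI) (simp_all add: axis_def vec_eq_iff)
    obtain D where "((\<lambda>x. f x $ i) has_derivative D) (at a within S)"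
      using assms[of i] unfolding differentiable_def by blast
    from bounded_linear.has_derivative[OF bl this]
    show "(\<lambda>x. axis i (f x $ i)) differentiable (at a within S)" unfolding differentiable_def by blast
  qed
  moreover have "(\<Sum>i\<in>UNIV. axis i (f x $ i)) = f x" for x
    by (simp add: vec_eq_iff axis_def if_distrib cong: if_cong)
  ultimately show ?thesis by simp
qed

lemma differentiable_component:
  fixes f :: "'a::real_normed_vector \<Rightarrow> complex ^ 'n ^ 'm"
  assumes "f differentiable (at a within S)"
  shows "(\<lambda>x. f x $ i $ j) differentiable (at a within S)"
proof -
  have bl: "bounded_linear (\<lambda>A :: complex ^ 'n ^ 'm. A $ i $ j)"
    by (rule bounded_linear_compose[OF bounded_linear_vec_nth bounded_linear_vec_nth])
  obtain D where "(f has_derivative D) (at a within S)" using assms unfolding differentiable_def by blast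
  from bounded_linear.has_derivative[OF bl this] show ?thesis unfolding differentiable_def by blast
qed

lemma differentiable_det:
  fixes f :: "'a::real_normed_vector \<Rightarrow> complex ^ 'n ^ 'n"
  assumes "\<And>i j. (\<lambda>x. f x $ i $ j) differentiable (at a within S)"
  shows "(\<lambda>x. det (f x)) differentiable (at a within S)"
proof -
  have "(\<lambda>x. \<Prod>i\<in>UNIV. f x $ i $ p i) differentiable (at a within S)" for p
  proof -
    have "\<forall>i. \<exists>D. ((\<lambda>x. f x $ i $ p i) has_derivative D) (at a within S)"
      using assms unfolding differentiable_def by blast
    then obtain D where D: "\<forall>i. ((\<lambda>x. f x $ i $ p i) has_derivative D i) (at a within S)"
      by (rule choice[THEN exE])
    have "((\<lambda>x. \<Prod>i\<in>UNIV. f x $ i $ p i) has_derivative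
        (\<lambda>y. \<Sum>i\<in>UNIV. D i y * (\<Prod>j\<in>UNIV - {i}. f a $ j $ p j))) (at a within S)"
      by (rule has_derivative_prod) (use D in blast)
    then show ?thesis unfolding differentiable_def by blast
  qed
  then show ?thesis unfolding det_def by (intro differentiable_sum) simp_all
qed

lemma differentiable_cinv:
  fixes f :: "'a::real_normed_vector \<Rightarrow> complex ^ 'n ^ 'n"
  assumes f: "f differentiable (at a within S)" and nz: "det (f a) \<noteq> 0"
  shows "(\<lambda>x. cinv (f x)) differentiable (at a within S)"
proof (intro differentiable_vec)
  fix i j
  note c = differentiable_component[OF f]
  show "(\<lambda>x. cinv (f x) $ i $ j) differentiable at a within S"
    unfolding cinv_def vec_lambda_beta
  proof (intro differentiable_divide differentiable_det nz)
    fix k l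
    show "(\<lambda>x. (\<chi> k l. if l = i then if k = j then 1 else 0 else f x $ k $ l) $ k $ l) differentiable at a within S"
      using c by (cases "l = i"; cases "k = j") simp_all
  qed (rule c)
qed

lemma matrix_mult_bounded_bilinear:
  "bounded_bilinear ((**) :: complex ^ 'n ^ 'm \<Rightarrow> complex ^ 'p ^ 'n \<Rightarrow> complex ^ 'p ^ 'm)"
proof -
  have "bilinear ((**) :: complex ^ 'n ^ 'm \<Rightarrow> complex ^ 'p ^ 'n \<Rightarrow> complex ^ 'p ^ 'm)"
    unfolding bilinear_def
    by (intro conjI allI linearI)
      (simp_all add: matrix_matrix_mult_def vec_eq_iff algebra_simps sum.distrib scaleR_sum_right)
  then show ?thesis by (simp add: bilinear_conv_bounded_bilinear)
qed

lemma differentiable_matrix_mult: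
  fixes f :: "'a::real_normed_vector \<Rightarrow> complex ^ 'n ^ 'm" and g :: "'a \<Rightarrow> complex ^ 'p ^ 'n"
  assumes "f differentiable (at a within S)" "g differentiable (at a within S)"
  shows "(\<lambda>x. f x ** g x) differentiable (at a within S)"
proof -
  obtain D E where "(f has_derivative D) (at a within S)" "(g has_derivative E) (at a within S)"
    using assms unfolding differentiable_def by blast
  from bounded_bilinear.FDERIV[OF matrix_mult_bounded_bilinear this]
  show ?thesis unfolding differentiable_def by blast
qed

subsection \<open>Charts\<close>

definition chart :: "('n phase \<Rightarrow> 'n phase) \<Rightarrow> 'n::finite phase set \<Rightarrow> complex ^ 'n ^ 'n" where
  "chart S L = (THE A. S ` graph A = L)"

lemma chart_graph: "symplectic_map S \<Longrightarrow> chart S (S ` graph A) = A"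
  unfolding chart_def by (simp add: inj_image_eq_iff[OF symplectic_inj] graph_eq_iff)

lemma chart_transv:
  assumes S: "symplectic_map S" "S ` graph_inf = N" and L: "L \<in> Lagr" "transv L N"
  shows "hermitian (chart S L)" "S ` graph (chart S L) = L"
proof -
  obtain A where "hermitian A" "S ` graph A = L" by (rule chart_exists[OF S L])
  then show "hermitian (chart S L)" "S ` graph (chart S L) = L" using chart_graph[OF S(1), of A] by simp_all
qed

text \<open>In the coordinates of \<open>S\<close> the frame becomes a pair whose first half is
  invertible exactly when the plane is transversal to the image of infinity. Both the domain and the
  values of a chart are thereby explicit functions of an arbitrary frame.\<close>

lemma chart_frame:
  assumes S: "symplectic_map S" "inv S = blk P Q R U" and F: "is_frame X Y L" and L: "L \<in> Lagr"
  shows "transv L (S ` graph_inf) \<longleftrightarrow> det (P ** X + Q ** Y) \<noteq> 0"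
    and "transv L (S ` graph_inf) \<Longrightarrow> chart S L = (R ** X + U ** Y) ** cinv (P ** X + Q ** Y)"
proof -
  have inv: "inv S (frame_map X Y x) = frame_map (P ** X + Q ** Y) (R ** X + U ** Y) x" for x
    unfolding S(2) by (simp add: blk_def frame_map_def matrix_vector_mult_add_rdistrib flip: matrix_vector_mul_assoc)
  have FL: "frame_map X Y x \<in> L" for x using F unfolding is_frame_def by blast
  have GL: "S ` graph_inf \<in> Lagr" by (rule symplectic_Lagr[OF S(1) graph_inf_Lagr])
  show iff: "transv L (S ` graph_inf) \<longleftrightarrow> det (P ** X + Q ** Y) \<noteq> 0"
  proof
    assume t: "transv L (S ` graph_inf)"
    show "det (P ** X + Q ** Y) \<noteq> 0"
      unfolding mat_ker_trivial_iff[symmetric]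
    proof (intro allI impI)
      fix x assume "(P ** X + Q ** Y) *v x = 0"
      then have "inv S (frame_map X Y x) \<in> graph_inf" unfolding inv by (simp add: frame_map_def graph_inf_iff)
      then have "S (inv S (frame_map X Y x)) \<in> S ` graph_inf" by blast
      then have "frame_map X Y x = 0"
        using transvD[OF t FL] symplectic_inv_apply(1)[OF S(1)] by simp
      then show "x = 0" using F unfolding is_frame_def is_frame_inj_iff by blast
    qed
  next
    assume d: "det (P ** X + Q ** Y) \<noteq> 0"
    show "transv L (S ` graph_inf)"
    proof (rule transvI[OF L GL])
      fix u assume u: "u \<in> L" "u \<in> S ` graph_inf"
      obtain x where x: "u = frame_map X Y x" using F u(1) unfolding is_frame_def by blast
      obtain v where v: "v \<in> graph_inf" "u = S v" using u(2) by blast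
      have "inv S (frame_map X Y x) = v" using symplectic_inv_apply(2)[OF S(1)] v(2) x by metis
      then have "(P ** X + Q ** Y) *v x = 0" using v(1) unfolding inv by (auto simp: graph_inf_iff frame_map_def)
      then have "x = 0" using d unfolding mat_ker_trivial_iff[symmetric] by blast
      then show "u = 0" using x by (simp add: frame_map_linear)
    qed
  qed
  assume t: "transv L (S ` graph_inf)"
  obtain A where A: "S ` graph A = L" using chart_transv(2)[OF S(1) refl L t] by blast
  let ?X = "P ** X + Q ** Y" and ?Y = "R ** X + U ** Y"
  have "A *v y = (?Y ** cinv ?X) *v y" for y
  proof -
    define x where "x = cinv ?X *v y"
    have Xx: "?X *v x = y" unfolding x_def using cinv(1) iff t by (intro mat_inverse_apply) blast
    have "inv S (frame_map X Y x) \<in> graph A"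
      using FL[of x] symplectic_inv_apply(4)[OF S(1), of "graph A"] unfolding A by blast
    then have "?Y *v x = A *v y" unfolding inv using Xx by (simp add: graph_iff frame_map_def)
    then show ?thesis by (simp add: x_def flip: matrix_vector_mul_assoc)
  qed
  then have "A = ?Y ** cinv ?X" by (simp add: matrix_eq)
  then show "chart S L = ?Y ** cinv ?X" using chart_graph[OF S(1), of A] A by simp
qed

lemma bounded_linear_lcomb:
  "bounded_linear (\<lambda>p :: (complex ^ 'n ^ 'n) \<times> (complex ^ 'n ^ 'n). P ** fst p + Q ** snd p)"
  by (rule bounded_linear_add
      bounded_linear_compose[OF bounded_bilinear.bounded_linear_right[OF matrix_mult_bounded_bilinear] bounded_linear_fst]
      bounded_linear_compose[OF bounded_bilinear.bounded_linear_right[OF matrix_mult_bounded_bilinear] bounded_linear_snd])+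

section \<open>Open charts and continuous frames\<close>

lemma topspace_Lagr_topology: "topspace (Lagr_topology :: 'n::finite phase set topology) = Lagr"
proof -
  have "{(X, Y) \<in> Lagr_frames. range (frame_map X Y) \<in> Lagr} = (Lagr_frames :: ((complex ^ 'n ^ 'n) \<times> _) set)"
    unfolding Lagr_frames_def is_frame_def by blast
  then have "openin (Lagr_topology :: 'n phase set topology) Lagr"
    unfolding openin_Lagr_topology by (simp only: openin_subtopology_self simp_thms subset_refl)
  then have "Lagr \<subseteq> topspace (Lagr_topology :: 'n phase set topology)" by (rule openin_subset)
  moreover have "topspace (Lagr_topology :: 'n phase set topology) \<subseteq> Lagr"
    using openin_topspace[of "Lagr_topology :: 'n phase set topology"] unfolding openin_Lagr_topology by blast
  ultimately show ?thesis by blast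
qed

text \<open>In the quotient topology the claim concerns the set of frames, where the chart is a
  continuous map on the open set of nonvanishing determinant.\<close>

lemma openin_chart:
  assumes S: "symplectic_map S" "S ` graph_inf = N" and U: "open U"
  shows "openin Lagr_topology {L\<in>Lagr. transv L N \<and> chart S L \<in> U}"
proof -
  obtain P Q R V where blk: "inv S = blk P Q R V"
    by (rule linear_is_blk[OF symplectic_linear[OF symplectic_inv[OF S(1)]]])
  define d where "d = (\<lambda>p :: (complex ^ 'a ^ 'a) \<times> (complex ^ 'a ^ 'a). P ** fst p + Q ** snd p)"
  define e where "e = (\<lambda>p :: (complex ^ 'a ^ 'a) \<times> (complex ^ 'a ^ 'a). (R ** fst p + V ** snd p) ** cinv (d p))"
  define W where "W = {p. det (d p) \<noteq> 0}"
  have dd: "d differentiable (at p)" for p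
    unfolding d_def by (rule bounded_linear_imp_differentiable[OF bounded_linear_lcomb])
  have "continuous (at p) (\<lambda>p. det (d p))" for p
    by (rule differentiable_imp_continuous_within) (intro differentiable_det differentiable_component dd)
  then have "continuous_on UNIV (\<lambda>p. det (d p))" by (simp add: continuous_at_imp_continuous_on)
  then have oW: "open W" unfolding W_def
    using open_Collect_neq[of "\<lambda>p. det (d p)" "\<lambda>p. 0"] by simp
  have "continuous (at p) e" if "p \<in> W" for p
    unfolding e_def
    by (rule differentiable_imp_continuous_within)
      (intro differentiable_matrix_mult differentiable_cinv dd bounded_linear_imp_differentiable bounded_linear_lcomb
        that[unfolded W_def mem_Collect_eq])
  then have "continuous_on W e" by (simp add: continuous_at_imp_continuous_on)
  then have o: "open (W \<inter> e -` U)" by (rule continuous_open_preimage[OF _ oW U])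
  have "(case p of (X, Y) \<Rightarrow> (X, Y) \<in> Lagr_frames \<and> range (frame_map X Y) \<in> {L\<in>Lagr. transv L N \<and> chart S L \<in> U})
    \<longleftrightarrow> p \<in> Lagr_frames \<inter> (W \<inter> e -` U)" for p
  proof (cases "p \<in> Lagr_frames")
    case True
    obtain X Y where p: "p = (X, Y)" by (cases p)
    then obtain L where L: "L \<in> Lagr" "is_frame X Y L" using True unfolding Lagr_frames_def by blast
    then have r: "range (frame_map X Y) = L" unfolding is_frame_def by blast
    show ?thesis
      using chart_frame[OF S(1) blk L(2,1)] L(1) True unfolding p S(2) W_def d_def e_def
      by (auto simp: r)
  qed (cases p, simp)
  then have "{(X, Y) \<in> Lagr_frames. range (frame_map X Y) \<in> {L\<in>Lagr. transv L N \<and> chart S L \<in> U}}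
    = Lagr_frames \<inter> (W \<inter> e -` U)" by (simp add: set_eq_iff)
  then show ?thesis unfolding openin_Lagr_topology using o by auto
qed

lemma openin_transv:
  assumes "N \<in> Lagr" shows "openin Lagr_topology {L\<in>Lagr. transv L N}"
proof -
  obtain K where K: "K \<in> Lagr" "\<forall>L\<in>{N}. transv L K"
    by (rule common_transversal[of "{N}"]) (use assms in auto)
  obtain S where S: "symplectic_map S" "S ` graph 0 = K" "S ` graph_inf = N"
    by (rule normal_form[OF K(1) assms]) (use K(2) transv_sym in blast)
  show ?thesis using openin_chart[OF S(1,3) open_UNIV] by simp
qed

text \<open>Immediate from the quotient topology; this is the way in which all paths and homotopies
  below are shown to be continuous.\<close>

lemma continuous_map_frames:
  fixes \<gamma> :: "'a::topological_space \<Rightarrow> 'n::finite phase set"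
  assumes "continuous_on T X" "continuous_on T Y"
    and F: "\<And>t. t \<in> T \<Longrightarrow> \<gamma> t \<in> Lagr" "\<And>t. t \<in> T \<Longrightarrow> is_frame (X t) (Y t) (\<gamma> t)"
  shows "continuous_map (top_of_set T) Lagr_topology \<gamma>"
  unfolding continuous_map_def
proof (intro conjI allI impI)
  show "\<gamma> \<in> topspace (top_of_set T) \<rightarrow> topspace Lagr_topology"
    using F(1) by (simp add: topspace_Lagr_topology Pi_iff)
  fix U :: "'n phase set set" assume U: "openin Lagr_topology U"
  let ?p = "\<lambda>t. (X t, Y t)"
  have c: "continuous_on T ?p" by (rule continuous_on_Pair[OF assms(1,2)])
  have im: "?p \<in> T \<rightarrow> Lagr_frames" using F unfolding Lagr_frames_def by blast
  have "openin (top_of_set T) (T \<inter> ?p -` {(X, Y) \<in> Lagr_frames. range (frame_map X Y) \<in> U})"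
    using U c im unfolding openin_Lagr_topology by (intro continuous_openin_preimage[of _ _ Lagr_frames]) auto
  moreover have "T \<inter> ?p -` {(X, Y) \<in> Lagr_frames. range (frame_map X Y) \<in> U} = {x \<in> topspace (top_of_set T). \<gamma> x \<in> U}"
    using F im by (auto simp: is_frame_def Pi_iff)
  ultimately show "openin (top_of_set T) {x \<in> topspace (top_of_set T). \<gamma> x \<in> U}" by simp
qed

text \<open>In a chart around \<open>L0\<close> the index consists of negative indices of
  \<open>B - A\<close>, \<open>C - B\<close> and \<open>C - A\<close>. The second does not involve
  \<open>L\<close>, and the others are nondegenerate at \<open>A = 0\<close> by transversality,
  hence locally constant there.\<close>

lemma iota_locally_constant:
  assumes L: "L0 \<in> Lagr" "N \<in> Lagr" "N' \<in> Lagr" and t: "transv L0 N" "transv L0 N'"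
  obtains W where "openin Lagr_topology W" "L0 \<in> W" "\<forall>L\<in>W. iota L N N' = iota L0 N N'"
proof -
  obtain K where K: "K \<in> Lagr" "\<forall>L\<in>{L0, N, N'}. transv L K"
    by (rule common_transversal[of "{L0, N, N'}"]) (use L in auto)
  have tK: "transv L0 K" "transv N K" "transv N' K" using K(2) by blast+
  obtain S where S: "symplectic_map S" "S ` graph 0 = L0" "S ` graph_inf = K"
    by (rule normal_form[OF L(1) K(1) tK(1)])
  obtain B where B: "hermitian B" "S ` graph B = N" by (rule chart_exists[OF S(1,3) L(2) tK(2)])
  obtain C where C: "hermitian C" "S ` graph C = N'" by (rule chart_exists[OF S(1,3) L(3) tK(3)])
  have "transv (graph 0) (graph B)" "transv (graph 0) (graph C)"
    using t unfolding S(2)[symmetric] B(2)[symmetric] C(2)[symmetric] symplectic_transv[OF S(1)] .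
  then have k: "mker (B - 0) = {0}" "mker (C - 0) = {0}"
    using transv_sym transv_graphs by blast+
  obtain e1 where e1: "e1 > 0" "\<forall>D. hermitian D \<longrightarrow> norm (D - (B - 0)) < e1 \<longrightarrow> mpos D = mpos (B - 0) \<and> mneg D = mneg (B - 0)"
    by (rule mpos_locally_constant[OF hermitian_diff[OF B(1) hermitian_0] k(1)])
  obtain e2 where e2: "e2 > 0" "\<forall>D. hermitian D \<longrightarrow> norm (D - (C - 0)) < e2 \<longrightarrow> mpos D = mpos (C - 0) \<and> mneg D = mneg (C - 0)"
    by (rule mpos_locally_constant[OF hermitian_diff[OF C(1) hermitian_0] k(2)])
  define W where "W = {L\<in>Lagr. transv L K \<and> chart S L \<in> ball 0 (min e1 e2)}"
  have "openin Lagr_topology W" unfolding W_def by (rule openin_chart[OF S(1,3) open_ball])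
  moreover have "L0 \<in> W"
    unfolding W_def using L(1) tK(1) chart_graph[OF S(1), of 0] S(2) e1(1) e2(1) by simp
  moreover have "iota L N N' = iota L0 N N'" if "L \<in> W" for L
  proof -
    have LL: "L \<in> Lagr" "transv L K" "norm (chart S L) < min e1 e2" using that by (simp_all add: W_def)
    define A where "A = chart S L"
    have A: "hermitian A" "S ` graph A = L" unfolding A_def by (rule chart_transv[OF S(1,3) LL(1,2)])+
    have "mneg (B - A) = mneg (B - 0)" "mneg (C - A) = mneg (C - 0)"
      using e1(2)[rule_format, of "B - A"] e2(2)[rule_format, of "C - A"] hermitian_diff[OF B(1) A(1)]
        hermitian_diff[OF C(1) A(1)] LL(3) by (simp_all add: A_def)
    then show ?thesis
      using iota_triple_chart[OF S(1) _ A(1) B(1) C(1)] iota_triple_chart[OF S(1) _ hermitian_0 B(1) C(1)]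
        K(1) S A(2) B(2) C(2) by simp
  qed
  ultimately show ?thesis using that by blast
qed

section \<open>The Maslov index of continuous paths\<close>

text \<open>Compactness of the interval without partitions. It serves to build primitives, to prove
  homotopy invariance, to compare reference planes and to glue smoothings.\<close>

lemma interval_bisection:
  fixes a b :: real
  assumes "a \<le> b"
    and trans: "\<And>c d e. a \<le> c \<Longrightarrow> c \<le> d \<Longrightarrow> d \<le> e \<Longrightarrow> e \<le> b \<Longrightarrow> P c d \<Longrightarrow> P d e \<Longrightarrow> P c e"
    and local: "\<And>x. a \<le> x \<Longrightarrow> x \<le> b \<Longrightarrow>
      \<exists>\<delta>>0. \<forall>c d. a \<le> c \<longrightarrow> c \<le> x \<longrightarrow> x \<le> d \<longrightarrow> d \<le> b \<longrightarrow> d - c < \<delta> \<longrightarrow> P c d"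
  shows "P a b"
proof -
  have "a \<le> a \<longrightarrow> b \<le> b \<longrightarrow> P a b"
  proof (rule Bolzano[of a b "\<lambda>c d. a \<le> c \<longrightarrow> d \<le> b \<longrightarrow> P c d"])
    fix c d e :: real
    assume "a \<le> c \<longrightarrow> d \<le> b \<longrightarrow> P c d" "a \<le> d \<longrightarrow> e \<le> b \<longrightarrow> P d e" "c \<le> d" "d \<le> e"
    then show "a \<le> c \<longrightarrow> e \<le> b \<longrightarrow> P c e" using trans[of c d e] by auto
  next
    fix x assume "a \<le> x" "x \<le> b"
    then show "\<exists>d>0. \<forall>c e. c \<le> x \<and> x \<le> e \<and> e - c < d \<longrightarrow> a \<le> c \<longrightarrow> e \<le> b \<longrightarrow> P c e"
      using local[of x] by blast
  qed (rule assms(1))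
  then show ?thesis by simp
qed

definition lagr_path :: "(real \<Rightarrow> 'n::finite phase set) \<Rightarrow> bool" where
  "lagr_path \<gamma> \<longleftrightarrow> continuous_map (top_of_set {0..1}) Lagr_topology \<gamma>"

lemma lagr_path_Lagr: "lagr_path \<gamma> \<Longrightarrow> t \<in> {0..1} \<Longrightarrow> \<gamma> t \<in> Lagr"
  unfolding lagr_path_def using continuous_map_image_subset_topspace topspace_Lagr_topology by fastforce

lemma lagr_path_open:
  assumes g: "lagr_path \<gamma>" and x: "x \<in> {0..1}" and W: "openin Lagr_topology W" "\<gamma> x \<in> W"
  obtains \<delta> where "\<delta> > 0" "\<forall>t\<in>{0..1}. \<bar>t - x\<bar> < \<delta> \<longrightarrow> \<gamma> t \<in> W"
proof -
  have "openin (top_of_set {0..1}) {t\<in>topspace (top_of_set {0..1}). \<gamma> t \<in> W}"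
    using g W(1) unfolding lagr_path_def by (rule openin_continuous_map_preimage)
  then obtain \<delta> where "\<delta> > 0" "\<forall>t\<in>{0..1}. dist t x < \<delta> \<longrightarrow> t \<in> {t\<in>topspace (top_of_set {0..1}). \<gamma> t \<in> W}"
    using x W(2) unfolding openin_euclidean_subtopology_iff by force
  then show ?thesis using that[of \<delta>] by (simp add: dist_real_def)
qed

lemma lagr_path_chart:
  assumes g: "lagr_path \<gamma>" and x: "x \<in> {0..1}" and F: "finite F" "F \<subseteq> Lagr"
  obtains N \<delta> where "N \<in> Lagr" "\<forall>L\<in>F. transv L N" "\<delta> > 0" "\<forall>t\<in>{0..1}. \<bar>t - x\<bar> < \<delta> \<longrightarrow> transv (\<gamma> t) N"
proof -
  have gx: "\<gamma> x \<in> Lagr" by (rule lagr_path_Lagr[OF g x])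
  obtain N where N: "N \<in> Lagr" "\<forall>L\<in>insert (\<gamma> x) F. transv L N"
    by (rule common_transversal[of "insert (\<gamma> x) F"]) (use F gx in auto)
  have "\<gamma> x \<in> {L\<in>Lagr. transv L N}" using gx N(2) by blast
  then obtain \<delta> where "\<delta> > 0" "\<forall>t\<in>{0..1}. \<bar>t - x\<bar> < \<delta> \<longrightarrow> \<gamma> t \<in> {L\<in>Lagr. transv L N}"
    by (rule lagr_path_open[OF g x openin_transv[OF N(1)]])
  then show ?thesis using that[of N \<delta>] N by blast
qed

text \<open>A potential for the increments of the Maslov index in the chart \<open>N\<close>: by
  \<open>pot_diff\<close> its differences are \<iota>(\<open>P\<close>, \<open>Q\<close>,
  \<open>M\<close>) - \<iota>(\<open>P\<close>, \<open>Q\<close>, \<open>N\<close>), and differences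
  of a potential are additive under subdivision.\<close>

definition pot :: "'n phase set \<Rightarrow> 'n phase set \<Rightarrow> 'n::finite phase set \<Rightarrow> int" where
  "pot M N Q = iota M Q M - iota M Q N"

lemma pot_diff:
  assumes "M \<in> Lagr" "N \<in> Lagr" "P \<in> Lagr" "Q \<in> Lagr"
  shows "pot M N Q - pot M N P = iota P Q M - iota P Q N"
  using iota_cocycle[OF assms(1,3,4,1)] iota_cocycle[OF assms(1,3,4,2)] unfolding pot_def by linarith

lemma pot_change:
  assumes "M \<in> Lagr" "N \<in> Lagr" "N' \<in> Lagr" "Q \<in> Lagr"
  shows "pot M N Q - pot M N' Q = iota M N N' - iota Q N N'"
  using iota_cocycle[OF assms(1,4,2,3)] unfolding pot_def by linarith

text \<open>Two potentials differ by a constant minus \<iota>(\<open>Q\<close>, \<open>N\<close>,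
  \<open>N'\<close>), and this index does not change as long as the path stays transversal to both
  planes.\<close>

lemma pot_change_constant:
  assumes g: "lagr_path \<gamma>" and M: "M \<in> Lagr" "N \<in> Lagr" "N' \<in> Lagr" and cd: "0 \<le> c" "c \<le> d" "d \<le> 1"
    and t: "\<forall>t\<in>{c..d}. transv (\<gamma> t) N" "\<forall>t\<in>{c..d}. transv (\<gamma> t) N'"
  shows "pot M N (\<gamma> d) - pot M N (\<gamma> c) = pot M N' (\<gamma> d) - pot M N' (\<gamma> c)"
proof -
  have gL: "\<gamma> t \<in> Lagr" if "t \<in> {c..d}" for t using that cd by (intro lagr_path_Lagr[OF g]) auto
  have "iota (\<gamma> c) N N' = iota (\<gamma> d) N N'"
  proof (rule interval_bisection[OF cd(2), of "\<lambda>c d. iota (\<gamma> c) N N' = iota (\<gamma> d) N N'"])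
    fix x assume x: "c \<le> x" "x \<le> d"
    then have gx: "\<gamma> x \<in> Lagr" "transv (\<gamma> x) N" "transv (\<gamma> x) N'" using gL t by simp_all
    have x01: "x \<in> {0..1}" using x cd by simp
    obtain W where W: "openin Lagr_topology W" "\<gamma> x \<in> W" "\<forall>L\<in>W. iota L N N' = iota (\<gamma> x) N N'"
      by (rule iota_locally_constant[OF gx(1) M(2,3) gx(2,3)])
    obtain \<delta> where \<delta>: "\<delta> > 0" "\<forall>t\<in>{0..1}. \<bar>t - x\<bar> < \<delta> \<longrightarrow> \<gamma> t \<in> W"
      by (rule lagr_path_open[OF g x01 W(1,2)])
    show "\<exists>\<delta>>0. \<forall>a b. c \<le> a \<longrightarrow> a \<le> x \<longrightarrow> x \<le> b \<longrightarrow> b \<le> d \<longrightarrow> b - a < \<delta> \<longrightarrow> iota (\<gamma> a) N N' = iota (\<gamma> b) N N'"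
    proof (intro exI[of _ \<delta>] conjI allI impI)
      fix a b assume ab: "c \<le> a" "a \<le> x" "x \<le> b" "b \<le> d" "b - a < \<delta>"
      then have "\<gamma> a \<in> W" "\<gamma> b \<in> W" using \<delta>(2) cd by auto
      then show "iota (\<gamma> a) N N' = iota (\<gamma> b) N N'" using W(3) by metis
    qed (rule \<delta>(1))
  qed simp
  then show ?thesis
    using pot_change[OF M gL, of c] pot_change[OF M gL, of d] cd by auto
qed

text \<open>A primitive records the local increments of the Maslov index along the path, measured in any
  chart \<open>N\<close> that contains the corresponding piece of the path.\<close>

definition mas_primitive ::
    "'n phase set \<Rightarrow> (real \<Rightarrow> 'n::finite phase set) \<Rightarrow> real \<Rightarrow> real \<Rightarrow> (real \<Rightarrow> int) \<Rightarrow> bool" where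
  "mas_primitive M \<gamma> a b F \<longleftrightarrow> (\<forall>N\<in>Lagr. \<forall>c d. a \<le> c \<longrightarrow> c \<le> d \<longrightarrow> d \<le> b \<longrightarrow> (\<forall>t\<in>{c..d}. transv (\<gamma> t) N) \<longrightarrow>
     F d - F c = pot M N (\<gamma> d) - pot M N (\<gamma> c))"

text \<open>On short intervals the potential of one chart is a primitive, and by
  \<open>pot_change_constant\<close> it serves every other chart as well. Longer intervals are
  obtained by gluing.\<close>

lemma mas_primitive_exists:
  assumes g: "lagr_path \<gamma>" and M: "M \<in> Lagr"
  shows "\<exists>F. mas_primitive M \<gamma> 0 1 F"
proof (rule interval_bisection[of 0 1 "\<lambda>a b. \<exists>F. mas_primitive M \<gamma> a b F"])
  fix a b c :: real
  assume abc: "0 \<le> a" "a \<le> b" "b \<le> c" "c \<le> 1"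
    and "\<exists>F. mas_primitive M \<gamma> a b F" "\<exists>F. mas_primitive M \<gamma> b c F"
  then obtain F G where F: "mas_primitive M \<gamma> a b F" and G: "mas_primitive M \<gamma> b c G" by blast
  \<comment> \<open>The second primitive is shifted by a constant to agree with the first at
    \<open>b\<close>; an interval across \<open>b\<close> is then treated as two.\<close>
  define H where "H t = (if t \<le> b then F t else F b + (G t - G b))" for t
  have H1: "H t = F t" if "t \<le> b" for t using that by (simp add: H_def)
  have H2: "H t = F b + (G t - G b)" if "b \<le> t" for t using that by (cases "t = b") (simp_all add: H_def)
  have "mas_primitive M \<gamma> a c H"
    unfolding mas_primitive_def
  proof (intro ballI allI impI)
    fix N p q assume N: "N \<in> Lagr" and pq: "a \<le> p" "p \<le> q" "q \<le> c" and t: "\<forall>t\<in>{p..q}. transv (\<gamma> t) N"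
    have Fd: "F v - F u = pot M N (\<gamma> v) - pot M N (\<gamma> u)" if "p \<le> u" "u \<le> v" "v \<le> q" "v \<le> b" for u v
    proof -
      have "\<forall>t\<in>{u..v}. transv (\<gamma> t) N" using t that by auto
      then show ?thesis using F N that pq unfolding mas_primitive_def by auto
    qed
    have Gd: "G v - G u = pot M N (\<gamma> v) - pot M N (\<gamma> u)" if "p \<le> u" "u \<le> v" "v \<le> q" "b \<le> u" for u v
    proof -
      have "\<forall>t\<in>{u..v}. transv (\<gamma> t) N" using t that by auto
      then show ?thesis using G N that pq unfolding mas_primitive_def by auto
    qed
    consider "q \<le> b" | "b \<le> p" | "p \<le> b" "b \<le> q" by linarith
    then show "H q - H p = pot M N (\<gamma> q) - pot M N (\<gamma> p)"
    proof cases
      case 1 then show ?thesis using Fd[of p q] pq H1 by simp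
    next
      case 2 then show ?thesis using Gd[of p q] pq H2 by simp
    next
      case 3
      then show ?thesis using Fd[of p b] Gd[of b q] pq H1[of p] H2[of q] by simp
    qed
  qed
  then show "\<exists>F. mas_primitive M \<gamma> a c F" by blast
next
  fix x :: real assume "0 \<le> x" "x \<le> 1"
  then have x: "x \<in> {0..1}" by simp
  obtain N \<delta> where N: "N \<in> Lagr" "\<forall>L\<in>{}. transv L N" "\<delta> > 0" "\<forall>t\<in>{0..1}. \<bar>t - x\<bar> < \<delta> \<longrightarrow> transv (\<gamma> t) N"
    by (rule lagr_path_chart[OF g x, of "{}"]) auto
  show "\<exists>\<delta>>0. \<forall>a b. 0 \<le> a \<longrightarrow> a \<le> x \<longrightarrow> x \<le> b \<longrightarrow> b \<le> 1 \<longrightarrow> b - a < \<delta> \<longrightarrow> (\<exists>F. mas_primitive M \<gamma> a b F)"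
  proof (intro exI[of _ \<delta>] conjI allI impI)
    fix a b assume ab: "0 \<le> a" "a \<le> x" "x \<le> b" "b \<le> 1" "b - a < \<delta>"
    have "mas_primitive M \<gamma> a b (\<lambda>t. pot M N (\<gamma> t))"
      unfolding mas_primitive_def
    proof (intro ballI allI impI)
      fix N' p q assume N': "N' \<in> Lagr" and pq: "a \<le> p" "p \<le> q" "q \<le> b" and t: "\<forall>t\<in>{p..q}. transv (\<gamma> t) N'"
      have "\<forall>t\<in>{p..q}. transv (\<gamma> t) N" using N(4) ab pq by auto
      then show "pot M N (\<gamma> q) - pot M N (\<gamma> p) = pot M N' (\<gamma> q) - pot M N' (\<gamma> p)"
        using ab pq t by (intro pot_change_constant[OF g M N(1) N']) auto
    qed
    then show "\<exists>F. mas_primitive M \<gamma> a b F" by blast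
  qed (rule N(3))
qed simp

text \<open>Being a difference of values of one chosen primitive, it is additive in its endpoints
  without hypotheses and for any order of them.\<close>

definition mas :: "'n phase set \<Rightarrow> (real \<Rightarrow> 'n::finite phase set) \<Rightarrow> real \<Rightarrow> real \<Rightarrow> int" where
  "mas M \<gamma> a b = (SOME F. mas_primitive M \<gamma> 0 1 F) b - (SOME F. mas_primitive M \<gamma> 0 1 F) a"

lemma mas_add: "mas M \<gamma> a b + mas M \<gamma> b c = mas M \<gamma> a c"
  by (simp add: mas_def)

lemma mas_local:
  assumes g: "lagr_path \<gamma>" and M: "M \<in> Lagr" "N \<in> Lagr" and cd: "0 \<le> c" "c \<le> d" "d \<le> 1"
    and t: "\<forall>t\<in>{c..d}. transv (\<gamma> t) N"
  shows "mas M \<gamma> c d = pot M N (\<gamma> d) - pot M N (\<gamma> c)"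
proof -
  have "mas_primitive M \<gamma> 0 1 (SOME F. mas_primitive M \<gamma> 0 1 F)"
    by (rule someI_ex[OF mas_primitive_exists[OF g M(1)]])
  then show ?thesis using assms(3-) unfolding mas_primitive_def mas_def by blast
qed

lemma mas_local_any:
  assumes g: "lagr_path \<gamma>" and M: "M \<in> Lagr" "N \<in> Lagr" and cd: "c \<in> {0..1}" "d \<in> {0..1}"
    and t: "\<forall>t\<in>{min c d..max c d}. transv (\<gamma> t) N"
  shows "mas M \<gamma> c d = pot M N (\<gamma> d) - pot M N (\<gamma> c)"
proof (cases "c \<le> d")
  case True
  then show ?thesis using assms by (intro mas_local[OF g M]) auto
next
  case False
  then have "mas M \<gamma> d c = pot M N (\<gamma> c) - pot M N (\<gamma> d)" using assms by (intro mas_local[OF g M]) auto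
  then show ?thesis using mas_add[of M \<gamma> c d c] by (simp add: mas_def)
qed

text \<open>Within a single chart the increments are differences of a potential, so they balance
  around a small rectangle. Summing over rectangles along a row compares neighbouring rows, up to
  the increments along the two outer vertical sides, and those sides are constant paths.\<close>

lemma mas_homotopy_invariant:
  assumes h: "continuous_map (prod_topology (top_of_set {0..1}) (top_of_set {0..1})) Lagr_topology h"
    and ends: "\<And>s. s \<in> {0..1} \<Longrightarrow> h (s, 0) = L0" "\<And>s. s \<in> {0..1} \<Longrightarrow> h (s, 1) = L1"
    and M: "M \<in> Lagr"
  shows "mas M (\<lambda>t. h (0, t)) 0 1 = mas M (\<lambda>t. h (1::real, t :: real)) 0 1"
proof -
  let ?I = "{0..1::real}"
  have row: "lagr_path (\<lambda>t. h (s, t))" if "s \<in> ?I" for s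
  proof -
    have "continuous_map (top_of_set ?I) (prod_topology (top_of_set ?I) (top_of_set ?I)) (\<lambda>t. (s, t))"
      using that by (intro continuous_map_pairedI) auto
    then have "continuous_map (top_of_set ?I) Lagr_topology (h \<circ> (\<lambda>t. (s, t)))"
      by (rule continuous_map_compose[OF _ h])
    then show ?thesis unfolding lagr_path_def comp_def .
  qed
  have col: "lagr_path (\<lambda>s. h (s, t))" if "t \<in> ?I" for t
  proof -
    have "continuous_map (top_of_set ?I) (prod_topology (top_of_set ?I) (top_of_set ?I)) (\<lambda>s. (s, t))"
      using that by (intro continuous_map_pairedI) auto
    then have "continuous_map (top_of_set ?I) Lagr_topology (h \<circ> (\<lambda>s. (s, t)))"
      by (rule continuous_map_compose[OF _ h])
    then show ?thesis unfolding lagr_path_def comp_def .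
  qed
  have loc: "\<exists>\<delta>>0. \<forall>s\<in>?I. \<bar>s - s0\<bar> < \<delta> \<longrightarrow> mas M (\<lambda>t. h (s, t)) 0 1 = mas M (\<lambda>t. h (s0, t)) 0 1"
    if s0: "s0 \<in> ?I" for s0
  proof -
    \<comment> \<open>The balance around the rectangle over \<open>[a, b]\<close> between the rows
      \<open>s0\<close> and \<open>s\<close>. The height \<delta> is quantified inside, so that
      joining two intervals may shrink it.\<close>
    define P where "P a b \<longleftrightarrow> (\<exists>\<delta>>0. \<forall>s\<in>?I. \<bar>s - s0\<bar> < \<delta> \<longrightarrow>
      mas M (\<lambda>t. h (s, t)) a b - mas M (\<lambda>t. h (s0, t)) a b
        = mas M (\<lambda>s. h (s, b)) s0 s - mas M (\<lambda>s. h (s, a)) s0 s)" for a b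
    have "P 0 1"
    proof (rule interval_bisection[of 0 1 P])
      fix a b c :: real assume "P a b" "P b c"
      then obtain d1 d2 where d: "d1 > 0" "d2 > 0"
        and 1: "\<forall>s\<in>?I. \<bar>s - s0\<bar> < d1 \<longrightarrow> mas M (\<lambda>t. h (s, t)) a b - mas M (\<lambda>t. h (s0, t)) a b
          = mas M (\<lambda>s. h (s, b)) s0 s - mas M (\<lambda>s. h (s, a)) s0 s"
        and 2: "\<forall>s\<in>?I. \<bar>s - s0\<bar> < d2 \<longrightarrow> mas M (\<lambda>t. h (s, t)) b c - mas M (\<lambda>t. h (s0, t)) b c
          = mas M (\<lambda>s. h (s, c)) s0 s - mas M (\<lambda>s. h (s, b)) s0 s"
        unfolding P_def by metis
      show "P a c"
        unfolding P_def
      proof (intro exI[of _ "min d1 d2"] conjI ballI impI)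
        fix s assume "s \<in> ?I" "\<bar>s - s0\<bar> < min d1 d2"
        then show "mas M (\<lambda>t. h (s, t)) a c - mas M (\<lambda>t. h (s0, t)) a c
          = mas M (\<lambda>s. h (s, c)) s0 s - mas M (\<lambda>s. h (s, a)) s0 s"
          using bspec[OF 1, of s] bspec[OF 2, of s] mas_add[of M "\<lambda>t. h (s, t)" a b c]
            mas_add[of M "\<lambda>t. h (s0, t)" a b c] by simp
      qed (use d in simp)
    next
      fix x :: real assume "0 \<le> x" "x \<le> 1"
      then have x: "x \<in> ?I" by simp
      have hx: "h (s0, x) \<in> Lagr" using lagr_path_Lagr[OF row[OF s0] x] .
      obtain N where N: "N \<in> Lagr" "\<forall>L\<in>{h (s0, x)}. transv L N"
        by (rule common_transversal[of "{h (s0, x)}"]) (use hx in auto)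
      have "openin (prod_topology (top_of_set ?I) (top_of_set ?I))
        {p\<in>topspace (prod_topology (top_of_set ?I) (top_of_set ?I)). h p \<in> {L\<in>Lagr. transv L N}}"
        by (rule openin_continuous_map_preimage[OF h openin_transv[OF N(1)]])
      moreover have "(s0, x) \<in> {p\<in>topspace (prod_topology (top_of_set ?I) (top_of_set ?I)). h p \<in> {L\<in>Lagr. transv L N}}"
        using s0 x hx N(2) by simp
      ultimately obtain U V where UV: "openin (top_of_set ?I) U" "openin (top_of_set ?I) V" "s0 \<in> U" "x \<in> V"
        "U \<times> V \<subseteq> {p\<in>topspace (prod_topology (top_of_set ?I) (top_of_set ?I)). h p \<in> {L\<in>Lagr. transv L N}}"
        unfolding openin_prod_topology_alt by meson
      obtain d1 where d1: "d1 > 0" "\<forall>s\<in>?I. dist s s0 < d1 \<longrightarrow> s \<in> U"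
        using UV(1,3) unfolding openin_euclidean_subtopology_iff by blast
      obtain d2 where d2: "d2 > 0" "\<forall>t\<in>?I. dist t x < d2 \<longrightarrow> t \<in> V"
        using UV(2,4) unfolding openin_euclidean_subtopology_iff by blast
      have tr: "transv (h (s, t)) N" if "s \<in> ?I" "\<bar>s - s0\<bar> < d1" "t \<in> ?I" "\<bar>t - x\<bar> < d2" for s t
      proof -
        have "s \<in> U" "t \<in> V" using d1(2) d2(2) that by (auto simp: dist_real_def)
        then show ?thesis using UV(5) by blast
      qed
      show "\<exists>\<delta>>0. \<forall>c d. 0 \<le> c \<longrightarrow> c \<le> x \<longrightarrow> x \<le> d \<longrightarrow> d \<le> 1 \<longrightarrow> d - c < \<delta> \<longrightarrow> P c d"
      proof (intro exI[of _ d2] conjI allI impI)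
        fix c d assume cd: "0 \<le> c" "c \<le> x" "x \<le> d" "d \<le> 1" "d - c < d2"
        show "P c d"
          unfolding P_def
        proof (intro exI[of _ d1] conjI ballI impI)
          fix s assume s: "s \<in> ?I" "\<bar>s - s0\<bar> < d1"
          have "mas M (\<lambda>t. h (s, t)) c d = pot M N (h (s, d)) - pot M N (h (s, c))"
            by (rule mas_local[OF row[OF s(1)] M N(1)]) (use cd s tr in auto)
          moreover have "mas M (\<lambda>t. h (s0, t)) c d = pot M N (h (s0, d)) - pot M N (h (s0, c))"
            by (rule mas_local[OF row[OF s0] M N(1)]) (use cd s0 tr d1(1) in auto)
          moreover have "mas M (\<lambda>s. h (s, t)) s0 s = pot M N (h (s, t)) - pot M N (h (s0, t))"
            if "t \<in> {c..d}" for t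
            by (rule mas_local_any[OF col M N(1) s0 s(1)]) (use cd s s0 that in \<open>auto intro!: tr\<close>)
          ultimately show "mas M (\<lambda>t. h (s, t)) c d - mas M (\<lambda>t. h (s0, t)) c d
            = mas M (\<lambda>s. h (s, d)) s0 s - mas M (\<lambda>s. h (s, c)) s0 s"
            using cd by simp
        qed (rule d1(1))
      qed (rule d2(1))
    qed simp
    \<comment> \<open>The homotopy fixes the endpoints, so a single chart covers each outer side and
      the potential does not change along it.\<close>
    moreover have "mas M (\<lambda>s. h (s, t)) s0 s = 0" if s: "s \<in> ?I" and t: "t = 0 \<or> t = 1" for s t
    proof -
      obtain L where L: "\<And>s. s \<in> ?I \<Longrightarrow> h (s, t) = L" using ends t by blast
      have LL: "L \<in> Lagr" using lagr_path_Lagr[OF col s] t L[OF s] by fastforce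
      obtain N where N: "N \<in> Lagr" "\<forall>L\<in>{L}. transv L N"
        by (rule common_transversal[of "{L}"]) (use LL in auto)
      have "mas M (\<lambda>s. h (s, t)) s0 s = pot M N (h (s, t)) - pot M N (h (s0, t))"
      proof (rule mas_local_any[OF col M N(1) s0 s])
        show "t \<in> ?I" using t by auto
        show "\<forall>r\<in>{min s0 s..max s0 s}. transv (h (r, t)) N"
        proof
          fix r assume "r \<in> {min s0 s..max s0 s}"
          then have "r \<in> ?I" using s s0 by (auto simp: min_def max_def split: if_splits)
          then show "transv (h (r, t)) N" using L N(2) by simp
        qed
      qed
      then show ?thesis using L s s0 by simp
    qed
    ultimately obtain \<delta> where \<delta>: "\<delta> > 0" "\<forall>s\<in>?I. \<bar>s - s0\<bar> < \<delta> \<longrightarrow>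
      mas M (\<lambda>t. h (s, t)) 0 1 - mas M (\<lambda>t. h (s0, t)) 0 1 = 0"
      unfolding P_def by fastforce
    then show ?thesis by auto
  qed
  show ?thesis
  proof (rule interval_bisection[of 0 1 "\<lambda>a b. mas M (\<lambda>t. h (a, t)) 0 1 = mas M (\<lambda>t. h (b, t)) 0 1"])
    fix x :: real assume x: "0 \<le> x" "x \<le> 1"
    then obtain \<delta> where \<delta>: "\<delta> > 0" "\<forall>s\<in>?I. \<bar>s - x\<bar> < \<delta> \<longrightarrow> mas M (\<lambda>t. h (s, t)) 0 1 = mas M (\<lambda>t. h (x, t)) 0 1"
      using loc[of x] by auto
    show "\<exists>\<delta>>0. \<forall>c d. 0 \<le> c \<longrightarrow> c \<le> x \<longrightarrow> x \<le> d \<longrightarrow> d \<le> 1 \<longrightarrow> d - c < \<delta> \<longrightarrow>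
      mas M (\<lambda>t. h (c, t)) 0 1 = mas M (\<lambda>t. h (d, t)) 0 1"
    proof (intro exI[of _ \<delta>] conjI allI impI)
      fix c d assume "0 \<le> c" "c \<le> x" "x \<le> d" "d \<le> 1" "d - c < \<delta>"
      then have "c \<in> ?I" "\<bar>c - x\<bar> < \<delta>" "d \<in> ?I" "\<bar>d - x\<bar> < \<delta>" using x by auto
      then show "mas M (\<lambda>t. h (c, t)) 0 1 = mas M (\<lambda>t. h (d, t)) 0 1" using \<delta>(2) by metis
    qed (rule \<delta>(1))
  qed simp_all
qed

text \<open>On a piece transversal to \<open>N\<close> the difference equals minus the index of its
  end planes with \<open>N\<close>, which does not see the reference plane. When pieces are joined,
  the cocycle identity produces the index of the three planes of the path at \<open>a\<close>,
  \<open>b\<close>, \<open>c\<close>, which does not see it either.\<close>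

lemma mas_reference_independent:
  assumes g: "lagr_path \<gamma>" and M: "M \<in> Lagr" "M' \<in> Lagr"
  shows "mas M \<gamma> 0 1 - iota (\<gamma> 0) (\<gamma> 1) M = mas M' \<gamma> 0 1 - iota (\<gamma> 0) (\<gamma> 1) M'"
proof (rule interval_bisection[of 0 1 "\<lambda>a b. mas M \<gamma> a b - iota (\<gamma> a) (\<gamma> b) M = mas M' \<gamma> a b - iota (\<gamma> a) (\<gamma> b) M'"])
  fix a b c :: real
  assume abc: "0 \<le> a" "a \<le> b" "b \<le> c" "c \<le> 1"
    and eq: "mas M \<gamma> a b - iota (\<gamma> a) (\<gamma> b) M = mas M' \<gamma> a b - iota (\<gamma> a) (\<gamma> b) M'"
      "mas M \<gamma> b c - iota (\<gamma> b) (\<gamma> c) M = mas M' \<gamma> b c - iota (\<gamma> b) (\<gamma> c) M'"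
  have L: "\<gamma> a \<in> Lagr" "\<gamma> b \<in> Lagr" "\<gamma> c \<in> Lagr" using abc by (auto intro!: lagr_path_Lagr[OF g])
  show "mas M \<gamma> a c - iota (\<gamma> a) (\<gamma> c) M = mas M' \<gamma> a c - iota (\<gamma> a) (\<gamma> c) M'"
    using eq iota_cocycle[OF L M(1)] iota_cocycle[OF L M(2)] mas_add[of M \<gamma> a b c] mas_add[of M' \<gamma> a b c]
    by linarith
next
  fix x :: real assume "0 \<le> x" "x \<le> 1"
  then have x: "x \<in> {0..1}" by simp
  obtain N \<delta> where N: "N \<in> Lagr" "\<forall>L\<in>{}. transv L N" "\<delta> > 0" "\<forall>t\<in>{0..1}. \<bar>t - x\<bar> < \<delta> \<longrightarrow> transv (\<gamma> t) N"
    by (rule lagr_path_chart[OF g x, of "{}"]) auto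
  show "\<exists>\<delta>>0. \<forall>a b. 0 \<le> a \<longrightarrow> a \<le> x \<longrightarrow> x \<le> b \<longrightarrow> b \<le> 1 \<longrightarrow> b - a < \<delta> \<longrightarrow>
    mas M \<gamma> a b - iota (\<gamma> a) (\<gamma> b) M = mas M' \<gamma> a b - iota (\<gamma> a) (\<gamma> b) M'"
  proof (intro exI[of _ \<delta>] conjI allI impI)
    fix a b assume ab: "0 \<le> a" "a \<le> x" "x \<le> b" "b \<le> 1" "b - a < \<delta>"
    have t: "\<forall>t\<in>{a..b}. transv (\<gamma> t) N" using N(4) ab by auto
    have L: "\<gamma> a \<in> Lagr" "\<gamma> b \<in> Lagr" using ab by (auto intro!: lagr_path_Lagr[OF g])
    have "mas M \<gamma> a b = iota (\<gamma> a) (\<gamma> b) M - iota (\<gamma> a) (\<gamma> b) N"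
      using mas_local[OF g M(1) N(1) ab(1) _ ab(4) t] pot_diff[OF M(1) N(1) L] ab by simp
    moreover have "mas M' \<gamma> a b = iota (\<gamma> a) (\<gamma> b) M' - iota (\<gamma> a) (\<gamma> b) N"
      using mas_local[OF g M(2) N(1) ab(1) _ ab(4) t] pot_diff[OF M(2) N(1) L] ab by simp
    ultimately show "mas M \<gamma> a b - iota (\<gamma> a) (\<gamma> b) M = mas M' \<gamma> a b - iota (\<gamma> a) (\<gamma> b) M'" by simp
  qed (rule N(3))
qed simp

section \<open>Differentiable paths and crossings\<close>

lemma diff_frame_deriv:
  assumes "diff_frame X Y L" "t \<in> {0..1}"
  shows "(X has_vector_derivative mderiv X t) (at t within {0..1})"
    "(Y has_vector_derivative mderiv Y t) (at t within {0..1})"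
  using assms unfolding diff_frame_def mderiv_def differentiable_on_def
  by (simp_all add: vector_derivative_works)

lemma diff_frame_Lagr: "diff_frame X Y L \<Longrightarrow> t \<in> {0..1} \<Longrightarrow> L t \<in> Lagr"
  and diff_frame_is_frame: "diff_frame X Y L \<Longrightarrow> t \<in> {0..1} \<Longrightarrow> is_frame (X t) (Y t) (L t)"
  unfolding diff_frame_def by blast+

lemma is_frame_mem: "is_frame X Y L \<Longrightarrow> frame_map X Y x \<in> L"
  unfolding is_frame_def by blast

lemma is_frame_obtain:
  assumes "is_frame X Y L" "u \<in> L" obtains x where "u = frame_map X Y x"
  using assms unfolding is_frame_def by blast

lemma diff_frame_lagr_path:
  assumes "diff_frame X Y L" shows "lagr_path L"
  unfolding lagr_path_def
proof (rule continuous_map_frames)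
  show "continuous_on {0..1} X" "continuous_on {0..1} Y"
    using assms unfolding diff_frame_def by (simp_all add: differentiable_imp_continuous_on)
qed (rule diff_frame_Lagr[OF assms] diff_frame_is_frame[OF assms]; assumption)+

lemma bounded_linear_mat_vec: "bounded_linear (\<lambda>A :: complex ^ 'n ^ 'm. A *v x)"
  by (rule bounded_bilinear.bounded_linear_left[OF bounded_bilinear_mat_vec])

lemma frame_velocity:
  assumes "(X has_vector_derivative X') F" "(Y has_vector_derivative Y') F" "F = at t within S"
  shows "((\<lambda>s. frame_map (X s) (Y s) y) has_vector_derivative frame_map X' Y' y) F"
  unfolding frame_map_def assms(3)
  using assms(1,2) unfolding assms(3)
  by (intro has_vector_derivative_Pair bounded_linear.has_vector_derivative[OF bounded_linear_mat_vec])

lemma crossing_sympl: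
  "cdot x ((adj X ** Y' - adj Y ** X') *v y) = sympl (frame_map X Y x) (frame_map X' Y' y)"
  by (simp add: sympl_def frame_map_def matrix_vector_mult_diff_rdistrib cdot_diff_right cdot_adj
      flip: matrix_vector_mul_assoc)

lemma has_vector_derivative_unique_unit:
  assumes "t \<in> {0..1::real}" "(f has_vector_derivative a) (at t within {0..1})"
    "(f has_vector_derivative b) (at t within {0..1})"
  shows "a = b"
  by (rule vector_derivative_unique_within_closed_interval[of 0 1 t f]) (use assms in simp_all)

lemma has_vector_derivative_transform_eventually:
  assumes "(f has_vector_derivative D) (at t within S)" "\<forall>\<^sub>F s in at t within S. f s = g s" "f t = g t" "t \<in> S"
  shows "(g has_vector_derivative D) (at t within S)"
  using has_derivative_transform_eventually[OF assms(1)[unfolded has_vector_derivative_def] assms(2,3,4)]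
  unfolding has_vector_derivative_def .

text \<open>Two curves in the moving plane through the same vector have a difference that vanishes
  at \<open>t\<close> and is symplectically orthogonal to the plane at every nearby time.
  Differentiating the pairing at \<open>t\<close> leaves only the difference of the
  velocities.\<close>

lemma crossing_velocity_unique:
  assumes F: "diff_frame X Y L" and t: "t \<in> {0..1}" and u: "u \<in> L t"
    and w: "(w has_vector_derivative w') (at t within {0..1})" "\<forall>\<^sub>F s in at t within {0..1}. w s \<in> L s"
    and v: "w t = frame_map (X t) (Y t) y"
  shows "sympl u w' = sympl u (frame_map (mderiv X t) (mderiv Y t) y)"
proof -
  obtain x where x: "u = frame_map (X t) (Y t) x" by (rule is_frame_obtain[OF diff_frame_is_frame[OF F t] u])
  let ?\<phi> = "\<lambda>x s. frame_map (X s) (Y s) x" and ?\<psi> = "\<lambda>x. frame_map (mderiv X t) (mderiv Y t) x"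
  have vel: "(?\<phi> z has_vector_derivative ?\<psi> z) (at t within {0..1})" for z
    by (rule frame_velocity[OF diff_frame_deriv[OF F t] refl])
  have dd: "((\<lambda>s. w s - ?\<phi> y s) has_vector_derivative (w' - ?\<psi> y)) (at t within {0..1})"
    by (rule has_vector_derivative_diff[OF w(1) vel])
  have "((\<lambda>s. sympl (?\<phi> x s) (w s - ?\<phi> y s)) has_vector_derivative
      (sympl (?\<phi> x t) (w' - ?\<psi> y) + sympl (?\<psi> x) (w t - ?\<phi> y t))) (at t within {0..1})"
    by (rule bounded_bilinear.has_vector_derivative[OF bounded_bilinear_sympl vel dd])
  then have 1: "((\<lambda>s. sympl (?\<phi> x s) (w s - ?\<phi> y s)) has_vector_derivative sympl u (w' - ?\<psi> y)) (at t within {0..1})"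
    using v x by simp
  have "\<forall>\<^sub>F s in at t within {0..1}. s \<in> {0..1}" by (simp add: eventually_at_filter)
  then have "\<forall>\<^sub>F s in at t within {0..1}. sympl (?\<phi> x s) (w s - ?\<phi> y s) = 0"
    using w(2)
  proof eventually_elim
    case (elim s)
    note fr = is_frame_mem[OF diff_frame_is_frame[OF F elim(1)]]
    show ?case
      using Lagr_isotropic[OF diff_frame_Lagr[OF F elim(1)] fr[of x] elim(2)]
        Lagr_isotropic[OF diff_frame_Lagr[OF F elim(1)] fr[of x] fr[of y]]
      by (simp add: sympl_diff_right)
  qed
  then have "((\<lambda>s. 0 :: complex) has_vector_derivative sympl u (w' - ?\<psi> y)) (at t within {0..1})"
    by (rule has_vector_derivative_transform_eventually[OF 1]) (use v t in simp_all)
  then have "sympl u (w' - ?\<psi> y) = 0"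
    using has_vector_derivative_unique_unit[OF t _ has_vector_derivative_const] by blast
  then show ?thesis by (simp add: sympl_diff_right)
qed

text \<open>The definite description is resolved by comparing all frames with one arbitrary
  differentiable curve \<open>w\<close> in the planes; afterwards the form can be computed along
  whichever curve is convenient, from a frame or from a chart.\<close>

lemma crossing_form_eq:
  assumes F: "diff_frame X Y L" and t: "t \<in> {0..1}" and u: "u \<in> L t"
    and w: "(w has_vector_derivative w') (at t within {0..1})" "\<forall>\<^sub>F s in at t within {0..1}. w s \<in> L s" "w t \<in> L t"
  shows "crossing_form L t u (w t) = sympl u w'"
  unfolding crossing_form_def
proof (rule the_equality)
  obtain x where x: "u = frame_map (X t) (Y t) x" by (rule is_frame_obtain[OF diff_frame_is_frame[OF F t] u])
  obtain y where y: "w t = frame_map (X t) (Y t) y" by (rule is_frame_obtain[OF diff_frame_is_frame[OF F t] w(3)])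
  have "sympl u w' = cdot x ((adj (X t) ** mderiv Y t - adj (Y t) ** mderiv X t) *v y)"
    unfolding crossing_sympl x[symmetric] by (rule crossing_velocity_unique[OF F t u w(1,2) y])
  then show "\<exists>X Y x y. diff_frame X Y L \<and> u = frame_map (X t) (Y t) x \<and> w t = frame_map (X t) (Y t) y \<and>
      sympl u w' = cdot x ((adj (X t) ** mderiv Y t - adj (Y t) ** mderiv X t) *v y)"
    using F x y by blast
next
  fix c assume "\<exists>X Y x y. diff_frame X Y L \<and> u = frame_map (X t) (Y t) x \<and> w t = frame_map (X t) (Y t) y \<and>
      c = cdot x ((adj (X t) ** mderiv Y t - adj (Y t) ** mderiv X t) *v y)"
  then obtain X Y x y where F: "diff_frame X Y L" and x: "u = frame_map (X t) (Y t) x"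
    and y: "w t = frame_map (X t) (Y t) y" and c: "c = cdot x ((adj (X t) ** mderiv Y t - adj (Y t) ** mderiv X t) *v y)"
    by blast
  show "c = sympl u w'"
    unfolding c crossing_sympl x[symmetric] by (rule crossing_velocity_unique[OF F t u w(1,2) y, symmetric])
qed

lemma crossing_form_frame:
  assumes F: "diff_frame X Y L" and t: "t \<in> {0..1}"
    and d: "(X has_vector_derivative X') (at t within {0..1})" "(Y has_vector_derivative Y') (at t within {0..1})"
  shows "crossing_form L t (frame_map (X t) (Y t) x) (frame_map (X t) (Y t) y)
    = sympl (frame_map (X t) (Y t) x) (frame_map X' Y' y)"
proof (rule crossing_form_eq[OF F t, of _ "\<lambda>s. frame_map (X s) (Y s) y"])
  show "\<forall>\<^sub>F s in at t within {0..1}. frame_map (X s) (Y s) y \<in> L s"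
    using is_frame_mem[OF diff_frame_is_frame[OF F]] by (simp add: eventually_at_filter)
qed (use is_frame_mem[OF diff_frame_is_frame[OF F t]] frame_velocity[OF d refl] in auto)

section \<open>Paths and crossing forms in charts\<close>

lemma chart_path:
  assumes F: "diff_frame X Y L" and S: "symplectic_map S" "S ` graph_inf = N"
  obtains A where "\<forall>s\<in>{0..1}. transv (L s) N \<longrightarrow>
    hermitian (A s) \<and> S ` graph (A s) = L s \<and> A differentiable (at s within {0..1})"
proof -
  obtain P Q R U where blk: "inv S = blk P Q R U"
    by (rule linear_is_blk[OF symplectic_linear[OF symplectic_inv[OF S(1)]]])
  define A where "A s = (R ** X s + U ** Y s) ** cinv (P ** X s + Q ** Y s)" for s
  have "hermitian (A s) \<and> S ` graph (A s) = L s \<and> A differentiable (at s within {0..1})"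
    if s: "s \<in> {0..1}" and t: "transv (L s) N" for s
  proof -
    note fr = diff_frame_is_frame[OF F s] and La = diff_frame_Lagr[OF F s]
    have c: "chart S (L s) = A s"
      unfolding A_def by (rule chart_frame(2)[OF S(1) blk fr La]) (simp add: S(2) t)
    have nz: "det (P ** X s + Q ** Y s) \<noteq> 0" using chart_frame(1)[OF S(1) blk fr La] S(2) t by simp
    have dX: "X differentiable (at s within {0..1})" "Y differentiable (at s within {0..1})"
      using F s unfolding diff_frame_def differentiable_on_def by blast+
    have "A differentiable (at s within {0..1})"
      unfolding A_def using nz dX
      by (intro differentiable_matrix_mult differentiable_cinv differentiable_add) simp_all
    then show ?thesis using chart_transv[OF S La t] unfolding c by blast
  qed
  then show ?thesis using that by blast
qed

lemma eventually_transv: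
  assumes "lagr_path L" "t \<in> {0..1}" "N \<in> Lagr" "transv (L t) N"
  shows "\<forall>\<^sub>F s in at t within {0..1}. s \<in> {0..1} \<and> transv (L s) N"
proof -
  have "L t \<in> {K\<in>Lagr. transv K N}" using assms(4) lagr_path_Lagr[OF assms(1,2)] by blast
  then obtain \<delta> where "\<delta> > 0" "\<forall>s\<in>{0..1}. \<bar>s - t\<bar> < \<delta> \<longrightarrow> L s \<in> {K\<in>Lagr. transv K N}"
    by (rule lagr_path_open[OF assms(1,2) openin_transv[OF assms(3)]])
  then show ?thesis unfolding eventually_at by (intro exI[of _ \<delta>]) (simp add: dist_real_def)
qed

lemma graph_image_mem: "S ` graph A = L \<Longrightarrow> S (z, A *v z) \<in> L"
proof -
  assume "S ` graph A = L"
  moreover have "(z, A *v z) \<in> graph A" by (simp add: graph_iff)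
  ultimately show ?thesis by blast
qed

text \<open>The curve \<open>S (y, A s y)\<close> has the vertical velocity
  \<open>S (0, A' y)\<close>, so in a chart the crossing form is the derivative of the Hermitian
  matrix of the path.\<close>

lemma crossing_form_chart:
  assumes F: "diff_frame X Y L" and S: "symplectic_map S" "S ` graph_inf = N" and N: "N \<in> Lagr"
    and t: "t \<in> {0..1}" "transv (L t) N"
    and A: "\<forall>s\<in>{0..1}. transv (L s) N \<longrightarrow> hermitian (A s) \<and> S ` graph (A s) = L s \<and> A differentiable (at s within {0..1})"
    and A': "(A has_vector_derivative A') (at t within {0..1})"
  shows "crossing_form L t (S (x, A t *v x)) (S (y, A t *v y)) = cdot x (A' *v y)" and "hermitian A'"
proof -
  note ev = eventually_transv[OF diff_frame_lagr_path[OF F] t(1) N t(2)]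
  have SA: "S (z, A s *v z) \<in> L s" if "s \<in> {0..1}" "transv (L s) N" for z s
    using A that by (intro graph_image_mem) blast
  have dz: "((\<lambda>s. A s *v y) has_vector_derivative A' *v y) (at t within {0..1})"
    by (rule bounded_linear.has_vector_derivative[OF bounded_linear_mat_vec A'])
  have w: "((\<lambda>s. S (y, A s *v y)) has_vector_derivative S (0, A' *v y)) (at t within {0..1})"
    by (rule bounded_linear.has_vector_derivative[OF phase_linear_imp_linear(2)[OF symplectic_linear[OF S(1)]]])
      (intro has_vector_derivative_Pair has_vector_derivative_const dz)
  have "crossing_form L t (S (x, A t *v x)) (S (y, A t *v y)) = sympl (S (x, A t *v x)) (S (0, A' *v y))"
  proof (rule crossing_form_eq[OF F t(1) _ w])
    show "\<forall>\<^sub>F s in at t within {0..1}. S (y, A s *v y) \<in> L s" using ev by eventually_elim (simp add: SA)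
  qed (use SA t in simp_all)
  also have "\<dots> = cdot x (A' *v y)" unfolding symplectic_sympl[OF S(1)] by (simp add: sympl_def)
  finally show "crossing_form L t (S (x, A t *v x)) (S (y, A t *v y)) = cdot x (A' *v y)" .
  have bl: "bounded_linear (adj :: complex ^ 'a ^ 'a \<Rightarrow> complex ^ 'a ^ 'a)"
    by (intro linear_conv_bounded_linear[THEN iffD1] linearI) (simp_all add: adj_def vec_eq_iff)
  have "((\<lambda>s. adj (A s)) has_vector_derivative adj A') (at t within {0..1})"
    by (rule bounded_linear.has_vector_derivative[OF bl A'])
  moreover have "\<forall>\<^sub>F s in at t within {0..1}. adj (A s) = A s"
    using ev by eventually_elim (use A in \<open>simp add: hermitian_def\<close>)
  moreover have "adj (A t) = A t" using A t by (simp add: hermitian_def)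
  ultimately have "(A has_vector_derivative adj A') (at t within {0..1})"
    using has_vector_derivative_transform_eventually t(1) by blast
  then show "hermitian A'" unfolding hermitian_def using has_vector_derivative_unique_unit[OF t(1) _ A'] by blast
qed

text \<open>With \<open>M\<close> at the zero matrix and \<open>N\<close> at infinity, the terms in
  \<open>B - A\<close> cancel between the two indices. Counting strictly positive directions only is
  what produces the half-open endpoint convention of the Maslov index.\<close>

lemma mas_chart:
  assumes g: "lagr_path \<gamma>" and M: "M \<in> Lagr" "N \<in> Lagr"
    and S: "symplectic_map S" "S ` graph 0 = M" "S ` graph_inf = N"
    and cd: "c \<in> {0..1}" "d \<in> {0..1}" "\<forall>t\<in>{min c d..max c d}. transv (\<gamma> t) N"
    and A: "hermitian A" "S ` graph A = \<gamma> c" and B: "hermitian B" "S ` graph B = \<gamma> d"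
  shows "mas M \<gamma> c d = int (mpos B) - int (mpos A)"
proof -
  have L: "\<gamma> c \<in> Lagr" "\<gamma> d \<in> Lagr" using lagr_path_Lagr[OF g] cd by blast+
  have "mas M \<gamma> c d = iota (\<gamma> c) (\<gamma> d) M - iota (\<gamma> c) (\<gamma> d) N"
    using mas_local_any[OF g M cd] pot_diff[OF M L] by simp
  moreover have "iota (\<gamma> c) (\<gamma> d) M = int (mneg (B - A)) + int (mneg (0 - B)) - int (mneg (0 - A))"
    using iota_triple_chart[OF S(1) _ A(1) B(1) hermitian_0] S M A B by simp
  moreover have "iota (\<gamma> c) (\<gamma> d) N = int (mneg (B - A))"
    using iota_chart[OF S(1,3) M(2) A(1) B(1)] A B by simp
  ultimately show ?thesis by simp
qed

text \<open>In a chart the quadratic forms of the matrices are non-decreasing in time, so their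
  positive index is too. The mean value theorem is used rather than an integral because the velocity
  need not be continuous.\<close>

lemma nondecreasing_mas_nonneg:
  assumes L: "nondecreasing L" and M: "M \<in> Lagr"
  shows "mas M L 0 1 \<ge> 0"
proof -
  obtain X Y where F: "diff_frame X Y L" using L unfolding nondecreasing_def diff_path_def by blast
  have g: "lagr_path L" by (rule diff_frame_lagr_path[OF F])
  show ?thesis
  proof (rule interval_bisection[of 0 1 "\<lambda>a b. mas M L a b \<ge> 0"])
    fix c d e :: real assume "mas M L c d \<ge> 0" "mas M L d e \<ge> 0"
    then show "mas M L c e \<ge> 0" using mas_add[of M L c d e] by linarith
  next
    fix x :: real assume "0 \<le> x" "x \<le> 1"
    then have x: "x \<in> {0..1}" by simp
    obtain N \<delta> where N: "N \<in> Lagr" "\<forall>L\<in>{M}. transv L N" "\<delta> > 0" "\<forall>t\<in>{0..1}. \<bar>t - x\<bar> < \<delta> \<longrightarrow> transv (L t) N"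
      by (rule lagr_path_chart[OF g x, of "{M}"]) (use M in auto)
    have MN: "transv M N" using N(2) by simp
    obtain S where S: "symplectic_map S" "S ` graph 0 = M" "S ` graph_inf = N"
      by (rule normal_form[OF M N(1) MN])
    obtain A where A: "\<forall>s\<in>{0..1}. transv (L s) N \<longrightarrow>
      hermitian (A s) \<and> S ` graph (A s) = L s \<and> A differentiable (at s within {0..1})"
      by (rule chart_path[OF F S(1,3)])
    show "\<exists>\<delta>>0. \<forall>c d. 0 \<le> c \<longrightarrow> c \<le> x \<longrightarrow> x \<le> d \<longrightarrow> d \<le> 1 \<longrightarrow> d - c < \<delta> \<longrightarrow> mas M L c d \<ge> 0"
    proof (intro exI[of _ \<delta>] conjI allI impI)
      fix c d assume cd: "0 \<le> c" "c \<le> x" "x \<le> d" "d \<le> 1" "d - c < \<delta>"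
      have tr: "transv (L t) N" "t \<in> {0..1}" if "t \<in> {c..d}" for t using N(4) cd that by auto
      have "mas M L c d = int (mpos (A d)) - int (mpos (A c))"
        by (rule mas_chart[OF g M N(1) S]) (use A tr cd in auto)
      moreover have "mpos (A c) \<le> mpos (A d)"
      proof (rule mpos_mono)
        fix z
        show "Re (cdot z (A c *v z)) \<le> Re (cdot z (A d *v z))"
        proof (cases "c < d")
          case True
          define f where "f t = Re (cdot z (A t *v z))" for t
          define f' where "f' t = Re (cdot z (vector_derivative A (at t within {0..1}) *v z))" for t
          have der: "(f has_derivative (\<lambda>h. h * f' t)) (at t within {c..d})" if t: "t \<in> {c..d}" for t
          proof -
            have "(A has_vector_derivative vector_derivative A (at t within {0..1})) (at t within {0..1})"
              using A tr[OF t] vector_derivative_works by blast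
            then have "(f has_vector_derivative f' t) (at t within {0..1})"
              unfolding f_def f'_def
              by (intro bounded_linear.has_vector_derivative[OF bounded_linear_Re]
                  bounded_linear.has_vector_derivative[OF bounded_bilinear.bounded_linear_right[OF bounded_bilinear_cdot]]
                  bounded_linear.has_vector_derivative[OF bounded_linear_mat_vec])
            then have "(f has_vector_derivative f' t) (at t within {c..d})"
              by (rule has_vector_derivative_within_subset) (use cd in auto)
            then show ?thesis unfolding has_vector_derivative_def by simp
          qed
          have "f' t \<ge> 0" if t: "t \<in> {c..d}" for t
          proof -
            have "(A has_vector_derivative vector_derivative A (at t within {0..1})) (at t within {0..1})"
              using A tr[OF t] vector_derivative_works by blast
            from crossing_form_chart(1)[OF F S(1,3) N(1) tr(2)[OF t] tr(1)[OF t] A this, of z z]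
            have "f' t = Re (crossing_form L t (S (z, A t *v z)) (S (z, A t *v z)))" by (simp add: f'_def)
            moreover have "S (z, A t *v z) \<in> L t" using A tr[OF t] by (intro graph_image_mem) blast
            ultimately show ?thesis using L tr(2)[OF t] unfolding nondecreasing_def by simp
          qed
          moreover obtain \<xi> where "\<xi> \<in> {c<..<d}" "f d - f c = (d - c) * f' \<xi>"
            using mvt_simple[OF True der] by auto
          ultimately have "f d - f c \<ge> 0" by simp
          then show ?thesis by (simp add: f_def)
        next
          case False
          then have "c = d" using cd by simp
          then show ?thesis by simp
        qed
      qed
      ultimately show "mas M L c d \<ge> 0" by simp
    qed (rule N(3))
  qed simp
qed

lemma mker_image:
  assumes S: "symplectic_map S"
  shows "S ` mker A = S ` graph A \<inter> S ` graph 0"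
proof -
  have "mker A = graph A \<inter> graph 0"
    unfolding mker_def horiz_def by (auto simp: graph_iff)
  then show ?thesis by (simp add: image_Int[OF symplectic_inj[OF S]])
qed

text \<open>Near \<open>t0\<close> the matrix is \<open>A t0\<close> plus \<open>t - t0\<close>
  times a small perturbation of the crossing matrix \<open>B\<close>. By
  \<open>crossing_inertia\<close> the positive index jumps by the positive index of \<open>B\<close>
  to the right; to the left the increment is positive in the direction of \<open>- B\<close>, which
  gives the negative index.\<close>

lemma crossing_local:
  assumes F: "diff_frame X Y L" and t0: "t0 \<in> {0..1}" and M: "M \<in> Lagr"
    and nd: "form_nondegenerate (crossing_form L t0) (L t0 \<inter> M)"
  obtains \<delta> where "\<delta> > 0"
    "\<forall>t\<in>{0..1}. 0 < \<bar>t - t0\<bar> \<longrightarrow> \<bar>t - t0\<bar> < \<delta> \<longrightarrow> transv (L t) M \<and>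
      mas M L t0 t = (if t0 < t then int (form_n_pos (crossing_form L t0) (L t0 \<inter> M))
        else int (form_n_neg (crossing_form L t0) (L t0 \<inter> M)))"
proof -
  have g: "lagr_path L" by (rule diff_frame_lagr_path[OF F])
  obtain N \<delta>1 where N: "N \<in> Lagr" "\<forall>L\<in>{M}. transv L N" "\<delta>1 > 0" "\<forall>t\<in>{0..1}. \<bar>t - t0\<bar> < \<delta>1 \<longrightarrow> transv (L t) N"
    by (rule lagr_path_chart[OF g t0, of "{M}"]) (use M in auto)
  have MN: "transv M N" using N(2) by simp
  have t0N: "transv (L t0) N" using N(3,4) t0 by simp
  obtain S where S: "symplectic_map S" "S ` graph 0 = M" "S ` graph_inf = N"
    by (rule normal_form[OF M N(1) MN])
  obtain A where A: "\<forall>s\<in>{0..1}. transv (L s) N \<longrightarrow>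
    hermitian (A s) \<and> S ` graph (A s) = L s \<and> A differentiable (at s within {0..1})"
    by (rule chart_path[OF F S(1,3)])
  define B where "B = vector_derivative A (at t0 within {0..1})"
  have B: "(A has_vector_derivative B) (at t0 within {0..1})"
    unfolding B_def using A t0 t0N vector_derivative_works by blast
  have hA: "hermitian (A t0)" "S ` graph (A t0) = L t0" using A t0 t0N by blast+
  have hB: "hermitian B" by (rule crossing_form_chart(2)[OF F S(1,3) N(1) t0 t0N A B])
  let ?q = "crossing_form L t0" and ?V = "L t0 \<inter> M"
  have V: "S ` mker (A t0) = ?V" using mker_image[OF S(1), of "A t0"] hA(2) S(2) by simp
  have q: "?q (S u) (S v) = mat_form B u v" if "u \<in> mker (A t0)" "v \<in> mker (A t0)" for u v
  proof -
    have "u = (fst u, A t0 *v fst u)" "v = (fst v, A t0 *v fst v)"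
      using that by (simp_all add: mker_def horiz_iff prod_eq_iff)
    then show ?thesis
      using crossing_form_chart(1)[OF F S(1,3) N(1) t0 t0N A B, of "fst u" "fst v"] by (simp add: mat_form_def)
  qed
  have sV: "phase.subspace ?V"
    by (intro phase.subspace_inter Lagr_subspace M lagr_path_Lagr[OF g t0])
  have hq: "herm_form ?V ?q"
    unfolding herm_form_def
  proof (intro conjI ballI allI)
    fix u v w c assume uv: "u \<in> ?V" "v \<in> ?V"
    obtain u' v' where u': "u' \<in> mker (A t0)" "u = S u'" "v' \<in> mker (A t0)" "v = S v'"
      using uv unfolding V[symmetric] by blast
    have hm: "herm_form UNIV (mat_form B)" by (rule herm_mat_form[OF hB])
    show "?q u (pscale c v) = c * ?q u v"
      unfolding u'(2,4) symplectic_scale[OF S(1), symmetric]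
      using q u' phase.subspace_scale[OF subspace_mker u'(3)] herm_scale_right[OF phase.subspace_UNIV hm] by simp
    show "?q v u = cnj (?q u v)"
      unfolding u'(2,4) using q u' herm_cnj[OF phase.subspace_UNIV hm, of u' v'] by simp
    assume w: "w \<in> ?V"
    obtain w' where w': "w' \<in> mker (A t0)" "w = S w'" using w unfolding V[symmetric] by blast
    show "?q u (v + w) = ?q u v + ?q u w"
      unfolding u'(2,4) w'(2) symplectic_add[OF S(1), symmetric]
      using q u' w' phase.subspace_add[OF subspace_mker u'(3) w'(1)] herm_add_right[OF phase.subspace_UNIV hm] by simp
  qed
  \<comment> \<open>Taken for \<open>c = 1\<close> and \<open>c = - 1\<close>, it transfers both
    indices to the kernel of \<open>A t0\<close>.\<close>
  have np: "npos (\<lambda>u v. c * ?q u v) ?V = npos (\<lambda>u v. c * mat_form B u v) (mker (A t0))" for c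
  proof -
    have "npos (\<lambda>u v. c * ?q u v) (S ` mker (A t0)) = npos (\<lambda>u v. c * ?q (S u) (S v)) (mker (A t0))"
      by (rule npos_image[OF subspace_mker symplectic_linear[OF S(1)]])
        (rule inj_on_subset[OF symplectic_inj[OF S(1)] subset_UNIV])
    also have "\<dots> = npos (\<lambda>u v. c * mat_form B u v) (mker (A t0))" by (rule npos_cong) (simp add: q)
    finally show ?thesis unfolding V .
  qed
  have npos: "form_n_pos ?q ?V = npos (mat_form B) (mker (A t0))"
    using form_n_pos_eq_npos[OF sV hq] np[of 1] by simp
  have nneg: "form_n_neg ?q ?V = npos (mat_form (- B)) (mker (A t0))"
    using form_n_neg_eq_nneg[OF sV hq] np[of "- 1"] npos_cong[of "mker (A t0)" "mat_form (- B)" "\<lambda>u v. - mat_form B u v"]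
    by (simp add: mat_form_uminus)
  have ndB: "form_nondegenerate (mat_form B) (mker (A t0))"
    unfolding form_nondegenerate_def
  proof (intro ballI impI)
    fix v assume v: "v \<in> mker (A t0)" "\<forall>u\<in>mker (A t0). mat_form B u v = 0"
    have "S v \<in> ?V" "\<forall>u\<in>?V. ?q u (S v) = 0" using v q unfolding V[symmetric] by auto
    then have "S v = 0" using nd unfolding form_nondegenerate_def by blast
    then have "S v = S 0" using symplectic_zero[OF S(1)] by simp
    then show "v = 0" by (rule injD[OF symplectic_inj[OF S(1)]])
  qed
  then have ndB': "form_nondegenerate (mat_form (- B)) (mker (A t0))"
    unfolding form_nondegenerate_def by (simp add: mat_form_uminus)
  obtain d1 e1 where 1: "d1 > 0" "e1 > 0" "\<forall>s E. 0 < s \<longrightarrow> s < d1 \<longrightarrow> norm E < e1 \<longrightarrow> hermitian (A t0 + s *\<^sub>R (B + E)) \<longrightarrow>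
    mpos (A t0 + s *\<^sub>R (B + E)) = mpos (A t0) + npos (mat_form B) (mker (A t0)) \<and> mker (A t0 + s *\<^sub>R (B + E)) = {0}"
    by (rule crossing_inertia[OF hA(1) hB ndB])
  obtain d2 e2 where 2: "d2 > 0" "e2 > 0" "\<forall>s E. 0 < s \<longrightarrow> s < d2 \<longrightarrow> norm E < e2 \<longrightarrow> hermitian (A t0 + s *\<^sub>R (- B + E)) \<longrightarrow>
    mpos (A t0 + s *\<^sub>R (- B + E)) = mpos (A t0) + npos (mat_form (- B)) (mker (A t0)) \<and> mker (A t0 + s *\<^sub>R (- B + E)) = {0}"
    by (rule crossing_inertia[OF hA(1) hermitian_uminus[OF hB] ndB'])
  define e where "e = min e1 e2 / 2"
  have e0: "e > 0" using 1 2 by (simp add: e_def)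
  obtain d3 where d3: "d3 > 0" "\<forall>t\<in>{0..1}. norm (t - t0) < d3 \<longrightarrow> norm (A t - A t0 - (t - t0) *\<^sub>R B) \<le> e * norm (t - t0)"
    using B e0 unfolding has_vector_derivative_def has_derivative_within_alt by blast
  define \<delta> where "\<delta> = min (min \<delta>1 d3) (min d1 d2)"
  have "transv (L t) M \<and> mas M L t0 t = (if t0 < t then int (form_n_pos ?q ?V) else int (form_n_neg ?q ?V))"
    if t: "t \<in> {0..1}" "0 < \<bar>t - t0\<bar>" "\<bar>t - t0\<bar> < \<delta>" for t
  proof -
    have tN: "transv (L r) N" "r \<in> {0..1}" if "r \<in> {min t0 t..max t0 t}" for r
    proof -
      show "r \<in> {0..1}" using that t(1) t0 by (auto simp: min_def max_def split: if_splits)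
      moreover have "\<bar>r - t0\<bar> < \<delta>1" using that t(3) unfolding \<delta>_def by (auto simp: min_def max_def split: if_splits)
      ultimately show "transv (L r) N" using N(4) by blast
    qed
    have At: "hermitian (A t)" "S ` graph (A t) = L t" using A t(1) tN[of t] by auto
    have mas: "mas M L t0 t = int (mpos (A t)) - int (mpos (A t0))"
      by (rule mas_chart[OF g M N(1) S t0 t(1) _ hA At]) (use tN in blast)
    define s where "s = \<bar>t - t0\<bar>"
    \<comment> \<open>The first-order Taylor remainder divided by \<open>t - t0\<close>;
      differentiability makes it smaller than the bounds of \<open>crossing_inertia\<close>. The
      half in \<open>e\<close> turns the weak estimate into strict ones.\<close>
    define E where "E = (1 / (t - t0)) *\<^sub>R (A t - A t0 - (t - t0) *\<^sub>R B)"
    have nE: "norm E \<le> e"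
    proof -
      have "norm (A t - A t0 - (t - t0) *\<^sub>R B) \<le> e * \<bar>t - t0\<bar>" using d3(2) t unfolding \<delta>_def by simp
      then have "\<bar>1 / (t - t0)\<bar> * norm (A t - A t0 - (t - t0) *\<^sub>R B) \<le> \<bar>1 / (t - t0)\<bar> * (e * \<bar>t - t0\<bar>)"
        by (rule mult_left_mono) simp
      also have "\<dots> = e" using t(2) by simp
      finally show ?thesis unfolding E_def by simp
    qed
    have nE': "norm E < e1" "norm E < e2" using nE e0 1(2) 2(2) unfolding e_def by auto
    have s: "0 < s" "s < d1" "s < d2" using t unfolding s_def \<delta>_def by auto
    have AE: "A t = A t0 + (t - t0) *\<^sub>R (B + E)"
      unfolding E_def scaleR_add_right using t(2) by simp
    have res: "mpos (A t) = mpos (A t0) + (if t0 < t then form_n_pos ?q ?V else form_n_neg ?q ?V) \<and> mker (A t) = {0}"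
    proof (cases "t0 < t")
      case True
      then have "A t = A t0 + s *\<^sub>R (B + E)" using AE by (simp add: s_def)
      then show ?thesis using 1(3)[rule_format, of s E] s nE' At(1) True npos by simp
    next
      case False
      then have "A t = A t0 + s *\<^sub>R (- B + - E)" using AE t(2) by (simp add: s_def algebra_simps)
      then show ?thesis using 2(3)[rule_format, of s "- E"] s nE' At(1) False nneg by simp
    qed
    have "transv (graph (A t)) (graph 0)" using res by (simp add: transv_graphs)
    then have "transv (L t) M" using symplectic_transv[OF S(1), of "graph (A t)" "graph 0"] At(2) S(2) by simp
    then show ?thesis using res mas by simp
  qed
  moreover have "\<delta> > 0" unfolding \<delta>_def using N(3) d3(1) 1(1) 2(1) by simp
  ultimately show ?thesis using that by blast
qed

lemma crossing_n_trivial: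
  fixes q :: "'n phase \<Rightarrow> 'n::finite phase \<Rightarrow> complex"
  shows "form_n_pos q {0} = 0" "form_n_neg q {0} = 0"
proof -
  have "phase.dim (form_eigenspace q {0} \<mu>) = 0" for \<mu>
  proof -
    have "form_eigenspace q {0} \<mu> \<subseteq> {0}" unfolding form_eigenspace_def by blast
    then show ?thesis using phasefd.dim_eq_0[of "form_eigenspace q {0} \<mu>"] by blast
  qed
  then show "form_n_pos q {0} = 0" "form_n_neg q {0} = 0"
    unfolding form_n_pos_def form_n_neg_def by (simp_all only: sum.neutral_const)
qed

text \<open>Bisection, with at most one crossing on a short interval. Finiteness of the crossings is
  part of the claim: the sums split over adjacent intervals only for finite index sets. The
  half-open ranges count a common endpoint once for each sign.\<close>

lemma maslov_regular_eq_mas: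
  assumes R: "regular_path L M" and M: "M \<in> Lagr"
  shows "maslov_regular L M = mas M L 0 1"
proof -
  obtain X Y where F: "diff_frame X Y L" using R unfolding regular_path_def C1_path_def by blast
  define C where "C = {t. L t \<inter> M \<noteq> {0}}"
  define p where "p t = int (form_n_pos (crossing_form L t) (L t \<inter> M))" for t
  define m where "m t = int (form_n_neg (crossing_form L t) (L t \<inter> M))" for t
  define P where "P a b \<longleftrightarrow> finite ({a..b} \<inter> C) \<and> mas M L a b = sum p ({a..<b} \<inter> C) - sum m ({a<..b} \<inter> C)" for a b
  have "P 0 1"
  proof (rule interval_bisection[of 0 1 P])
    fix a b c :: real assume abc: "0 \<le> a" "a \<le> b" "b \<le> c" "c \<le> 1" and P: "P a b" "P b c"
    have fin: "finite ({a..b} \<inter> C)" "finite ({b..c} \<inter> C)" using P unfolding P_def by blast+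
    have "{a..c} \<inter> C = ({a..b} \<inter> C) \<union> ({b..c} \<inter> C)" using abc by auto
    then have "finite ({a..c} \<inter> C)" using fin by simp
    moreover have "sum p ({a..<c} \<inter> C) = sum p ({a..<b} \<inter> C) + sum p ({b..<c} \<inter> C)"
    proof -
      have "{a..<c} \<inter> C = ({a..<b} \<inter> C) \<union> ({b..<c} \<inter> C)" using abc by auto
      moreover have "finite ({a..<b} \<inter> C)" "finite ({b..<c} \<inter> C)"
        by (rule finite_subset[OF _ fin(1)], force) (rule finite_subset[OF _ fin(2)], force)
      ultimately show ?thesis using sum.union_disjoint[of "{a..<b} \<inter> C" "{b..<c} \<inter> C" p] by force
    qed
    moreover have "sum m ({a<..c} \<inter> C) = sum m ({a<..b} \<inter> C) + sum m ({b<..c} \<inter> C)"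
    proof -
      have "{a<..c} \<inter> C = ({a<..b} \<inter> C) \<union> ({b<..c} \<inter> C)" using abc by auto
      moreover have "finite ({a<..b} \<inter> C)" "finite ({b<..c} \<inter> C)"
        by (rule finite_subset[OF _ fin(1)], force) (rule finite_subset[OF _ fin(2)], force)
      ultimately show ?thesis using sum.union_disjoint[of "{a<..b} \<inter> C" "{b<..c} \<inter> C" m] by force
    qed
    ultimately show "P a c" using P mas_add[of M L a b c] unfolding P_def by simp
  next
    fix x :: real assume "0 \<le> x" "x \<le> 1"
    then have x: "x \<in> {0..1}" by simp
    have nd: "form_nondegenerate (crossing_form L x) (L x \<inter> M)"
    proof (cases "L x \<inter> M = {0}")
      case True then show ?thesis unfolding form_nondegenerate_def by blast
    next
      case False then show ?thesis using R x unfolding regular_path_def by blast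
    qed
    obtain \<delta> where \<delta>: "\<delta> > 0" "\<forall>t\<in>{0..1}. 0 < \<bar>t - x\<bar> \<longrightarrow> \<bar>t - x\<bar> < \<delta> \<longrightarrow> transv (L t) M \<and>
      mas M L x t = (if x < t then int (form_n_pos (crossing_form L x) (L x \<inter> M))
        else int (form_n_neg (crossing_form L x) (L x \<inter> M)))"
      by (rule crossing_local[OF F x M nd])
    \<comment> \<open>Off the crossings both contributions are zero, so the formulas for
      \<open>sp\<close> and \<open>sm\<close> need not distinguish whether the centre is a
      crossing.\<close>
    have tr0: "p x = 0 \<and> m x = 0" if "x \<notin> C"
      using that unfolding C_def p_def m_def by (simp add: crossing_n_trivial)
    show "\<exists>\<delta>>0. \<forall>a b. 0 \<le> a \<longrightarrow> a \<le> x \<longrightarrow> x \<le> b \<longrightarrow> b \<le> 1 \<longrightarrow> b - a < \<delta> \<longrightarrow> P a b"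
    proof (intro exI[of _ \<delta>] conjI allI impI)
      fix a b assume ab: "0 \<le> a" "a \<le> x" "x \<le> b" "b \<le> 1" "b - a < \<delta>"
      have noC: "t \<notin> C" if "t \<in> {a..b}" "t \<noteq> x" for t
      proof -
        have "transv (L t) M" using \<delta>(2) that ab by auto
        then show ?thesis unfolding C_def transv_def by blast
      qed
      then have sub: "{a..b} \<inter> C \<subseteq> {x}" by blast
      have fin: "finite ({a..b} \<inter> C)" by (rule finite_subset[OF sub]) simp
      have sp: "sum p ({a..<b} \<inter> C) = (if x < b then p x else 0)"
      proof (cases "x < b \<and> x \<in> C")
        case True
        then have "x \<in> {a..<b} \<inter> C" using ab by simp
        moreover have "{a..<b} \<inter> C \<subseteq> {x}" by (rule order_trans[OF _ sub]) auto
        ultimately have "{a..<b} \<inter> C = {x}" by blast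
        then show ?thesis using True by simp
      next
        case False
        then have "x \<notin> {a..<b} \<inter> C" by auto
        moreover have "{a..<b} \<inter> C \<subseteq> {x}" by (rule order_trans[OF _ sub]) auto
        ultimately have "{a..<b} \<inter> C = {}" by blast
        then show ?thesis using False tr0 by auto
      qed
      have sm: "sum m ({a<..b} \<inter> C) = (if a < x then m x else 0)"
      proof (cases "a < x \<and> x \<in> C")
        case True
        then have "x \<in> {a<..b} \<inter> C" using ab by simp
        moreover have "{a<..b} \<inter> C \<subseteq> {x}" by (rule order_trans[OF _ sub]) auto
        ultimately have "{a<..b} \<inter> C = {x}" by blast
        then show ?thesis using True by simp
      next
        case False
        then have "x \<notin> {a<..b} \<inter> C" by auto
        moreover have "{a<..b} \<inter> C \<subseteq> {x}" by (rule order_trans[OF _ sub]) auto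
        ultimately have "{a<..b} \<inter> C = {}" by blast
        then show ?thesis using False tr0 by auto
      qed
      have mb: "mas M L x b = (if x < b then p x else 0)"
      proof (cases "x < b")
        case True then show ?thesis using \<delta>(2) ab unfolding p_def by auto
      next
        case False then show ?thesis using ab by (simp add: mas_def)
      qed
      have ma: "mas M L x a = (if a < x then m x else 0)"
      proof (cases "a < x")
        case True then show ?thesis using \<delta>(2) ab unfolding m_def by auto
      next
        case False then show ?thesis using ab by (simp add: mas_def)
      qed
      have "mas M L a b = mas M L x b - mas M L x a" by (simp add: mas_def)
      then show "P a b" unfolding P_def sp sm using fin ma mb by simp
    qed (rule \<delta>(1))
  qed simp
  moreover have "{t. t \<in> {0..<1} \<and> L t \<inter> M \<noteq> {0}} = {0..<1} \<inter> C" "{t. t \<in> {0<..1} \<and> L t \<inter> M \<noteq> {0}} = {0<..1} \<inter> C"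
    unfolding C_def by auto
  ultimately show ?thesis unfolding maslov_regular_def P_def p_def m_def by simp
qed

section \<open>Regular representatives\<close>

subsection \<open>Rotating a path\<close>

text \<open>A one-parameter group of symplectic isometries. Its generator pairs with every nonzero
  vector to the squared norm, so increasing the angle moves every plane in the positive
  direction.\<close>

definition rot :: "real \<Rightarrow> 'n::finite phase \<Rightarrow> 'n phase" where
  "rot a v = (cos a *\<^sub>R fst v - sin a *\<^sub>R snd v, sin a *\<^sub>R fst v + cos a *\<^sub>R snd v)"

definition rot_X :: "real \<Rightarrow> complex ^ 'n ^ 'n \<Rightarrow> complex ^ 'n ^ 'n \<Rightarrow> complex ^ 'n ^ 'n" where
  "rot_X a X Y = cos a *\<^sub>R X - sin a *\<^sub>R Y"

definition rot_Y :: "real \<Rightarrow> complex ^ 'n ^ 'n \<Rightarrow> complex ^ 'n ^ 'n \<Rightarrow> complex ^ 'n ^ 'n" where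
  "rot_Y a X Y = sin a *\<^sub>R X + cos a *\<^sub>R Y"

lemma cdot_scaleR_left: "cdot (r *\<^sub>R x) y = of_real r * cdot x y"
proof -
  have "cdot (r *\<^sub>R x) y = r *\<^sub>R cdot x y" by (simp add: cdot_def scaleR_sum_right)
  then show ?thesis by (simp add: scaleR_conv_of_real)
qed

lemma sympl_rot: "sympl (rot a u) (rot a v) = sympl u v"
proof -
  have "sympl (rot a u) (rot a v) = (of_real (cos a))\<^sup>2 * sympl u v + (of_real (sin a))\<^sup>2 * sympl u v"
    by (simp add: sympl_def rot_def cdot_add_left cdot_add_right cdot_diff_left cdot_diff_right
        cdot_scaleR_left cdot_scaleR_right algebra_simps power2_eq_square)
  also have "\<dots> = of_real ((cos a)\<^sup>2 + (sin a)\<^sup>2) * sympl u v"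
    by (simp only: distrib_right of_real_add of_real_power)
  finally show ?thesis by simp
qed

lemma symplectic_rot: "symplectic_map (rot a)"
  unfolding symplectic_map_def phase_linear_iff
proof (intro conjI allI sympl_rot)
  fix x y :: "'a phase" and c
  show "rot a (x + y) = rot a x + rot a y"
    by (simp add: rot_def prod_eq_iff scaleR_add_right)
  show "rot a (pscale c x) = pscale c (rot a x)"
    by (simp add: rot_def prod_eq_iff vec_eq_iff algebra_simps)
qed

lemma rot_0: "rot 0 = id"
  by (simp add: rot_def fun_eq_iff)

lemma frame_rot: "frame_map (rot_X a X Y) (rot_Y a X Y) x = rot a (frame_map X Y x)"
  by (simp add: frame_map_def rot_def rot_X_def rot_Y_def matrix_vector_mult_add_rdistrib
      matrix_vector_mult_diff_rdistrib mat_vec_scaleR)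

lemma is_frame_rot: "is_frame X Y L \<Longrightarrow> is_frame (rot_X a X Y) (rot_Y a X Y) (rot a ` L)"
proof -
  assume F: "is_frame X Y L"
  have "frame_map (rot_X a X Y) (rot_Y a X Y) = rot a \<circ> frame_map X Y" by (rule ext) (simp add: frame_rot)
  then show ?thesis
    using F inj_compose[OF symplectic_inj[OF symplectic_rot[of a]], of "frame_map X Y"] unfolding is_frame_def
    by (metis image_comp)
qed

definition rot_gen :: "'n::finite phase \<Rightarrow> 'n phase" where
  "rot_gen v = (- snd v, fst v)"

lemma sympl_rot_gen: "sympl v (rot_gen v) = of_real ((norm v)\<^sup>2)"
  unfolding pdot_self[symmetric] by (simp add: sympl_def rot_gen_def pdot_def cdot_minus_right)

lemma norm_rot: "norm (rot a v) = norm v"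
proof -
  have "rot_gen (rot a v) = rot a (rot_gen v)" by (simp add: rot_gen_def rot_def)
  then have "sympl (rot a v) (rot_gen (rot a v)) = sympl v (rot_gen v)" by (simp add: sympl_rot)
  then have "(norm (rot a v))\<^sup>2 = (norm v)\<^sup>2" unfolding sympl_rot_gen of_real_eq_iff .
  then show ?thesis by simp
qed

lemma mderiv_eq:
  assumes "t \<in> {0..1}" "(X has_vector_derivative X') (at t within {0..1})"
  shows "mderiv X t = X'"
proof -
  have "(X has_vector_derivative mderiv X t) (at t within {0..1})"
    unfolding mderiv_def using assms(2) vector_derivative_works differentiableI_vector by blast
  then show ?thesis by (rule has_vector_derivative_unique_unit[OF assms(1) _ assms(2)])
qed

section \<open>Rotated frames and their crossing forms\<close>

locale framed_path =
  fixes X Y X' Y' :: "real \<Rightarrow> complex ^ 'n ^ 'n" and K :: "real \<Rightarrow> 'n::finite phase set"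
  assumes dX: "t \<in> {0..1} \<Longrightarrow> (X has_vector_derivative X' t) (at t within {0..1})"
    and dY: "t \<in> {0..1} \<Longrightarrow> (Y has_vector_derivative Y' t) (at t within {0..1})"
    and K: "t \<in> {0..1} \<Longrightarrow> K t \<in> Lagr" and fr: "t \<in> {0..1} \<Longrightarrow> is_frame (X t) (Y t) (K t)"
begin

lemma diff_frame: "diff_frame X Y K"
  unfolding diff_frame_def differentiable_on_def
  using differentiableI_vector[OF dX] differentiableI_vector[OF dY] K fr by blast

lemma cont: "continuous_on {0..1} X" "continuous_on {0..1} Y"
  using diff_frame unfolding diff_frame_def by (simp_all add: differentiable_imp_continuous_on)

lemma C1:
  assumes "continuous_on {0..1} X'" "continuous_on {0..1} Y'"
  shows "C1_path K"
  unfolding C1_path_def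
proof (intro exI conjI)
  show "continuous_on {0..1} (mderiv X)" "continuous_on {0..1} (mderiv Y)"
    by (rule continuous_on_eq[OF assms(1)], rule mderiv_eq[OF _ dX, symmetric]; assumption)
      (rule continuous_on_eq[OF assms(2)], rule mderiv_eq[OF _ dY, symmetric]; assumption)
qed (rule diff_frame)

lemma crossing:
  "t \<in> {0..1} \<Longrightarrow> crossing_form K t (frame_map (X t) (Y t) x) (frame_map (X t) (Y t) y)
     = sympl (frame_map (X t) (Y t) x) (frame_map (X' t) (Y' t) y)"
  by (rule crossing_form_frame[OF diff_frame _ dX dY])

lemma rotated:
  assumes \<phi>: "\<And>t. t \<in> {0..1} \<Longrightarrow> (\<phi> has_vector_derivative \<phi>' t) (at t within {0..1})"
  shows "framed_path (\<lambda>t. rot_X (\<phi> t) (X t) (Y t)) (\<lambda>t. rot_Y (\<phi> t) (X t) (Y t))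
     (\<lambda>t. rot_X (\<phi> t) (X' t) (Y' t) - \<phi>' t *\<^sub>R rot_Y (\<phi> t) (X t) (Y t))
     (\<lambda>t. rot_Y (\<phi> t) (X' t) (Y' t) + \<phi>' t *\<^sub>R rot_X (\<phi> t) (X t) (Y t)) (\<lambda>t. rot (\<phi> t) ` K t)"
proof
  fix t :: real assume t: "t \<in> {0..1}"
  have c: "((\<lambda>t. cos (\<phi> t)) has_real_derivative (- sin (\<phi> t) * \<phi>' t)) (at t within {0..1})"
    and s: "((\<lambda>t. sin (\<phi> t)) has_real_derivative (cos (\<phi> t) * \<phi>' t)) (at t within {0..1})"
    using \<phi>[OF t] unfolding has_real_derivative_iff_has_vector_derivative[symmetric]
    by (auto intro!: derivative_eq_intros)
  show "((\<lambda>t. rot_X (\<phi> t) (X t) (Y t)) has_vector_derivative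
      rot_X (\<phi> t) (X' t) (Y' t) - \<phi>' t *\<^sub>R rot_Y (\<phi> t) (X t) (Y t)) (at t within {0..1})"
  proof -
    have "((\<lambda>t. rot_X (\<phi> t) (X t) (Y t)) has_vector_derivative
      (cos (\<phi> t) *\<^sub>R X' t + (- sin (\<phi> t) * \<phi>' t) *\<^sub>R X t) - (sin (\<phi> t) *\<^sub>R Y' t + (cos (\<phi> t) * \<phi>' t) *\<^sub>R Y t)) (at t within {0..1})"
      unfolding rot_X_def
      by (intro has_vector_derivative_diff has_vector_derivative_scaleR c s dX[OF t] dY[OF t])
    then show ?thesis by (simp add: rot_X_def rot_Y_def algebra_simps)
  qed
  show "((\<lambda>t. rot_Y (\<phi> t) (X t) (Y t)) has_vector_derivative
      rot_Y (\<phi> t) (X' t) (Y' t) + \<phi>' t *\<^sub>R rot_X (\<phi> t) (X t) (Y t)) (at t within {0..1})"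
  proof -
    have "((\<lambda>t. rot_Y (\<phi> t) (X t) (Y t)) has_vector_derivative
      (sin (\<phi> t) *\<^sub>R X' t + (cos (\<phi> t) * \<phi>' t) *\<^sub>R X t) + (cos (\<phi> t) *\<^sub>R Y' t + (- sin (\<phi> t) * \<phi>' t) *\<^sub>R Y t)) (at t within {0..1})"
      unfolding rot_Y_def
      by (intro has_vector_derivative_add has_vector_derivative_scaleR c s dX[OF t] dY[OF t])
    then show ?thesis by (simp add: rot_X_def rot_Y_def algebra_simps)
  qed
  show "rot (\<phi> t) ` K t \<in> Lagr" by (rule symplectic_Lagr[OF symplectic_rot K[OF t]])
  show "is_frame (rot_X (\<phi> t) (X t) (Y t)) (rot_Y (\<phi> t) (X t) (Y t)) (rot (\<phi> t) ` K t)"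
    by (rule is_frame_rot[OF fr[OF t]])
qed

text \<open>The rotation preserves the symplectic pairing of the frame with its velocity and adds
  the speed of the angle times the squared norm; a fast enough rotation thus decides the
  sign.\<close>

lemma rotated_crossing:
  assumes \<phi>: "\<And>t. t \<in> {0..1} \<Longrightarrow> (\<phi> has_vector_derivative \<phi>' t) (at t within {0..1})" and t: "t \<in> {0..1}"
  shows "crossing_form (\<lambda>t. rot (\<phi> t) ` K t) t (rot (\<phi> t) (frame_map (X t) (Y t) x)) (rot (\<phi> t) (frame_map (X t) (Y t) x))
    = sympl (frame_map (X t) (Y t) x) (frame_map (X' t) (Y' t) x) + of_real (\<phi>' t * (norm (frame_map (X t) (Y t) x))\<^sup>2)"
proof -
  let ?v = "frame_map (X t) (Y t) x" and ?w = "frame_map (X' t) (Y' t) x"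
  have "frame_map (rot_X (\<phi> t) (X' t) (Y' t) - \<phi>' t *\<^sub>R rot_Y (\<phi> t) (X t) (Y t))
      (rot_Y (\<phi> t) (X' t) (Y' t) + \<phi>' t *\<^sub>R rot_X (\<phi> t) (X t) (Y t)) x
    = frame_map (rot_X (\<phi> t) (X' t) (Y' t)) (rot_Y (\<phi> t) (X' t) (Y' t)) x
      + \<phi>' t *\<^sub>R rot_gen (frame_map (rot_X (\<phi> t) (X t) (Y t)) (rot_Y (\<phi> t) (X t) (Y t)) x)"
    by (simp add: frame_map_def rot_gen_def matrix_vector_mult_add_rdistrib
      matrix_vector_mult_diff_rdistrib mat_vec_scaleR)
  also have "\<dots> = rot (\<phi> t) ?w + \<phi>' t *\<^sub>R rot_gen (rot (\<phi> t) ?v)" unfolding frame_rot ..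
  finally have "crossing_form (\<lambda>t. rot (\<phi> t) ` K t) t (rot (\<phi> t) ?v) (rot (\<phi> t) ?v)
    = sympl (rot (\<phi> t) ?v) (rot (\<phi> t) ?w + \<phi>' t *\<^sub>R rot_gen (rot (\<phi> t) ?v))"
    using framed_path.crossing[OF rotated[OF \<phi>] t, of x x] unfolding frame_rot by simp
  also have "\<dots> = sympl ?v ?w + of_real (\<phi>' t) * of_real ((norm ?v)\<^sup>2)"
    unfolding sympl_add_right sympl_rot scaleR_eq_pscale sympl_scale_right sympl_rot_gen norm_rot ..
  finally show ?thesis by simp
qed

lemma crossing_bound:
  assumes "continuous_on {0..1} X'" "continuous_on {0..1} Y'"
  obtains C where "C > 0" "\<forall>t\<in>{0..1}. \<forall>x. norm (sympl (frame_map (X t) (Y t) x) (frame_map (X' t) (Y' t) x))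
    \<le> C * (norm (frame_map (X t) (Y t) x))\<^sup>2"
proof -
  define S where "S = {0..1::real} \<times> sphere (0 :: complex ^ 'n) 1"
  have cS: "compact S" unfolding S_def by (intro compact_Times) simp_all
  have c: "continuous_on S (\<lambda>p. frame_map (F (fst p)) (G (fst p)) (snd p))"
    if "continuous_on {0..1} F" "continuous_on {0..1} G" for F G :: "real \<Rightarrow> complex ^ 'n ^ 'n"
    unfolding frame_map_def
    by (intro continuous_on_Pair bounded_bilinear.continuous_on[OF bounded_bilinear_mat_vec]
        continuous_on_compose2[OF that(1) continuous_on_fst[OF continuous_on_id]]
        continuous_on_compose2[OF that(2) continuous_on_fst[OF continuous_on_id]]
        continuous_on_snd[OF continuous_on_id]) (auto simp: S_def)
  \<comment> \<open>Numerator and denominator are homogeneous of degree two in \<open>x\<close>, so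
    a bound on the unit sphere is enough; there compactness in both variables provides it.\<close>
  define r where "r = (\<lambda>p. norm (sympl (frame_map (X (fst p)) (Y (fst p)) (snd p)) (frame_map (X' (fst p)) (Y' (fst p)) (snd p)))
      / (norm (frame_map (X (fst p)) (Y (fst p)) (snd p)))\<^sup>2)"
  have nz: "frame_map (X t) (Y t) x \<noteq> 0" if "t \<in> {0..1}" "x \<noteq> 0" for t x
    using fr[OF that(1)] that(2) unfolding is_frame_def is_frame_inj_iff by blast
  have nzS: "\<forall>p\<in>S. (norm (frame_map (X (fst p)) (Y (fst p)) (snd p)))\<^sup>2 \<noteq> 0"
  proof
    fix p assume "p \<in> S"
    then have "fst p \<in> {0..1}" "snd p \<noteq> 0" by (auto simp: S_def)
    then show "(norm (frame_map (X (fst p)) (Y (fst p)) (snd p)))\<^sup>2 \<noteq> 0" using nz by simp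
  qed
  have "continuous_on S r"
    unfolding r_def
    by (intro continuous_on_divide continuous_on_norm continuous_on_power
        bounded_bilinear.continuous_on[OF bounded_bilinear_sympl] c cont assms nzS)
  then have "compact (r ` S)" by (rule compact_continuous_image[OF _ cS])
  then have "bounded (r ` S)" by (rule compact_imp_bounded)
  then obtain B where B: "\<forall>p\<in>S. norm (r p) \<le> B" unfolding bounded_iff by blast
  have "norm (sympl (frame_map (X t) (Y t) x) (frame_map (X' t) (Y' t) x)) \<le> max B 1 * (norm (frame_map (X t) (Y t) x))\<^sup>2"
    if t: "t \<in> {0..1}" for t x
  proof (cases "x = 0")
    case False
    define y where "y = (1 / norm x) *\<^sub>R x"
    have "y \<noteq> 0" using False by (simp add: y_def)
    have sc: "frame_map F G x = pscale (of_real (norm x)) (frame_map F G y)" for F G :: "complex ^ 'n ^ 'n"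
    proof -
      have "x = of_real (norm x) *s y" using False by (simp add: y_def vec_eq_iff) (simp add: scaleR_conv_of_real)
      then show ?thesis using frame_map_linear(2)[of F G "of_real (norm x)" y] by simp
    qed
    have "(t, y) \<in> S" using t False by (simp add: S_def y_def)
    then have "r (t, y) \<le> B" using B by fastforce
    then have "norm (sympl (frame_map (X t) (Y t) y) (frame_map (X' t) (Y' t) y)) \<le> B * (norm (frame_map (X t) (Y t) y))\<^sup>2"
      using nz[OF t \<open>y \<noteq> 0\<close>] by (simp add: r_def divide_le_eq)
    also have "\<dots> \<le> max B 1 * (norm (frame_map (X t) (Y t) y))\<^sup>2" by (rule mult_right_mono) simp_all
    finally have le: "norm (sympl (frame_map (X t) (Y t) y) (frame_map (X' t) (Y' t) y)) \<le> max B 1 * (norm (frame_map (X t) (Y t) y))\<^sup>2" .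
    have "norm (sympl (frame_map (X t) (Y t) x) (frame_map (X' t) (Y' t) x))
      = (norm x)\<^sup>2 * norm (sympl (frame_map (X t) (Y t) y) (frame_map (X' t) (Y' t) y))"
      unfolding sc sympl_scale_left sympl_scale_right by (simp add: norm_mult power2_eq_square)
    also have "\<dots> \<le> (norm x)\<^sup>2 * (max B 1 * (norm (frame_map (X t) (Y t) y))\<^sup>2)" by (rule mult_left_mono[OF le]) simp
    also have "\<dots> = max B 1 * (norm (frame_map (X t) (Y t) x))\<^sup>2"
      unfolding sc scaleR_eq_pscale[symmetric] by (simp add: power_mult_distrib)
    finally show ?thesis .
  qed (simp add: frame_map_linear)
  then show ?thesis using that[of "max B 1"] by simp
qed

end

lemma form_nondegenerate_definite:
  assumes "\<And>v. v \<in> V \<Longrightarrow> v \<noteq> 0 \<Longrightarrow> q v v \<noteq> 0"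
  shows "form_nondegenerate q V"
  unfolding form_nondegenerate_def using assms by blast

text \<open>The path of rotated planes has a positive definite crossing form, so its crossing with
  \<open>M\<close> at the angle \<open>\<theta>0\<close>, if any, is isolated, and every slightly
  larger angle is free of crossings.\<close>

lemma generic_rotation:
  assumes L: "L \<in> Lagr" and M: "M \<in> Lagr"
  obtains \<theta> where "\<theta> > \<theta>0" "transv (rot \<theta> ` L) M"
proof -
  obtain X Y where F: "is_frame X Y L" by (rule frame_exists[OF L])
  interpret framed_path "\<lambda>t. X" "\<lambda>t. Y" "\<lambda>t. 0" "\<lambda>t. 0" "\<lambda>t. L"
    by unfold_locales (simp_all add: L F)
  define \<phi> where "\<phi> t = \<theta>0 + t" for t
  have \<phi>: "(\<phi> has_vector_derivative 1) (at t within {0..1})" for t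
    unfolding \<phi>_def has_real_derivative_iff_has_vector_derivative[symmetric] by (auto intro!: derivative_eq_intros)
  interpret R: framed_path "\<lambda>t. rot_X (\<phi> t) X Y" "\<lambda>t. rot_Y (\<phi> t) X Y"
     "\<lambda>t. rot_X (\<phi> t) 0 0 - 1 *\<^sub>R rot_Y (\<phi> t) X Y" "\<lambda>t. rot_Y (\<phi> t) 0 0 + 1 *\<^sub>R rot_X (\<phi> t) X Y" "\<lambda>t. rot (\<phi> t) ` L"
    by (rule rotated[OF \<phi>])
  have "form_nondegenerate (crossing_form (\<lambda>t. rot (\<phi> t) ` L) 0) (rot (\<phi> 0) ` L \<inter> M)"
  proof (rule form_nondegenerate_definite)
    fix v assume v: "v \<in> rot (\<phi> 0) ` L \<inter> M" "v \<noteq> 0"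
    then obtain u where u: "u \<in> L" "v = rot (\<phi> 0) u" by blast
    obtain x where x: "u = frame_map X Y x" by (rule is_frame_obtain[OF F u(1)])
    have "norm u \<noteq> 0" using v(2) u(2) norm_rot[of "\<phi> 0" u] by auto
    moreover have "crossing_form (\<lambda>t. rot (\<phi> t) ` L) 0 v v = of_real ((norm u)\<^sup>2)"
    proof -
      have "frame_map (0 :: complex ^ 'a ^ 'a) 0 x = 0" by (simp add: frame_map_def zero_prod_def)
      then show ?thesis using rotated_crossing[OF \<phi>, of 0 x] unfolding u(2) x by simp
    qed
    ultimately show "crossing_form (\<lambda>t. rot (\<phi> t) ` L) 0 v v \<noteq> 0" by simp
  qed
  note nd = this
  have z: "0 \<in> {0..1::real}" by simp
  obtain \<delta> where \<delta>: "\<delta> > 0" "\<forall>t\<in>{0..1}. 0 < \<bar>t - 0\<bar> \<longrightarrow> \<bar>t - 0\<bar> < \<delta> \<longrightarrow> transv (rot (\<phi> t) ` L) M \<and>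
      mas M (\<lambda>t. rot (\<phi> t) ` L) 0 t = (if 0 < t then int (form_n_pos (crossing_form (\<lambda>t. rot (\<phi> t) ` L) 0) (rot (\<phi> 0) ` L \<inter> M))
        else int (form_n_neg (crossing_form (\<lambda>t. rot (\<phi> t) ` L) 0) (rot (\<phi> 0) ` L \<inter> M)))"
    by (rule crossing_local[OF R.diff_frame z M nd])
  define t where "t = min (\<delta> / 2) 1"
  have "t \<in> {0..1}" "0 < \<bar>t - 0\<bar>" "\<bar>t - 0\<bar> < \<delta>" using \<delta>(1) by (auto simp: t_def)
  then have "transv (rot (\<phi> t) ` L) M" using \<delta>(2) by blast
  then show ?thesis using that[of "\<phi> t"] \<delta>(1) by (simp add: \<phi>_def t_def)
qed

lemma path_homotopicI:
  fixes h :: "real \<times> real \<Rightarrow> 'n::finite phase set"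
  assumes "continuous_map (top_of_set ({0..1} \<times> {0..1})) Lagr_topology h"
    and "\<And>t. t \<in> {0..1} \<Longrightarrow> h (0, t) = L t" "\<And>t. t \<in> {0..1} \<Longrightarrow> h (1, t) = R t"
    and "\<And>s. s \<in> {0..1} \<Longrightarrow> h (s, 0) = L 0" "\<And>s. s \<in> {0..1} \<Longrightarrow> h (s, 1) = L 1"
  shows "path_homotopic L R"
proof -
  let ?P = "\<lambda>h. h 0 = L 0 \<and> h 1 = L 1"
  \<comment> \<open>The predicate inspects only the values at 0 and 1, so it is enough that the
    homotopy agrees with the two paths on the unit interval.\<close>
  have iff: "homotopic_with ?P (top_of_set {0..1}) Lagr_topology L R \<longleftrightarrow>
      (\<exists>h :: real \<times> real \<Rightarrow> 'n phase set. continuous_map (prod_topology (top_of_set {0..1}) (top_of_set {0..1})) Lagr_topology h \<and>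
        (\<forall>x\<in>topspace (top_of_set {0..1}). h (0, x) = L x) \<and>
        (\<forall>x\<in>topspace (top_of_set {0..1}). h (1, x) = R x) \<and> (\<forall>t\<in>{0..1}. ?P (\<lambda>x. h (t, x))))"
    by (rule homotopic_with) simp
  show ?thesis
    unfolding path_homotopic_def iff prod_topology_subtopology_eu topspace_euclidean_subtopology
    by (intro exI[of _ h] conjI ballI assms) simp_all
qed

text \<open>The reparametrisation stops at the endpoint for \<open>t \<ge> 1/2\<close>, with velocity of order \<open>1 - 2 t\<close>
  before; it is dominated by the rotation angle \<open>4 \<theta> t (1 - t)\<close>, which makes the crossing form positive
  before \<open>1/2\<close> and negative after.\<close>

definition stop :: "real \<Rightarrow> real" where
  "stop t = 1 - (max 0 (1 - 2 * t))\<^sup>2"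

lemma pos_part_square_deriv: "((\<lambda>x. (max 0 x)\<^sup>2) has_real_derivative 2 * max 0 x) (at x)" for x :: real
proof -
  consider "x > 0" | "x < 0" | "x = 0" by linarith
  then show ?thesis
  proof cases
    case 1
    have "((\<lambda>x. x\<^sup>2) has_real_derivative 2 * max 0 x) (at x)" using 1 by (auto intro!: derivative_eq_intros)
    then show ?thesis
      by (rule has_field_derivative_transform_within_open[of _ _ _ "{0<..}"]) (use 1 in auto)
  next
    case 2
    have "((\<lambda>x. 0) has_real_derivative 2 * max 0 x) (at x)" using 2 by simp
    then show ?thesis
      by (rule has_field_derivative_transform_within_open[of _ _ _ "{..<0}"]) (use 2 in auto)
  next
    case 3
    have "isCont (\<lambda>z. max 0 z :: real) 0" by (intro continuous_intros)
    moreover have "(max 0 z)\<^sup>2 - (max 0 0)\<^sup>2 = max 0 z * (z - 0)" for z :: real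
      by (cases "0 \<le> z") (simp_all add: max_def power2_eq_square)
    \<comment> \<open>Caratheodory's criterion: the difference quotient at 0 extends continuously by
      \<open>max 0 z\<close>.\<close>
    ultimately show ?thesis unfolding 3 CARAT_DERIV by (intro exI[of _ "\<lambda>z. max 0 z"]) simp
  qed
qed

lemma stop_deriv: "(stop has_real_derivative 4 * max 0 (1 - 2 * t)) (at t within S)"
proof -
  have "((\<lambda>t. 1 - 2 * t) has_real_derivative - 2) (at t within S)" by (auto intro!: derivative_eq_intros)
  from DERIV_chain2[OF pos_part_square_deriv this]
  have "((\<lambda>t. (max 0 (1 - 2 * t))\<^sup>2) has_real_derivative 2 * max 0 (1 - 2 * t) * - 2) (at t within S)" .
  from DERIV_diff[OF DERIV_const this, of 1]
  show ?thesis unfolding stop_def by simp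
qed

lemma stop_range: "t \<in> {0..1} \<Longrightarrow> stop t \<in> {0..1}"
proof -
  assume "t \<in> {0..1}"
  then have "0 \<le> max 0 (1 - 2 * t)" "max 0 (1 - 2 * t) \<le> 1" by auto
  then have "(max 0 (1 - 2 * t))\<^sup>2 \<le> 1\<^sup>2" by (intro power_mono)
  then show ?thesis unfolding stop_def by simp
qed

context framed_path
begin

lemma regular_representative:
  assumes c': "continuous_on {0..1} X'" "continuous_on {0..1} Y'" and M: "M \<in> Lagr"
  obtains R where "regular_path R M" "path_homotopic K R"
proof -
  obtain C where C: "C > 0" "\<forall>t\<in>{0..1}. \<forall>x. norm (sympl (frame_map (X t) (Y t) x) (frame_map (X' t) (Y' t) x))
    \<le> C * (norm (frame_map (X t) (Y t) x))\<^sup>2"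
    by (rule crossing_bound[OF c'])
  \<comment> \<open>The rotation must return to angle zero at the end, so its speed vanishes at
    \<open>1/2\<close>, where also the reparametrized path is at rest. No crossing may occur there;
    hence \<theta>, the angle reached at that time, is chosen to make the rotated final plane
    transversal to \<open>M\<close>.\<close>
  obtain \<theta> where \<theta>: "\<theta> > C" "transv (rot \<theta> ` K 1) M" by (rule generic_rotation[OF K M, of 1]) simp
  define \<phi> where "\<phi> t = 4 * \<theta> * (t * (1 - t))" for t
  define \<phi>' where "\<phi>' t = 4 * \<theta> * (1 - 2 * t)" for t
  define \<rho>' where "\<rho>' t = 4 * max 0 (1 - 2 * t)" for t :: real
  have \<phi>: "(\<phi> has_vector_derivative \<phi>' t) (at t within {0..1})" for t
    unfolding \<phi>_def \<phi>'_def has_real_derivative_iff_has_vector_derivative[symmetric]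
    by (auto intro!: derivative_eq_intros simp: algebra_simps)
  have \<rho>: "(stop has_vector_derivative \<rho>' t) (at t within {0..1})" for t
    using stop_deriv unfolding \<rho>'_def has_real_derivative_iff_has_vector_derivative .
  have comp: "((\<lambda>t. F (stop t)) has_vector_derivative \<rho>' t *\<^sub>R F' (stop t)) (at t within {0..1})"
    if t: "t \<in> {0..1}" and F: "\<And>t. t \<in> {0..1} \<Longrightarrow> (F has_vector_derivative F' t) (at t within {0..1})"
    for F F' :: "real \<Rightarrow> complex ^ 'n ^ 'n" and t
  proof -
    have "(F has_vector_derivative F' (stop t)) (at (stop t) within stop ` {0..1})"
      by (rule has_vector_derivative_within_subset[OF F[OF stop_range[OF t]]]) (use stop_range in auto)
    from vector_diff_chain_within[OF \<rho> this] show ?thesis by (simp add: o_def)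
  qed
  interpret S: framed_path "\<lambda>t. X (stop t)" "\<lambda>t. Y (stop t)" "\<lambda>t. \<rho>' t *\<^sub>R X' (stop t)" "\<lambda>t. \<rho>' t *\<^sub>R Y' (stop t)" "\<lambda>t. K (stop t)"
  proof
    fix t :: real assume t: "t \<in> {0..1}"
    show "((\<lambda>t. X (stop t)) has_vector_derivative \<rho>' t *\<^sub>R X' (stop t)) (at t within {0..1})" by (rule comp[OF t dX])
    show "((\<lambda>t. Y (stop t)) has_vector_derivative \<rho>' t *\<^sub>R Y' (stop t)) (at t within {0..1})" by (rule comp[OF t dY])
    show "K (stop t) \<in> Lagr" "is_frame (X (stop t)) (Y (stop t)) (K (stop t))"
      using K[OF stop_range[OF t]] fr[OF stop_range[OF t]] by blast+
  qed
  define R where "R t = rot (\<phi> t) ` K (stop t)" for t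
  interpret R: framed_path "\<lambda>t. rot_X (\<phi> t) (X (stop t)) (Y (stop t))" "\<lambda>t. rot_Y (\<phi> t) (X (stop t)) (Y (stop t))"
     "\<lambda>t. rot_X (\<phi> t) (\<rho>' t *\<^sub>R X' (stop t)) (\<rho>' t *\<^sub>R Y' (stop t)) - \<phi>' t *\<^sub>R rot_Y (\<phi> t) (X (stop t)) (Y (stop t))"
     "\<lambda>t. rot_Y (\<phi> t) (\<rho>' t *\<^sub>R X' (stop t)) (\<rho>' t *\<^sub>R Y' (stop t)) + \<phi>' t *\<^sub>R rot_X (\<phi> t) (X (stop t)) (Y (stop t))" R
    unfolding R_def by (rule S.rotated[OF \<phi>])
  have cstop: "continuous_on {0..1} stop" unfolding stop_def by (intro continuous_intros)
  have c\<phi>: "continuous_on {0..1} \<phi>" "continuous_on {0..1} \<phi>'" "continuous_on {0..1} \<rho>'"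
    unfolding \<phi>_def \<phi>'_def \<rho>'_def by (intro continuous_intros)+
  have cS: "continuous_on {0..1} (\<lambda>t. F (stop t))" if "continuous_on {0..1} F" for F :: "real \<Rightarrow> complex ^ 'n ^ 'n"
    by (rule continuous_on_compose2[OF that cstop]) (use stop_range in auto)
  have "C1_path R"
    by (rule R.C1; unfold rot_X_def rot_Y_def) (intro continuous_intros c\<phi> cS cont c')+
  moreover have "form_nondegenerate (crossing_form R t) (R t \<inter> M)" if t: "t \<in> {0..1}" and n0: "R t \<inter> M \<noteq> {0}" for t
  proof (rule form_nondegenerate_definite)
    fix v assume v: "v \<in> R t \<inter> M" "v \<noteq> 0"
    have st: "stop t \<in> {0..1}" by (rule stop_range[OF t])
    obtain u where u: "u \<in> K (stop t)" "v = rot (\<phi> t) u" using v(1) unfolding R_def by blast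
    obtain x where x: "u = frame_map (X (stop t)) (Y (stop t)) x" by (rule is_frame_obtain[OF fr[OF st] u(1)])
    have nu: "(norm u)\<^sup>2 > 0" using v(2) u(2) norm_rot[of "\<phi> t" u] by auto
    define s where "s = Re (sympl u (frame_map (X' (stop t)) (Y' (stop t)) x))"
    have "frame_map (\<rho>' t *\<^sub>R X' (stop t)) (\<rho>' t *\<^sub>R Y' (stop t)) x = \<rho>' t *\<^sub>R frame_map (X' (stop t)) (Y' (stop t)) x"
      by (simp add: frame_map_def mat_vec_scaleR)
    then have "Re (crossing_form R t v v) = \<rho>' t * s + \<phi>' t * (norm u)\<^sup>2"
      using S.rotated_crossing[OF \<phi> t, of x] unfolding R_def[symmetric] u(2) x[symmetric] s_def
      by (simp add: scaleR_eq_pscale sympl_scale_right)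
    moreover have "\<bar>s\<bar> \<le> C * (norm u)\<^sup>2"
      unfolding s_def x using C(2) st abs_Re_le_cmod order_trans by blast
    moreover have "\<rho>' t * s + \<phi>' t * (norm u)\<^sup>2 \<noteq> 0"
    proof -
      consider "t < 1 / 2" | "t > 1 / 2" | "t = 1 / 2" by linarith
      then show ?thesis
      proof cases
        case 1
        \<comment> \<open>Both velocities carry the same factor \<open>4 * (1 - 2 * t)\<close>; this
          is why the path is reparametrized by \<open>stop\<close>, and \<open>\<theta> > C\<close>
          then decides the sign.\<close>
        then have "\<rho>' t * s + \<phi>' t * (norm u)\<^sup>2 = 4 * (1 - 2 * t) * (s + \<theta> * (norm u)\<^sup>2)"
          unfolding \<rho>'_def \<phi>'_def by (simp add: algebra_simps)
        moreover have "C * (norm u)\<^sup>2 < \<theta> * (norm u)\<^sup>2" using \<theta>(1) nu by simp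
        then have "s + \<theta> * (norm u)\<^sup>2 > 0" using \<open>\<bar>s\<bar> \<le> C * (norm u)\<^sup>2\<close> by linarith
        ultimately show ?thesis using 1 by simp
      next
        case 2
        then have "\<rho>' t * s + \<phi>' t * (norm u)\<^sup>2 = 4 * \<theta> * (1 - 2 * t) * (norm u)\<^sup>2"
          unfolding \<rho>'_def \<phi>'_def by simp
        then show ?thesis using 2 \<theta>(1) C(1) nu by simp
      next
        case 3
        have "\<phi> t = \<theta>" "stop t = 1" unfolding 3 \<phi>_def stop_def by simp_all
        then have "R t \<inter> M = {0}" using \<theta>(2) unfolding R_def transv_def by simp
        then show ?thesis using n0 by blast
      qed
    qed
    ultimately show "crossing_form R t v v \<noteq> 0" by auto
  qed
  ultimately have reg: "regular_path R M" unfolding regular_path_def by blast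
  let ?T = "{0..1} \<times> {0..1::real}"
  \<comment> \<open>The homotopy deforms the parameter affinely into \<open>stop\<close> while the
    rotation is switched on in proportion.\<close>
  define \<tau> where "\<tau> p = (1 - fst p) * snd p + fst p * stop (snd p)" for p :: "real \<times> real"
  define \<psi> where "\<psi> p = fst p * \<phi> (snd p)" for p :: "real \<times> real"
  have \<tau>: "\<tau> p \<in> {0..1}" if p: "p \<in> ?T" for p
  proof -
    have m: "fst p \<in> {0..1}" "snd p \<in> {0..1}" using p by (simp_all add: mem_Times_iff)
    note st = stop_range[OF m(2)]
    have "(1 - fst p) *\<^sub>R snd p + fst p *\<^sub>R stop (snd p) \<in> {0..1}"
      by (rule convexD_alt[OF convex_real_interval(5) m(2) st]) (use m(1) in simp_all)
    then show ?thesis by (simp add: \<tau>_def)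
  qed
  have "path_homotopic K R"
  proof (rule path_homotopicI[where h = "\<lambda>p. rot (\<psi> p) ` K (\<tau> p)"])
    have c\<tau>: "continuous_on ?T \<tau>" unfolding \<tau>_def
      by (intro continuous_intros continuous_on_compose2[OF cstop]) auto
    have c\<psi>: "continuous_on ?T \<psi>" unfolding \<psi>_def
      by (intro continuous_intros continuous_on_compose2[OF c\<phi>(1)]) auto
    have cX: "continuous_on ?T (\<lambda>p. X (\<tau> p))" "continuous_on ?T (\<lambda>p. Y (\<tau> p))"
      by (rule continuous_on_compose2[OF cont(1) c\<tau> image_subsetI[OF \<tau>]] continuous_on_compose2[OF cont(2) c\<tau> image_subsetI[OF \<tau>]]; assumption)+
    show "continuous_map (top_of_set ?T) Lagr_topology (\<lambda>p. rot (\<psi> p) ` K (\<tau> p))"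
    proof (rule continuous_map_frames)
      show "continuous_on ?T (\<lambda>p. rot_X (\<psi> p) (X (\<tau> p)) (Y (\<tau> p)))"
        "continuous_on ?T (\<lambda>p. rot_Y (\<psi> p) (X (\<tau> p)) (Y (\<tau> p)))"
        unfolding rot_X_def rot_Y_def by (intro continuous_intros c\<psi> cX)+
    qed (rule symplectic_Lagr[OF symplectic_rot K[OF \<tau>]] is_frame_rot[OF fr[OF \<tau>]]; assumption)+
    show "rot (\<psi> (0, t)) ` K (\<tau> (0, t)) = K t" for t by (simp add: \<psi>_def \<tau>_def rot_0)
    show "rot (\<psi> (1, t)) ` K (\<tau> (1, t)) = R t" for t by (simp add: \<psi>_def \<tau>_def R_def)
    show "rot (\<psi> (s, 0)) ` K (\<tau> (s, 0)) = K 0" for s by (simp add: \<psi>_def \<tau>_def \<phi>_def stop_def rot_0)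
    show "rot (\<psi> (s, 1)) ` K (\<tau> (s, 1)) = K 1" for s by (simp add: \<psi>_def \<tau>_def \<phi>_def stop_def rot_0)
  qed
  then show ?thesis using that reg by blast
qed

end

subsection \<open>Continuously differentiable approximations\<close>

text \<open>The velocities vanish at both ends, so that concatenations are again continuously differentiable.\<close>

definition smooth_approx :: "(real \<Rightarrow> 'n::finite phase set) \<Rightarrow> real \<Rightarrow> real \<Rightarrow> bool" where
  "smooth_approx L a b \<longleftrightarrow> (\<exists>X Y X' Y' h.
     (\<forall>t\<in>{a..b}. (X has_vector_derivative X' t) (at t within {a..b}) \<and> (Y has_vector_derivative Y' t) (at t within {a..b})) \<and>
     continuous_on {a..b} X' \<and> continuous_on {a..b} Y' \<and> X' a = 0 \<and> X' b = 0 \<and> Y' a = 0 \<and> Y' b = 0 \<and>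
     (\<forall>t\<in>{a..b}. h (1, t) \<in> Lagr \<and> is_frame (X t) (Y t) (h (1, t))) \<and>
     continuous_map (top_of_set ({0..1} \<times> {a..b})) Lagr_topology (h :: real \<times> real \<Rightarrow> _) \<and>
     (\<forall>t\<in>{a..b}. h (0, t) = L t) \<and> (\<forall>s\<in>{0..1}. h (s, a) = L a \<and> h (s, b) = L b))"

lemma smooth_approxI:
  fixes h :: "real \<times> real \<Rightarrow> 'n::finite phase set"
  assumes "\<And>t. t \<in> {a..b} \<Longrightarrow> (X has_vector_derivative X' t) (at t within {a..b})"
    "\<And>t. t \<in> {a..b} \<Longrightarrow> (Y has_vector_derivative Y' t) (at t within {a..b})"
    "continuous_on {a..b} X'" "continuous_on {a..b} Y'" "X' a = 0" "X' b = 0" "Y' a = 0" "Y' b = 0"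
    "\<And>t. t \<in> {a..b} \<Longrightarrow> h (1, t) \<in> Lagr" "\<And>t. t \<in> {a..b} \<Longrightarrow> is_frame (X t) (Y t) (h (1, t))"
    "continuous_map (top_of_set ({0..1} \<times> {a..b})) Lagr_topology h"
    "\<And>t. t \<in> {a..b} \<Longrightarrow> h (0, t) = L t"
    "\<And>s. s \<in> {0..1} \<Longrightarrow> h (s, a) = L a" "\<And>s. s \<in> {0..1} \<Longrightarrow> h (s, b) = L b"
  shows "smooth_approx L a b"
  unfolding smooth_approx_def
  by (intro exI[of _ X] exI[of _ Y] exI[of _ X'] exI[of _ Y'] exI[of _ h] conjI ballI assms; assumption)

text \<open>The first frame read through the inverse of the second is a linear coordinate change
  with trivial kernel.\<close>

lemma frame_change:
  assumes F: "is_frame X Y L" and G: "is_frame Z V (L :: 'n::finite phase set)"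
  obtains C C' where "C ** C' = mat 1" "C' ** C = mat 1" "X = Z ** C" "Y = V ** C"
proof -
  define c where "c x = inv (frame_map Z V) (frame_map X Y x)" for x
  have injG: "inj (frame_map Z V)" using G unfolding is_frame_def by blast
  have c: "frame_map Z V (c x) = frame_map X Y x" for x
    unfolding c_def by (rule f_inv_into_f) (use F G in \<open>auto simp: is_frame_def\<close>)
  have "Vector_Spaces.linear (*s) (*s) c"
    unfolding Vector_Spaces.linear_iff
  proof (intro conjI allI vec.vector_space_axioms)
    fix x y k
    have "frame_map Z V (c (x + y)) = frame_map Z V (c x + c y)" unfolding frame_map_linear c ..
    then show "c (x + y) = c x + c y" by (rule injD[OF injG])
    have "frame_map Z V (c (k *s x)) = frame_map Z V (k *s c x)" unfolding frame_map_linear c ..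
    then show "c (k *s x) = k *s c x" by (rule injD[OF injG])
  qed
  then have mc: "matrix c *v x = c x" for x by (rule matrix_works)
  have "x = 0" if "matrix c *v x = 0" for x
  proof -
    have "c x = 0" using that unfolding mc .
    then have "frame_map X Y x = 0" using c[of x] by (simp add: frame_map_linear)
    then show ?thesis using F unfolding is_frame_def is_frame_inj_iff by blast
  qed
  then obtain C' where C': "matrix c ** C' = mat 1" "C' ** matrix c = mat 1" using mat_inverse_exists by blast
  moreover have "X = Z ** matrix c" "Y = V ** matrix c"
    using c unfolding matrix_eq by (simp_all add: mc frame_map_def flip: matrix_vector_mul_assoc)
  ultimately show ?thesis using that by blast
qed

lemma is_frame_mult:
  fixes C C' :: "complex ^ 'n ^ 'n"
  assumes F: "is_frame X Y L" and C: "C ** C' = mat 1" "C' ** C = mat 1"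
  shows "is_frame (X ** C) (Y ** C) L"
proof -
  have eq: "frame_map (X ** C) (Y ** C) = frame_map X Y \<circ> (*v) C"
    by (rule ext) (simp add: frame_map_def flip: matrix_vector_mul_assoc)
  have "bij ((*v) C)"
    by (rule o_bij[of "(*v) C'"]) (auto simp: fun_eq_iff mat_inverse_apply[OF C(1)] mat_inverse_apply[OF C(2)])
  then have "inj ((*v) C)" "range ((*v) C) = UNIV" unfolding bij_def by blast+
  then show ?thesis
    using F unfolding is_frame_def eq image_comp[symmetric] by (simp add: inj_compose)
qed

lemma is_frame_graph:
  assumes S: "symplectic_map S" "S = blk P Q R U"
  shows "is_frame (P + Q ** A) (R + U ** A) (S ` graph A)"
proof -
  have eq: "frame_map (P + Q ** A) (R + U ** A) = S \<circ> (\<lambda>x. (x, A *v x))"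
    by (rule ext) (simp add: S(2) blk_def frame_map_def matrix_vector_mult_add_rdistrib flip: matrix_vector_mul_assoc)
  have "inj (\<lambda>x. (x, A *v x))" by (rule injI) simp
  then show ?thesis
    unfolding is_frame_def eq graph_def using inj_compose[OF symplectic_inj[OF S(1)]] by (auto simp: image_comp)
qed

lemma has_vector_derivative_glue:
  fixes f g :: "real \<Rightarrow> 'a::real_normed_vector"
  assumes "a \<le> b" "b \<le> c"
    and f: "\<And>t. t \<in> {a..b} \<Longrightarrow> (f has_vector_derivative f' t) (at t within {a..b})"
    and g: "\<And>t. t \<in> {b..c} \<Longrightarrow> (g has_vector_derivative g' t) (at t within {b..c})"
    and eq: "f b = g b" "f' b = g' b" and t: "t \<in> {a..c}"
  shows "((\<lambda>t. if t \<in> {a..b} then f t else g t) has_vector_derivative (if t \<in> {a..b} then f' t else g' t)) (at t within {a..c})"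
proof -
  have cl: "closure {a..b} \<inter> closure {b..c} = {b}" using assms(1,2) by auto
  have un: "{a..b} \<union> {b} = {a..b}" "{b..c} \<union> {b} = {b..c}" using assms(1,2) by auto
  show ?thesis
    by (rule has_vector_derivative_If_within_closures[of t "{a..b}" "{b..c}"]; (unfold cl un)?)
      (use assms in auto)
qed

text \<open>The two frames at \<open>b\<close> span the same plane but may differ by an invertible
  matrix \<open>C\<close>; multiplying the second frame by \<open>C\<close> makes the values agree.
  The velocities agree without adjustment because both are zero at \<open>b\<close>.\<close>

lemma smooth_approx_trans:
  assumes abc: "a \<le> b" "b \<le> c" and "smooth_approx L a b" "smooth_approx (L :: real \<Rightarrow> 'n::finite phase set) b c"
  shows "smooth_approx L a c"
proof -
  obtain X1 Y1 X1' Y1' h1 where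
    d1: "\<forall>t\<in>{a..b}. (X1 has_vector_derivative X1' t) (at t within {a..b}) \<and> (Y1 has_vector_derivative Y1' t) (at t within {a..b})"
    and c1: "continuous_on {a..b} X1'" "continuous_on {a..b} Y1'"
    and z1: "X1' a = 0" "X1' b = 0" "Y1' a = 0" "Y1' b = 0"
    and f1: "\<forall>t\<in>{a..b}. h1 (1, t) \<in> Lagr \<and> is_frame (X1 t) (Y1 t) (h1 (1, t))"
    and h1: "continuous_map (top_of_set ({0..1} \<times> {a..b})) Lagr_topology (h1 :: real \<times> real \<Rightarrow> 'n phase set)"
      "\<forall>t\<in>{a..b}. h1 (0, t) = L t" "\<forall>s\<in>{0..1}. h1 (s, a) = L a \<and> h1 (s, b) = L b"
    using assms(3) unfolding smooth_approx_def by blast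
  obtain X2 Y2 X2' Y2' h2 where
    d2: "\<forall>t\<in>{b..c}. (X2 has_vector_derivative X2' t) (at t within {b..c}) \<and> (Y2 has_vector_derivative Y2' t) (at t within {b..c})"
    and c2: "continuous_on {b..c} X2'" "continuous_on {b..c} Y2'"
    and z2: "X2' b = 0" "X2' c = 0" "Y2' b = 0" "Y2' c = 0"
    and f2: "\<forall>t\<in>{b..c}. h2 (1, t) \<in> Lagr \<and> is_frame (X2 t) (Y2 t) (h2 (1, t))"
    and h2: "continuous_map (top_of_set ({0..1} \<times> {b..c})) Lagr_topology (h2 :: real \<times> real \<Rightarrow> 'n phase set)"
      "\<forall>t\<in>{b..c}. h2 (0, t) = L t" "\<forall>s\<in>{0..1}. h2 (s, b) = L b \<and> h2 (s, c) = L c"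
    using assms(4) unfolding smooth_approx_def by blast
  have bb: "b \<in> {a..b}" "b \<in> {b..c}" using abc by auto
  have fb: "is_frame (X1 b) (Y1 b) (L b)" "is_frame (X2 b) (Y2 b) (L b)"
    using bspec[OF f1 bb(1)] bspec[OF f2 bb(2)] bspec[OF h1(3), of 1] bspec[OF h2(3), of 1] by auto
  obtain C C' where C: "C ** C' = mat 1" "C' ** C = mat 1" "X1 b = X2 b ** C" "Y1 b = Y2 b ** C"
    by (rule frame_change[OF fb])
  have blC: "bounded_linear (\<lambda>A :: complex ^ 'n ^ 'n. A ** C)"
    by (rule bounded_bilinear.bounded_linear_left[OF matrix_mult_bounded_bilinear])
  have zC: "(0 :: complex ^ 'n ^ 'n) ** C = 0" by (rule bounded_bilinear.zero_left[OF matrix_mult_bounded_bilinear])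
  have glue: "\<exists>G G'. (\<forall>t\<in>{a..c}. (G has_vector_derivative G' t) (at t within {a..c})) \<and> continuous_on {a..c} G' \<and>
      G' a = 0 \<and> G' c = 0 \<and> (\<forall>t\<in>{a..b}. G t = F1 t) \<and> (\<forall>t\<in>{b..c}. G t = F2 t ** C)"
    if F: "\<forall>t\<in>{a..b}. (F1 has_vector_derivative F1' t) (at t within {a..b})"
      "\<forall>t\<in>{b..c}. (F2 has_vector_derivative F2' t) (at t within {b..c})"
      "continuous_on {a..b} F1'" "continuous_on {b..c} F2'" "F1' a = 0" "F1' b = 0" "F2' b = 0" "F2' c = 0" "F1 b = F2 b ** C"
    for F1 F2 F1' F2' :: "real \<Rightarrow> complex ^ 'n ^ 'n"
  proof -
    define G where "G t = (if t \<in> {a..b} then F1 t else F2 t ** C)" for t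
    define G' where "G' t = (if t \<in> {a..b} then F1' t else F2' t ** C)" for t
    have "(G has_vector_derivative G' t) (at t within {a..c})" if t: "t \<in> {a..c}" for t
      unfolding G_def[abs_def] G'_def
    proof (rule has_vector_derivative_glue[OF abc _ _ _ _ t])
      fix t assume "t \<in> {b..c}"
      then show "((\<lambda>t. F2 t ** C) has_vector_derivative F2' t ** C) (at t within {b..c})"
        using F(2) by (intro bounded_linear.has_vector_derivative[OF blC]) blast
    qed (use F zC in auto)
    moreover have "continuous_on {a..c} G'"
    proof -
      have "continuous_on ({a..b} \<union> {b..c}) (\<lambda>t. if t \<in> {a..b} then F1' t else F2' t ** C)"
      proof (rule continuous_on_cases)
        show "continuous_on {b..c} (\<lambda>t. F2' t ** C)"
          by (rule bounded_linear.continuous_on[OF blC F(4)])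
        show "\<forall>x. x \<in> {a..b} \<and> x \<notin> {a..b} \<or> x \<in> {b..c} \<and> x \<in> {a..b} \<longrightarrow> F1' x = F2' x ** C"
        proof (intro allI impI)
          fix x assume "x \<in> {a..b} \<and> x \<notin> {a..b} \<or> x \<in> {b..c} \<and> x \<in> {a..b}"
          then have "x = b" by auto
          then show "F1' x = F2' x ** C" using F zC by simp
        qed
      qed (use F in auto)
      moreover have "{a..b} \<union> {b..c} = {a..c}" using abc by auto
      ultimately show ?thesis unfolding G'_def[abs_def] by simp
    qed
    moreover have "G' a = 0" using F abc by (simp add: G'_def)
    moreover have "G' c = 0"
    proof (cases "c = b")
      case False
      then have "c \<notin> {a..b}" using abc by auto
      then show ?thesis using F(8) zC by (simp only: G'_def if_False)
    qed (use F abc in \<open>simp add: G'_def\<close>)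
    moreover have "G t = F1 t" if "t \<in> {a..b}" for t using that by (simp add: G_def)
    moreover have "G t = F2 t ** C" if "t \<in> {b..c}" for t
    proof (cases "t = b")
      case True
      then show ?thesis using F(9) bb by (simp add: G_def)
    next
      case False
      then show ?thesis using that by (simp add: G_def)
    qed
    ultimately show ?thesis by blast
  qed
  obtain X X' where X: "\<forall>t\<in>{a..c}. (X has_vector_derivative X' t) (at t within {a..c})" "continuous_on {a..c} X'"
      "X' a = 0" "X' c = 0" "\<forall>t\<in>{a..b}. X t = X1 t" "\<forall>t\<in>{b..c}. X t = X2 t ** C"
    using glue[of X1 X1' X2 X2'] d1 d2 c1 c2 z1 z2 C(3) by blast
  obtain Y Y' where Y: "\<forall>t\<in>{a..c}. (Y has_vector_derivative Y' t) (at t within {a..c})" "continuous_on {a..c} Y'"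
      "Y' a = 0" "Y' c = 0" "\<forall>t\<in>{a..b}. Y t = Y1 t" "\<forall>t\<in>{b..c}. Y t = Y2 t ** C"
    using glue[of Y1 Y1' Y2 Y2'] d1 d2 c1 c2 z1 z2 C(4) by blast
  \<comment> \<open>Both homotopies keep the plane at \<open>b\<close> fixed, so they agree along
    \<open>t = b\<close>.\<close>
  define h where "h p = (if snd p \<le> b then h1 p else h2 p)" for p
  let ?X = "top_of_set ({0..1::real} \<times> {a..c})"
  have "continuous_map ?X Lagr_topology h"
    unfolding h_def
  proof (rule continuous_map_cases_le)
    show "continuous_map ?X euclideanreal snd" "continuous_map ?X euclideanreal (\<lambda>p. b)"
      by (auto intro!: continuous_intros)
    have "{p \<in> topspace ?X. snd p \<le> b} = {0..1} \<times> {a..b}" "{p \<in> topspace ?X. b \<le> snd p} = {0..1} \<times> {b..c}"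
      using abc by auto
    moreover have "({0..1} \<times> {a..c}) \<inter> ({0..1} \<times> {a..b}) = {0..1::real} \<times> {a..b}"
      "({0..1} \<times> {a..c}) \<inter> ({0..1} \<times> {b..c}) = {0..1::real} \<times> {b..c}" using abc by auto
    ultimately show "continuous_map (subtopology ?X {p \<in> topspace ?X. snd p \<le> b}) Lagr_topology h1"
      "continuous_map (subtopology ?X {p \<in> topspace ?X. b \<le> snd p}) Lagr_topology h2"
      using h1(1) h2(1) by (simp_all add: subtopology_subtopology)
    fix p assume "p \<in> topspace ?X" "snd p = b"
    then have "fst p \<in> {0..1}" "p = (fst p, b)" by (auto simp: prod_eq_iff)
    then show "h1 p = h2 p" using h1(3) h2(3) by metis
  qed
  note ch = this
  have H1: "h (s, t) = h1 (s, t)" if "t \<in> {a..b}" for s t using that by (simp add: h_def)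
  have H2: "h (s, t) = h2 (s, t)" if "t \<in> {b..c}" "s \<in> {0..1}" for s t
    using that h1(3) h2(3) by (cases "t = b") (simp_all add: h_def)
  have hf: "h (1, t) \<in> Lagr \<and> is_frame (X t) (Y t) (h (1, t))" if t: "t \<in> {a..c}" for t
  proof (cases "t \<in> {a..b}")
    case True
    then show ?thesis using f1 X(5) Y(5) H1 by simp
  next
    case False
    then have t: "t \<in> {b..c}" using t by simp
    have "is_frame (X2 t ** C) (Y2 t ** C) (h2 (1, t))" using f2 t by (intro is_frame_mult[OF _ C(1,2)]) blast
    then show ?thesis using f2 X(6) Y(6) H2[of t 1] t by simp
  qed
  show ?thesis
  proof (rule smooth_approxI[OF _ _ X(2) Y(2) X(3,4) Y(3,4) _ _ ch])
    fix t assume t: "t \<in> {a..c}"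
    show "(X has_vector_derivative X' t) (at t within {a..c})" using X(1) t by blast
    show "(Y has_vector_derivative Y' t) (at t within {a..c})" using Y(1) t by blast
    show "h (1, t) \<in> Lagr" "is_frame (X t) (Y t) (h (1, t))" using hf[OF t] by blast+
    show "h (0, t) = L t"
    proof (cases "t \<in> {a..b}")
      case True then show ?thesis using H1 h1(2) by simp
    next
      case False
      then have "t \<in> {b..c}" using t by simp
      then show ?thesis using H2[of t 0] h2(2) by simp
    qed
  next
    fix s :: real assume s: "s \<in> {0..1}"
    show "h (s, a) = L a" using H1[of a s] h1(3) s abc by simp
    show "h (s, c) = L c" using H2[of c s] h2(3) s abc by simp
  qed
qed

text \<open>Hermitian matrices form a real vector space, so inside one chart any continuous path can
  be deformed affinely, with fixed ends, into the segment between its end matrices.\<close>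

lemma smooth_approx_chart:
  assumes S: "symplectic_map S" and cd: "c \<le> d"
    and A: "\<forall>t\<in>{c..d}. hermitian (A t) \<and> S ` graph (A t) = L t" "continuous_on {c..d} A"
  shows "smooth_approx (L :: real \<Rightarrow> 'n::finite phase set) c d"
proof -
  obtain P Q R U where blk: "S = blk P Q R U" by (rule linear_is_blk[OF symplectic_linear[OF S]])
  define k where "k = inverse (d - c)"
  \<comment> \<open>The cubic \<open>3 x^2 - 2 x^3\<close> runs from 0 to 1 with derivative zero at
    both ends. For \<open>c = d\<close> the factor \<open>k\<close> is 0 by the convention for
    \<open>inverse\<close>, and \<sigma> vanishes.\<close>
  define \<sigma> where "\<sigma> t = 3 * ((t - c) * k)\<^sup>2 - 2 * ((t - c) * k) ^ 3" for t
  define \<sigma>' where "\<sigma>' t = (6 * ((t - c) * k) - 6 * ((t - c) * k)\<^sup>2) * k" for t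
  have \<sigma>: "(\<sigma> has_real_derivative \<sigma>' t) (at t within {c..d})" for t
    unfolding \<sigma>_def \<sigma>'_def by (auto intro!: derivative_eq_intros simp: algebra_simps power2_eq_square)
  have kd: "(d - c) * k = 1 \<or> d = c" by (cases "d = c") (simp_all add: k_def)
  define D where "D = A d - A c"
  define B where "B t = A c + \<sigma> t *\<^sub>R D" for t
  have Ac: "hermitian (A c)" "hermitian (A d)" using A(1) cd by auto
  have hB: "hermitian (B t)" for t
    unfolding B_def D_def by (intro hermitian_add hermitian_scaleR hermitian_diff Ac)
  have Bc: "B c = A c" by (simp add: B_def \<sigma>_def)
  have Bd: "B d = A d"
  proof (cases "d = c")
    case False
    then have "\<sigma> d = 1" using kd by (simp add: \<sigma>_def)
    then show ?thesis by (simp add: B_def D_def)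
  qed (simp add: Bc)
  have \<sigma>'0: "\<sigma>' c = 0" "\<sigma>' d = 0" using kd by (auto simp: \<sigma>'_def)
  define H where "H p = (1 - fst p) *\<^sub>R A (snd p) + fst p *\<^sub>R B (snd p)" for p :: "real \<times> real"
  have hH: "hermitian (H p)" if "snd p \<in> {c..d}" for p
    unfolding H_def by (intro hermitian_add hermitian_scaleR hB) (use A(1) that in blast)
  have c\<sigma>: "continuous_on {c..d} \<sigma>" "continuous_on {c..d} \<sigma>'" unfolding \<sigma>_def \<sigma>'_def by (intro continuous_intros)+
  have c\<sigma>2: "continuous_on ({0..1} \<times> {c..d}) (\<lambda>p :: real \<times> real. \<sigma> (snd p))"
    unfolding \<sigma>_def by (intro continuous_intros)
  have cA2: "continuous_on ({0..1} \<times> {c..d}) (\<lambda>p :: real \<times> real. A (snd p))"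
    by (rule continuous_on_compose2[OF A(2) continuous_on_snd[OF continuous_on_id]]) auto
  have cH: "continuous_on ({0..1} \<times> {c..d}) H"
    unfolding H_def B_def by (intro continuous_intros c\<sigma>2 cA2)
  have mult: "W ** (A c + r *\<^sub>R D) = W ** A c + r *\<^sub>R (W ** D)" for W r
    by (simp add: bounded_bilinear.add_right[OF matrix_mult_bounded_bilinear]
        bounded_bilinear.scaleR_right[OF matrix_mult_bounded_bilinear])
  have der: "((\<lambda>t. V + W ** B t) has_vector_derivative \<sigma>' t *\<^sub>R (W ** D)) (at t within {c..d})" for V W t
  proof -
    have "((\<lambda>t. (V + W ** A c) + \<sigma> t *\<^sub>R (W ** D)) has_vector_derivative 0 + (\<sigma> t *\<^sub>R 0 + \<sigma>' t *\<^sub>R (W ** D))) (at t within {c..d})"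
      by (intro has_vector_derivative_add has_vector_derivative_const has_vector_derivative_scaleR \<sigma>)
    then show ?thesis unfolding B_def mult by (simp add: add.assoc)
  qed
  let ?h = "\<lambda>p. S ` graph (H p)"
  have contW: "continuous_on ({0..1} \<times> {c..d}) (\<lambda>p. V + W ** H p)" for V W
    by (intro continuous_intros bounded_linear.continuous_on[OF bounded_bilinear.bounded_linear_right[OF matrix_mult_bounded_bilinear] cH])
  have ch: "continuous_map (top_of_set ({0..1} \<times> {c..d})) Lagr_topology ?h"
  proof (rule continuous_map_frames[OF contW[of P Q] contW[of R U]])
    fix p :: "real \<times> real" assume "p \<in> {0..1} \<times> {c..d}"
    then have "snd p \<in> {c..d}" by auto
    then show "?h p \<in> Lagr" by (intro symplectic_Lagr[OF S graph_Lagr[OF hH]])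
    show "is_frame (P + Q ** H p) (R + U ** H p) (?h p)" by (rule is_frame_graph[OF S blk])
  qed
  have H1: "H (1, t) = B t" and H0: "H (0, t) = A t" for t by (simp_all add: H_def)
  have Hc: "H (s, c) = A c" "H (s, d) = A d" for s
    by (simp_all add: H_def Bc Bd flip: scaleR_add_left)
  show ?thesis
  proof (rule smooth_approxI[OF der[of P Q] der[of R U] _ _ _ _ _ _ _ _ ch])
    show "continuous_on {c..d} (\<lambda>t. \<sigma>' t *\<^sub>R (Q ** D))" "continuous_on {c..d} (\<lambda>t. \<sigma>' t *\<^sub>R (U ** D))"
      by (intro continuous_intros c\<sigma>)+
    show "S ` graph (H (1, t)) \<in> Lagr" for t
      unfolding H1 by (rule symplectic_Lagr[OF S graph_Lagr[OF hB]])
    show "is_frame (P + Q ** B t) (R + U ** B t) (S ` graph (H (1, t)))" for t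
      unfolding H1 by (rule is_frame_graph[OF S blk])
    show "S ` graph (H (0, t)) = L t" if "t \<in> {c..d}" for t unfolding H0 using A(1) that by blast
    show "S ` graph (H (s, c)) = L c" "S ` graph (H (s, d)) = L d" for s unfolding Hc using A(1) cd by auto
  qed (simp_all add: \<sigma>'0)
qed

lemma diff_frame_smooth_approx:
  assumes F: "diff_frame X Y L"
  shows "smooth_approx L 0 1"
proof (rule interval_bisection[of 0 1 "smooth_approx L"])
  fix a b c assume "a \<le> b" "b \<le> c" "smooth_approx L a b" "smooth_approx L b c"
  then show "smooth_approx L a c" by (rule smooth_approx_trans)
next
  fix x :: real assume "0 \<le> x" "x \<le> 1"
  then have x: "x \<in> {0..1}" by simp
  obtain N \<delta> where N: "N \<in> Lagr" "\<forall>L\<in>{}. transv L N" "\<delta> > 0" "\<forall>t\<in>{0..1}. \<bar>t - x\<bar> < \<delta> \<longrightarrow> transv (L t) N"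
    by (rule lagr_path_chart[OF diff_frame_lagr_path[OF F] x, of "{}"]) auto
  obtain S where S: "symplectic_map S" "S ` graph 0 = L x" "S ` graph_inf = N"
    by (rule normal_form[OF diff_frame_Lagr[OF F x] N(1)]) (use N(3,4) x in simp)
  obtain A where A: "\<forall>s\<in>{0..1}. transv (L s) N \<longrightarrow>
    hermitian (A s) \<and> S ` graph (A s) = L s \<and> A differentiable (at s within {0..1})"
    by (rule chart_path[OF F S(1,3)])
  show "\<exists>\<delta>>0. \<forall>c d. 0 \<le> c \<longrightarrow> c \<le> x \<longrightarrow> x \<le> d \<longrightarrow> d \<le> 1 \<longrightarrow> d - c < \<delta> \<longrightarrow> smooth_approx L c d"
  proof (intro exI[of _ \<delta>] conjI allI impI)
    fix c d assume cd: "0 \<le> c" "c \<le> x" "x \<le> d" "d \<le> 1" "d - c < \<delta>"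
    have tr: "transv (L t) N" "t \<in> {0..1}" if "t \<in> {c..d}" for t using N(4) cd that by auto
    have "continuous (at t within {c..d}) A" if t: "t \<in> {c..d}" for t
    proof -
      have "continuous (at t within {0..1}) A"
        using A tr[OF t] by (intro differentiable_imp_continuous_within) blast
      then show ?thesis by (rule continuous_within_subset) (use cd in auto)
    qed
    then have "continuous_on {c..d} A" by (simp add: continuous_on_eq_continuous_within)
    then show "smooth_approx L c d"
      by (intro smooth_approx_chart[OF S(1), of c d A]) (use cd A tr in auto)
  qed (rule N(3))
qed simp

section \<open>The Maslov index of a differentiable path\<close>

lemma regular_path_exists:
  assumes F: "diff_frame X Y L" and M: "M \<in> Lagr"
  obtains R where "regular_path R M" "path_homotopic L R"
proof -
  obtain X Y X' Y' h where
    d: "\<forall>t\<in>{0..1}. (X has_vector_derivative X' t) (at t within {0..1}) \<and> (Y has_vector_derivative Y' t) (at t within {0..1})"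
    and c: "continuous_on {0..1} X'" "continuous_on {0..1} Y'"
    and f: "\<forall>t\<in>{0..1}. h (1, t) \<in> Lagr \<and> is_frame (X t) (Y t) (h (1, t))"
    and h: "continuous_map (top_of_set ({0..1} \<times> {0..1})) Lagr_topology (h :: real \<times> real \<Rightarrow> 'a phase set)"
      "\<forall>t\<in>{0..1}. h (0, t) = L t" "\<forall>s\<in>{0..1}. h (s, 0) = L 0 \<and> h (s, 1) = L 1"
    using diff_frame_smooth_approx[OF F] unfolding smooth_approx_def by blast
  define K where "K t = h (1, t)" for t
  interpret framed_path X Y X' Y' K
    by unfold_locales (use d f K_def in auto)
  have LK: "path_homotopic L K" by (rule path_homotopicI[OF h(1)]) (use h(2,3) in \<open>auto simp: K_def\<close>)
  obtain R where R: "regular_path R M" "path_homotopic K R" by (rule regular_representative[OF c M])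
  have K01: "K 0 = L 0" "K 1 = L 1" using h(3) by (auto simp: K_def)
  have "path_homotopic L R"
    unfolding path_homotopic_def
    by (rule homotopic_with_trans[OF LK[unfolded path_homotopic_def] R(2)[unfolded path_homotopic_def K01]])
  then show ?thesis using that R(1) by blast
qed

lemma maslov_eq_mas:
  assumes F: "diff_frame X Y L" and M: "M \<in> Lagr"
  shows "maslov L M = mas M L 0 1"
proof -
  \<comment> \<open>Every regular representative has the value \<open>mas\<close> of the original
    path, by homotopy invariance; the definite description then needs only one of them to
    exist.\<close>
  have uniq: "maslov_regular R M = mas M L 0 1" if R: "regular_path R M" "path_homotopic L R" for R
  proof -
    obtain h where h: "continuous_map (prod_topology (top_of_set {0..1::real}) (top_of_set {0..1::real})) Lagr_topology h"
      "\<forall>x. h (0, x) = L x" "\<forall>x. h (1, x) = R x" "\<forall>t\<in>{0..1}. h (t, 0) = L 0 \<and> h (t, 1) = L 1"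
      using R(2) unfolding path_homotopic_def homotopic_with_def by blast
    have "mas M (\<lambda>t. h (0, t)) 0 1 = mas M (\<lambda>t. h (1, t)) 0 1"
      by (rule mas_homotopy_invariant[OF h(1) _ _ M]) (use h(4) in blast)+
    then show ?thesis using maslov_regular_eq_mas[OF R(1) M] h(2,3) by simp
  qed
  obtain R where "regular_path R M" "path_homotopic L R" by (rule regular_path_exists[OF F M])
  then show ?thesis unfolding maslov_def using uniq by (intro the_equality) metis+
qed

section \<open>Minimal non-decreasing paths\<close>

text \<open>The segment has constant velocity in its chart, so its crossing form is that of
  \<open>A1 - A0\<close> at all times.\<close>

lemma symplectic_graph_path:
  assumes S: "symplectic_map S" and A: "hermitian A0" "hermitian A1"
  defines "L \<equiv> \<lambda>t. S ` graph (A0 + t *\<^sub>R (A1 - A0))"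
  shows "\<exists>X Y. diff_frame X Y L"
    and "\<And>t x. t \<in> {0..1} \<Longrightarrow> crossing_form L t (S (x, (A0 + t *\<^sub>R (A1 - A0)) *v x)) (S (x, (A0 + t *\<^sub>R (A1 - A0)) *v x))
      = cdot x ((A1 - A0) *v x)"
proof -
  define B where "B t = A0 + t *\<^sub>R (A1 - A0)" for t
  have hB: "hermitian (B t)" for t unfolding B_def by (intro hermitian_add hermitian_scaleR hermitian_diff A)
  have LB: "L t = S ` graph (B t)" for t by (simp add: L_def B_def)
  have dB: "(B has_vector_derivative (A1 - A0)) (at t within {0..1})" for t
    unfolding B_def by (auto intro!: derivative_eq_intros)
  obtain P Q R U where blk: "S = blk P Q R U" by (rule linear_is_blk[OF symplectic_linear[OF S]])
  have der: "((\<lambda>t. V + W ** B t) has_vector_derivative W ** (A1 - A0)) (at t within {0..1})" for V W t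
  proof -
    have "((\<lambda>t. V + W ** B t) has_vector_derivative 0 + W ** (A1 - A0)) (at t within {0..1})"
      by (intro has_vector_derivative_add has_vector_derivative_const
          bounded_linear.has_vector_derivative[OF bounded_bilinear.bounded_linear_right[OF matrix_mult_bounded_bilinear] dB])
    then show ?thesis by simp
  qed
  interpret framed_path "\<lambda>t. P + Q ** B t" "\<lambda>t. R + U ** B t" "\<lambda>t. Q ** (A1 - A0)" "\<lambda>t. U ** (A1 - A0)" L
    by unfold_locales (simp_all add: der LB symplectic_Lagr[OF S graph_Lagr[OF hB]] is_frame_graph[OF S blk])
  show "\<exists>X Y. diff_frame X Y L" using diff_frame by blast
  fix t :: real and x assume t: "t \<in> {0..1}"
  have dz: "((\<lambda>s. B s *v x) has_vector_derivative (A1 - A0) *v x) (at t within {0..1})"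
    by (rule bounded_linear.has_vector_derivative[OF bounded_linear_mat_vec dB])
  have w: "((\<lambda>s. S (x, B s *v x)) has_vector_derivative S (0, (A1 - A0) *v x)) (at t within {0..1})"
    by (rule bounded_linear.has_vector_derivative[OF phase_linear_imp_linear(2)[OF symplectic_linear[OF S]]])
      (intro has_vector_derivative_Pair has_vector_derivative_const dz)
  have mem: "S (x, B s *v x) \<in> L s" for s by (rule graph_image_mem) (simp add: LB)
  have "crossing_form L t (S (x, B t *v x)) (S (x, B t *v x)) = sympl (S (x, B t *v x)) (S (0, (A1 - A0) *v x))"
    by (rule crossing_form_eq[OF diff_frame t mem w]) (simp_all add: mem)
  also have "\<dots> = cdot x ((A1 - A0) *v x)" unfolding symplectic_sympl[OF S] by (simp add: sympl_def)
  finally show "crossing_form L t (S (x, (A0 + t *\<^sub>R (A1 - A0)) *v x)) (S (x, (A0 + t *\<^sub>R (A1 - A0)) *v x))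
      = cdot x ((A1 - A0) *v x)" by (simp add: B_def)
qed


text \<open>A small shift keeps a maximal negative subspace negative, while any positive shift makes
  the complementary non-negative subspace positive. The dimensions leave no room for a
  kernel.\<close>

lemma small_positive_shift:
  assumes D: "hermitian (D :: complex ^ 'n ^ 'n)"
  obtains e where "e > 0" "mneg (D + e *\<^sub>R mat 1) = mneg D" "mker (D + e *\<^sub>R mat 1) = {0}"
proof -
  have h1: "hermitian (mat 1 :: complex ^ 'n ^ 'n)" by (simp add: hermitian_def adj_def mat_def vec_eq_iff)
  have id: "mat_form (mat 1) u u = of_real ((norm u)\<^sup>2)" if "u \<in> horiz" for u :: "'n phase"
    using that by (simp add: mat_form_def cdot_self norm_horiz)
  obtain P where P: "phase.subspace P" "P \<subseteq> horiz" "pos_on (mat_form (- D)) P" "phase.dim P = mneg D"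
    by (rule mpos_attained)
  obtain e0 where e0: "e0 > 0" "\<forall>B. norm (B - (- D)) < e0 \<longrightarrow> pos_on (mat_form B) P"
    by (rule pos_on_open[OF P(1) hermitian_uminus[OF D] P(3)])
  \<comment> \<open>Small enough for \<open>e\<close> times the norm of the identity to stay below
    \<open>e0\<close>; the summand 2 keeps the denominator positive.\<close>
  define e where "e = e0 / (2 * norm (mat 1 :: complex ^ 'n ^ 'n) + 2)"
  have e: "e > 0" unfolding e_def using e0(1) by (intro divide_pos_pos add_nonneg_pos) auto
  define C where "C = D + e *\<^sub>R mat 1"
  have hC: "hermitian C" unfolding C_def by (intro hermitian_add D hermitian_scaleR h1)
  have "norm (- C - (- D)) = e * norm (mat 1 :: complex ^ 'n ^ 'n)" using e by (simp add: C_def)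
  also have "\<dots> < e0"
    unfolding e_def using e0(1) norm_ge_zero[of "mat 1 :: complex ^ 'n ^ 'n"] by (simp add: divide_less_eq algebra_simps add_pos_nonneg)
  finally have "pos_on (mat_form (- C)) P" using e0(2) by blast
  then have 1: "mneg D \<le> mneg C" using mpos_ge[OF P(1,2)] P(4) by simp
  obtain Q where Q: "phase.subspace Q" "Q \<subseteq> horiz" "\<forall>u\<in>Q. Re (mat_form (- D) u u) \<le> 0"
    "mneg D + phase.dim Q = CARD('n)" by (rule mpos_decomposition[OF hermitian_uminus[OF D]])
  have "pos_on (mat_form C) Q"
    unfolding pos_on_def
  proof (intro ballI impI)
    fix u assume u: "u \<in> Q" "u \<noteq> 0"
    have "Re (mat_form C u u) = Re (mat_form D u u) + e * (norm u)\<^sup>2"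
      using id[of u] u(1) Q(2) by (auto simp: C_def mat_form_add mat_form_scaleR)
    moreover have "Re (mat_form D u u) \<ge> 0" using bspec[OF Q(3) u(1)] by (simp add: mat_form_uminus)
    moreover have "e * (norm u)\<^sup>2 > 0" using e u(2) by simp
    ultimately show "Re (mat_form C u u) > 0" by linarith
  qed
  then have 2: "phase.dim Q \<le> mpos C" by (rule mpos_ge[OF Q(1,2)])
  have "mneg C = mneg D" "phase.dim (mker C) = 0" using 1 2 Q(4) mpos_mneg_le[OF hC] by linarith+
  then show ?thesis
    using that[of e] e phase.subspace_0[OF subspace_mker[of C]] phasefd.dim_eq_0[of "mker C"] unfolding C_def by blast
qed

text \<open>Let \<open>L0\<close> be the zero graph and \<open>L1\<close> the graph of
  \<open>D\<close>, and let \<open>N\<close> be the graph of \<open>D + e\<close>. The index of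
  \<open>L0\<close>, \<open>L1\<close>, \<open>N\<close> is
  \<open>n\<^sub>-(D) + 0 - n\<^sub>-(D + e)\<close>, which is zero for the shift chosen. With
  \<open>N\<close> moved to infinity the same index is the negative index of
  \<open>A1 - A0\<close>.\<close>

lemma ordered_chart:
  assumes L: "L0 \<in> Lagr" "L1 \<in> (Lagr :: 'n::finite phase set set)"
  obtains N S A0 A1 where "N \<in> Lagr" "symplectic_map S" "S ` graph_inf = N"
    "hermitian A0" "S ` graph A0 = L0" "hermitian A1" "S ` graph A1 = L1"
    "\<forall>x. Re (cdot x ((A1 - A0) *v x)) \<ge> 0" "iota L0 L1 N = 0"
proof -
  obtain K where K: "K \<in> Lagr" "\<forall>L\<in>{L0, L1}. transv L K"
    by (rule common_transversal[of "{L0, L1}"]) (use L in auto)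
  have t: "transv L0 K" "transv L1 K" using K(2) by blast+
  obtain T where T: "symplectic_map T" "T ` graph 0 = L0" "T ` graph_inf = K" by (rule normal_form[OF L(1) K(1) t(1)])
  obtain D where D: "hermitian D" "T ` graph D = L1" by (rule chart_exists[OF T(1,3) L(2) t(2)])
  obtain e where e: "e > 0" "mneg (D + e *\<^sub>R mat 1) = mneg D" "mker (D + e *\<^sub>R mat 1) = {0}"
    by (rule small_positive_shift[OF D(1)])
  define C where "C = D + e *\<^sub>R mat 1"
  have h1: "hermitian (e *\<^sub>R mat 1 :: complex ^ 'n ^ 'n)"
    by (intro hermitian_scaleR) (simp add: hermitian_def adj_def mat_def vec_eq_iff)
  have hC: "hermitian C" unfolding C_def by (intro hermitian_add D(1) h1)
  define N where "N = T ` graph C"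
  have N: "N \<in> Lagr" unfolding N_def by (rule symplectic_Lagr[OF T(1) graph_Lagr[OF hC]])
  have ap: "(e *\<^sub>R mat 1) *v x = e *\<^sub>R x" for x :: "complex ^ 'n" by (simp add: mat_vec_scaleR)
  have k1: "mker (D - C) = {0}"
    unfolding mker_eq_0_iff C_def using e(1) by (simp add: mat_vec_minus ap)
  have "mker (0 - C) = {0}" using e(3) unfolding mker_eq_0_iff C_def[symmetric] by (simp add: mat_vec_minus)
  then have tN: "transv L0 N" "transv L1 N"
    unfolding N_def T(2)[symmetric] D(2)[symmetric] symplectic_transv[OF T(1)] transv_graphs using k1 by blast+
  have "mneg (C - D) = 0"
  proof -
    have "mneg (C - D) + phase.dim (horiz :: 'n phase set) \<le> CARD('n)"
    proof (rule mpos_le[OF subspace_horiz subset_refl])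
      fix u :: "'n phase"
      have "mat_form (- (C - D)) u u = - (of_real e * cdot (fst u) (fst u))"
        by (simp add: C_def mat_form_def mat_vec_minus ap cdot_minus_right cdot_scaleR_right)
      then show "Re (mat_form (- (C - D)) u u) \<le> 0" using e(1) by (simp add: cdot_self)
    qed
    then show ?thesis by (simp add: dim_horiz)
  qed
  moreover have "iota L0 L1 N = int (mneg (D - 0)) + int (mneg (C - D)) - int (mneg (C - 0))"
    unfolding N_def T(2)[symmetric] D(2)[symmetric]
    by (rule iota_triple_chart[OF T(1) _ hermitian_0 D(1) hC]) (simp add: T(3) K(1))
  ultimately have i0: "iota L0 L1 N = 0" using e(2) unfolding C_def[symmetric] by simp
  obtain S where S: "symplectic_map S" "S ` graph 0 = L0" "S ` graph_inf = N" by (rule normal_form[OF L(1) N tN(1)])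
  obtain A where A: "hermitian A" "S ` graph A = L1" by (rule chart_exists[OF S(1,3) L(2) tN(2)])
  have "mneg (A - 0) = 0"
    using iota_chart[OF S(1,3) N hermitian_0 A(1)] S(2) A(2) i0 by simp
  then have nA: "mneg A = 0" by simp
  have "Re (cdot x ((A - 0) *v x)) \<ge> 0" for x
  \<comment> \<open>A vector of negative value would span a line on which \<open>- A\<close> is
    positive definite, against the vanishing of the negative index.\<close>
  proof (rule ccontr)
    assume n: "\<not> Re (cdot x ((A - 0) *v x)) \<ge> 0"
    define u :: "'n phase" where "u = (x, 0)"
    have "x \<noteq> 0" using n by auto
    then have u0: "u \<noteq> 0" by (simp add: u_def zero_prod_def)
    have uh: "phase.span {u} \<subseteq> horiz"
      by (rule phase.span_minimal[OF _ subspace_horiz]) (simp add: u_def horiz_iff)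
    have "pos_on (mat_form (- A)) (phase.span {u})"
      unfolding pos_on_def
    proof (intro ballI impI)
      fix w assume w: "w \<in> phase.span {u}" "w \<noteq> 0"
      obtain c where c: "w = pscale c u" using w(1) unfolding phase.span_singleton by blast
      have "c \<noteq> 0" using w(2) c by auto
      have "Re (mat_form (- A) w w) = (cmod c)\<^sup>2 * Re (mat_form (- A) u u)"
        unfolding c by (rule herm_quad_scale[OF phase.subspace_UNIV herm_mat_form[OF hermitian_uminus[OF A(1)]]]) simp
      moreover have "Re (mat_form (- A) u u) > 0" using n by (simp add: mat_form_def u_def mat_vec_minus cdot_minus_right)
      ultimately show "Re (mat_form (- A) w w) > 0" using \<open>c \<noteq> 0\<close> by simp
    qed
    then have "phase.dim (phase.span {u}) \<le> mneg A" by (rule mpos_ge[OF phase.subspace_span uh])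
    then show False using nA u0 by simp
  qed
  then show ?thesis using that[OF N S(1,3) hermitian_0 S(2) A] i0 by blast
qed

text \<open>The segment stays in the chart of \<open>N\<close>, so its Maslov index with respect to
  \<open>N\<close> is zero, and so is \<iota>(\<open>L0\<close>, \<open>L1\<close>,
  \<open>N\<close>). Since the excess over \<iota> is independent of the reference plane, it is zero
  for all of them.\<close>

lemma minimal_path_exists:
  assumes L: "L0 \<in> Lagr" "L1 \<in> Lagr"
  obtains L where "nondecreasing_from_to L0 L1 L" "\<forall>M\<in>Lagr. mas M L 0 1 = iota L0 L1 M"
proof -
  obtain N S A0 A1 where N: "N \<in> Lagr" and S: "symplectic_map S" "S ` graph_inf = N"
    and A0: "hermitian A0" "S ` graph A0 = L0" and A1: "hermitian A1" "S ` graph A1 = L1"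
    and pos: "\<forall>x. Re (cdot x ((A1 - A0) *v x)) \<ge> 0" and i0: "iota L0 L1 N = 0"
    by (rule ordered_chart[OF L])
  define L where "L = (\<lambda>t. S ` graph (A0 + t *\<^sub>R (A1 - A0)))"
  obtain X Y where F: "diff_frame X Y L"
    using symplectic_graph_path(1)[OF S(1) A0(1) A1(1)] unfolding L_def by blast
  have ends: "L 0 = L0" "L 1 = L1" by (simp_all add: L_def A0 A1)
  have "Re (crossing_form L t v v) \<ge> 0" if t: "t \<in> {0..1}" and v: "v \<in> L t" for t v
  proof -
    obtain x where "v = S (x, (A0 + t *\<^sub>R (A1 - A0)) *v x)" using v unfolding L_def graph_def by blast
    then show ?thesis using symplectic_graph_path(2)[OF S(1) A0(1) A1(1) t, of x] pos unfolding L_def by simp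
  qed
  then have nd: "nondecreasing_from_to L0 L1 L"
    unfolding nondecreasing_from_to_def nondecreasing_def diff_path_def using F ends by blast
  have g: "lagr_path L" by (rule diff_frame_lagr_path[OF F])
  have "transv (L t) N" for t
    unfolding L_def S(2)[symmetric] symplectic_transv[OF S(1)] by (rule transv_graph_inf)
  then have "mas N L 0 1 = pot N N (L 1) - pot N N (L 0)" by (intro mas_local[OF g N N]) simp_all
  then have "mas N L 0 1 = 0" by (simp add: pot_def)
  then have "mas M L 0 1 = iota L0 L1 M" if "M \<in> Lagr" for M
    using mas_reference_independent[OF g that N] i0 ends by simp
  then show ?thesis using that nd by blast
qed

theorem theorem1p6:
  fixes L0 L1 :: "'n::finite phase set"
  assumes "L0 \<in> Lagr" and "L1 \<in> Lagr"
  shows "(\<forall>M\<in>Lagr.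
           (\<exists>L. nondecreasing_from_to L0 L1 L \<and>
                int (duistermaat_index (L0, L1, M)) = maslov L M) \<and>
           (\<forall>L. nondecreasing_from_to L0 L1 L \<longrightarrow>
                int (duistermaat_index (L0, L1, M)) \<le> maslov L M)) \<and>
         (\<forall>L. \<forall>M\<in>Lagr.
           is_arg_min (\<lambda>L. maslov L M) (nondecreasing_from_to L0 L1) L \<longrightarrow>
           (\<forall>M'\<in>Lagr. is_arg_min (\<lambda>L. maslov L M') (nondecreasing_from_to L0 L1) L))"
proof -
  let ?P = "nondecreasing_from_to L0 L1"
  have mas: "maslov L M = mas M L 0 1" if "?P L" "M \<in> Lagr" for L M
    using that maslov_eq_mas unfolding nondecreasing_from_to_def nondecreasing_def diff_path_def by blast
  have diff: "maslov L M - iota L0 L1 M = maslov L M' - iota L0 L1 M'" if L: "?P L" and M: "M \<in> Lagr" "M' \<in> Lagr" for L M M'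
  proof -
    have "lagr_path L"
      using L diff_frame_lagr_path unfolding nondecreasing_from_to_def nondecreasing_def diff_path_def by blast
    moreover have "L 0 = L0" "L 1 = L1" using L unfolding nondecreasing_from_to_def by blast+
    ultimately show ?thesis using mas_reference_independent[of L M M'] mas[OF L] M by simp
  qed
  \<comment> \<open>The excess is evaluated at the reference plane \<open>L1\<close>, where \<iota>
    contributes nothing and monotonicity of the path gives the sign.\<close>
  have ge: "iota L0 L1 M \<le> maslov L M" if L: "?P L" and M: "M \<in> Lagr" for L M
  proof -
    have "maslov L L1 \<ge> 0"
      using nondecreasing_mas_nonneg[OF _ assms(2), of L] L mas[OF L assms(2)] unfolding nondecreasing_from_to_def by simp
    then show ?thesis using diff[OF L M assms(2)] iota_degenerate[OF assms] by simp
  qed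
  obtain G where G: "?P G" "\<forall>M\<in>Lagr. mas M G 0 1 = iota L0 L1 M" by (rule minimal_path_exists[OF assms])
  have eq: "maslov G M = iota L0 L1 M" if "M \<in> Lagr" for M using mas[OF G(1) that] G(2) that by simp
  have "is_arg_min (\<lambda>L. maslov L M') ?P L"
    if M: "M \<in> Lagr" "M' \<in> Lagr" and L: "is_arg_min (\<lambda>L. maslov L M) ?P L" for L M M'
  proof -
    have PL: "?P L" using L unfolding is_arg_min_def by blast
    have "\<not> maslov G M < maslov L M" using L G(1) unfolding is_arg_min_def by blast
    \<comment> \<open>Comparison with \<open>G\<close> shows that a minimizer for \<open>M\<close>
      has excess zero; \<open>diff\<close> carries this to every other reference plane, where the
      lower bound makes it minimal.\<close>
    then have "maslov L M = iota L0 L1 M" using ge[OF PL M(1)] eq[OF M(1)] by simp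
    then have "maslov L M' = iota L0 L1 M'" using diff[OF PL M] by simp
    then show ?thesis using PL ge[OF _ M(2)] unfolding is_arg_min_def by force
  qed
  then show ?thesis using G(1) eq ge unfolding iota_def by metis
qed

end
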